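(* Let $\mathbb{X}^{n-1}$ be a mirror of $\Gamma$ in $\mathbb{M}^n$, let $F\subset\mathbb{X}^{n-1}$ be a facet, $C$ a chamber having $F$ as a facet, and let $B\supset F$ be the domain in $\mathbb{X}^{n-1}$ obtained by rolling $C$ along $\mathbb{X}^{n-1}$ starting from $F$. Then the group $\Gamma_*(\mathbb{X}^{n-1})$ is a semidirect product $$\Gamma_*(\mathbb{X}^{n-1})=\mathrm{Deck}(B)\ltimes\Delta(\mathbb{X}^{n-1}),$$ with $\Delta(\mathbb{X}^{n-1})$ the normal factor.
   Context: $\mathbb{M}^n$ is one of $\mathbb{R}^n$, $\mathbb{S}^n$, $\mathbb{L}^n$ (Lobachevsky space) equipped with a Coxeter (reflection) group $\Gamma$, i.e. the group generated by the reflections in the $(n-1)$-dimensional faces of a Coxeter domain (an intersection of a finite or locally finite family of half-spaces whose iterated reflections in faces tile the whole space). More generally, $\mathbb{M}^n$ may be an open convex subset of real projective space $\mathbb{RP}^n$ on which a Coxeter group $\Gamma$ acts, in Tits' realization, as a group of projective transformations generated by reflections in hyperplanes meeting the subset, the closures of chambers being convex polyhedra; then "isometry" means projective transformation of the subset, and two distinct mirrors are called orthogonal if their reflections commute. Mirrors are the hyperplanes of reflections in $\Gamma$; $s_Y$ is the reflection in the mirror $Y$. Mirrors divide $\mathbb{M}^n$ into chambers (the polyhedra of the tiling), on which $\Gamma$ acts simply transitively. A facet is an $(n-1)$-dimensional face of a chamber, a hyperedge is an $(n-2)$-dimensional stratum of a chamber. The label $m_I$ of a hyperedge $I$ is the integer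 $m\ge2$ such that the dihedral angle at $I$ is $\pi/m$ (equivalently, $m$ is the number of mirrors containing $I$). The mirror $\mathbb{X}^{n-1}$ is tiled by the facets it contains. $\Gamma_*(\mathbb{X}^{n-1})$ is the group of all isometries of $\mathbb{X}^{n-1}$ induced by elements of $\Gamma$ preserving $\mathbb{X}^{n-1}$. $\Delta(\mathbb{X}^{n-1})$ is the group of transformations of $\mathbb{X}^{n-1}$ generated by the restrictions of the reflections $s_Z$, over all mirrors $Z$ of $\Gamma$ orthogonal to $\mathbb{X}^{n-1}$. Rolling: let a chamber $C'$ have a facet $F'\subset\mathbb{X}^{n-1}$, let $I$ be a hyperedge of $F'$ with odd label, and let $G'\neq F'$ be the other facet of $C'$ containing $I$. There is $\gamma\in\Gamma$ fixing $I$ pointwise such that $\gamma G'$ is the facet of $\mathbb{X}^{n-1}$ adjacent to $F'$ across $I$; the rolling step over $I$ replaces $(C',F')$ by $(\gamma C',\gamma G')$. Rolling over hyperedges with even labels is forbidden. $B$ is the union of all facets in $\mathbb{X}^{n-1}$ reached from $(C,F)$ by finite sequences of such steps (including $F$). Let $\Xi'(C)$ be the surface (boundary) of $C$ with all closed hyperedges of even label deleted, and $\Omega$ the connected component of $\Xi'(C)$ containing the facet $F$ (up to deleted boundary points). Each facet $H\subset B$ is $\Gamma$-equivalent to exactly one facet $F_i$ of $C$ in $\Omega$, via a canonical identification $F_i\to H$ induced by an element of $\Gamma$; these identifications define a map $B\to\Omega$ (with boundary points of $B$ deleted) which is the universal covering of $\Omega$. $\mathrm{Deck}(B)$ is the group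 of deck transformations of this covering; each deck transformation extends uniquely to an element of $\Gamma_*(\mathbb{X}^{n-1})$ preserving $B$, and $\mathrm{Deck}(B)$ is regarded in this way as a subgroup of $\Gamma_*(\mathbb{X}^{n-1})$. *)

theory Defs
  imports "HOL-Analysis.Analysis" "HOL-Algebra.Bij" "HOL-Algebra.Coset"
    "HOL-Algebra.Generated_Groups"
begin

section \<open>The spaces\<close>

text \<open>
  A space is given by a set of points in a Euclidean space. The Euclidean space is the whole type,
  the sphere is the unit sphere, the Lobachevsky space is the upper sheet of the hyperboloid of the
  Lorentz form whose time axis is spanned by the unit vector \<open>e\<close>. In the projective case
  \<open>K\<close> is the open convex cone over an open convex subset of the real projective space. Since
  \<open>K\<close> does not contain \<open>0\<close>, it does not contain two opposite vectors, so each point of the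
  subset is represented by exactly one unit vector of \<open>K\<close>. Hence the dimension of the space is
  that of the type in the Euclidean case, and one less in the other cases.
\<close>

datatype 'a geometry = Euclidean | Spherical | Lobachevsky 'a | Projective "'a set"

definition lorentz :: "'a::euclidean_space \<Rightarrow> 'a \<Rightarrow> 'a \<Rightarrow> real"
  where "lorentz e x y = x \<bullet> y - 2 * (x \<bullet> e) * (y \<bullet> e)"

fun is_geometry :: "'a::euclidean_space geometry \<Rightarrow> bool" where
  "is_geometry Euclidean \<longleftrightarrow> True"
| "is_geometry Spherical \<longleftrightarrow> True"
| "is_geometry (Lobachevsky e) \<longleftrightarrow> norm e = 1"
| "is_geometry (Projective K) \<longleftrightarrow>
     open K \<and> convex K \<and> K \<noteq> {} \<and> 0 \<notin> K \<and> (\<forall>x\<in>K. \<forall>c>0. c *\<^sub>R x \<in> K)"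

fun points :: "'a::euclidean_space geometry \<Rightarrow> 'a set" where
  "points Euclidean = UNIV"
| "points Spherical = sphere 0 1"
| "points (Lobachevsky e) = {x. lorentz e x x = -1 \<and> x \<bullet> e > 0}"
| "points (Projective K) = K \<inter> sphere 0 1"

abbreviation space_top :: "'a::euclidean_space geometry \<Rightarrow> 'a topology"
  where "space_top S \<equiv> top_of_set (points S)"

text \<open>
  A projective transformation of the subset is induced by a linear automorphism of the cone over it,
  and \<^const>\<open>sgn\<close> is the normalisation of a vector.
\<close>

fun isometries :: "'a::euclidean_space geometry \<Rightarrow> ('a \<Rightarrow> 'a) set" where
  "isometries Euclidean =
     {f \<in> Bij (points Euclidean). \<forall>x y. dist (f x) (f y) = dist x y}"
| "isometries Spherical =
     {f \<in> Bij (points Spherical). \<forall>x\<in>points Spherical. \<forall>y\<in>points Spherical.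
        arccos (f x \<bullet> f y) = arccos (x \<bullet> y)}"
| "isometries (Lobachevsky e) =
     {f \<in> Bij (points (Lobachevsky e)).
        \<forall>x\<in>points (Lobachevsky e). \<forall>y\<in>points (Lobachevsky e).
          arcosh (- lorentz e (f x) (f y)) = arcosh (- lorentz e x y)}"
| "isometries (Projective K) =
     {f \<in> Bij (points (Projective K)).
        \<exists>A. linear A \<and> bij A \<and> A ` K = K \<and> (\<forall>x\<in>points (Projective K). f x = sgn (A x))}"

fun form :: "'a::euclidean_space geometry \<Rightarrow> 'a \<Rightarrow> 'a \<Rightarrow> real" where
  "form (Lobachevsky e) a x = lorentz e a x"
| "form _ a x = a \<bullet> x"

definition hyperplane_eq :: "'a::euclidean_space geometry \<Rightarrow> 'a \<Rightarrow> real \<Rightarrow> 'a set"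
  where "hyperplane_eq S a b = {x \<in> points S. form S a x = b}"

definition halfspace :: "'a::euclidean_space geometry \<Rightarrow> 'a \<Rightarrow> real \<Rightarrow> 'a set"
  where "halfspace S a b = {x \<in> points S. form S a x \<ge> b}"

text \<open>
  The pairs of a normal vector and a constant which define the hyperplane \<open>Y\<close>. Outside the
  Euclidean case the hyperplanes are the sections by linear hyperplanes of the ambient space.
\<close>

definition normals :: "'a::euclidean_space geometry \<Rightarrow> 'a set \<Rightarrow> ('a \<times> real) set"
  where "normals S Y =
    {(a, b). a \<noteq> 0 \<and> (S = Euclidean \<or> b = 0) \<and> Y = hyperplane_eq S a b}"

definition is_hyperplane :: "'a::euclidean_space geometry \<Rightarrow> 'a set \<Rightarrow> bool"
  where "is_hyperplane S Y \<longleftrightarrow> Y \<noteq> {} \<and> normals S Y \<noteq> {}"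

text \<open>
  Dimension inside the space: outside the Euclidean case it is the projective dimension of the
  linear span.
\<close>

fun dimension_in :: "'a::euclidean_space geometry \<Rightarrow> 'a set \<Rightarrow> int" where
  "dimension_in Euclidean T = aff_dim T"
| "dimension_in _ T = int (dim T) - 1"

definition reflection_in ::
  "'a::euclidean_space geometry \<Rightarrow> 'a set \<Rightarrow> ('a \<Rightarrow> 'a) \<Rightarrow> bool"
  where "reflection_in S Y s \<longleftrightarrow>
    is_hyperplane S Y \<and> s \<in> isometries S \<and>
    (\<forall>x\<in>points S. s (s x) = x) \<and> {x \<in> points S. s x = x} = Y"


section \<open>Coxeter groups and their chambers\<close>

definition is_wall :: "'a::euclidean_space geometry \<Rightarrow> 'a set \<Rightarrow> 'a set \<Rightarrow> bool"
  where "is_wall S D W \<longleftrightarrow>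
    is_hyperplane S W \<and> (\<exists>(a, b)\<in>normals S W. D \<subseteq> halfspace S a b) \<and>
    dimension_in S (D \<inter> W) = dimension_in S (points S) - 1"

definition polyhedral_domain :: "'a::euclidean_space geometry \<Rightarrow> 'a set \<Rightarrow> bool"
  where "polyhedral_domain S D \<longleftrightarrow>
    (\<exists>N. (\<forall>(a, b)\<in>N. is_hyperplane S (hyperplane_eq S a b) \<and>
                     (a, b) \<in> normals S (hyperplane_eq S a b)) \<and>
         locally_finite_in (space_top S) ((\<lambda>(a, b). hyperplane_eq S a b) ` N) \<and>
         D = {x \<in> points S. \<forall>(a, b)\<in>N. x \<in> halfspace S a b}) \<and>
    space_top S interior_of D \<noteq> {}"

text \<open>
  \<open>\<Gamma>\<close> is generated by reflections in the walls of the Coxeter domain \<open>D\<close>, one for each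
  wall (in the projective case a wall does not determine the reflection, so the reflections are
  chosen), and the images of \<open>D\<close> under the distinct elements of \<open>\<Gamma>\<close> tile the space.
\<close>

definition coxeter_group ::
  "'a::euclidean_space geometry \<Rightarrow> ('a \<Rightarrow> 'a) set \<Rightarrow> 'a set \<Rightarrow> bool"
  where "coxeter_group S \<Gamma> D \<longleftrightarrow>
    polyhedral_domain S D \<and>
    (\<exists>R. (\<forall>s\<in>R. \<exists>W. is_wall S D W \<and> reflection_in S W s) \<and>
         (\<forall>W. is_wall S D W \<longrightarrow> (\<exists>!s. s \<in> R \<and> reflection_in S W s)) \<and>
         \<Gamma> = generate (BijGroup (points S)) R) \<and>
    (\<Union>\<gamma>\<in>\<Gamma>. \<gamma> ` D) = points S \<and>
    (\<forall>\<gamma>\<in>\<Gamma>. \<forall>\<delta>\<in>\<Gamma>. \<gamma> \<noteq> \<delta> \<longrightarrow>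
       space_top S interior_of (\<gamma> ` D) \<inter> space_top S interior_of (\<delta> ` D) = {}) \<and>
    locally_finite_in (space_top S) ((\<lambda>\<gamma>. \<gamma> ` D) ` \<Gamma>)"

definition chambers :: "('a \<Rightarrow> 'a) set \<Rightarrow> 'a set \<Rightarrow> 'a set set"
  where "chambers \<Gamma> D = (\<lambda>\<gamma>. \<gamma> ` D) ` \<Gamma>"

definition mirrors :: "'a::euclidean_space geometry \<Rightarrow> ('a \<Rightarrow> 'a) set \<Rightarrow> 'a set set"
  where "mirrors S \<Gamma> = {Y. \<exists>s\<in>\<Gamma>. reflection_in S Y s}"

text \<open>In the projective case there are no angles, and orthogonality means that the reflections commute.\<close>

definition orthogonal_mirrors ::
  "'a::euclidean_space geometry \<Rightarrow> ('a \<Rightarrow> 'a) set \<Rightarrow> 'a set \<Rightarrow> 'a set \<Rightarrow> bool"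
  where "orthogonal_mirrors S \<Gamma> Y Z \<longleftrightarrow>
    (case S of
       Projective K \<Rightarrow>
         Y \<noteq> Z \<and>
         (\<forall>s\<in>\<Gamma>. \<forall>t\<in>\<Gamma>. reflection_in S Y s \<and> reflection_in S Z t \<longrightarrow>
            (\<forall>x\<in>points S. s (t x) = t (s x)))
     | _ \<Rightarrow> (\<exists>(a, b)\<in>normals S Y. \<exists>(a', b')\<in>normals S Z. form S a a' = 0))"

text \<open>
  Faces are closed; each proper face of a chamber is cut out by mirrors, because the walls of a
  chamber are mirrors and mirrors do not meet the interiors of chambers.
\<close>

definition is_face ::
  "'a::euclidean_space geometry \<Rightarrow> ('a \<Rightarrow> 'a) set \<Rightarrow> 'a set \<Rightarrow> 'a set \<Rightarrow> bool"
  where "is_face S \<Gamma> C T \<longleftrightarrow>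
    T \<noteq> {} \<and> (\<exists>\<Y>. \<Y> \<noteq> {} \<and> \<Y> \<subseteq> mirrors S \<Gamma> \<and> T = C \<inter> \<Inter>\<Y>)"

definition facet ::
  "'a::euclidean_space geometry \<Rightarrow> ('a \<Rightarrow> 'a) set \<Rightarrow> 'a set \<Rightarrow> 'a set \<Rightarrow> bool"
  where "facet S \<Gamma> C T \<longleftrightarrow>
    is_face S \<Gamma> C T \<and> dimension_in S T = dimension_in S (points S) - 1"

definition hyperedge ::
  "'a::euclidean_space geometry \<Rightarrow> ('a \<Rightarrow> 'a) set \<Rightarrow> 'a set \<Rightarrow> 'a set \<Rightarrow> bool"
  where "hyperedge S \<Gamma> C I \<longleftrightarrow>
    is_face S \<Gamma> C I \<and> dimension_in S I = dimension_in S (points S) - 2"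

text \<open>
  The dihedral angle at \<open>I\<close> is \<open>\<pi> / m\<close> iff exactly \<open>m\<close> mirrors contain \<open>I\<close>; the latter
  makes sense in the projective case as well.
\<close>

definition label ::
  "'a::euclidean_space geometry \<Rightarrow> ('a \<Rightarrow> 'a) set \<Rightarrow> 'a set \<Rightarrow> nat"
  where "label S \<Gamma> I = card {Y \<in> mirrors S \<Gamma>. I \<subseteq> Y}"


section \<open>The groups acting on a mirror\<close>

definition Gamma_star :: "('a \<Rightarrow> 'a) set \<Rightarrow> 'a set \<Rightarrow> ('a \<Rightarrow> 'a) set"
  where "Gamma_star \<Gamma> X = {restrict \<gamma> X |\<gamma>. \<gamma> \<in> \<Gamma> \<and> \<gamma> ` X = X}"

definition Delta ::
  "'a::euclidean_space geometry \<Rightarrow> ('a \<Rightarrow> 'a) set \<Rightarrow> 'a set \<Rightarrow> ('a \<Rightarrow> 'a) set"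
  where "Delta S \<Gamma> X =
    generate (BijGroup X)
      {restrict s X |s. s \<in> \<Gamma> \<and> (\<exists>Z. reflection_in S Z s \<and> orthogonal_mirrors S \<Gamma> X Z)}"


section \<open>Rolling\<close>

text \<open>
  The element \<open>\<gamma>\<close> of a step is determined up to the reflection in \<open>X\<close>, which is the identity
  on \<open>X\<close>; so the chamber in the new pair may lie on either side of \<open>X\<close>.
\<close>

inductive roll_step ::
  "'a::euclidean_space geometry \<Rightarrow> ('a \<Rightarrow> 'a) set \<Rightarrow> 'a set \<Rightarrow>
   'a set \<times> 'a set \<Rightarrow> 'a set \<times> 'a set \<Rightarrow> bool"
  for S \<Gamma> X where
  "\<lbrakk>facet S \<Gamma> C' F'; F' \<subseteq> X; hyperedge S \<Gamma> C' I; I \<subseteq> F'; odd (label S \<Gamma> I);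
    facet S \<Gamma> C' G'; G' \<noteq> F'; I \<subseteq> G';
    \<gamma> \<in> \<Gamma>; \<forall>x\<in>I. \<gamma> x = x; \<gamma> ` G' \<subseteq> X; \<gamma> ` G' \<noteq> F'\<rbrakk>
   \<Longrightarrow> roll_step S \<Gamma> X (C', F') (\<gamma> ` C', \<gamma> ` G')"

definition rolled_facets ::
  "'a::euclidean_space geometry \<Rightarrow> ('a \<Rightarrow> 'a) set \<Rightarrow> 'a set \<Rightarrow> 'a set \<Rightarrow> 'a set \<Rightarrow> 'a set set"
  where "rolled_facets S \<Gamma> X C F = {H. \<exists>C'. (roll_step S \<Gamma> X)\<^sup>*\<^sup>* (C, F) (C', H)}"

definition rolled_domain ::
  "'a::euclidean_space geometry \<Rightarrow> ('a \<Rightarrow> 'a) set \<Rightarrow> 'a set \<Rightarrow> 'a set \<Rightarrow> 'a set \<Rightarrow> 'a set"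
  where "rolled_domain S \<Gamma> X C F = \<Union>(rolled_facets S \<Gamma> X C F)"

definition rolled_interior ::
  "'a::euclidean_space geometry \<Rightarrow> ('a \<Rightarrow> 'a) set \<Rightarrow> 'a set \<Rightarrow> 'a set \<Rightarrow> 'a set \<Rightarrow> 'a set"
  where "rolled_interior S \<Gamma> X C F =
    rolled_domain S \<Gamma> X C F - top_of_set X frontier_of (rolled_domain S \<Gamma> X C F)"

definition Xi' :: "'a::euclidean_space geometry \<Rightarrow> ('a \<Rightarrow> 'a) set \<Rightarrow> 'a set \<Rightarrow> 'a set"
  where "Xi' S \<Gamma> C =
    space_top S frontier_of C - \<Union>{I. hyperedge S \<Gamma> C I \<and> even (label S \<Gamma> I)}"

definition Omega ::
  "'a::euclidean_space geometry \<Rightarrow> ('a \<Rightarrow> 'a) set \<Rightarrow> 'a set \<Rightarrow> 'a set \<Rightarrow> 'a set"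
  where "Omega S \<Gamma> C F = (\<Union>x\<in>F \<inter> Xi' S \<Gamma> C. connected_component_set (Xi' S \<Gamma> C) x)"

definition roll_map ::
  "'a::euclidean_space geometry \<Rightarrow> ('a \<Rightarrow> 'a) set \<Rightarrow> 'a set \<Rightarrow> 'a set \<Rightarrow> 'a set \<Rightarrow> 'a \<Rightarrow> 'a"
  where "roll_map S \<Gamma> X C F x =
    (THE y. \<exists>H\<in>rolled_facets S \<Gamma> X C F. \<exists>F\<^sub>i. \<exists>\<gamma>\<in>\<Gamma>.
       facet S \<Gamma> C F\<^sub>i \<and> F\<^sub>i \<inter> Xi' S \<Gamma> C \<subseteq> Omega S \<Gamma> C F \<and>
       \<gamma> ` F\<^sub>i = H \<and> y \<in> F\<^sub>i \<and> \<gamma> y = x)"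

definition deck_transformations :: "('a::topological_space \<Rightarrow> 'b) \<Rightarrow> 'a set \<Rightarrow> ('a \<Rightarrow> 'a) set"
  where "deck_transformations p E =
    {\<phi> \<in> extensional E.
       homeomorphic_map (top_of_set E) (top_of_set E) \<phi> \<and> (\<forall>x\<in>E. p (\<phi> x) = p x)}"

text \<open>
  The deck transformations of the covering \<^const>\<open>roll_map\<close> of \<^const>\<open>Omega\<close>, replaced by
  their extensions to the mirror.
\<close>

definition Deck ::
  "'a::euclidean_space geometry \<Rightarrow> ('a \<Rightarrow> 'a) set \<Rightarrow> 'a set \<Rightarrow> 'a set \<Rightarrow> 'a set \<Rightarrow> ('a \<Rightarrow> 'a) set"
  where "Deck S \<Gamma> X C F =
    {g \<in> Gamma_star \<Gamma> X.
       g ` rolled_domain S \<Gamma> X C F = rolled_domain S \<Gamma> X C F \<and>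
       restrict g (rolled_interior S \<Gamma> X C F)
         \<in> deck_transformations (roll_map S \<Gamma> X C F) (rolled_interior S \<Gamma> X C F)}"


definition is_semidirect_product ::
  "('g, 'm) monoid_scheme \<Rightarrow> 'g set \<Rightarrow> 'g set \<Rightarrow> bool"
  where "is_semidirect_product G H N \<longleftrightarrow>
    group G \<and> subgroup H G \<and> N \<lhd> G \<and> H \<inter> N = {\<one>\<^bsub>G\<^esub>} \<and> H <#>\<^bsub>G\<^esub> N = carrier G"

end

theory Submission
  imports Defs
begin

text \<open>
  The four geometries have a common linear model: the points are the rays of an open cone \<open>K\<close> in
  a Euclidean space (the complement of \<open>0\<close> for the sphere, the future light cone for the Lobachevsky
  space, the half-space of positive last coordinate for the Euclidean space). Hyperplanes become
  kernels of functionals, isometries become linear maps up to a positive factor, and a reflection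
  becomes a map \<open>v \<mapsto> v - 2 (w \<bullet> v) u\<close> with \<open>w \<bullet> u = 1\<close>. In the model orthogonality has the same
  meaning in all geometries: the mirror \<open>Z\<close> is orthogonal to \<open>X\<close> iff \<open>Z \<noteq> X\<close> and the reflection in
  \<open>Z\<close> preserves \<open>X\<close> (\<open>orthogonal_iff_stable\<close>, \<open>commuting_iff\<close>). The theorem is proved for such a
  model (\<open>semidirect\<close>), and the four geometries are instances of it.

  Let \<open>s\<close> be the reflection in the mirror \<open>X\<close>, let \<open>T\<close> be the set of the reflections in the mirrors
  orthogonal to \<open>X\<close>, let \<open>W\<close> be the group generated by \<open>T\<close>, and let \<open>St\<close> consist of the elements of
  \<open>\<Gamma>\<close> which preserve \<open>X\<close> and the rolled domain \<open>B\<close>. The restrictions to \<open>X\<close> of the elements of \<open>W\<close>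
  form \<open>\<Delta>(X)\<close>. The theorem rests on three facts.

  \<^item> \<open>Deck(B)\<close> consists of the restrictions of the elements of \<open>St\<close> (\<open>Deck_eq\<close>). The map \<open>B \<rightarrow> \<Omega>\<close> is
  defined by means of the elements of \<open>\<Gamma>\<close> that carry facets of \<open>C\<close> to facets of \<open>B\<close>. Composition with
  an element of \<open>St\<close> permutes them, so it induces a deck transformation.

  \<^item> If \<open>X\<close> has positive dimension, a facet in \<open>X\<close> is reached by rolling iff no mirror orthogonal to
  \<open>X\<close> separates it from \<open>F\<close>. Conjugation by \<open>s\<close> is an involution on the reflections in the mirrors
  through a hyperedge \<open>I\<close> in \<open>X\<close>, and it fixes exactly \<open>s\<close> and those in \<open>T\<close>; so if the label of \<open>I\<close> is
  even, then \<open>I\<close> lies in a mirror orthogonal to \<open>X\<close> (\<open>orthogonal_if_even_label\<close>). If, conversely, \<open>I\<close>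
  lies in the mirror of \<open>t \<in> T\<close>, then conjugation by \<open>t\<close> fixes exactly \<open>s\<close> and \<open>t\<close>, and the label is
  even (\<open>even_label_if_orthogonal\<close>). So a rolling step crosses no orthogonal mirror
  (\<open>roll_step_same_side\<close>). Conversely, let \<open>I\<close> lie in no orthogonal mirror. The element which
  fixes \<open>I\<close> and carries \<open>C'\<close> to a chamber at the next facet of \<open>X\<close> is then a rolling step
  (\<open>roll_facet\<close>): if it carried \<open>F'\<close> itself to the next facet, then it would flip \<open>X\<close> across \<open>I\<close>,
  and would be, up to \<open>s\<close>, a reflection in a mirror orthogonal to \<open>X\<close> (\<open>flip_gives_orthogonal\<close>). A
  path in \<open>X\<close> that avoids the strata of codimension two then connects any two facets which no
  orthogonal mirror separates (\<open>unseparated_rolled\<close>).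

  \<^item> \<open>W\<close> acts simply transitively on the domains into which the orthogonal mirrors divide \<open>X\<close>. This is
  the exchange argument for groups generated by reflections, given here for an abstract system of
  walls (\<open>generate_transitive\<close>, \<open>generate_free\<close>).

  By the second fact \<open>B\<close> is one of these domains. So for each \<open>g\<close> preserving \<open>X\<close> there is \<open>w \<in> W\<close> with
  \<open>w g \<in> St\<close> (\<open>W_transitive\<close>), and the elements of \<open>W\<close> in \<open>St\<close> are trivial on \<open>X\<close> (\<open>W_free\<close>). As \<open>T\<close> is
  closed under conjugation by the stabiliser of \<open>X\<close>, \<open>W\<close> is normal in it, and the decomposition follows. If \<open>X\<close> has dimension \<open>0\<close>, it
  has at most two points and there are no hyperedges; this case is treated directly
  (\<open>two_point_mirror\<close>).
\<close>

section \<open>Groups generated by reflections\<close>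

text \<open>
  An abstract system of walls. A wall is represented by the involution in it, and \<open>sep x y\<close> stands
  for the set of the walls that separate \<open>x\<close> from \<open>y\<close>; the points off all walls form \<open>Pts\<close>. Since a
  wall has two sides, a third point changes the separating walls by symmetric difference.
\<close>

locale walled_action = group G for G (structure) +
  fixes act :: "'a \<Rightarrow> 'x \<Rightarrow> 'x" and Pts :: "'x set" and T :: "'a set"
    and sep :: "'x \<Rightarrow> 'x \<Rightarrow> 'a set"
  assumes act_closed: "\<lbrakk>g \<in> carrier G; x \<in> Pts\<rbrakk> \<Longrightarrow> act g x \<in> Pts"
    and act_one: "x \<in> Pts \<Longrightarrow> act \<one> x = x"
    and act_mult: "\<lbrakk>g \<in> carrier G; h \<in> carrier G; x \<in> Pts\<rbrakk> \<Longrightarrow> act (g \<otimes> h) x = act g (act h x)"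
    and T_carrier: "T \<subseteq> carrier G"
    and T_inv: "t \<in> T \<Longrightarrow> t \<otimes> t = \<one>"
    and T_conj: "\<lbrakk>g \<in> carrier G; t \<in> T\<rbrakk> \<Longrightarrow> g \<otimes> t \<otimes> inv g \<in> T"
    and sep_T: "\<lbrakk>x \<in> Pts; y \<in> Pts\<rbrakk> \<Longrightarrow> sep x y \<subseteq> T"
    and sep_sym: "\<lbrakk>x \<in> Pts; y \<in> Pts\<rbrakk> \<Longrightarrow> sep x y = sep y x"
    and sep_diff: "\<lbrakk>x \<in> Pts; y \<in> Pts; z \<in> Pts\<rbrakk> \<Longrightarrow>
        sep x z = (sep x y - sep y z) \<union> (sep y z - sep x y)"
    and sep_act: "\<lbrakk>g \<in> carrier G; x \<in> Pts; y \<in> Pts; t \<in> T\<rbrakk> \<Longrightarrow>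
        g \<otimes> t \<otimes> inv g \<in> sep (act g x) (act g y) \<longleftrightarrow> t \<in> sep x y"
    and sep_self: "\<lbrakk>t \<in> T; x \<in> Pts\<rbrakk> \<Longrightarrow> t \<in> sep x (act t x)"
begin

text \<open>
  Either the two points lie in one domain, or a single wall separates them and their domains are
  mirror images of each other in it.
\<close>

definition near :: "'x \<Rightarrow> 'x \<Rightarrow> bool"
  where "near x y \<longleftrightarrow> x \<in> Pts \<and> y \<in> Pts \<and>
    (sep x y = {} \<or> (\<exists>t. sep x y = {t} \<and> sep x (act t y) = {}))"

text \<open>
  The reflections in the walls of the domain of \<open>x\<close>: for some point \<open>h\<close> of this domain, the wall of
  \<open>t\<close> is the only one between \<open>h\<close> and its mirror image.
\<close>

definition simple :: "'x \<Rightarrow> 'a set"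
  where "simple x = {t \<in> T. \<exists>h\<in>Pts. sep x h = {} \<and> sep h (act t h) = {t}}"

abbreviation word :: "'a list \<Rightarrow> 'a"
  where "word ts \<equiv> foldr (\<otimes>) ts \<one>"

lemma tc: "t \<in> T \<Longrightarrow> t \<in> carrier G"
  using T_carrier by blast

lemma sep_empty_left: "\<lbrakk>x \<in> Pts; y \<in> Pts; z \<in> Pts; sep x y = {}\<rbrakk> \<Longrightarrow> sep x z = sep y z"
  using sep_diff[of x y z] by auto

lemma sep_empty_right: "\<lbrakk>x \<in> Pts; y \<in> Pts; z \<in> Pts; sep y z = {}\<rbrakk> \<Longrightarrow> sep x z = sep x y"
  using sep_diff[of x y z] by auto

lemma sep_refl: "x \<in> Pts \<Longrightarrow> sep x x = {}"
  using sep_diff[of x x x] by auto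

lemma conj_inv:
  assumes "g \<in> carrier G" "t \<in> carrier G"
  shows "inv g \<otimes> (g \<otimes> t \<otimes> inv g) \<otimes> g = t" "g \<otimes> (inv g \<otimes> t \<otimes> g) \<otimes> inv g = t"
    "(g \<otimes> t \<otimes> inv g) \<otimes> g = g \<otimes> t"
  using assms by (simp_all add: m_assoc) (simp_all add: m_assoc[symmetric])

lemma sep_image:
  assumes g: "g \<in> carrier G" and x: "x \<in> Pts" and y: "y \<in> Pts"
  shows "sep (act g x) (act g y) = (\<lambda>t. g \<otimes> t \<otimes> inv g) ` sep x y"
proof
  show "(\<lambda>t. g \<otimes> t \<otimes> inv g) ` sep x y \<subseteq> sep (act g x) (act g y)"
    using sep_act[OF g x y] sep_T[OF x y] by auto
  show "sep (act g x) (act g y) \<subseteq> (\<lambda>t. g \<otimes> t \<otimes> inv g) ` sep x y"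
  proof
    fix r assume r: "r \<in> sep (act g x) (act g y)"
    then have rT: "r \<in> T"
      using sep_T act_closed g x y by blast
    define t where "t = inv g \<otimes> r \<otimes> g"
    have tT: "t \<in> T"
      using T_conj[of "inv g" r] g rT by (simp add: t_def)
    have "g \<otimes> t \<otimes> inv g = r"
      using conj_inv(2)[OF g tc[OF rT]] by (simp add: t_def)
    then show "r \<in> (\<lambda>t. g \<otimes> t \<otimes> inv g) ` sep x y"
      using sep_act[OF g x y tT] r by auto
  qed
qed

text \<open>
  If \<open>w\<close> moves the domain of \<open>y\<close> to that of \<open>x\<close>, then it moves the wall between \<open>y\<close> and \<open>z\<close> to a wall
  of the domain of \<open>x\<close>. The reflection in the latter brings the moved domain of \<open>z\<close> back to that of \<open>x\<close>.
\<close>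

lemma simple_conjugate:
  assumes x: "x \<in> Pts" and n: "near y z" and t: "t \<in> sep y z"
    and w: "w \<in> carrier G" and e: "sep x (act w y) = {}"
  defines "r \<equiv> w \<otimes> t \<otimes> inv w"
  shows "r \<in> simple x" "sep x (act (r \<otimes> w) z) = {}"
proof -
  have yz: "y \<in> Pts" "z \<in> Pts"
    using n by (auto simp: near_def)
  have st: "sep y z = {t}" "sep y (act t z) = {}"
    using n t by (auto simp: near_def)
  have tT: "t \<in> T"
    using sep_T[OF yz] t by blast
  note cl = act_closed tc[OF tT] w yz
  have rT: "r \<in> T"
    unfolding r_def using T_conj w tT by blast
  have rw: "r \<otimes> w = w \<otimes> t"
    unfolding r_def using conj_inv(3) w tc[OF tT] by blast
  define h where "h = act (r \<otimes> w) z"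
  have h: "h \<in> Pts"
    unfolding h_def using cl tc[OF rT] by simp
  have "h = act w (act t z)"
    unfolding h_def rw using cl act_mult by simp
  then have wyh: "sep (act w y) h = {}"
    using sep_image[OF w yz(1), of "act t z"] st cl by simp
  then have xh: "sep x h = {}"
    using sep_empty_left[OF x _ h e] cl by simp
  have "act r h = act (r \<otimes> (r \<otimes> w)) z"
    unfolding h_def using act_mult[of r "r \<otimes> w" z] tc[OF rT] cl by simp
  also have "r \<otimes> (r \<otimes> w) = w"
    using T_inv[OF rT] tc[OF rT] w by (simp add: m_assoc[symmetric])
  finally have rh: "act r h = act w z" .
  have "sep h (act w z) = sep (act w y) (act w z)"
    using sep_empty_left[of "act w y" h "act w z"] wyh h cl by simp
  also have "\<dots> = {r}"
    using sep_image[OF w yz] st by (simp add: r_def)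
  finally have "sep h (act r h) = {r}"
    by (simp add: rh)
  then show "r \<in> simple x"
    unfolding simple_def using rT h xh by blast
  show "sep x (act (r \<otimes> w) z) = {}"
    using xh by (simp add: h_def)
qed

lemma simple_carrier: "simple x \<subseteq> carrier G"
  unfolding simple_def using tc by blast

lemma simple_transitive:
  assumes x: "x \<in> Pts" and c: "near\<^sup>*\<^sup>* x y"
  shows "\<exists>w\<in>generate G (simple x). sep x (act w y) = {}"
  using c
proof induction
  case base
  then show ?case
    using generate.one sep_refl[OF x] act_one[OF x] by (intro bexI[of _ \<one>]) auto
next
  case (step y z)
  then obtain w where w: "w \<in> generate G (simple x)" "sep x (act w y) = {}"
    by blast
  have wc: "w \<in> carrier G"
    using w(1) generate_in_carrier[OF simple_carrier] by blast
  have yz: "y \<in> Pts" "z \<in> Pts"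
    using step by (auto simp: near_def)
  show ?case
  proof (cases "sep y z = {}")
    case True
    then have "sep (act w y) (act w z) = {}"
      using sep_image[OF wc yz] by simp
    then have "sep x (act w z) = {}"
      using sep_empty_left[of x "act w y" "act w z"] x w(2) act_closed wc yz by simp
    then show ?thesis
      using w(1) by blast
  next
    case False
    then obtain t where t: "t \<in> sep y z"
      by blast
    note * = simple_conjugate[OF x step.hyps(2) t wc w(2)]
    then show ?thesis
      using generate.eng[OF generate.incl[OF *(1)] w(1)] by blast
  qed
qed

lemma chain_crosses:
  assumes x: "x \<in> Pts" and c: "near\<^sup>*\<^sup>* x y" and t: "t \<in> sep x y"
  shows "\<exists>u v. near\<^sup>*\<^sup>* x u \<and> near u v \<and> t \<in> sep u v"
  using c t
proof induction
  case base
  then show ?case using sep_refl[OF x] by simp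
next
  case (step y z)
  then have "y \<in> Pts" "z \<in> Pts"
    by (auto simp: near_def)
  then show ?case
    using step sep_diff[OF x, of y z] by blast
qed

text \<open>
  A chain from \<open>x\<close> to its image under \<open>t\<close> has to cross the wall of \<open>t\<close>. Moving the place of the crossing
  to the domain of \<open>x\<close> turns this wall into one of the domain, so \<open>t\<close> is conjugate to a simple
  reflection by a product of simple reflections.
\<close>

lemma T_simple:
  assumes x: "x \<in> Pts" and c: "\<And>y. y \<in> Pts \<Longrightarrow> near\<^sup>*\<^sup>* x y" and t: "t \<in> T"
  shows "t \<in> generate G (simple x)"
proof -
  have "t \<in> sep x (act t x)" "act t x \<in> Pts"
    using sep_self[OF t x] act_closed tc t x by auto
  then obtain u v where uv: "near\<^sup>*\<^sup>* x u" "near u v" "t \<in> sep u v"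
    using chain_crosses[OF x c] by blast
  obtain w where w: "w \<in> generate G (simple x)" "sep x (act w u) = {}"
    using simple_transitive[OF x uv(1)] by blast
  have wc: "w \<in> carrier G"
    using w(1) generate_in_carrier[OF simple_carrier] by blast
  have r: "w \<otimes> t \<otimes> inv w \<in> simple x"
    using simple_conjugate(1)[OF x uv(2,3) wc w(2)] .
  have "inv w \<otimes> (w \<otimes> t \<otimes> inv w) \<otimes> w \<in> generate G (simple x)"
    by (intro generate.eng generate.incl r w(1) generate_m_inv_closed[OF simple_carrier w(1)])
  then show ?thesis
    using conj_inv(1)[OF wc tc[OF t]] by simp
qed

lemma word_carrier: "set ts \<subseteq> carrier G \<Longrightarrow> word ts \<in> carrier G"
  by (induction ts) auto

lemma word_append:
  "\<lbrakk>set us \<subseteq> carrier G; set vs \<subseteq> carrier G\<rbrakk> \<Longrightarrow> word (us @ vs) = word us \<otimes> word vs"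
  by (induction us) (auto simp: word_carrier m_assoc)

lemma generate_word:
  assumes S: "S \<subseteq> T" and w: "w \<in> generate G S"
  shows "\<exists>ts. set ts \<subseteq> S \<and> w = word ts"
  using w
proof induction
  case one
  show ?case by (intro exI[of _ "[]"]) simp
next
  case (incl h)
  then show ?case using tc S by (intro exI[of _ "[h]"]) auto
next
  case (inv h)
  then have "inv h = h"
    using T_inv tc S by (metis inv_equality subsetD)
  then show ?case using inv tc S by (intro exI[of _ "[h]"]) auto
next
  case (eng h1 h2)
  then obtain us vs where *: "set us \<subseteq> S" "h1 = word us" "set vs \<subseteq> S" "h2 = word vs"
    by blast
  have "set us \<subseteq> carrier G" "set vs \<subseteq> carrier G"
    using *(1,3) S T_carrier by blast+
  then show ?case
    using * word_append[of us vs] by (intro exI[of _ "us @ vs"]) auto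
qed

lemma sep_simple:
  assumes x: "x \<in> Pts" and t: "t \<in> simple x"
  shows "sep x (act t x) = {t}"
proof -
  obtain h where h: "h \<in> Pts" "sep x h = {}" "sep h (act t h) = {t}" and tT: "t \<in> T"
    using t by (auto simp: simple_def)
  note t' = tc[OF tT]
  have "sep (act t h) (act t x) = {}"
    using sep_image[OF t' h(1) x] h sep_sym[OF h(1) x] by simp
  then show ?thesis
    using sep_empty_left[OF x h(1) act_closed[OF t' x] h(2)]
      sep_empty_right[OF h(1) act_closed[OF t' h(1)] act_closed[OF t' x]] h(3)
    by simp
qed

text \<open>
  The word \<open>b\<^sub>1 b\<^sub>2 \<dots>\<close> describes a gallery through the domains of \<open>x\<close>, \<open>b\<^sub>1 x\<close>, \<open>b\<^sub>1 b\<^sub>2 x\<close>, and so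
  on. The walls that it crosses are the conjugates of its letters by the preceding prefixes, and a
  wall that separates its ends is crossed somewhere.
\<close>

lemma separating_letter:
  assumes x: "x \<in> Pts"
  shows "\<lbrakk>set ts \<subseteq> simple x; r \<in> sep x (act (word ts) x)\<rbrakk> \<Longrightarrow>
    \<exists>us b vs. ts = us @ b # vs \<and> r = word us \<otimes> b \<otimes> inv (word us)"
proof (induction ts arbitrary: r)
  case Nil
  then show ?case using act_one x sep_refl by simp
next
  case (Cons b ts)
  have bT: "b \<in> T" and bs: "b \<in> simple x"
    using Cons.prems by (auto simp: simple_def)
  note bc = tc[OF bT]
  have tsc: "set ts \<subseteq> carrier G"
    using Cons.prems simple_carrier by auto
  define p where "p = act (word ts) x"
  have p: "p \<in> Pts"
    unfolding p_def using act_closed word_carrier[OF tsc] x by blast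
  have "act (word (b # ts)) x = act b p"
    unfolding p_def using act_mult[OF bc word_carrier[OF tsc] x] by simp
  then have "r \<in> sep x (act b x) \<or> r \<in> sep (act b x) (act b p)"
    using Cons.prems(2) sep_diff[OF x act_closed[OF bc x] act_closed[OF bc p]] by auto
  then show ?case
  proof
    assume "r \<in> sep x (act b x)"
    then have "r = b"
      using sep_simple[OF x bs] by simp
    then show ?thesis
      using bc by (intro exI[of _ "[]"] exI[of _ b] exI[of _ ts]) simp
  next
    assume "r \<in> sep (act b x) (act b p)"
    then obtain r' where r': "r' \<in> sep x p" "r = b \<otimes> r' \<otimes> inv b"
      using sep_image[OF bc x p] by auto
    then obtain us c vs where *: "ts = us @ c # vs" "r' = word us \<otimes> c \<otimes> inv (word us)"
      using Cons.IH[of r'] Cons.prems(1) unfolding p_def by auto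
    have "set us \<subseteq> carrier G" and c: "c \<in> carrier G"
      using tsc *(1) by auto
    note u = word_carrier[OF this(1)]
    have "r = word (b # us) \<otimes> c \<otimes> inv (word (b # us))"
      using r'(2) *(2) u c bc by (simp add: m_assoc inv_mult_group)
    then show ?thesis
      using *(1) by (intro exI[of _ "b # us"] exI[of _ c] exI[of _ vs]) simp
  qed
qed

text \<open>
  The exchange condition. If \<open>t us\<close> moves \<open>x\<close> within its domain, then \<open>t\<close> separates \<open>x\<close> from its image
  under \<open>us\<close>. So \<open>t\<close> is a conjugate of a letter of \<open>us\<close> by a prefix, both letters cancel, and the
  induction hypothesis applies to a shorter word for the same element.
\<close>

lemma word_trivial:
  assumes x: "x \<in> Pts"
  shows "\<lbrakk>set ts \<subseteq> simple x; sep x (act (word ts) x) = {}\<rbrakk> \<Longrightarrow> word ts = \<one>"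
proof (induction ts rule: length_induct)
  case (1 ts)
  show ?case
  proof (cases ts)
    case Nil
    then show ?thesis by simp
  next
    case (Cons t us)
    have tT: "t \<in> T" and ts: "t \<in> simple x" and us: "set us \<subseteq> simple x"
      using 1 Cons by (auto simp: simple_def)
    note tc' = tc[OF tT]
    have usc: "set us \<subseteq> carrier G"
      using us simple_carrier by blast
    define p where "p = act (word us) x"
    have p: "p \<in> Pts"
      unfolding p_def using act_closed word_carrier[OF usc] x by blast
    have ap: "act (word ts) x = act t p"
      unfolding p_def Cons using act_mult[OF tc' word_carrier[OF usc] x] by simp
    have "t \<in> sep (act t x) (act t p)"
      using sep_diff[OF x act_closed[OF tc' x] act_closed[OF tc' p]] sep_simple[OF x ts] 1(3) ap
      by auto
    moreover have "t \<otimes> t \<otimes> inv t = t"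
      using tc' by (simp add: m_assoc)
    ultimately have "t \<in> sep x p"
      using sep_act[OF tc' x p tT] by simp
    then obtain as b bs where *: "us = as @ b # bs" "t = word as \<otimes> b \<otimes> inv (word as)"
      using separating_letter[OF x us] unfolding p_def by blast
    have c: "set as \<subseteq> carrier G" "b \<in> carrier G" "set bs \<subseteq> carrier G" and bT: "b \<in> T"
      using *(1) usc us by (auto simp: simple_def)
    note a = word_carrier[OF c(1)] and b = word_carrier[OF c(3)]
    have "t \<otimes> word as = word as \<otimes> b"
      using conj_inv(3)[OF a c(2)] *(2) by simp
    have "word ts = t \<otimes> (word as \<otimes> (b \<otimes> word bs))"
      unfolding Cons *(1) using word_append[of as "b # bs"] c by simp
    also have "\<dots> = (t \<otimes> word as) \<otimes> (b \<otimes> word bs)"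
      using a b c tc' by (simp add: m_assoc)
    also have "\<dots> = word as \<otimes> ((b \<otimes> b) \<otimes> word bs)"
      unfolding \<open>t \<otimes> word as = word as \<otimes> b\<close> using a b c by (simp add: m_assoc)
    also have "\<dots> = word (as @ bs)"
      using T_inv[OF bT] b word_append c by simp
    finally have e: "word ts = word (as @ bs)" .
    have "length (as @ bs) < length ts" "set (as @ bs) \<subseteq> simple x"
      using Cons *(1) us by auto
    then have "word (as @ bs) = \<one>"
      using 1(1,3) e by (metis (no_types, lifting))
    then show ?thesis using e by simp
  qed
qed

theorem generate_transitive:
  assumes x: "x \<in> Pts" and c: "\<And>y. y \<in> Pts \<Longrightarrow> near\<^sup>*\<^sup>* x y" and y: "y \<in> Pts"
  shows "\<exists>w\<in>generate G T. sep x (act w y) = {}"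
proof -
  have "simple x \<subseteq> T"
    by (auto simp: simple_def)
  then have "generate G (simple x) \<subseteq> generate G T"
    by (rule mono_generate)
  then show ?thesis
    using simple_transitive[OF x c[OF y]] by blast
qed

theorem generate_free:
  assumes x: "x \<in> Pts" and c: "\<And>y. y \<in> Pts \<Longrightarrow> near\<^sup>*\<^sup>* x y"
    and w: "w \<in> generate G T" and s: "sep x (act w x) = {}"
  shows "w = \<one>"
proof -
  have "generate G T \<subseteq> generate G (simple x)"
    using T_simple[OF x c] generate_is_subgroup[OF simple_carrier]
    by (intro generate_subgroup_incl) auto
  then have "w \<in> generate G (simple x)"
    using w by blast
  then obtain ts where "set ts \<subseteq> simple x" "w = word ts"
    using generate_word[of "simple x" w] by (auto simp: simple_def)
  then show ?thesis
    using word_trivial[OF x] s by blast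
qed

end

section \<open>Linear algebra\<close>

subsection \<open>Linear functionals\<close>

lemma small_shift:
  fixes e v :: "'v::real_normed_vector"
  assumes "open W" "e \<in> W"
  obtains d where "d > 0" "\<And>t. \<bar>t\<bar> \<le> d \<Longrightarrow> e + t *\<^sub>R v \<in> W"
proof -
  obtain r where r: "r > 0" "ball e r \<subseteq> W"
    using assms by (meson open_contains_ball)
  define d where "d = r / (2 * (norm v + 1))"
  have nv: "norm v + 1 > 0"
    by (smt (verit) norm_ge_zero)
  have d: "d > 0"
    unfolding d_def using r nv by simp
  moreover have "e + t *\<^sub>R v \<in> W" if "\<bar>t\<bar> \<le> d" for t
  proof -
    have "\<bar>t\<bar> * norm v \<le> d * (norm v + 1)"
      using that d by (intro mult_mono) auto
    also have "\<dots> = r / 2"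
      unfolding d_def using nv by (simp add: field_simps)
    also have "\<dots> < r"
      using r by simp
    finally show ?thesis
      using r(2) by (auto simp: subset_iff dist_norm)
  qed
  ultimately show ?thesis
    using that by blast
qed

text \<open>
  If \<open>e\<close> and \<open>v\<close> are independent, the eigenvalues at three points of a line through \<open>e\<close> in the
  direction of \<open>v\<close> agree by linearity, and then \<open>v\<close> has the same eigenvalue.
\<close>

lemma locally_eigen_imp_scalar:
  fixes B :: "'v::real_normed_vector \<Rightarrow> 'v"
  assumes B: "linear B" and U: "subspace U" and W: "open W"
    and e: "e \<in> W" "e \<in> U" "e \<noteq> 0"
    and eig: "\<And>v. \<lbrakk>v \<in> W; v \<in> U\<rbrakk> \<Longrightarrow> \<exists>c. B v = c *\<^sub>R v"
  obtains c where "\<And>v. v \<in> U \<Longrightarrow> B v = c *\<^sub>R v"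
proof -
  obtain c where c: "B e = c *\<^sub>R e"
    using eig e by blast
  have "B v = c *\<^sub>R v" if v: "v \<in> U" for v
  proof (cases "\<exists>k. v = k *\<^sub>R e")
    case True
    then show ?thesis
      using c B by (auto simp: linear_scale)
  next
    case False
    \<comment> \<open>The three points are \<open>e\<close>, \<open>e + (d/2) v\<close> and \<open>e + d v\<close>.\<close>
    obtain d where d: "d > 0" "\<And>t. \<bar>t\<bar> \<le> d \<Longrightarrow> e + t *\<^sub>R v \<in> W"
      using small_shift[OF W e(1)] by blast
    have "e + t *\<^sub>R v \<in> U" for t
      using U e v by (simp add: subspace_add subspace_scale)
    then obtain c1 c2 where
      c12: "B (e + d *\<^sub>R v) = c1 *\<^sub>R (e + d *\<^sub>R v)"
        "B (e + (d/2) *\<^sub>R v) = c2 *\<^sub>R (e + (d/2) *\<^sub>R v)"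
      using eig[of "e + d *\<^sub>R v"] eig[of "e + (d/2) *\<^sub>R v"] d(1) d(2)[of d] d(2)[of "d/2"]
      by auto
    have e1: "c *\<^sub>R e + d *\<^sub>R B v = c1 *\<^sub>R e + (c1 * d) *\<^sub>R v"
      using c12(1) c B by (simp add: linear_add linear_scale scaleR_right_distrib)
    have e2: "c *\<^sub>R e + (d/2) *\<^sub>R B v = c2 *\<^sub>R e + (c2 * (d/2)) *\<^sub>R v"
      using c12(2) c B by (simp add: linear_add linear_scale scaleR_right_distrib)
    have "d *\<^sub>R B v = (c *\<^sub>R e + d *\<^sub>R B v) - c *\<^sub>R e"
      by simp
    also have "\<dots> = (c1 - c) *\<^sub>R e + (c1 * d) *\<^sub>R v"
      unfolding e1 by (simp add: scaleR_left_diff_distrib)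
    finally have f1: "d *\<^sub>R B v = (c1 - c) *\<^sub>R e + (c1 * d) *\<^sub>R v" .
    have "d *\<^sub>R B v = 2 *\<^sub>R ((c *\<^sub>R e + (d/2) *\<^sub>R B v) - c *\<^sub>R e)"
      by simp
    also have "\<dots> = (2 * (c2 - c)) *\<^sub>R e + (c2 * d) *\<^sub>R v"
      unfolding e2 by (simp add: scaleR_left_diff_distrib scaleR_right_distrib scaleR_right_diff_distrib)
    finally have "(c1 - c) *\<^sub>R e + (c1 * d) *\<^sub>R v = (2 * (c2 - c)) *\<^sub>R e + (c2 * d) *\<^sub>R v"
      unfolding f1 .
    moreover have "h - b = a - g" if "a + b = g + h" for a b g h :: 'v
    proof -
      have "h = a + b - g"
        using that by simp
      then show ?thesis by simp
    qed
    ultimately have "(c2 * d) *\<^sub>R v - (c1 * d) *\<^sub>R v = (c1 - c) *\<^sub>R e - (2 * (c2 - c)) *\<^sub>R e"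
      by blast
    then have rel: "((c2 - c1) * d) *\<^sub>R v = (c1 - c - 2 * (c2 - c)) *\<^sub>R e"
      by (simp only: scaleR_left_diff_distrib left_diff_distrib)
    have "c2 = c1"
    proof (rule ccontr)
      assume n: "c2 \<noteq> c1"
      have "v = (1 / ((c2 - c1) * d)) *\<^sub>R (((c2 - c1) * d) *\<^sub>R v)"
        using n d by simp
      then show False
        unfolding rel scaleR_scaleR using False by blast
    qed
    then have "c1 = c"
      using rel e(3) by simp
    then have "d *\<^sub>R B v = d *\<^sub>R (c *\<^sub>R v)"
      using f1 by (simp add: mult.commute)
    then show ?thesis
      using d(1) by (simp only: scaleR_cancel_left) simp
  qed
  then show ?thesis
    using that by blast
qed

lemma in_span_two_functionals:
  fixes a b r :: "'v::euclidean_space"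
  assumes "\<And>v. \<lbrakk>a \<bullet> v = 0; b \<bullet> v = 0\<rbrakk> \<Longrightarrow> r \<bullet> v = 0"
  obtains \<alpha> \<beta> where "r = \<alpha> *\<^sub>R a + \<beta> *\<^sub>R b"
proof -
  obtain y z where yz: "y \<in> span {a, b}" "\<And>w. w \<in> span {a, b} \<Longrightarrow> orthogonal z w" "r = y + z"
    using orthogonal_subspace_decomp_exists[of "{a, b}" r] by blast
  have "a \<bullet> z = 0" "b \<bullet> z = 0"
    using yz(2)[of a] yz(2)[of b] by (auto simp: orthogonal_def span_base inner_commute)
  then have "r \<bullet> z = 0"
    using assms by blast
  moreover have "y \<bullet> z = 0"
    using yz(1,2) by (simp add: orthogonal_def inner_commute)
  ultimately have "z = 0"
    using yz(3) by (simp add: inner_add_left)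
  then have "r \<in> span {a, b}"
    using yz by simp
  then obtain k where "r - k *\<^sub>R a \<in> span {b}"
    using span_breakdown_eq[of r a "{b}"] by blast
  then obtain l where "r - k *\<^sub>R a = l *\<^sub>R b"
    by (auto simp: span_singleton)
  then have "r = k *\<^sub>R a + l *\<^sub>R b"
    by (simp add: diff_eq_eq add.commute)
  then show ?thesis
    using that by blast
qed

text \<open>
  Differences of vectors near \<open>e\<close> span the kernel of \<open>w\<close>, so a functional which vanishes on the part
  of this kernel near \<open>e\<close> vanishes on all of it.
\<close>

lemma functional_proportional:
  fixes w z :: "'v::euclidean_space"
  assumes W: "open W" and e: "e \<in> W" "w \<bullet> e = 0"
    and v: "\<And>v. \<lbrakk>v \<in> W; w \<bullet> v = 0\<rbrakk> \<Longrightarrow> z \<bullet> v = 0"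
  obtains k where "z = k *\<^sub>R w"
proof -
  have "z \<bullet> v = 0" if "w \<bullet> v = 0" for v
  proof -
    obtain d where d: "d > 0" "\<And>t. \<bar>t\<bar> \<le> d \<Longrightarrow> e + t *\<^sub>R v \<in> W"
      using small_shift[OF W e(1)] by blast
    have "z \<bullet> (e + d *\<^sub>R v) = 0"
      using v[of "e + d *\<^sub>R v"] d e(2) that by (simp add: inner_add_right)
    then show ?thesis
      using v[OF e] d by (simp add: inner_add_right)
  qed
  then obtain \<alpha> \<beta> where "z = \<alpha> *\<^sub>R w + \<beta> *\<^sub>R w"
    using in_span_two_functionals[of w w z] by blast
  then show ?thesis
    using that[of "\<alpha> + \<beta>"] by (simp add: scaleR_left_distrib)
qed

lemma dim_two_hyperplanes:
  fixes a b :: "'v::euclidean_space"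
  assumes "a \<noteq> 0" "\<nexists>k. b = k *\<^sub>R a"
  shows "dim {v. a \<bullet> v = 0 \<and> b \<bullet> v = 0} + 2 = DIM('v)"
proof -
  have "dim {y \<in> UNIV. \<forall>x\<in>span {a, b}. orthogonal x y} + dim (span {a, b}) = dim (UNIV :: 'v set)"
    by (rule dim_subspace_orthogonal_to_vectors) auto
  moreover have "{y \<in> UNIV. \<forall>x\<in>span {a, b}. orthogonal x y} = {v. a \<bullet> v = 0 \<and> b \<bullet> v = 0}"
  proof (rule equalityI; rule subsetI)
    fix v assume "v \<in> {y \<in> UNIV. \<forall>x\<in>span {a, b}. orthogonal x y}"
    then show "v \<in> {v. a \<bullet> v = 0 \<and> b \<bullet> v = 0}"
      by (auto simp: orthogonal_def span_base)
  next
    fix v assume v: "v \<in> {v. a \<bullet> v = 0 \<and> b \<bullet> v = 0}"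
    have "orthogonal v x" if "x \<in> span {a, b}" for x
      using orthogonal_to_span[OF that, of v] v by (auto simp: orthogonal_def inner_commute)
    then show "v \<in> {y \<in> UNIV. \<forall>x\<in>span {a, b}. orthogonal x y}"
      by (simp add: orthogonal_commute)
  qed
  moreover have "dim (span {a, b}) = 2"
  proof -
    have "b \<notin> span {a}"
      using assms(2) by (auto simp: span_singleton)
    then have "dim {b, a} = dim {a} + 1"
      by (simp add: dim_insert)
    then show ?thesis
      using assms(1) by (simp add: insert_commute dim_insert)
  qed
  ultimately show ?thesis
    by simp
qed

text \<open>
  By its dimension, \<open>L\<close> spans the common kernel of \<open>a\<close> and \<open>b\<close>.
\<close>

lemma in_span_two_functionals_dim:
  fixes a b r :: "'v::euclidean_space"
  assumes ab: "a \<noteq> 0" "\<nexists>k. b = k *\<^sub>R a" and L: "dim L + 2 = DIM('v)"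
    and z: "\<And>v. v \<in> L \<Longrightarrow> a \<bullet> v = 0 \<and> b \<bullet> v = 0 \<and> r \<bullet> v = 0"
  obtains \<alpha> \<beta> where "r = \<alpha> *\<^sub>R a + \<beta> *\<^sub>R b"
proof -
  let ?N = "{v. a \<bullet> v = 0 \<and> b \<bullet> v = 0}"
  have N: "subspace ?N" "dim ?N + 2 = DIM('v)"
    using dim_two_hyperplanes[OF ab] by (auto simp: subspace_def inner_add_right)
  have "L \<subseteq> ?N"
    using z by blast
  then have "span L \<subseteq> ?N"
    using N(1) span_minimal by blast
  then have "span L = ?N"
    using N L by (intro subspace_dim_equal) auto
  moreover have "span L \<subseteq> {v. r \<bullet> v = 0}"
    using z by (intro span_minimal) (auto simp: subspace_hyperplane)
  ultimately have "\<And>v. \<lbrakk>a \<bullet> v = 0; b \<bullet> v = 0\<rbrakk> \<Longrightarrow> r \<bullet> v = 0"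
    by blast
  then show ?thesis
    using in_span_two_functionals that by blast
qed

lemma sign_transfer:
  fixes a b c :: real
  assumes "a * b > 0" "b * c > 0"
  shows "a * c > 0"
  using assms by (auto simp: zero_less_mult_iff)

lemma pos_mult_neg_iff: "c > 0 \<Longrightarrow> c * x < 0 \<longleftrightarrow> x < (0::real)"
  by (auto simp: mult_less_0_iff)

lemma segment_zero:
  fixes w u v :: "'v::real_inner"
  assumes "(w \<bullet> u) * (w \<bullet> v) \<le> 0"
  obtains x where "x \<in> closed_segment u v" "w \<bullet> x = 0"
proof (cases "w \<bullet> u = 0")
  case True
  then show ?thesis using that[of u] by simp
next
  case False
  define t where "t = (w \<bullet> u) / (w \<bullet> u - w \<bullet> v)"
  have s: "w \<bullet> u > 0 \<and> w \<bullet> v \<le> 0 \<or> w \<bullet> u < 0 \<and> w \<bullet> v \<ge> 0"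
    using assms False by (auto simp: mult_le_0_iff)
  then have t: "0 \<le> t" "t \<le> 1" and d: "w \<bullet> u - w \<bullet> v \<noteq> 0"
    by (auto simp: t_def divide_simps)
  have "w \<bullet> ((1 - t) *\<^sub>R u + t *\<^sub>R v) = w \<bullet> u - t * (w \<bullet> u - w \<bullet> v)"
    by (simp add: inner_add_right algebra_simps)
  also have "\<dots> = 0"
    using d by (simp add: t_def)
  finally show ?thesis
    using that[of "(1 - t) *\<^sub>R u + t *\<^sub>R v"] t by (auto simp: closed_segment_def)
qed

lemma segment_positive:
  fixes w u v :: "'v::real_inner"
  assumes "(w \<bullet> u) * (w \<bullet> v) > 0" "x \<in> closed_segment u v"
  shows "(w \<bullet> u) * (w \<bullet> x) > 0"
proof -
  obtain t where t: "0 \<le> t" "t \<le> 1" "x = (1 - t) *\<^sub>R u + t *\<^sub>R v"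
    using assms(2) by (auto simp: closed_segment_def)
  have u: "w \<bullet> u \<noteq> 0"
    using assms(1) by auto
  have "(w \<bullet> u) * (w \<bullet> x) = (1 - t) * ((w \<bullet> u) * (w \<bullet> u)) + t * ((w \<bullet> u) * (w \<bullet> v))"
    by (simp add: t(3) inner_add_right algebra_simps)
  moreover have "(w \<bullet> u) * (w \<bullet> u) > 0"
    using u by (metis not_real_square_gt_zero)
  moreover have "(1 - t) * a + t * b > 0" if "a > 0" "b > 0" for a b :: real
    using t(1,2) that by (cases "t = 0") (simp_all add: add_nonneg_pos)
  ultimately show ?thesis
    using assms(1) by presburger
qed

text \<open>
  In a minimal system \<open>M\<close> equivalent to the inequalities of \<open>N\<close> no inequality \<open>w\<close> can be omitted, so
  some point violates \<open>w\<close> and no other member of \<open>M\<close>. The segment from this point to the interior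
  point \<open>q\<close> meets the hyperplane of \<open>w\<close> where all other inequalities of \<open>M\<close> are strict. In the geometric
  application this is a point in the relative interior of a facet.
\<close>

lemma minimal_subsystem:
  fixes N :: "'v::real_inner set"
  assumes fin: "finite N" and ne: "N \<noteq> {}" and nz: "\<And>w. w \<in> N \<Longrightarrow> w \<noteq> 0"
    and q: "\<And>w. w \<in> N \<Longrightarrow> w \<bullet> q > 0"
  obtains M w z where "M \<subseteq> N" "w \<in> M" "w \<bullet> z = 0" "\<forall>w'\<in>M. w' \<noteq> w \<longrightarrow> w' \<bullet> z > 0"
    "\<forall>u. (\<forall>w\<in>M. w \<bullet> u \<ge> 0) \<longrightarrow> (\<forall>w\<in>N. w \<bullet> u \<ge> 0)"
proof -
  define Q where "Q M \<longleftrightarrow> M \<subseteq> N \<and> (\<forall>u. (\<forall>w\<in>M. w \<bullet> u \<ge> 0) \<longrightarrow> (\<forall>w\<in>N. w \<bullet> u \<ge> 0))" for M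
  have "Q N"
    by (simp add: Q_def)
  then obtain M where M: "Q M" "\<And>M'. Q M' \<Longrightarrow> card M \<le> card M'"
    using ex_has_least_nat[of Q N card] by blast
  have MN: "M \<subseteq> N" and MQ: "\<And>u. (\<forall>w\<in>M. w \<bullet> u \<ge> 0) \<Longrightarrow> (\<forall>w\<in>N. w \<bullet> u \<ge> 0)"
    using M(1) unfolding Q_def by simp_all
  obtain w1 where w1: "w1 \<in> N"
    using ne by blast
  have "M \<noteq> {}"
  proof
    assume "M = {}"
    then have "w1 \<bullet> (- w1) \<ge> 0"
      using MQ[of "- w1"] w1 by simp
    moreover have "w1 \<bullet> w1 > 0"
      using nz[OF w1] by simp
    ultimately show False
      by simp
  qed
  then obtain w where w: "w \<in> M"
    by blast
  have finM: "finite M"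
    using fin MN by (rule rev_finite_subset)
  have "\<not> Q (M - {w})"
  proof
    assume "Q (M - {w})"
    then have "card M \<le> card (M - {w})"
      by (rule M(2))
    moreover have "card (M - {w}) < card M"
      using finM w by (rule card_Diff1_less)
    ultimately show False by simp
  qed
  then obtain u0 where u0: "\<forall>w'\<in>M - {w}. w' \<bullet> u0 \<ge> 0" "\<not> (\<forall>w\<in>N. w \<bullet> u0 \<ge> 0)"
    using MN unfolding Q_def by auto
  have wu0: "w \<bullet> u0 < 0"
  proof (rule ccontr)
    assume "\<not> w \<bullet> u0 < 0"
    then have "\<forall>w'\<in>M. w' \<bullet> u0 \<ge> 0"
      using u0(1) by auto
    then show False
      using MQ u0(2) by simp
  qed
  \<comment> \<open>a positive multiple of the point where the segment from \<open>u0\<close> to \<open>q\<close> meets the hyperplane of \<open>w\<close>\<close>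
  define z where "z = (w \<bullet> q) *\<^sub>R u0 - (w \<bullet> u0) *\<^sub>R q"
  have wq: "w \<bullet> q > 0"
    using q w MN by auto
  have 1: "w \<bullet> z = 0"
    by (simp add: z_def inner_diff_right)
  have 2: "w' \<bullet> z > 0" if "w' \<in> M" "w' \<noteq> w" for w'
  proof -
    have "w' \<bullet> u0 \<ge> 0" "w' \<bullet> q > 0"
      using u0(1) that q MN by auto
    moreover have "w' \<bullet> z = (w \<bullet> q) * (w' \<bullet> u0) + (- (w \<bullet> u0)) * (w' \<bullet> q)"
      by (simp add: z_def inner_diff_right)
    moreover have "(w \<bullet> q) * (w' \<bullet> u0) \<ge> 0" "(- (w \<bullet> u0)) * (w' \<bullet> q) > 0"
      using calculation wq wu0 by (simp_all add: mult_neg_pos)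
    ultimately show ?thesis
      by linarith
  qed
  have 2: "\<forall>w'\<in>M. w' \<noteq> w \<longrightarrow> w' \<bullet> z > 0"
    using 2 by simp
  have 3: "\<forall>u. (\<forall>w\<in>M. w \<bullet> u \<ge> 0) \<longrightarrow> (\<forall>w\<in>N. w \<bullet> u \<ge> 0)"
    by (intro allI impI MQ)
  show ?thesis
    by (rule that[OF MN w 1 2 3])
qed

subsection \<open>Linear involutions\<close>

text \<open>
  For \<open>w \<bullet> u = 1\<close> this is the linear reflection that fixes the kernel of \<open>w\<close> and negates \<open>u\<close>. The axis
  \<open>u\<close> need not be orthogonal to the kernel.
\<close>

definition skew_reflection :: "'v::real_inner \<Rightarrow> 'v \<Rightarrow> 'v \<Rightarrow> 'v"
  where "skew_reflection w u v = v - (2 * (w \<bullet> v)) *\<^sub>R u"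

lemma linear_skew_reflection: "linear (skew_reflection w u)"
  by (rule linearI) (auto simp: skew_reflection_def algebra_simps inner_add_right)

lemma skew_reflection_wall: "w \<bullet> v = 0 \<Longrightarrow> skew_reflection w u v = v"
  by (simp add: skew_reflection_def)

lemma skew_reflection_flip: "w \<bullet> u = 1 \<Longrightarrow> w \<bullet> skew_reflection w u v = - (w \<bullet> v)"
  by (simp add: skew_reflection_def inner_diff_right)

lemma skew_reflection_invol: "w \<bullet> u = 1 \<Longrightarrow> skew_reflection w u (skew_reflection w u v) = v"
  using skew_reflection_flip[of w u v]
  by (simp add: skew_reflection_def[of w u "skew_reflection w u v"])
    (simp add: skew_reflection_def)

text \<open>
  As \<open>A\<close> fixes the kernel of \<open>w\<close>, it has the form \<open>A v = v + (w \<bullet> v) y\<close>. The fixed vector \<open>e\<close> forces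
  \<open>c = 1\<close>, and then the only value of \<open>w \<bullet> y\<close> that makes \<open>A\<close> a nontrivial involution is \<open>-2\<close>.
\<close>

lemma involution_fixing_hyperplane:
  fixes A :: "'v::real_inner \<Rightarrow> 'v"
  assumes A: "linear A" and fixed: "\<And>v. w \<bullet> v = 0 \<Longrightarrow> A v = v"
    and sq: "\<And>v. A (A v) = c *\<^sub>R v" and e: "w \<bullet> e = 0" "e \<noteq> 0"
    and w: "w \<noteq> 0" and ne: "A \<noteq> id"
  obtains u where "w \<bullet> u = 1" "A = skew_reflection w u"
proof -
  have c: "c = 1"
  proof -
    have "c *\<^sub>R e = 1 *\<^sub>R e"
      using sq[of e] by (simp add: fixed[OF e(1)])
    then show ?thesis
      using e(2) by (simp only: scaleR_cancel_right) simp
  qed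
  define u0 where "u0 = (1 / (w \<bullet> w)) *\<^sub>R w"
  have u0: "w \<bullet> u0 = 1"
    using w by (simp add: u0_def)
  have dec: "A v = v + (w \<bullet> v) *\<^sub>R (A u0 - u0)" for v
  proof -
    have "A (v - (w \<bullet> v) *\<^sub>R u0) = v - (w \<bullet> v) *\<^sub>R u0"
      using u0 by (intro fixed) (simp add: inner_diff_right)
    then show ?thesis
      using A by (simp add: linear_diff linear_scale algebra_simps)
  qed
  define y where "y = A u0 - u0"
  have "A y = - y"
    unfolding y_def using A sq[of u0] c by (simp add: linear_diff)
  then have "y + (w \<bullet> y) *\<^sub>R y = - y"
    using dec[of y] by (simp add: y_def)
  then have "(2 + w \<bullet> y) *\<^sub>R y = 0"
    by (simp add: algebra_simps scaleR_2)
  moreover have "y \<noteq> 0"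
  proof
    assume "y = 0"
    then have "A v = v" for v
      using dec[of v] by (simp add: y_def)
    then show False
      using ne by auto
  qed
  ultimately have wy: "w \<bullet> y = -2"
    by auto
  define u where "u = - (1/2) *\<^sub>R y"
  have "A v = skew_reflection w u v" for v
    using dec[of v] by (simp add: skew_reflection_def u_def y_def[symmetric])
  then show ?thesis
    using that[of u] wy by (auto simp: u_def)
qed

text \<open>
  The involution negates all vectors \<open>v - A v\<close>, and they lie in the kernel of \<open>w\<close>. A combination of
  such a vector and of \<open>x - A x\<close> which also lies in the kernel of \<open>z\<close> is fixed and negated, hence
  zero. So \<open>A - id\<close> has rank one.
\<close>

lemma involution_is_skew_reflection:
  fixes A :: "'v::euclidean_space \<Rightarrow> 'v"
  assumes A: "linear A" and sq: "\<And>v. A (A v) = v" and w: "\<And>v. w \<bullet> A v = w \<bullet> v"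
    and fixed: "\<And>v. \<lbrakk>w \<bullet> v = 0; z \<bullet> v = 0\<rbrakk> \<Longrightarrow> A v = v"
    and x: "w \<bullet> x = 0" "(z \<bullet> x) * (z \<bullet> A x) < 0"
  obtains q u where "q \<bullet> u = 1" "w \<bullet> u = 0" "A = skew_reflection q u"
proof -
  define u where "u = x - A x"
  have Au: "A u = - u"
    unfolding u_def using A sq by (simp add: linear_diff)
  have wu: "w \<bullet> u = 0"
    using w[of x] by (simp add: u_def inner_diff_right)
  have zu: "z \<bullet> u \<noteq> 0"
    using x(2) by (auto simp: u_def inner_diff_right mult_less_0_iff)
  have key: "v - A v = ((z \<bullet> (v - A v)) / (z \<bullet> u)) *\<^sub>R u" for v
  proof -
    define d where "d = v - A v"
    define k where "k = (z \<bullet> d) / (z \<bullet> u)"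
    have Ad: "A d = - d"
      unfolding d_def using A sq by (simp add: linear_diff)
    have f1: "A (d - k *\<^sub>R u) = d - k *\<^sub>R u"
      using w[of v] wu zu by (intro fixed) (auto simp: d_def k_def inner_diff_right)
    have f2: "A (d - k *\<^sub>R u) = - (d - k *\<^sub>R u)"
      using A Ad Au by (simp add: linear_diff linear_scale)
    have "d - k *\<^sub>R u = - (d - k *\<^sub>R u)"
      by (rule trans[OF f1[symmetric] f2])
    then have "2 *\<^sub>R (d - k *\<^sub>R u) = 0"
      by (simp only: scaleR_2 eq_neg_iff_add_eq_0)
    then show ?thesis
      by (simp add: d_def k_def)
  qed
  define q where "q = (1 / (2 * (z \<bullet> u))) *\<^sub>R (z - adjoint A z)"
  have q: "q \<bullet> v = (z \<bullet> (v - A v)) / (2 * (z \<bullet> u))" for v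
    using adjoint_works[OF A, of v z]
    by (simp add: q_def inner_diff_left inner_diff_right inner_commute)
  have "q \<bullet> u = 1"
    using zu by (simp add: q Au inner_add_right)
  moreover have "A v = skew_reflection q u v" for v
  proof -
    have "2 * (q \<bullet> v) = (z \<bullet> (v - A v)) / (z \<bullet> u)"
      by (simp add: q)
    then have "skew_reflection q u v = v - (v - A v)"
      by (simp only: skew_reflection_def key[symmetric])
    then show ?thesis
      by simp
  qed
  ultimately show ?thesis
    using that wu by blast
qed

text \<open>The elements that \<open>f\<close> moves fall into pairs.\<close>

lemma card_parity_fixed_points:
  assumes "finite M" "\<And>x. x \<in> M \<Longrightarrow> f x \<in> M" "\<And>x. x \<in> M \<Longrightarrow> f (f x) = x"
  shows "even (card M) \<longleftrightarrow> even (card {x \<in> M. f x = x})"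
  using assms
proof (induction "card M" arbitrary: M rule: less_induct)
  case less
  show ?case
  proof (cases "\<forall>x\<in>M. f x = x")
    case True
    then have "{x \<in> M. f x = x} = M" by blast
    then show ?thesis by simp
  next
    case False
    then obtain x where x: "x \<in> M" "f x \<noteq> x" by blast
    define N where "N = M - {x, f x}"
    have fx: "f x \<in> M" "f (f x) = x"
      using less x by auto
    have M: "M = insert x (insert (f x) N)"
      using x fx by (auto simp: N_def)
    have fN: "finite N" "x \<notin> N" "f x \<notin> N"
      using less by (auto simp: N_def)
    have c: "card M = card N + 2"
      unfolding M using fN x by simp
    have "f y \<in> N" if "y \<in> N" for y
      using that less fx x by (auto simp: N_def) metis
    moreover have "f (f y) = y" if "y \<in> N" for y
      using that less.prems(3) by (auto simp: N_def)
    ultimately have "even (card N) \<longleftrightarrow> even (card {x \<in> N. f x = x})"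
      using c fN(1) by (intro less.hyps) auto
    moreover have "{y \<in> M. f y = y} = {y \<in> N. f y = y}"
      using x fx by (auto simp: N_def)
    ultimately show ?thesis
      using c by simp
  qed
qed

subsection \<open>Generic points\<close>

lemma subspace_subset_closure_diff:
  fixes U N :: "'v::real_normed_vector set"
  assumes U: "subspace U" and N: "subspace N" and b: "b \<in> U" "b \<notin> N"
  shows "U \<subseteq> closure (U - N)"
proof
  fix x assume x: "x \<in> U"
  show "x \<in> closure (U - N)"
  proof (cases "x \<in> N")
    case False
    then show ?thesis
      using x closure_subset[of "U - N"] by auto
  next
    case True
    show ?thesis
      unfolding closure_approachable
    proof safe
      fix \<epsilon> :: real assume "\<epsilon> > 0"
      then obtain d where d: "d > 0" "x + d *\<^sub>R b \<in> ball x \<epsilon>"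
        using small_shift[of "ball x \<epsilon>" x b] by (metis abs_of_pos centre_in_ball open_ball order_refl)
      have "x + d *\<^sub>R b \<notin> N"
      proof
        assume "x + d *\<^sub>R b \<in> N"
        then have "(1/d) *\<^sub>R ((x + d *\<^sub>R b) - x) \<in> N"
          using N True by (intro subspace_scale subspace_diff) auto
        then show False
          using b d by simp
      qed
      moreover have "x + d *\<^sub>R b \<in> U"
        using U x b by (simp add: subspace_add subspace_scale)
      ultimately show "\<exists>y\<in>U - N. dist y x < \<epsilon>"
        using d(2) by (auto simp: dist_commute)
    qed
  qed
qed

text \<open>
  Proper subspaces of \<open>U\<close> are closed and nowhere dense in it, so countably many of them do not fill an
  open part of \<open>U\<close> by Baire's theorem.
\<close>

lemma subspace_generic_point:
  fixes U :: "'v::euclidean_space set"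
  assumes U: "subspace U" and W: "open W" "W \<inter> U \<noteq> {}" and \<N>: "countable \<N>"
    and N: "\<And>N. N \<in> \<N> \<Longrightarrow> subspace N \<and> \<not> U \<subseteq> N"
  shows "\<exists>z\<in>W \<inter> U. \<forall>N\<in>\<N>. z \<notin> N"
proof -
  let ?G = "insert U ((\<lambda>N. U - N) ` \<N>)"
  have "U \<subseteq> closure (\<Inter>?G)"
  proof (rule Baire)
    show "closed U"
      by (rule closed_subspace[OF U])
    show "countable ?G"
      using \<N> by simp
    fix T assume "T \<in> ?G"
    then consider "T = U" | N where "N \<in> \<N>" "T = U - N"
      by blast
    then show "openin (top_of_set U) T \<and> U \<subseteq> closure T"
    proof cases
      case 1
      then show ?thesis using closure_subset[of U] by simp
    next
      case 2
      have "openin (top_of_set U) (U - N)"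
        using closed_subspace[of N] N[OF 2(1)]
        by (metis Diff_Compl Int_commute openin_open open_Compl Diff_eq)
      moreover obtain b where "b \<in> U" "b \<notin> N"
        using N[OF 2(1)] by blast
      ultimately show ?thesis
        using subspace_subset_closure_diff[OF U] N[OF 2(1)] 2 by blast
    qed
  qed
  then have "W \<inter> closure (\<Inter>?G) \<noteq> {}"
    using W by blast
  then have "W \<inter> \<Inter>?G \<noteq> {}"
    using open_Int_closure_eq_empty[OF W(1)] by blast
  then show ?thesis
    by blast
qed

text \<open>
  The points \<open>u\<close> and \<open>v\<close> are joined by segments to a third point \<open>z\<close>. The segment from \<open>u\<close> to \<open>z\<close> meets
  \<open>M\<close> only if \<open>z\<close> lies in the span of \<open>u\<close> and \<open>M\<close>, which is a proper subspace of \<open>U\<close>; so a generic \<open>z\<close>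
  will do. Because \<open>U\<close> has dimension at least two, \<open>{0}\<close> can be treated as a member of the family,
  and then the segments stay in \<open>Q\<close>.
\<close>

lemma connected_minus_codim2:
  fixes U :: "'v::euclidean_space set"
  assumes U: "subspace U" "2 \<le> dim U" and Q: "openin (top_of_set U) Q" "0 \<notin> Q"
    and seg: "\<And>u v. \<lbrakk>u \<in> Q; v \<in> Q; 0 \<notin> closed_segment u v\<rbrakk> \<Longrightarrow> closed_segment u v \<subseteq> Q"
    and \<M>: "countable \<M>"
    and M: "\<And>M. M \<in> \<M> \<Longrightarrow> subspace M \<and> M \<subseteq> U \<and> dim M + 2 \<le> dim U"
  shows "connected (Q - \<Union>\<M>)"
proof -
  \<comment> \<open>With \<open>{0}\<close> in the family, the segments to \<open>z\<close> also avoid \<open>0\<close>, as \<open>seg\<close> requires.\<close>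
  let ?M = "insert {0} \<M>"
  have M': "subspace M \<and> dim M + 2 \<le> dim U" if "M \<in> ?M" for M
  proof (cases "M = {0}")
    case True
    then show ?thesis
      using U(2) subspace_single_0 by simp
  next
    case False
    then show ?thesis
      using that M by simp
  qed
  obtain W where W: "open W" "Q = U \<inter> W"
    using Q(1) by (auto simp: openin_open)
  have "\<exists>C. connected C \<and> C \<subseteq> Q - \<Union>\<M> \<and> u \<in> C \<and> v \<in> C"
    if u: "u \<in> Q - \<Union>\<M>" and v: "v \<in> Q - \<Union>\<M>" for u v
  proof -
    let ?N = "(\<lambda>M. span (insert u M)) ` ?M \<union> (\<lambda>M. span (insert v M)) ` ?M"
    have N: "subspace N \<and> \<not> U \<subseteq> N" if "N \<in> ?N" for N
    proof -
      have "\<exists>x. \<exists>M\<in>?M. N = span (insert x M)"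
        using that unfolding Un_iff image_iff by (elim disjE) (rule exI, assumption)+
      then obtain x M where *: "N = span (insert x M)" "M \<in> ?M"
        by (elim exE bexE) (rule that)
      have "dim N \<le> dim M + 1"
        unfolding *(1) by (simp add: dim_insert)
      then have "dim N < dim U"
        using M'[OF *(2)] by simp
      then show ?thesis
        unfolding *(1) using dim_subset by (metis leD subspace_span)
    qed
    have "W \<inter> U \<noteq> {}"
      using u W by blast
    moreover have "countable ?N"
      using \<M> by simp
    ultimately obtain z where z: "z \<in> W" "z \<in> U" "\<forall>N\<in>?N. z \<notin> N"
      using subspace_generic_point[OF U(1) W(1) _ _ N] by blast
    have avoid: "closed_segment x z \<inter> M = {}"
      if x: "x \<in> {u, v}" "x \<notin> M" and Mm: "M \<in> ?M" for x M
    proof (rule ccontr)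
      assume "closed_segment x z \<inter> M \<noteq> {}"
      then obtain t where t: "0 \<le> t" "t \<le> 1" "(1 - t) *\<^sub>R x + t *\<^sub>R z \<in> M"
        by (auto simp: closed_segment_def)
      have "t \<noteq> 0"
        using t x(2) by auto
      have zz: "z = (1/t) *\<^sub>R (((1 - t) *\<^sub>R x + t *\<^sub>R z) - (1 - t) *\<^sub>R x)"
        using \<open>t \<noteq> 0\<close> by simp
      have "z \<in> span (insert x M)"
        by (subst zz) (intro span_scale span_diff span_base; use t in auto)
      then show False
        using z(3)[rule_format, of "span (insert x M)"] x(1) Mm by auto
    qed
    have zQ: "z \<in> Q"
      using z W by blast
    have seg': "closed_segment x z \<subseteq> Q - \<Union>\<M>" if x: "x \<in> {u, v}" for x
    proof -
      have xx: "x \<in> Q" "x \<notin> \<Union>\<M>"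
        using x u v by auto
      have "0 \<notin> closed_segment x z"
        using avoid[of x "{0}"] x xx Q(2) by auto
      then have "closed_segment x z \<subseteq> Q"
        using seg xx zQ by blast
      moreover have "closed_segment x z \<inter> M = {}" if "M \<in> \<M>" for M
        using avoid[of x M] x xx that by auto
      ultimately show ?thesis
        by blast
    qed
    have "connected (closed_segment u z \<union> closed_segment v z)"
      by (rule connected_Un) auto
    then show ?thesis
      using seg'[of u] seg'[of v] by (intro exI[of _ "closed_segment u z \<union> closed_segment v z"]) auto
  qed
  then have "\<forall>u\<in>Q - \<Union>\<M>. \<forall>v\<in>Q - \<Union>\<M>. connected_component (Q - \<Union>\<M>) u v"
    unfolding connected_component_def by blast
  then show ?thesis
    by (rule iffD2[OF connected_iff_connected_component])
qed

section \<open>Linear models of the spaces\<close>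

text \<open>
  The points of the space are the rays of the cone \<open>K\<close>: \<open>\<pi>\<close> maps a vector to the point on its ray, and
  \<open>\<phi>\<close> chooses a vector for a point. In the Euclidean case \<open>\<phi> x = (x, 1)\<close>, which makes affine functions
  linear; otherwise the points are unit vectors of some kind and \<open>\<pi>\<close> is a normalisation. Segments
  through \<open>0\<close> are excluded from the convexity condition in order to cover the sphere, where \<open>K\<close> is the
  complement of \<open>0\<close>.
\<close>

locale space_model =
  fixes S :: "'a::euclidean_space geometry"
    and \<phi> :: "'a \<Rightarrow> 'v::euclidean_space" and \<pi> :: "'v \<Rightarrow> 'a" and K :: "'v set"
  assumes open_K: "open K" and K_nonempty: "K \<noteq> {}" and zero_K: "0 \<notin> K"
    and scale_K: "\<lbrakk>v \<in> K; c > 0\<rbrakk> \<Longrightarrow> c *\<^sub>R v \<in> K"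
    and segment_K: "\<lbrakk>u \<in> K; v \<in> K; 0 \<notin> closed_segment u v\<rbrakk> \<Longrightarrow> closed_segment u v \<subseteq> K"
    and \<phi>_K: "x \<in> points S \<Longrightarrow> \<phi> x \<in> K" and \<pi>_\<phi>: "x \<in> points S \<Longrightarrow> \<pi> (\<phi> x) = x"
    and \<pi>_points: "v \<in> K \<Longrightarrow> \<pi> v \<in> points S"
    and \<phi>_\<pi>: "v \<in> K \<Longrightarrow> \<exists>c>0. \<phi> (\<pi> v) = c *\<^sub>R v"
    and \<pi>_scale: "\<lbrakk>v \<in> K; c > 0\<rbrakk> \<Longrightarrow> \<pi> (c *\<^sub>R v) = \<pi> v"
    and continuous_\<phi>: "continuous_on (points S) \<phi>" and continuous_\<pi>: "continuous_on K \<pi>"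
    and hyperplane_functional: "\<lbrakk>a \<noteq> 0; S = Euclidean \<or> b = 0\<rbrakk> \<Longrightarrow>
      \<exists>w. w \<noteq> 0 \<and> (\<forall>x\<in>points S. form S a x - b = w \<bullet> \<phi> x)"
    and functional_hyperplane: "\<lbrakk>w \<noteq> 0; x\<^sub>0 \<in> points S; w \<bullet> \<phi> x\<^sub>0 = 0\<rbrakk> \<Longrightarrow>
      \<exists>a b. a \<noteq> 0 \<and> (S = Euclidean \<or> b = 0) \<and> (\<forall>x\<in>points S. form S a x - b = w \<bullet> \<phi> x)"
    and dimension_\<phi>: "T \<subseteq> points S \<Longrightarrow> dimension_in S T = int (dim (\<phi> ` T)) - 1"
    and isometry_linear: "f \<in> isometries S \<Longrightarrow>
      \<exists>A. linear A \<and> (\<forall>v\<in>K. A v \<in> K \<and> \<pi> (A v) = f (\<pi> v))"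
    and isometries_subgroup: "subgroup (isometries S) (BijGroup (points S))"
begin

abbreviation "P \<equiv> points S"

definition hat :: "'a set \<Rightarrow> 'v set"
  where "hat T = {v \<in> K. \<pi> v \<in> T}"

text \<open>
  A linear lift of a transformation. By \<open>rep_identity_scalar\<close> it is unique up to a positive factor.
\<close>

definition rep :: "('a \<Rightarrow> 'a) \<Rightarrow> ('v \<Rightarrow> 'v) \<Rightarrow> bool"
  where "rep f A \<longleftrightarrow> linear A \<and> (\<forall>v\<in>K. A v \<in> K \<and> \<pi> (A v) = f (\<pi> v))"

lemma rep_linear: "rep f A \<Longrightarrow> linear A"
  and rep_K: "\<lbrakk>rep f A; v \<in> K\<rbrakk> \<Longrightarrow> A v \<in> K"
  and rep_\<pi>: "\<lbrakk>rep f A; v \<in> K\<rbrakk> \<Longrightarrow> \<pi> (A v) = f (\<pi> v)"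
  by (auto simp: rep_def)

lemma isometry_rep: "f \<in> isometries S \<Longrightarrow> \<exists>A. rep f A"
  using isometry_linear by (auto simp: rep_def)

lemma same_ray:
  assumes "u \<in> K" "v \<in> K" "\<pi> u = \<pi> v"
  shows "\<exists>c>0. u = c *\<^sub>R v"
proof -
  obtain a b where ab: "a > 0" "\<phi> (\<pi> u) = a *\<^sub>R u" "b > 0" "\<phi> (\<pi> v) = b *\<^sub>R v"
    using \<phi>_\<pi> assms(1,2) by blast
  then have "a *\<^sub>R u = b *\<^sub>R v"
    using assms(3) by simp
  then have "u = (b / a) *\<^sub>R v"
    using ab(1) by (metis divide_inverse_commute less_irrefl real_vector.scale_left_imp_eq
        scaleR_scaleR right_inverse scaleR_one mult.commute)
  then show ?thesis
    using ab by (intro exI[of _ "b / a"]) simp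
qed

lemma K_nonzero: "v \<in> K \<Longrightarrow> v \<noteq> 0"
  using zero_K by blast

lemma rep_scale: "\<lbrakk>rep f A; c > 0\<rbrakk> \<Longrightarrow> rep f (\<lambda>v. c *\<^sub>R A v)"
  by (auto simp: rep_def scale_K \<pi>_scale intro: linear_compose_scale_right)

lemma rep_comp:
  assumes "rep f A" "rep g B"
  shows "rep (compose P f g) (\<lambda>v. A (B v))"
  using assms linear_compose[of B A] by (auto simp: rep_def compose_def \<pi>_points o_def)

lemma rep_identity_scalar:
  assumes r: "rep f A" and f: "\<And>x. x \<in> P \<Longrightarrow> f x = x"
  obtains c where "c > 0" "\<And>v. A v = c *\<^sub>R v"
proof -
  obtain e where e: "e \<in> K"
    using K_nonempty by blast
  have *: "\<exists>c>0. A v = c *\<^sub>R v" if "v \<in> K" for v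
    using same_ray[of "A v" v] rep_K[OF r that] rep_\<pi>[OF r that] f[OF \<pi>_points[OF that]] that
    by simp
  obtain c where c: "\<And>v. A v = c *\<^sub>R v"
    using locally_eigen_imp_scalar[OF rep_linear[OF r] subspace_UNIV open_K e _ K_nonzero[OF e]] *
    by (metis UNIV_I)
  moreover have "c > 0"
    using *[OF e] c[of e] K_nonzero[OF e] by (metis scaleR_cancel_right)
  ultimately show ?thesis
    using that by blast
qed

text \<open>
  This allows to normalise the lift of an isometry so that it fixes every vector over the points which
  are known to be fixed.
\<close>

lemma fixed_scalar:
  assumes r: "rep f A" and U: "subspace U" and W: "open W" "e \<in> W" "e \<in> U" "W \<subseteq> K"
    and fixed: "\<And>v. \<lbrakk>v \<in> W; v \<in> U\<rbrakk> \<Longrightarrow> f (\<pi> v) = \<pi> v"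
  obtains c where "c > 0" "\<And>v. v \<in> U \<Longrightarrow> A v = c *\<^sub>R v"
proof -
  have eK: "e \<in> K"
    using W by blast
  have *: "\<exists>c>0. A v = c *\<^sub>R v" if "v \<in> W" "v \<in> U" for v
    using same_ray[of "A v" v] rep_K[OF r, of v] rep_\<pi>[OF r, of v] fixed[OF that] that W(4)
    by auto
  obtain c where c: "\<And>v. v \<in> U \<Longrightarrow> A v = c *\<^sub>R v"
    using locally_eigen_imp_scalar[OF rep_linear[OF r] U W(1,2,3) K_nonzero[OF eK]] *
    by metis
  moreover have "c > 0"
    using *[OF W(2,3)] c[OF W(3)] K_nonzero[OF eK] by (metis scaleR_cancel_right)
  ultimately show ?thesis
    using that by blast
qed

lemma rep_fixing_point:
  assumes f: "f \<in> isometries S" and e: "e \<in> K" "f (\<pi> e) = \<pi> e"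
  obtains A where "rep f A" "A e = e"
proof -
  obtain A where A: "rep f A"
    using isometry_rep f by blast
  obtain c where c: "c > 0" "A e = c *\<^sub>R e"
    using same_ray[of "A e" e] rep_K[OF A e(1)] rep_\<pi>[OF A e(1)] e by auto
  show ?thesis
    using that[OF rep_scale[OF A, of "1 / c"]] c by simp
qed

lemma isometry_Bij: "f \<in> isometries S \<Longrightarrow> f \<in> Bij P"
  using subgroup.subset[OF isometries_subgroup] by (auto simp: BijGroup_def)

lemma isometry_points: "\<lbrakk>f \<in> isometries S; x \<in> P\<rbrakk> \<Longrightarrow> f x \<in> P"
  using isometry_Bij Bij_imp_funcset by blast

definition ginv :: "('a \<Rightarrow> 'a) \<Rightarrow> 'a \<Rightarrow> 'a"
  where "ginv f = restrict (inv_into P f) P"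

lemma ginv_eq: "f \<in> Bij P \<Longrightarrow> inv\<^bsub>BijGroup P\<^esub> f = ginv f"
  unfolding ginv_def by (rule inv_BijGroup)

lemma ginv_isometry: "f \<in> isometries S \<Longrightarrow> ginv f \<in> isometries S"
  using subgroup.m_inv_closed[OF isometries_subgroup] ginv_eq isometry_Bij by metis

lemma ginv_left: "\<lbrakk>f \<in> Bij P; x \<in> P\<rbrakk> \<Longrightarrow> ginv f (f x) = x"
  by (auto simp: ginv_def Bij_def bij_betw_def)

lemma ginv_right: "\<lbrakk>f \<in> Bij P; x \<in> P\<rbrakk> \<Longrightarrow> f (ginv f x) = x"
  by (auto simp: ginv_def Bij_def bij_betw_def f_inv_into_f)

text \<open>
  A composition of lifts of \<open>f\<close> and of its inverse is a lift of the identity, that is, a scalar, which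
  can be absorbed into one of them.
\<close>

lemma rep_inverse:
  assumes f: "f \<in> isometries S" and A: "rep f A"
  obtains B where "rep (ginv f) B" "\<And>v. B (A v) = v" "\<And>v. A (B v) = v"
proof -
  obtain B where B: "rep (ginv f) B"
    using isometry_rep ginv_isometry[OF f] by blast
  have "compose P (ginv f) f x = x" if "x \<in> P" for x
    using ginv_left[OF isometry_Bij[OF f] that] that by (simp add: compose_def)
  then obtain c where c: "c > 0" "\<And>v. B (A v) = c *\<^sub>R v"
    using rep_identity_scalar[OF rep_comp[OF B A]] by blast
  define C where "C = (\<lambda>v. (1 / c) *\<^sub>R B v)"
  have C: "rep (ginv f) C"
    unfolding C_def using rep_scale[OF B, of "1 / c"] c by simp
  have CA: "C (A v) = v" for v
    using c by (simp add: C_def)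
  then have "inj A"
    by (metis injI)
  then have "surj A"
    using linear_injective_imp_surjective rep_linear[OF A] by blast
  then have "A (C v) = v" for v
    using CA by (metis surjD)
  then show ?thesis
    using that C CA by blast
qed

subsection \<open>Topology and dimension\<close>

lemma hat_K: "hat T \<subseteq> K"
  by (auto simp: hat_def)

lemma open_hat:
  assumes "openin (space_top S) T"
  shows "open (hat T)"
proof -
  have "openin (top_of_set K) (K \<inter> \<pi> -` T)"
    using continuous_openin_preimage[OF continuous_\<pi> _ assms] \<pi>_points by blast
  moreover have "K \<inter> \<pi> -` T = hat T"
    by (auto simp: hat_def)
  ultimately show ?thesis
    using open_K by (simp add: openin_open_eq)
qed

lemma interior_hat: "interior (hat T) = hat (space_top S interior_of T)"
proof
  have "hat (space_top S interior_of T) \<subseteq> hat T"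
    using interior_of_subset[of "space_top S" T] by (auto simp: hat_def)
  then show "hat (space_top S interior_of T) \<subseteq> interior (hat T)"
    using open_hat[OF openin_interior_of] by (rule interior_maximal)
  show "interior (hat T) \<subseteq> hat (space_top S interior_of T)"
  proof
    fix v assume v: "v \<in> interior (hat T)"
    have vK: "v \<in> K"
      using v interior_subset[of "hat T"] hat_K[of T] by auto
    obtain c where c: "c > 0" "\<phi> (\<pi> v) = c *\<^sub>R v"
      using \<phi>_\<pi>[OF vK] by blast
    define W where "W = (\<lambda>u. c *\<^sub>R u) ` interior (hat T)"
    have W: "open W"
      unfolding W_def using c(1) by (intro open_scaling) auto
    have "openin (space_top S) (P \<inter> \<phi> -` W)"
      using continuous_openin_preimage_gen[OF continuous_\<phi> W] .
    moreover have "\<pi> v \<in> P \<inter> \<phi> -` W"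
      using \<pi>_points[OF vK] c v by (auto simp: W_def)
    moreover have "P \<inter> \<phi> -` W \<subseteq> T"
    proof
      fix x assume x: "x \<in> P \<inter> \<phi> -` W"
      then obtain u where u: "u \<in> interior (hat T)" "\<phi> x = c *\<^sub>R u"
        by (auto simp: W_def)
      then have "u \<in> hat T"
        using interior_subset[of "hat T"] by auto
      then have "u \<in> K" "\<pi> u \<in> T"
        by (auto simp: hat_def)
      then show "x \<in> T"
        using \<pi>_\<phi>[of x] \<pi>_scale[of u c] u(2) x c(1) by simp
    qed
    ultimately have "\<pi> v \<in> space_top S interior_of T"
      unfolding interior_of_def by blast
    then show "v \<in> hat (space_top S interior_of T)"
      using vK by (simp add: hat_def)
  qed
qed

lemma dimension_hat:
  assumes T: "T \<subseteq> P"
  shows "dimension_in S T = int (dim (hat T)) - 1"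
proof -
  have "\<phi> ` T \<subseteq> hat T"
    using T \<phi>_K \<pi>_\<phi> by (auto simp: hat_def)
  moreover have "hat T \<subseteq> span (\<phi> ` T)"
  proof
    fix v assume "v \<in> hat T"
    then have v: "v \<in> K" "\<pi> v \<in> T"
      by (auto simp: hat_def)
    obtain c where c: "c > 0" "\<phi> (\<pi> v) = c *\<^sub>R v"
      using \<phi>_\<pi>[OF v(1)] by blast
    have "(1 / c) *\<^sub>R \<phi> (\<pi> v) \<in> span (\<phi> ` T)"
      using v(2) by (intro span_scale span_base) auto
    then show "v \<in> span (\<phi> ` T)"
      using c by simp
  qed
  ultimately have "dim (\<phi> ` T) = dim (hat T)"
    by (metis dim_span dim_subset le_antisym)
  then show ?thesis
    using dimension_\<phi>[OF T] by simp
qed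

lemma dimension_points: "dimension_in S P = int (DIM('v)) - 1"
proof -
  have "hat P = K"
    using \<pi>_points by (auto simp: hat_def)
  then show ?thesis
    using dimension_hat[of P] dim_openin[of UNIV K] open_K K_nonempty by simp
qed

lemma K_not_in_hyperplane:
  assumes "w \<noteq> 0" "open W" "W \<noteq> {}"
  obtains v where "v \<in> W" "w \<bullet> v \<noteq> 0"
proof -
  obtain e where e: "e \<in> W"
    using assms(3) by blast
  obtain d where d: "d > 0" "\<And>t. \<bar>t\<bar> \<le> d \<Longrightarrow> e + t *\<^sub>R w \<in> W"
    using small_shift[OF assms(2) e] by blast
  have "w \<bullet> (e + d *\<^sub>R w) = w \<bullet> e + d * (w \<bullet> w)"
    by (simp add: inner_add_right)
  then have "w \<bullet> (e + d *\<^sub>R w) \<noteq> w \<bullet> e"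
    using d(1) assms(1) by simp
  then consider "w \<bullet> e \<noteq> 0" | "w \<bullet> (e + d *\<^sub>R w) \<noteq> 0"
    by fastforce
  then show ?thesis
    using that e d(2)[of d] d(1) by cases auto
qed

subsection \<open>Hyperplanes and reflections\<close>

lemma functional_sign:
  assumes "v \<in> K"
  obtains c where "c > 0" "w \<bullet> \<phi> (\<pi> v) = c * (w \<bullet> v)"
  using \<phi>_\<pi>[OF assms] by (metis inner_scaleR_right)

lemma normals_functional:
  assumes "(a, b) \<in> normals S Y"
  obtains w where "w \<noteq> 0"
    "Y = {x \<in> P. w \<bullet> \<phi> x = 0}" "halfspace S a b = {x \<in> P. w \<bullet> \<phi> x \<ge> 0}"
proof -
  have *: "a \<noteq> 0" "S = Euclidean \<or> b = 0" "Y = hyperplane_eq S a b"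
    using assms by (auto simp: normals_def)
  obtain w where w: "w \<noteq> 0" "\<And>x. x \<in> P \<Longrightarrow> form S a x - b = w \<bullet> \<phi> x"
    using hyperplane_functional[OF *(1,2)] by blast
  have "form S a x = b \<longleftrightarrow> w \<bullet> \<phi> x = 0" "form S a x \<ge> b \<longleftrightarrow> w \<bullet> \<phi> x \<ge> 0" if "x \<in> P" for x
    using w(2)[OF that] by auto
  then show ?thesis
    using that[OF w(1)] *(3) by (auto simp: hyperplane_eq_def halfspace_def)
qed

lemma functional_normals:
  assumes "w \<noteq> 0" "x\<^sub>0 \<in> P" "w \<bullet> \<phi> x\<^sub>0 = 0"
  obtains a b where "(a, b) \<in> normals S {x \<in> P. w \<bullet> \<phi> x = 0}"
    "halfspace S a b = {x \<in> P. w \<bullet> \<phi> x \<ge> 0}"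
proof -
  obtain a b where ab: "a \<noteq> 0" "S = Euclidean \<or> b = 0"
    "\<And>x. x \<in> P \<Longrightarrow> form S a x - b = w \<bullet> \<phi> x"
    using functional_hyperplane[OF assms] by blast
  have "form S a x = b \<longleftrightarrow> w \<bullet> \<phi> x = 0" "form S a x \<ge> b \<longleftrightarrow> w \<bullet> \<phi> x \<ge> 0" if "x \<in> P" for x
    using ab(3)[OF that] by auto
  then show ?thesis
    using that[of a b] ab(1,2) by (auto simp: hyperplane_eq_def halfspace_def normals_def)
qed

lemma is_hyperplane_functional:
  assumes "w \<noteq> 0" "x\<^sub>0 \<in> P" "w \<bullet> \<phi> x\<^sub>0 = 0"
  shows "is_hyperplane S {x \<in> P. w \<bullet> \<phi> x = 0}"
proof -
  obtain a b where "(a, b) \<in> normals S {x \<in> P. w \<bullet> \<phi> x = 0}"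
    using functional_normals[OF assms] .
  then show ?thesis
    unfolding is_hyperplane_def using assms by blast
qed

text \<open>
  The lift of a reflection is a scalar on the hyperplane over its mirror. After normalisation it fixes
  this hyperplane, and its square is a scalar.
\<close>

lemma reflection_skew:
  assumes r: "reflection_in S Y t"
  obtains w u where "w \<bullet> u = 1" "rep t (skew_reflection w u)"
    "\<And>v. v \<in> K \<Longrightarrow> \<pi> v \<in> Y \<longleftrightarrow> w \<bullet> v = 0"
proof -
  have Y: "is_hyperplane S Y" and t: "t \<in> isometries S" and tt: "\<And>x. x \<in> P \<Longrightarrow> t (t x) = x"
    and fixY: "Y = {x \<in> P. t x = x}"
    using r by (auto simp: reflection_in_def)
  obtain a b where "(a, b) \<in> normals S Y"
    using Y by (auto simp: is_hyperplane_def)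
  then obtain w where w: "w \<noteq> 0" "Y = {x \<in> P. w \<bullet> \<phi> x = 0}"
    using normals_functional by metis
  have Yw: "\<pi> v \<in> Y \<longleftrightarrow> w \<bullet> v = 0" if v: "v \<in> K" for v
  proof -
    obtain c where "c > 0" "w \<bullet> \<phi> (\<pi> v) = c * (w \<bullet> v)"
      using functional_sign[OF v] .
    then show ?thesis
      using \<pi>_points[OF v] by (simp add: w(2))
  qed
  obtain x0 where "x0 \<in> Y"
    using Y by (auto simp: is_hyperplane_def)
  then have e: "\<phi> x0 \<in> K" "w \<bullet> \<phi> x0 = 0"
    using w(2) \<phi>_K by auto
  obtain A0 where A0: "rep t A0"
    using isometry_rep[OF t] by blast
  have "t (\<pi> v) = \<pi> v" if "v \<in> K" "w \<bullet> v = 0" for v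
    using Yw[OF that(1)] that(2) fixY by blast
  then obtain c0 where c0: "c0 > 0" "\<And>v. w \<bullet> v = 0 \<Longrightarrow> A0 v = c0 *\<^sub>R v"
    using fixed_scalar[OF A0 subspace_hyperplane[of w] open_K e(1), of] e(2) by auto
  define A where "A = (\<lambda>v. (1 / c0) *\<^sub>R A0 v)"
  have A: "rep t A"
    unfolding A_def using rep_scale[OF A0, of "1 / c0"] c0(1) by simp
  have fixed: "A v = v" if "w \<bullet> v = 0" for v
    using c0(1) c0(2)[OF that] by (simp add: A_def)
  have "compose P t t x = x" if "x \<in> P" for x
    using tt[OF that] that by (simp add: compose_def)
  then obtain c where c: "\<And>v. A (A v) = c *\<^sub>R v"
    using rep_identity_scalar[OF rep_comp[OF A A]] by blast
  have ne: "A \<noteq> id"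
  proof
    assume "A = id"
    then have "t (\<pi> v) = \<pi> v" if "v \<in> K" for v
      using rep_\<pi>[OF A that] by simp
    then have "w \<bullet> v = 0" if "v \<in> K" for v
      using Yw[OF that] fixY \<pi>_points that by blast
    then show False
      using K_not_in_hyperplane[OF w(1) open_K K_nonempty] by blast
  qed
  obtain u where "w \<bullet> u = 1" "A = skew_reflection w u"
    using involution_fixing_hyperplane[OF rep_linear[OF A] fixed c e(2) K_nonzero[OF e(1)] w(1) ne]
    by blast
  then show ?thesis
    using that A Yw by blast
qed

text \<open>
  A skew reflection multiplies the value of \<open>w\<close> by \<open>-1\<close>, so it cannot map a vector off the kernel of \<open>w\<close>
  to a positive multiple of it.
\<close>

lemma skew_reflection_in:
  assumes t: "t \<in> isometries S" "rep t (skew_reflection w u)" and wu: "w \<bullet> u = 1"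
    and e: "e \<in> K" "w \<bullet> e = 0"
  shows "reflection_in S {x \<in> P. t x = x} t"
    and "\<And>v. v \<in> K \<Longrightarrow> t (\<pi> v) = \<pi> v \<longleftrightarrow> w \<bullet> v = 0"
proof -
  show iff: "t (\<pi> v) = \<pi> v \<longleftrightarrow> w \<bullet> v = 0" if v: "v \<in> K" for v
  proof
    assume "w \<bullet> v = 0"
    then show "t (\<pi> v) = \<pi> v"
      using rep_\<pi>[OF t(2) v] by (simp add: skew_reflection_wall)
  next
    assume "t (\<pi> v) = \<pi> v"
    then obtain c where c: "c > 0" "skew_reflection w u v = c *\<^sub>R v"
      using same_ray[of "skew_reflection w u v" v] rep_K[OF t(2) v] rep_\<pi>[OF t(2) v] v by auto
    then have "- (w \<bullet> v) = c * (w \<bullet> v)"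
      using skew_reflection_flip[OF wu, of v] by simp
    then have "(c + 1) * (w \<bullet> v) = 0"
      by (simp add: algebra_simps)
    then show "w \<bullet> v = 0"
      using c(1) by simp
  qed
  have "t x = x \<longleftrightarrow> w \<bullet> \<phi> x = 0" if "x \<in> P" for x
    using iff[OF \<phi>_K[OF that]] \<pi>_\<phi>[OF that] by simp
  then have eq: "{x \<in> P. t x = x} = {x \<in> P. w \<bullet> \<phi> x = 0}"
    by blast
  obtain c where c: "w \<bullet> \<phi> (\<pi> e) = c * (w \<bullet> e)"
    using functional_sign[OF e(1)] by blast
  have "is_hyperplane S {x \<in> P. t x = x}"
    unfolding eq using wu e c by (intro is_hyperplane_functional[of w "\<pi> e"]) (auto simp: \<pi>_points)
  moreover have "t (t x) = x" if x: "x \<in> P" for x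
  proof -
    have "t (t x) = t (t (\<pi> (\<phi> x)))"
      using \<pi>_\<phi>[OF x] by simp
    also have "\<dots> = \<pi> (skew_reflection w u (skew_reflection w u (\<phi> x)))"
      using rep_\<pi>[OF t(2)] rep_K[OF t(2)] \<phi>_K[OF x] by metis
    also have "\<dots> = x"
      using skew_reflection_invol[OF wu] \<pi>_\<phi>[OF x] by simp
    finally show ?thesis .
  qed
  ultimately show "reflection_in S {x \<in> P. t x = x} t"
    unfolding reflection_in_def using t(1) by blast
qed

end

section \<open>Chambers and mirrors\<close>

locale coxeter_model = space_model S \<phi> \<pi> K
  for S :: "'a::euclidean_space geometry" and \<phi> :: "'a \<Rightarrow> 'v::euclidean_space"
    and \<pi> :: "'v \<Rightarrow> 'a" and K :: "'v set" +
  fixes \<Gamma> :: "('a \<Rightarrow> 'a) set" and D :: "'a set"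
  assumes coxeter: "coxeter_group S \<Gamma> D"
begin

definition gmul :: "('a \<Rightarrow> 'a) \<Rightarrow> ('a \<Rightarrow> 'a) \<Rightarrow> 'a \<Rightarrow> 'a"
  where "gmul g h = compose P g h"

definition gone :: "'a \<Rightarrow> 'a"
  where "gone = (\<lambda>x\<in>P. x)"

lemma generators:
  obtains R where "R \<subseteq> \<Gamma>" "\<And>W. is_wall S D W \<Longrightarrow> \<exists>s\<in>R. reflection_in S W s"
    "R \<subseteq> isometries S" "\<Gamma> = generate (BijGroup P) R"
proof -
  have "\<exists>R. (\<forall>s\<in>R. \<exists>W. is_wall S D W \<and> reflection_in S W s) \<and>
    (\<forall>W. is_wall S D W \<longrightarrow> (\<exists>!s. s \<in> R \<and> reflection_in S W s)) \<and>
    \<Gamma> = generate (BijGroup P) R"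
    using coxeter unfolding coxeter_group_def by (elim conjE)
  then obtain R where R': "(\<forall>s\<in>R. \<exists>W. is_wall S D W \<and> reflection_in S W s) \<and>
    (\<forall>W. is_wall S D W \<longrightarrow> (\<exists>!s. s \<in> R \<and> reflection_in S W s)) \<and>
    \<Gamma> = generate (BijGroup P) R"
    by (rule exE)
  note R = R'[THEN conjunct1] R'[THEN conjunct2, THEN conjunct1] R'[THEN conjunct2, THEN conjunct2]
  have "R \<subseteq> isometries S"
    using R(1) by (auto simp: reflection_in_def)
  moreover have "R \<subseteq> \<Gamma>"
    unfolding R(3) by (auto intro: generate.incl)
  moreover have "\<exists>s\<in>R. reflection_in S W s" if "is_wall S D W" for W
    using R(2)[rule_format, OF that] by (elim ex1E) auto
  ultimately show ?thesis
    using that[of R] R(3) by simp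
qed

lemma \<Gamma>_isometries: "g \<in> \<Gamma> \<Longrightarrow> g \<in> isometries S"
proof -
  obtain R where R: "R \<subseteq> isometries S" "\<Gamma> = generate (BijGroup P) R"
    using generators by metis
  have "\<Gamma> \<subseteq> isometries S"
    unfolding R(2) by (rule group.generate_subgroup_incl[OF group_BijGroup R(1) isometries_subgroup])
  then show "g \<in> \<Gamma> \<Longrightarrow> g \<in> isometries S"
    by blast
qed

lemma \<Gamma>_Bij: "g \<in> \<Gamma> \<Longrightarrow> g \<in> Bij P"
  using \<Gamma>_isometries isometry_Bij by blast

lemma \<Gamma>_subgroup: "subgroup \<Gamma> (BijGroup P)"
proof -
  obtain R where R: "R \<subseteq> isometries S" "\<Gamma> = generate (BijGroup P) R"
    using generators by metis
  have "R \<subseteq> carrier (BijGroup P)"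
    using R(1) subgroup.subset[OF isometries_subgroup] by blast
  then show ?thesis
    unfolding R(2) by (rule group.generate_is_subgroup[OF group_BijGroup])
qed

lemma \<Gamma>_mul: "\<lbrakk>g \<in> \<Gamma>; h \<in> \<Gamma>\<rbrakk> \<Longrightarrow> gmul g h \<in> \<Gamma>"
  using subgroup.m_closed[OF \<Gamma>_subgroup, of g h] \<Gamma>_Bij[of g] \<Gamma>_Bij[of h]
  by (simp add: BijGroup_def gmul_def)

lemma \<Gamma>_one: "gone \<in> \<Gamma>"
  using subgroup.one_closed[OF \<Gamma>_subgroup] by (simp add: BijGroup_def gone_def)

lemma \<Gamma>_inv: "g \<in> \<Gamma> \<Longrightarrow> ginv g \<in> \<Gamma>"
  using subgroup.m_inv_closed[OF \<Gamma>_subgroup, of g] ginv_eq[OF \<Gamma>_Bij, of g] by simp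

lemma \<Gamma>_points: "\<lbrakk>g \<in> \<Gamma>; x \<in> P\<rbrakk> \<Longrightarrow> g x \<in> P"
  using \<Gamma>_isometries isometry_points by blast

lemma gmul_apply: "x \<in> P \<Longrightarrow> gmul g h x = g (h x)"
  by (simp add: gmul_def compose_def)

lemma gone_apply: "x \<in> P \<Longrightarrow> gone x = x"
  by (simp add: gone_def)

lemma ginv_l: "\<lbrakk>g \<in> \<Gamma>; x \<in> P\<rbrakk> \<Longrightarrow> ginv g (g x) = x"
  and ginv_r: "\<lbrakk>g \<in> \<Gamma>; x \<in> P\<rbrakk> \<Longrightarrow> g (ginv g x) = x"
  using ginv_left ginv_right \<Gamma>_Bij by blast+

lemma \<Gamma>_ext: "\<lbrakk>g \<in> \<Gamma>; h \<in> \<Gamma>; \<And>x. x \<in> P \<Longrightarrow> g x = h x\<rbrakk> \<Longrightarrow> g = h"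
  using \<Gamma>_Bij Bij_imp_extensional by (metis extensionalityI)

lemma \<Gamma>_inj: "\<lbrakk>g \<in> \<Gamma>; x \<in> P; y \<in> P; g x = g y\<rbrakk> \<Longrightarrow> x = y"
  using ginv_l by metis

lemma gmul_assoc: "\<lbrakk>f \<in> \<Gamma>; g \<in> \<Gamma>; h \<in> \<Gamma>\<rbrakk> \<Longrightarrow> gmul (gmul f g) h = gmul f (gmul g h)"
  by (rule \<Gamma>_ext) (auto simp: \<Gamma>_mul gmul_apply \<Gamma>_points)

lemma gmul_inv_right: "\<lbrakk>g \<in> \<Gamma>; h \<in> \<Gamma>\<rbrakk> \<Longrightarrow> gmul (gmul h g) (ginv g) = h"
  by (rule \<Gamma>_ext) (auto simp: \<Gamma>_mul \<Gamma>_inv gmul_apply \<Gamma>_points ginv_r)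

lemma gmul_inv_right': "\<lbrakk>g \<in> \<Gamma>; h \<in> \<Gamma>\<rbrakk> \<Longrightarrow> gmul (gmul h (ginv g)) g = h"
  by (rule \<Gamma>_ext) (auto simp: \<Gamma>_mul \<Gamma>_inv gmul_apply \<Gamma>_points ginv_l)

lemma gmul_one: "g \<in> \<Gamma> \<Longrightarrow> gmul g gone = g" "g \<in> \<Gamma> \<Longrightarrow> gmul gone g = g"
  by (rule \<Gamma>_ext; auto simp: \<Gamma>_mul \<Gamma>_one gmul_apply gone_apply \<Gamma>_points)+

lemma \<Gamma>_rep: "g \<in> \<Gamma> \<Longrightarrow> \<exists>A. rep g A"
  using \<Gamma>_isometries isometry_rep by blast

subsection \<open>Chambers as cones\<close>

definition ch :: "('a \<Rightarrow> 'a) \<Rightarrow> 'v set"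
  where "ch g = hat (g ` D)"

lemma D_P: "D \<subseteq> P"
  using coxeter by (auto simp: coxeter_group_def polyhedral_domain_def)

lemma ch_K: "v \<in> ch g \<Longrightarrow> v \<in> K"
  by (simp add: ch_def hat_def)

lemma ch_one: "ch gone = hat D"
proof -
  have "gone ` D = D"
    using D_P by (force simp: gone_def)
  then show ?thesis by (simp add: ch_def)
qed

lemma ch_rep:
  assumes "g \<in> \<Gamma>" "h \<in> \<Gamma>" "rep h A" "v \<in> K"
  shows "A v \<in> ch (gmul h g) \<longleftrightarrow> v \<in> ch g"
proof -
  have "gmul h g ` D = h ` g ` D"
    using D_P by (force simp: gmul_def compose_def image_image)
  moreover have "h (\<pi> v) \<in> h ` g ` D \<longleftrightarrow> \<pi> v \<in> g ` D"
  proof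
    assume "h (\<pi> v) \<in> h ` g ` D"
    then obtain x where x: "x \<in> D" "h (\<pi> v) = h (g x)"
      by auto
    then have "\<pi> v = g x"
      using \<Gamma>_inj[OF assms(2) \<pi>_points[OF assms(4)]] \<Gamma>_points[OF assms(1)] D_P by auto
    then show "\<pi> v \<in> g ` D"
      using x by blast
  qed auto
  ultimately show ?thesis
    using rep_K[OF assms(3,4)] rep_\<pi>[OF assms(3,4)] assms(4) by (simp add: ch_def hat_def)
qed

lemma ch_cover: "v \<in> K \<Longrightarrow> \<exists>g\<in>\<Gamma>. v \<in> ch g"
  using coxeter \<pi>_points by (fastforce simp: coxeter_group_def ch_def hat_def)

text \<open>The definition of a polyhedral domain in terms of linear inequalities on the cone.\<close>

lemma D_inequalities:
  obtains N where "\<forall>w\<in>N. w \<noteq> 0"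
    "\<forall>v\<in>K. v \<in> hat D \<longleftrightarrow> (\<forall>w\<in>N. w \<bullet> v \<ge> 0)"
    "\<forall>v\<in>K. \<exists>r>0. ball v r \<subseteq> K \<and>
       finite {H \<in> (\<lambda>w. {u \<in> K. w \<bullet> u = 0}) ` N. H \<inter> ball v r \<noteq> {}}"
proof -
  obtain N0 where N0: "\<And>a b. (a, b) \<in> N0 \<Longrightarrow> (a, b) \<in> normals S (hyperplane_eq S a b)"
    "locally_finite_in (space_top S) ((\<lambda>(a, b). hyperplane_eq S a b) ` N0)"
    "D = {x \<in> P. \<forall>(a, b)\<in>N0. x \<in> halfspace S a b}"
    using coxeter unfolding coxeter_group_def polyhedral_domain_def by fast
  have "\<forall>p\<in>N0. \<exists>w. w \<noteq> 0 \<and> hyperplane_eq S (fst p) (snd p) = {x \<in> P. w \<bullet> \<phi> x = 0} \<and>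
      halfspace S (fst p) (snd p) = {x \<in> P. w \<bullet> \<phi> x \<ge> 0}"
  proof
    fix p assume p: "p \<in> N0"
    have np: "(fst p, snd p) \<in> normals S (hyperplane_eq S (fst p) (snd p))"
      using N0(1)[of "fst p" "snd p"] p by simp
    obtain w where "w \<noteq> 0"
      "hyperplane_eq S (fst p) (snd p) = {x \<in> P. w \<bullet> \<phi> x = 0}"
      "halfspace S (fst p) (snd p) = {x \<in> P. w \<bullet> \<phi> x \<ge> 0}"
      using normals_functional[OF np] .
    then show "\<exists>w. w \<noteq> 0 \<and> hyperplane_eq S (fst p) (snd p) = {x \<in> P. w \<bullet> \<phi> x = 0} \<and>
      halfspace S (fst p) (snd p) = {x \<in> P. w \<bullet> \<phi> x \<ge> 0}"
      by (intro exI[of _ w] conjI)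
  qed
  from bchoice[OF this] obtain W where W': "\<forall>p\<in>N0. W p \<noteq> 0 \<and>
      hyperplane_eq S (fst p) (snd p) = {x \<in> P. W p \<bullet> \<phi> x = 0} \<and>
      halfspace S (fst p) (snd p) = {x \<in> P. W p \<bullet> \<phi> x \<ge> 0}"
    by (rule exE)
  note W = W'[rule_format]
  have hateq: "hat {x \<in> P. w \<bullet> \<phi> x = 0} = {u \<in> K. w \<bullet> u = 0}" for w
  proof -
    have "\<pi> u \<in> {x \<in> P. w \<bullet> \<phi> x = 0} \<longleftrightarrow> w \<bullet> u = 0" if u: "u \<in> K" for u
    proof -
      obtain c where "c > 0" "w \<bullet> \<phi> (\<pi> u) = c * (w \<bullet> u)"
        using functional_sign[OF u] .
      then show ?thesis
        using \<pi>_points[OF u] by simp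
    qed
    then show ?thesis by (auto simp: hat_def)
  qed
  have hatge: "\<pi> u \<in> {x \<in> P. w \<bullet> \<phi> x \<ge> 0} \<longleftrightarrow> w \<bullet> u \<ge> 0" if u: "u \<in> K" for u w
  proof -
    obtain c where "c > 0" "w \<bullet> \<phi> (\<pi> u) = c * (w \<bullet> u)"
      using functional_sign[OF u] .
    then show ?thesis
      using \<pi>_points[OF u] by (simp add: zero_le_mult_iff)
  qed
  have 1: "w \<noteq> 0" if "w \<in> W ` N0" for w
    using that W by auto
  have 2: "v \<in> hat D \<longleftrightarrow> (\<forall>w\<in>W ` N0. w \<bullet> v \<ge> 0)" if v: "v \<in> K" for v
  proof -
    have "\<pi> v \<in> halfspace S (fst p) (snd p) \<longleftrightarrow> W p \<bullet> v \<ge> 0" if "p \<in> N0" for p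
      using hatge[OF v, of "W p"] W[OF that] by simp
    then show ?thesis
      using v \<pi>_points[OF v] by (auto simp: hat_def N0(3))
  qed
  have 3: "\<exists>r>0. ball v r \<subseteq> K \<and>
       finite {H \<in> (\<lambda>w. {u \<in> K. w \<bullet> u = 0}) ` (W ` N0). H \<inter> ball v r \<noteq> {}}" if v: "v \<in> K" for v
  proof -
    let ?H = "(\<lambda>(a, b). hyperplane_eq S a b) ` N0"
    obtain V where V: "openin (space_top S) V" "\<pi> v \<in> V" "finite {U \<in> ?H. U \<inter> V \<noteq> {}}"
      using N0(2) \<pi>_points[OF v] unfolding locally_finite_in_def by auto
    have "open (hat V)" "v \<in> hat V"
      using open_hat[OF V(1)] V(2) v by (auto simp: hat_def)
    then obtain r where r: "r > 0" "ball v r \<subseteq> hat V"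
      by (meson open_contains_ball)
    have "{H \<in> (\<lambda>w. {u \<in> K. w \<bullet> u = 0}) ` (W ` N0). H \<inter> ball v r \<noteq> {}}
        \<subseteq> hat ` {U \<in> ?H. U \<inter> V \<noteq> {}}"
    proof
      fix H assume "H \<in> {H \<in> (\<lambda>w. {u \<in> K. w \<bullet> u = 0}) ` (W ` N0). H \<inter> ball v r \<noteq> {}}"
      then have Hm: "H \<in> (\<lambda>w. {u \<in> K. w \<bullet> u = 0}) ` (W ` N0)" "H \<inter> ball v r \<noteq> {}"
        by simp_all
      from Hm(1) obtain p where p: "p \<in> N0" "H = {u \<in> K. W p \<bullet> u = 0}"
        by blast
      from Hm(2) obtain u where u: "u \<in> H" "u \<in> ball v r"
        by blast
      define U where "U = hyperplane_eq S (fst p) (snd p)"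
      have H: "H = hat U"
        using p W hateq by (simp add: U_def)
      have "U \<in> ?H"
        using p(1) by (auto simp: U_def intro!: image_eqI[of _ _ p] split: prod.splits)
      moreover have "\<pi> u \<in> U \<inter> V"
        using u r(2) H by (auto simp: hat_def)
      ultimately show "H \<in> hat ` {U \<in> ?H. U \<inter> V \<noteq> {}}"
        using H by blast
    qed
    then have "finite {H \<in> (\<lambda>w. {u \<in> K. w \<bullet> u = 0}) ` (W ` N0). H \<inter> ball v r \<noteq> {}}"
      by (rule finite_subset[OF _ finite_imageI[OF V(3)]])
    moreover have "ball v r \<subseteq> K"
      using r(2) hat_K[of V] by blast
    ultimately show ?thesis
      using r(1) by blast
  qed
  show ?thesis
    by (rule that[of "W ` N0"]; intro ballI) (fact 1 2 3)+
qed

lemma ch_cone: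
  assumes g: "g \<in> \<Gamma>"
  obtains C where "closed C" "convex C" "ch g = K \<inter> C"
proof -
  obtain N where "\<forall>w\<in>N. w \<noteq> 0" and N': "\<forall>v\<in>K. v \<in> hat D \<longleftrightarrow> (\<forall>w\<in>N. w \<bullet> v \<ge> 0)"
    and "\<forall>v\<in>K. \<exists>r>0. ball v r \<subseteq> K \<and> finite {H \<in> (\<lambda>w. {u \<in> K. w \<bullet> u = 0}) ` N. H \<inter> ball v r \<noteq> {}}"
    using D_inequalities .
  note N = N'[rule_format]
  obtain A where A: "rep g A"
    using \<Gamma>_rep[OF g] by blast
  obtain B where B: "rep (ginv g) B" "\<And>v. A (B v) = v"
    using rep_inverse[OF \<Gamma>_isometries[OF g] A] by metis
  let ?N = "adjoint B ` N"
  define C where "C = (\<Inter>w\<in>?N. {u. w \<bullet> u \<ge> 0})"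
  have "v \<in> ch g \<longleftrightarrow> v \<in> C" if v: "v \<in> K" for v
  proof -
    have Bv: "B v \<in> K"
      using rep_K[OF B(1) v] .
    have "v \<in> ch g \<longleftrightarrow> B v \<in> ch gone"
      using ch_rep[OF \<Gamma>_one g A Bv] B(2)[of v] gmul_one[OF g] by simp
    also have "\<dots> \<longleftrightarrow> (\<forall>w\<in>N. w \<bullet> B v \<ge> 0)"
      using N[OF Bv] by (simp add: ch_one)
    also have "\<dots> \<longleftrightarrow> v \<in> C"
      using adjoint_works[OF rep_linear[OF B(1)]] by (simp add: C_def inner_commute)
    finally show ?thesis .
  qed
  then have eq: "ch g = K \<inter> C"
    using ch_K by blast
  have cl: "closed C" unfolding C_def
    by (intro closed_INT ballI closed_halfspace_ge)
  have cv: "convex C" unfolding C_def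
    by (intro convex_INT convex_halfspace_ge)
  show ?thesis
    by (rule that[OF cl cv eq])
qed

lemma ch_interior_rep:
  assumes g: "g \<in> \<Gamma>" and h: "h \<in> \<Gamma>" and A: "rep h A" and v: "v \<in> interior (ch g)"
  shows "A v \<in> interior (ch (gmul h g))"
proof -
  obtain B where B: "rep (ginv h) B" "\<And>v. B (A v) = v" "\<And>v. A (B v) = v"
    using rep_inverse[OF \<Gamma>_isometries[OF h] A] by metis
  have "continuous_on UNIV B"
    using rep_linear[OF B(1)] by (simp add: linear_continuous_on linear_conv_bounded_linear)
  then have "open (B -` interior (ch g))"
    by (rule open_vimage[OF open_interior])
  moreover have "B -` interior (ch g) \<subseteq> ch (gmul h g)"
  proof
    fix u assume "u \<in> B -` interior (ch g)"
    then have "B u \<in> ch g"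
      using interior_subset[of "ch g"] by auto
    then show "u \<in> ch (gmul h g)"
      using ch_rep[OF g h A ch_K[of "B u" g]] B(3)[of u] by simp
  qed
  ultimately have "B -` interior (ch g) \<subseteq> interior (ch (gmul h g))"
    by (simp add: interior_maximal)
  then show ?thesis
    using v B(2)[of v] by auto
qed

lemma ch_interior_nonempty:
  assumes g: "g \<in> \<Gamma>"
  shows "interior (ch g) \<noteq> {}"
proof -
  obtain x where x: "x \<in> space_top S interior_of D"
    using coxeter by (auto simp: coxeter_group_def polyhedral_domain_def)
  have "x \<in> P"
    using interior_of_subset_topspace[of "space_top S" D] x by auto
  then have "\<phi> x \<in> interior (ch gone)"
    unfolding ch_one interior_hat using x \<phi>_K \<pi>_\<phi> by (simp add: hat_def)
  moreover obtain A where "rep g A"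
    using \<Gamma>_rep[OF g] by blast
  ultimately have "A (\<phi> x) \<in> interior (ch (gmul g gone))"
    using ch_interior_rep[OF \<Gamma>_one g] by blast
  then show ?thesis
    using gmul_one[OF g] by auto
qed

lemma ch_disjoint:
  assumes "g \<in> \<Gamma>" "h \<in> \<Gamma>" "v \<in> interior (ch g)" "v \<in> interior (ch h)"
  shows "g = h"
proof (rule ccontr)
  assume "g \<noteq> h"
  then have "space_top S interior_of (g ` D) \<inter> space_top S interior_of (h ` D) = {}"
    using coxeter assms(1,2) unfolding coxeter_group_def by blast
  then show False
    using assms(3,4) unfolding ch_def interior_hat by (auto simp: hat_def)
qed

text \<open>A convex set with interior points lies in the closure of its interior.\<close>

lemma ch_interior_dense:
  assumes g: "g \<in> \<Gamma>" and v: "v \<in> ch g" and W: "open W" "v \<in> W"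
  obtains u where "u \<in> W" "u \<in> interior (ch g)"
proof -
  obtain C where C: "convex C" "ch g = K \<inter> C"
    using ch_cone[OF g] by metis
  have int: "interior (ch g) = K \<inter> interior C"
    unfolding C(2) using open_K by (simp add: interior_open)
  obtain q where q: "q \<in> interior C"
    using ch_interior_nonempty[OF g] int by blast
  have "v \<in> W \<inter> K"
    using W v ch_K by blast
  then obtain d where d: "d > 0" "\<And>t. \<bar>t\<bar> \<le> d \<Longrightarrow> v + t *\<^sub>R (q - v) \<in> W \<inter> K"
    using small_shift[of "W \<inter> K" v] open_Int[OF W(1) open_K] by blast
  define t where "t = min d 1"
  have t: "0 < t" "t \<le> 1" "\<bar>t\<bar> \<le> d"
    using d(1) by (auto simp: t_def)
  have "v - t *\<^sub>R (v - q) \<in> interior C"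
    using mem_interior_convex_shrink[OF C(1) q _ t(1,2), of v] v C(2) by blast
  moreover have "v - t *\<^sub>R (v - q) = v + t *\<^sub>R (q - v)"
    by (simp add: algebra_simps)
  ultimately show ?thesis
    using that[of "v + t *\<^sub>R (q - v)"] d(2)[OF t(3)] int by auto
qed

lemma ch_interior_inj: "inj_on (\<lambda>g. interior (ch g)) \<Gamma>"
proof (rule inj_onI)
  fix g h assume *: "g \<in> \<Gamma>" "h \<in> \<Gamma>" "interior (ch g) = interior (ch h)"
  then show "g = h"
    using ch_interior_nonempty[OF *(1)] ch_disjoint[OF *(1,2)] by blast
qed

text \<open>The interiors of the chambers are disjoint nonempty open sets in a separable space.\<close>

lemma countable_\<Gamma>: "countable \<Gamma>"
proof -
  have "countable ((\<lambda>g. interior (ch g)) ` \<Gamma>)"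
  proof (rule countable_disjoint_open_subsets)
    show "pairwise disjnt ((\<lambda>g. interior (ch g)) ` \<Gamma>)"
      using ch_disjoint unfolding pairwise_def disjnt_def by blast
  qed auto
  then show ?thesis
    using countable_image_inj_on[OF _ ch_interior_inj] by blast
qed

text \<open>
  Of the finitely many chambers near \<open>v\<close>, those which do not contain \<open>v\<close> keep a distance from it, since
  they are closed in \<open>K\<close>.
\<close>

lemma ch_locally_finite:
  assumes v: "v \<in> K"
  obtains r where "r > 0" "ball v r \<subseteq> K" "finite {g \<in> \<Gamma>. ch g \<inter> ball v r \<noteq> {}}"
    "\<forall>g\<in>\<Gamma>. ch g \<inter> ball v r \<noteq> {} \<longrightarrow> v \<in> ch g"
proof -
  let ?H = "(\<lambda>g. g ` D) ` \<Gamma>"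
  have "locally_finite_in (space_top S) ?H"
    using coxeter by (simp add: coxeter_group_def)
  then obtain V where V: "openin (space_top S) V" "\<pi> v \<in> V" "finite {U \<in> ?H. U \<inter> V \<noteq> {}}"
    using \<pi>_points[OF v] unfolding locally_finite_in_def by auto
  define F where "F = {g \<in> \<Gamma>. ch g \<inter> hat V \<noteq> {}}"
  have oV: "open (hat V)" "v \<in> hat V"
    using open_hat[OF V(1)] V(2) v by (auto simp: hat_def)
  have "inj_on (\<lambda>g. g ` D) \<Gamma>"
  proof (rule inj_onI)
    fix g h assume *: "g \<in> \<Gamma>" "h \<in> \<Gamma>" "g ` D = h ` D"
    then have "interior (ch g) = interior (ch h)"
      by (simp add: ch_def)
    then show "g = h"
      using inj_onD[OF ch_interior_inj] * by blast
  qed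
  then have "inj_on (\<lambda>g. g ` D) F"
    by (rule inj_on_subset) (auto simp: F_def)
  moreover have "(\<lambda>g. g ` D) ` F \<subseteq> {U \<in> ?H. U \<inter> V \<noteq> {}}"
    by (auto simp: F_def ch_def hat_def)
  ultimately have F: "finite F"
    using V(3) by (meson finite_imageD finite_subset)
  define W where "W = hat V - \<Union>(ch ` {g \<in> F. v \<notin> ch g})"
  have "open W"
  proof -
    have o: "open (K - ch g)" if "g \<in> F" for g
    proof -
      have "g \<in> \<Gamma>"
        using that by (simp add: F_def)
      then obtain C where C: "closed C" "ch g = K \<inter> C"
        using ch_cone by metis
      have "K - ch g = K \<inter> - C"
        unfolding C(2) by auto
      then show ?thesis
        using C(1) open_K by (simp add: open_Int open_Compl)
    qed
    have "W = hat V \<inter> (\<Inter>g\<in>{g \<in> F. v \<notin> ch g}. K - ch g) "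
      using hat_K[of V] by (auto simp: W_def)
    then show ?thesis
      using F o by (simp only:) (intro open_Int oV(1) open_INT ballI; simp)
  qed
  moreover have "v \<in> W"
    using oV by (auto simp: W_def)
  ultimately obtain r where r: "r > 0" "ball v r \<subseteq> W"
    by (meson open_contains_ball)
  have WV: "W \<subseteq> hat V"
    by (auto simp: W_def)
  have "v \<in> ch g" if g: "g \<in> \<Gamma>" "ch g \<inter> ball v r \<noteq> {}" for g
  proof (rule ccontr)
    assume n: "v \<notin> ch g"
    have "g \<in> F"
      using g r(2) WV unfolding F_def by blast
    then have "ch g \<inter> W = {}"
      using n unfolding W_def by blast
    then show False
      using g(2) r(2) by blast
  qed
  moreover have "{g \<in> \<Gamma>. ch g \<inter> ball v r \<noteq> {}} \<subseteq> F"
    using r(2) WV unfolding F_def by blast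
  then have "finite {g \<in> \<Gamma>. ch g \<inter> ball v r \<noteq> {}}"
    by (rule finite_subset[OF _ F])
  moreover have "ball v r \<subseteq> K"
    using r(2) WV hat_K[of V] by blast
  ultimately show ?thesis
    using that r(1) by blast
qed

subsection \<open>Reflections of the group\<close>

definition mir :: "('a \<Rightarrow> 'a) \<Rightarrow> 'a set"
  where "mir t = {x \<in> P. t x = x}"

definition Rf :: "('a \<Rightarrow> 'a) set"
  where "Rf = {t \<in> \<Gamma>. reflection_in S (mir t) t}"

text \<open>
  A functional and an axis for each reflection. They are unique up to a factor, which may be negative;
  so only products of two values of one functional have a meaningful sign.
\<close>

definition skew_data :: "('a \<Rightarrow> 'a) \<Rightarrow> 'v \<times> 'v"
  where "skew_data t = (SOME p. fst p \<bullet> snd p = 1 \<and> rep t (skew_reflection (fst p) (snd p)) \<and>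
    (\<forall>v\<in>K. \<pi> v \<in> mir t \<longleftrightarrow> fst p \<bullet> v = 0))"

definition fn :: "('a \<Rightarrow> 'a) \<Rightarrow> 'v"
  where "fn t = fst (skew_data t)"

definition ax :: "('a \<Rightarrow> 'a) \<Rightarrow> 'v"
  where "ax t = snd (skew_data t)"

abbreviation sk :: "('a \<Rightarrow> 'a) \<Rightarrow> 'v \<Rightarrow> 'v"
  where "sk t \<equiv> skew_reflection (fn t) (ax t)"

lemma Rf_\<Gamma>: "t \<in> Rf \<Longrightarrow> t \<in> \<Gamma>"
  by (simp add: Rf_def)

lemma reflection_Rf:
  assumes "t \<in> \<Gamma>" "reflection_in S Y t"
  shows "t \<in> Rf" "Y = mir t"
  using assms by (auto simp: Rf_def mir_def reflection_in_def)

lemma fn_data: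
  assumes "t \<in> Rf"
  shows "fn t \<bullet> ax t = 1 \<and> rep t (sk t) \<and> (\<forall>v\<in>K. \<pi> v \<in> mir t \<longleftrightarrow> fn t \<bullet> v = 0)"
proof -
  obtain w u where "w \<bullet> u = 1" "rep t (skew_reflection w u)"
    "\<And>v. v \<in> K \<Longrightarrow> \<pi> v \<in> mir t \<longleftrightarrow> w \<bullet> v = 0"
    using reflection_skew[of "mir t" t] assms unfolding Rf_def by blast
  then have "\<exists>p. fst p \<bullet> snd p = 1 \<and> rep t (skew_reflection (fst p) (snd p)) \<and>
    (\<forall>v\<in>K. \<pi> v \<in> mir t \<longleftrightarrow> fst p \<bullet> v = 0)"
    by (intro exI[of _ "(w, u)"]) simp
  then show ?thesis
    unfolding fn_def ax_def skew_data_def by (rule someI_ex)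
qed

lemma fn_ax: "t \<in> Rf \<Longrightarrow> fn t \<bullet> ax t = 1"
  and sk_rep: "t \<in> Rf \<Longrightarrow> rep t (sk t)"
  and mir_fn: "\<lbrakk>t \<in> Rf; v \<in> K\<rbrakk> \<Longrightarrow> \<pi> v \<in> mir t \<longleftrightarrow> fn t \<bullet> v = 0"
  using fn_data by blast+

lemma fix_fn: "\<lbrakk>t \<in> Rf; v \<in> K\<rbrakk> \<Longrightarrow> t (\<pi> v) = \<pi> v \<longleftrightarrow> fn t \<bullet> v = 0"
  using mir_fn \<pi>_points by (auto simp: mir_def)

lemma fn_nonzero: "t \<in> Rf \<Longrightarrow> fn t \<noteq> 0"
  using fn_ax by force

lemma mir_point:
  assumes "t \<in> Rf"
  obtains e where "e \<in> K" "fn t \<bullet> e = 0"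
proof -
  have "is_hyperplane S (mir t)"
    using assms by (auto simp: Rf_def reflection_in_def)
  then obtain x where "x \<in> mir t"
    by (auto simp: is_hyperplane_def)
  then show ?thesis
    using that[of "\<phi> x"] mir_fn[OF assms, of "\<phi> x"] \<phi>_K[of x] \<pi>_\<phi>[of x] by (auto simp: mir_def)
qed

lemma Rf_involution:
  assumes "t \<in> Rf"
  shows "\<And>x. x \<in> P \<Longrightarrow> t (t x) = x" "gmul t t = gone"
proof -
  show *: "\<And>x. x \<in> P \<Longrightarrow> t (t x) = x"
    using assms by (auto simp: Rf_def reflection_in_def)
  show "gmul t t = gone"
    using * Rf_\<Gamma>[OF assms]
    by (intro \<Gamma>_ext) (auto simp: \<Gamma>_mul \<Gamma>_one gmul_apply gone_apply)
qed

lemma Rf_not_one: "t \<in> Rf \<Longrightarrow> t \<noteq> gone"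
proof
  assume t: "t \<in> Rf" "t = gone"
  obtain v where v: "v \<in> K" "fn t \<bullet> v \<noteq> 0"
    using K_not_in_hyperplane[OF fn_nonzero[OF t(1)] open_K K_nonempty] .
  then show False
    using fix_fn[OF t(1) v(1)] t(2) \<pi>_points[OF v(1)] by (simp add: gone_apply)
qed

lemma countable_Rf: "countable Rf"
  by (rule countable_subset[OF _ countable_\<Gamma>]) (auto simp: Rf_def)

lemma fn_proportional:
  assumes t: "t \<in> Rf" and z: "\<And>v. \<lbrakk>v \<in> K; fn t \<bullet> v = 0\<rbrakk> \<Longrightarrow> z \<bullet> v = 0"
  obtains k where "z = k *\<^sub>R fn t"
  using mir_point[OF t] functional_proportional[OF open_K, of _ "fn t" z] z by metis

text \<open>
  The reflection would fix an interior point of a chamber, so it would map the chamber to itself, and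
  \<open>\<Gamma>\<close> acts freely on the chambers.
\<close>

lemma mirror_avoids_interior:
  assumes g: "g \<in> \<Gamma>" and v: "v \<in> interior (ch g)" and t: "t \<in> Rf"
  shows "fn t \<bullet> v \<noteq> 0"
proof
  assume "fn t \<bullet> v = 0"
  then have "sk t v = v"
    by (rule skew_reflection_wall)
  then have "v \<in> interior (ch (gmul t g))"
    using ch_interior_rep[OF g Rf_\<Gamma>[OF t] sk_rep[OF t] v] by simp
  then have eq: "gmul t g = g"
    using ch_disjoint[of "gmul t g" g v] v g \<Gamma>_mul Rf_\<Gamma>[OF t] by blast
  have "t = gmul (gmul t g) (ginv g)"
    using gmul_inv_right[OF g Rf_\<Gamma>[OF t]] by simp
  also have "\<dots> = gone"
    unfolding eq using g by (intro \<Gamma>_ext) (auto simp: \<Gamma>_mul \<Gamma>_inv \<Gamma>_one gmul_apply ginv_r gone_apply)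
  finally show False
    using Rf_not_one[OF t] by blast
qed

definition cj :: "('a \<Rightarrow> 'a) \<Rightarrow> ('a \<Rightarrow> 'a) \<Rightarrow> 'a \<Rightarrow> 'a"
  where "cj g t = gmul (gmul g t) (ginv g)"

lemma cj_\<Gamma>: "\<lbrakk>g \<in> \<Gamma>; t \<in> \<Gamma>\<rbrakk> \<Longrightarrow> cj g t \<in> \<Gamma>"
  by (simp add: cj_def \<Gamma>_mul \<Gamma>_inv)

lemma cj_apply: "\<lbrakk>g \<in> \<Gamma>; t \<in> \<Gamma>; x \<in> P\<rbrakk> \<Longrightarrow> cj g t (g x) = g (t x)"
  by (simp add: cj_def gmul_apply \<Gamma>_points ginv_l \<Gamma>_inv)

lemma cj_Rf:
  assumes g: "g \<in> \<Gamma>" and t: "t \<in> Rf"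
  shows "cj g t \<in> Rf" "mir (cj g t) = g ` mir t"
proof -
  note t' = Rf_\<Gamma>[OF t]
  obtain A where A: "rep g A"
    using \<Gamma>_rep[OF g] by blast
  obtain B where B: "rep (ginv g) B" "\<And>v. B (A v) = v" "\<And>v. A (B v) = v"
    using rep_inverse[OF \<Gamma>_isometries[OF g] A] by metis
  define w where "w = adjoint B (fn t)"
  have w: "w \<bullet> v = fn t \<bullet> B v" for v
    using adjoint_works[OF rep_linear[OF B(1)], of v "fn t"] by (simp add: w_def inner_commute)
  have "rep (cj g t) (\<lambda>v. A (sk t (B v)))"
    unfolding cj_def gmul_def by (rule rep_comp[OF rep_comp[OF A sk_rep[OF t]] B(1)])
  moreover have "A (sk t (B v)) = skew_reflection w (A (ax t)) v" for v
    using rep_linear[OF A] by (simp add: skew_reflection_def linear_diff linear_scale w B(3))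
  ultimately have r: "rep (cj g t) (skew_reflection w (A (ax t)))"
    by simp
  obtain e where e: "e \<in> K" "fn t \<bullet> e = 0"
    using mir_point[OF t] .
  have "reflection_in S (mir (cj g t)) (cj g t)"
    unfolding mir_def
    by (rule skew_reflection_in(1)[OF \<Gamma>_isometries[OF cj_\<Gamma>[OF g t']] r _ rep_K[OF A e(1)]])
      (auto simp: w B(2) fn_ax[OF t] e)
  then show "cj g t \<in> Rf"
    using cj_\<Gamma>[OF g t'] by (simp add: Rf_def)
  show "mir (cj g t) = g ` mir t"
  proof (intro equalityI subsetI)
    fix x assume x: "x \<in> mir (cj g t)"
    define y where "y = ginv g x"
    have y: "y \<in> P" "g y = x"
      using x g by (auto simp: y_def mir_def ginv_r \<Gamma>_inv \<Gamma>_points)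
    then have "g (t y) = g y"
      using cj_apply[OF g t' y(1)] x by (simp add: mir_def)
    then have "t y = y"
      using \<Gamma>_inj[OF g] y(1) \<Gamma>_points[OF t'] by blast
    then show "x \<in> g ` mir t"
      using y by (auto simp: mir_def)
  next
    fix x assume "x \<in> g ` mir t"
    then show "x \<in> mir (cj g t)"
      using cj_apply[OF g t'] \<Gamma>_points[OF g] by (auto simp: mir_def)
  qed
qed

lemma cj_fn:
  assumes g: "g \<in> \<Gamma>" and t: "t \<in> Rf" and A: "rep g A"
  obtains k where "k \<noteq> 0" "\<And>v. fn (cj g t) \<bullet> A v = k * (fn t \<bullet> v)"
proof -
  note c = cj_Rf[OF g t]
  define z where "z = adjoint A (fn (cj g t))"
  have z: "z \<bullet> v = fn (cj g t) \<bullet> A v" for v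
    using adjoint_works[OF rep_linear[OF A], of v "fn (cj g t)"] by (simp add: z_def inner_commute)
  have "z \<bullet> v = 0" if v: "v \<in> K" "fn t \<bullet> v = 0" for v
  proof -
    have "\<pi> (A v) \<in> mir (cj g t)"
      unfolding c(2) rep_\<pi>[OF A v(1)] using mir_fn[OF t v(1)] v(2) by blast
    then show ?thesis
      using mir_fn[OF c(1) rep_K[OF A v(1)]] z by simp
  qed
  then obtain k where k: "z = k *\<^sub>R fn t"
    using fn_proportional[OF t] by blast
  have kk: "fn (cj g t) \<bullet> A v = k * (fn t \<bullet> v)" for v
    using z[of v] k by simp
  obtain B where B: "\<And>v. A (B v) = v"
    using rep_inverse[OF \<Gamma>_isometries[OF g] A] by metis
  have "k \<noteq> 0"
  proof
    assume "k = 0"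
    then have "fn (cj g t) \<bullet> v = 0" for v
      using kk[of "B v"] B[of v] by simp
    then show False
      using fn_nonzero[OF c(1)] inner_eq_zero_iff by blast
  qed
  then show ?thesis
    using that kk by blast
qed

section \<open>Local structure of the tiling\<close>

text \<open>
  Near \<open>v\<close> the domain is given by the finitely many inequalities which are equalities at \<open>v\<close>. A member
  \<open>w\<close> of a minimal subsystem of these has a point \<open>p\<close> near \<open>v\<close> where no other member is an equality.
  So near \<open>p\<close> the domain contains an open part of the kernel of \<open>w\<close>, which therefore spans a wall of
  the domain, and the reflection in this wall is one of the generators.
\<close>

lemma boundary_wall_D:
  assumes v: "v \<in> hat D" and nv: "v \<notin> interior (hat D)"
  shows "\<exists>t\<in>Rf. fn t \<bullet> v = 0"
proof -
  obtain N where N': "\<forall>w\<in>N. w \<noteq> 0"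
    and ND': "\<forall>v\<in>K. v \<in> hat D \<longleftrightarrow> (\<forall>w\<in>N. w \<bullet> v \<ge> 0)"
    and NF: "\<forall>v\<in>K. \<exists>r>0. ball v r \<subseteq> K \<and>
       finite {H \<in> (\<lambda>w. {u \<in> K. w \<bullet> u = 0}) ` N. H \<inter> ball v r \<noteq> {}}"
    using D_inequalities .
  note N = N'[rule_format] and ND = ND'[rule_format]
  let ?H = "\<lambda>w. {u \<in> K. w \<bullet> u = 0}"
  have vK: "v \<in> K"
    using v by (simp add: hat_def)
  obtain r where r: "r > 0" "ball v r \<subseteq> K" and fH: "finite {H \<in> ?H ` N. H \<inter> ball v r \<noteq> {}}"
    using NF vK by blast
  obtain q where q: "q \<in> interior (hat D)"
    using ch_interior_nonempty[OF \<Gamma>_one] unfolding ch_one by blast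
  have qpos: "w \<bullet> q > 0" if w: "w \<in> N" for w
  proof -
    obtain d where d: "d > 0" "\<And>t. \<bar>t\<bar> \<le> d \<Longrightarrow> q + t *\<^sub>R w \<in> interior (hat D)"
      using small_shift[OF open_interior q] by blast
    have "q + (- d) *\<^sub>R w \<in> hat D"
      using d(2)[of "- d"] d(1) interior_subset[of "hat D"] by auto
    then have "w \<bullet> (q + (- d) *\<^sub>R w) \<ge> 0"
      using ND[of "q + (- d) *\<^sub>R w"] w hat_K[of D] by blast
    then have "w \<bullet> q \<ge> d * (w \<bullet> w)"
      by (simp add: inner_diff_right)
    moreover have "d * (w \<bullet> w) > 0"
      using d(1) N[OF w] by simp
    ultimately show ?thesis
      by linarith
  qed
  have vN: "w \<bullet> v \<ge> 0" if "w \<in> N" for w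
    using ND[OF vK] v that by blast
  from finite_subset_image[OF fH, of ?H N]
  obtain N2 where N2: "N2 \<subseteq> N" "finite N2" "{H \<in> ?H ` N. H \<inter> ball v r \<noteq> {}} = ?H ` N2"
    by auto
  \<comment> \<open>\<open>N2\<close> represents the finitely many hyperplanes near \<open>v\<close>, and \<open>N1\<close> those through \<open>v\<close>.\<close>
  define N1 where "N1 = {w \<in> N2. w \<bullet> v = 0}"
  define W where "W = ball v r \<inter> (\<Inter>w\<in>N2 - N1. {u. w \<bullet> u > 0})"
  have N1: "finite N1" "N1 \<subseteq> N"
    using N2 by (auto simp: N1_def)
  have vbad: "w \<bullet> v > 0" if "w \<in> N2 - N1" for w
    using that vN[of w] N2(1) by (auto simp: N1_def less_le)
  have oW: "open W"
    unfolding W_def using N2(2) by (intro open_Int open_ball open_INT ballI open_halfspace_gt) auto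
  have vW: "v \<in> W"
    using r(1) vbad by (auto simp: W_def)
  have WK: "W \<subseteq> K"
    using r(2) by (auto simp: W_def)
  have cW: "convex W"
    unfolding W_def by (intro convex_Int convex_ball convex_INT convex_halfspace_gt)
  have WD: "u \<in> hat D" if u: "u \<in> W" and p: "\<forall>w\<in>N1. w \<bullet> u \<ge> 0" for u
  proof -
    have uK: "u \<in> K"
      using u WK by blast
    have "w \<bullet> u \<ge> 0" if w: "w \<in> N" for w
    proof (rule ccontr)
      assume neg: "\<not> w \<bullet> u \<ge> 0"
      then have "(w \<bullet> v) * (w \<bullet> u) \<le> 0"
        using vN[OF w] by (simp add: mult_nonneg_nonpos)
      then obtain z where z: "z \<in> closed_segment v u" "w \<bullet> z = 0"
        using segment_zero by metis
      have zW: "z \<in> W"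
        using closed_segment_subset[OF vW u cW] z(1) by blast
      then have zH: "z \<in> ?H w" "z \<in> ball v r"
        using z(2) WK by (auto simp: W_def)
      then have "?H w \<in> {H \<in> ?H ` N. H \<inter> ball v r \<noteq> {}}"
        using w by blast
      then obtain w2 where w2: "w2 \<in> N2" "?H w = ?H w2"
        unfolding N2(3) by blast
      have "w2 \<in> N1"
      proof (rule ccontr)
        assume "w2 \<notin> N1"
        then have "w2 \<bullet> z > 0"
          using zW w2(1) unfolding W_def by blast
        then show False
          using zH(1) w2(2) by auto
      qed
      then have w2v: "w2 \<bullet> v = 0" "w2 \<in> N"
        using N1 by (auto simp: N1_def)
      have "w \<bullet> x = 0" if "x \<in> K" "w2 \<bullet> x = 0" for x
        using w2(2) that by blast
      then obtain k where k: "w = k *\<^sub>R w2"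
        using functional_proportional[OF open_K vK w2v(1)] by blast
      have "k * (w2 \<bullet> q) > 0"
        using qpos[OF w] k by simp
      then have "k > 0"
        using qpos[OF w2v(2)] by (simp add: zero_less_mult_iff)
      then have "w \<bullet> u \<ge> 0"
        using p \<open>w2 \<in> N1\<close> k by simp
      then show False
        using neg by blast
    qed
    then show ?thesis
      using ND[OF uK] by blast
  qed
  have N1ne: "N1 \<noteq> {}"
  proof
    assume "N1 = {}"
    then have "W \<subseteq> hat D"
      using WD by auto
    then have "W \<subseteq> interior (hat D)"
      using oW by (rule interior_maximal)
    then show False
      using nv vW by blast
  qed
  obtain M w z where M: "M \<subseteq> N1" "w \<in> M" "w \<bullet> z = 0"
    "\<forall>w'\<in>M. w' \<noteq> w \<longrightarrow> w' \<bullet> z > 0"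
    and MQ: "\<forall>u. (\<forall>w\<in>M. w \<bullet> u \<ge> 0) \<longrightarrow> (\<forall>w\<in>N1. w \<bullet> u \<ge> 0)"
    using minimal_subsystem[OF N1(1) N1ne N[OF subsetD[OF N1(2)]] qpos[OF subsetD[OF N1(2)]]] .
  have wv: "w \<bullet> v = 0" and wN: "w \<in> N"
    using M(1,2) N1(2) by (auto simp: N1_def)
  obtain d where d: "d > 0" "\<And>t. \<bar>t\<bar> \<le> d \<Longrightarrow> v + t *\<^sub>R z \<in> W"
    using small_shift[OF oW vW] by blast
  \<comment> \<open>\<open>O'\<close> is a neighbourhood of \<open>p\<close> in which \<open>w\<close> is the only inequality of \<open>M\<close> that can fail.\<close>
  define p where "p = v + d *\<^sub>R z"
  define O' where "O' = W \<inter> (\<Inter>w'\<in>M - {w}. {u. w' \<bullet> u > 0})"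
  have "finite M"
    using N1(1) M(1) by (rule rev_finite_subset)
  then have oO: "open O'"
    unfolding O'_def by (intro open_Int oW open_INT ballI open_halfspace_gt) auto
  have "w' \<bullet> p > 0" if "w' \<in> M - {w}" for w'
  proof -
    have "w' \<bullet> v \<ge> 0" "w' \<bullet> z > 0"
      using that M(1) N1(2) vN M(4) by auto
    then show ?thesis
      using d(1) by (simp add: p_def inner_add_right add_nonneg_pos)
  qed
  then have pO: "p \<in> O'"
    using d(2)[of d] d(1) by (simp add: O'_def p_def)
  have wp: "w \<bullet> p = 0"
    by (simp add: p_def inner_add_right wv M(3))
  define Y where "Y = {x \<in> P. w \<bullet> \<phi> x = 0}"
  have \<pi>Y: "\<pi> u \<in> Y \<longleftrightarrow> w \<bullet> u = 0" if u: "u \<in> K" for u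
  proof -
    obtain c where "c > 0" "w \<bullet> \<phi> (\<pi> u) = c * (w \<bullet> u)"
      using functional_sign[OF u] .
    then show ?thesis
      using \<pi>_points[OF u] by (simp add: Y_def)
  qed
  let ?w = "{u. w \<bullet> u = 0}"
  have sub1: "?w \<inter> O' \<subseteq> hat (D \<inter> Y)"
  proof
    fix u assume u: "u \<in> ?w \<inter> O'"
    have uW: "u \<in> W"
      using u by (simp add: O'_def)
    have "w' \<bullet> u \<ge> 0" if "w' \<in> M" for w'
    proof (cases "w' = w")
      case True
      then show ?thesis using u by simp
    next
      case False
      then have "w' \<bullet> u > 0"
        using u that by (simp add: O'_def)
      then show ?thesis by simp
    qed
    then have "u \<in> hat D"
      using WD[OF uW] MQ by blast
    moreover have "\<pi> u \<in> Y"
      using \<pi>Y u uW WK by blast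
    ultimately show "u \<in> hat (D \<inter> Y)"
      by (simp add: hat_def)
  qed
  have sub2: "hat (D \<inter> Y) \<subseteq> ?w"
    using \<pi>Y by (auto simp: hat_def)
  have "openin (top_of_set ?w) (?w \<inter> O')"
    using oO by (rule openin_open_Int)
  moreover have "?w \<inter> O' \<noteq> {}"
    using pO wp by blast
  ultimately have "dim (?w \<inter> O') = dim ?w"
    using dim_openin[of ?w "?w \<inter> O'"] subspace_hyperplane[of w] by simp
  then have "dim (hat (D \<inter> Y)) = dim ?w"
    using dim_subset[OF sub1] dim_subset[OF sub2] by simp
  also have "dim ?w = DIM('v) - 1"
    using N[OF wN] by (rule dim_hyperplane)
  finally have dimY: "dimension_in S (D \<inter> Y) = dimension_in S P - 1"
    using dimension_hat[of "D \<inter> Y"] dimension_points D_P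
    by (simp add: le_infI1 of_nat_diff)
  have wx: "\<pi> v \<in> P" "w \<bullet> \<phi> (\<pi> v) = 0"
    using \<pi>Y[OF vK] wv by (auto simp: Y_def)
  obtain a b where ab: "(a, b) \<in> normals S Y" "halfspace S a b = {x \<in> P. w \<bullet> \<phi> x \<ge> 0}"
    using functional_normals[OF N[OF wN] wx] unfolding Y_def .
  have "D \<subseteq> halfspace S a b"
  proof
    fix x assume x: "x \<in> D"
    then have xP: "x \<in> P"
      using D_P by blast
    then have "\<phi> x \<in> hat D"
      using x \<phi>_K \<pi>_\<phi> by (simp add: hat_def)
    then have "w \<bullet> \<phi> x \<ge> 0"
      using ND[OF \<phi>_K[OF xP]] wN by blast
    then show "x \<in> halfspace S a b"
      using xP ab(2) by simp
  qed
  moreover have "is_hyperplane S Y"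
    unfolding Y_def using is_hyperplane_functional[OF N[OF wN] wx] .
  ultimately have "is_wall S D Y"
    unfolding is_wall_def using ab(1) dimY by auto
  then obtain s where s: "s \<in> \<Gamma>" "reflection_in S Y s"
    using generators by (metis subsetD)
  have "s \<in> Rf" "Y = mir s"
    using reflection_Rf[OF s] by auto
  then show ?thesis
    using mir_fn[of s v] vK \<pi>Y[OF vK] wv by blast
qed

lemma boundary_wall:
  assumes g: "g \<in> \<Gamma>" and v: "v \<in> ch g" "v \<notin> interior (ch g)"
  shows "\<exists>t\<in>Rf. fn t \<bullet> v = 0"
proof -
  obtain A where A: "rep g A"
    using \<Gamma>_rep[OF g] by blast
  obtain B where B: "rep (ginv g) B" "\<And>v. A (B v) = v"
    using rep_inverse[OF \<Gamma>_isometries[OF g] A] by metis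
  have Bv: "B v \<in> K"
    using rep_K[OF B(1) ch_K[OF v(1)]] .
  have "B v \<in> ch gone"
    using ch_rep[OF \<Gamma>_one g A Bv] B(2)[of v] gmul_one[OF g] v(1) by simp
  moreover have "B v \<notin> interior (ch gone)"
    using ch_interior_rep[OF \<Gamma>_one g A, of "B v"] B(2)[of v] gmul_one[OF g] v(2) by auto
  ultimately obtain s where s: "s \<in> Rf" "fn s \<bullet> B v = 0"
    using boundary_wall_D[of "B v"] unfolding ch_one by blast
  obtain k where "\<And>v. fn (cj g s) \<bullet> A v = k * (fn s \<bullet> v)"
    using cj_fn[OF g s(1) A] by metis
  then have "fn (cj g s) \<bullet> v = 0"
    using B(2)[of v] s(2) by (metis mult_zero_right)
  then show ?thesis
    using cj_Rf(1)[OF g s(1)] by blast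
qed

subsection \<open>Generic points\<close>

definition gen :: "'v \<Rightarrow> bool"
  where "gen v \<longleftrightarrow> v \<in> K \<and> (\<forall>t\<in>Rf. fn t \<bullet> v \<noteq> 0)"

lemma gen_interior: "\<lbrakk>gen v; g \<in> \<Gamma>; v \<in> ch g\<rbrakk> \<Longrightarrow> v \<in> interior (ch g)"
  using boundary_wall[of g v] unfolding gen_def by auto

lemma interior_gen: "\<lbrakk>g \<in> \<Gamma>; v \<in> interior (ch g)\<rbrakk> \<Longrightarrow> gen v"
  using mirror_avoids_interior[of g v] interior_subset[of "ch g"] ch_K[of v g]
  unfolding gen_def by auto

lemma gen_unique: "\<lbrakk>gen v; g \<in> \<Gamma>; h \<in> \<Gamma>; v \<in> ch g; v \<in> ch h\<rbrakk> \<Longrightarrow> g = h"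
  using ch_disjoint[OF _ _ gen_interior gen_interior] by simp

text \<open>
  The interiors of the chambers are disjoint, and they cover a segment of generic points; the segment
  is connected.
\<close>

lemma segment_same_chamber:
  assumes g: "g \<in> \<Gamma>" and u: "u \<in> ch g" and s: "\<And>x. x \<in> closed_segment u v \<Longrightarrow> gen x"
  shows "v \<in> ch g"
proof (rule ccontr)
  assume v: "v \<notin> ch g"
  define V where "V = (\<Union>h\<in>\<Gamma> - {g}. interior (ch h))"
  have oV: "open V"
    unfolding V_def by (intro open_UN ballI open_interior)
  have dis: "interior (ch g) \<inter> V = {}"
    unfolding V_def using ch_disjoint[OF g] by auto
  have cov: "x \<in> interior (ch g) \<union> V" if "x \<in> closed_segment u v" for x
  proof -
    have gx: "gen x"
      using s[OF that] .
    then obtain h where "h \<in> \<Gamma>" "x \<in> ch h"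
      using ch_cover[of x] unfolding gen_def by blast
    then show ?thesis
      using gen_interior[OF gx] unfolding V_def by (cases "h = g") auto
  qed
  have "u \<in> interior (ch g)"
    using gen_interior[OF s g u] by simp
  moreover have "v \<in> V"
    using cov[of v] v interior_subset[of "ch g"] by auto
  moreover have "interior (ch g) \<inter> V \<inter> closed_segment u v = {}"
    using dis by blast
  moreover have "closed_segment u v \<subseteq> interior (ch g) \<union> V"
    using cov by blast
  ultimately show False
    using connectedD[OF connected_segment(1)[of u v] open_interior[of "ch g"] oV]
      ends_in_segment[of u v] by blast
qed

text \<open>
  Within the radius \<open>r\<close> the tiling looks the same at all scales: the ball meets only chambers and
  mirrors which contain its centre.
\<close>

definition small :: "'v \<Rightarrow> real \<Rightarrow> bool"
  where "small v r \<longleftrightarrow> r > 0 \<and> ball v r \<subseteq> K \<and>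
    (\<forall>g\<in>\<Gamma>. ch g \<inter> ball v r \<noteq> {} \<longrightarrow> v \<in> ch g) \<and>
    (\<forall>t\<in>Rf. \<forall>u\<in>ball v r. fn t \<bullet> u = 0 \<longrightarrow> fn t \<bullet> v = 0)"

text \<open>
  If a mirror passes through \<open>u\<close>, and \<open>u\<close> lies in the chamber of \<open>g\<close>, then it lies in that of \<open>t g\<close> as
  well. So the reflections in the mirrors near \<open>v\<close> are quotients of elements from a finite set.
\<close>

lemma mirrors_locally_finite:
  assumes v: "v \<in> K"
  obtains r where "small v r" "finite {t \<in> Rf. fn t \<bullet> v = 0}"
proof -
  obtain r0 where r0: "r0 > 0" "ball v r0 \<subseteq> K" "finite {g \<in> \<Gamma>. ch g \<inter> ball v r0 \<noteq> {}}"
    and r0c: "\<forall>g\<in>\<Gamma>. ch g \<inter> ball v r0 \<noteq> {} \<longrightarrow> v \<in> ch g"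
    using ch_locally_finite[OF v] .
  let ?F = "{g \<in> \<Gamma>. ch g \<inter> ball v r0 \<noteq> {}}"
  \<comment> \<open>Each such reflection is \<open>(t g) g\<^sup>-\<^sup>1\<close> for two chambers that meet the ball.\<close>
  define M where "M = {t \<in> Rf. \<exists>u\<in>ball v r0. fn t \<bullet> u = 0}"
  have "M \<subseteq> (\<lambda>(a, b). gmul a (ginv b)) ` (?F \<times> ?F)"
  proof
    fix t assume "t \<in> M"
    then obtain u where t: "t \<in> Rf" and u: "u \<in> ball v r0" "fn t \<bullet> u = 0"
      by (auto simp: M_def)
    have uK: "u \<in> K"
      using u(1) r0(2) by blast
    obtain g where g: "g \<in> \<Gamma>" "u \<in> ch g"
      using ch_cover[OF uK] by blast
    have "sk t u = u"
      using u(2) by (rule skew_reflection_wall)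
    then have "u \<in> ch (gmul t g)"
      using ch_rep[OF g(1) Rf_\<Gamma>[OF t] sk_rep[OF t] uK] g(2) by simp
    then have "(gmul t g, g) \<in> ?F \<times> ?F"
      using g u(1) \<Gamma>_mul[OF Rf_\<Gamma>[OF t] g(1)] by auto
    moreover have "t = (\<lambda>(a, b). gmul a (ginv b)) (gmul t g, g)"
      using gmul_inv_right[OF g(1) Rf_\<Gamma>[OF t]] by simp
    ultimately show "t \<in> (\<lambda>(a, b). gmul a (ginv b)) ` (?F \<times> ?F)"
      by (rule rev_image_eqI)
  qed
  then have finM: "finite M"
    by (rule finite_subset[OF _ finite_imageI[OF finite_cartesian_product[OF r0(3) r0(3)]]])
  define W where "W = ball v r0 \<inter> (\<Inter>t\<in>{t \<in> M. fn t \<bullet> v \<noteq> 0}. {u. fn t \<bullet> u \<noteq> 0})"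
  have o1: "open {u. fn t \<bullet> u \<noteq> 0}" for t
  proof -
    have "{u. fn t \<bullet> u \<noteq> 0} = - {u. fn t \<bullet> u = 0}"
      by auto
    then show ?thesis
      using closed_hyperplane[of "fn t" 0] by (simp only: open_Compl)
  qed
  have "open W"
    unfolding W_def using finM o1 by (intro open_Int open_ball open_INT ballI) auto
  moreover have "v \<in> W"
    using r0(1) by (auto simp: W_def)
  ultimately obtain r where r: "r > 0" "ball v r \<subseteq> W"
    by (meson open_contains_ball)
  have sub: "ball v r \<subseteq> ball v r0"
    using r(2) by (auto simp: W_def)
  have "fn t \<bullet> v = 0" if "t \<in> Rf" "u \<in> ball v r" "fn t \<bullet> u = 0" for t u
  proof (rule ccontr)
    assume n: "fn t \<bullet> v \<noteq> 0"
    have "t \<in> M"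
      using that sub unfolding M_def by blast
    then have "fn t \<bullet> u \<noteq> 0"
      using n that(2) r(2) unfolding W_def by blast
    then show False
      using that by simp
  qed
  moreover have "v \<in> ch g" if "g \<in> \<Gamma>" "ch g \<inter> ball v r \<noteq> {}" for g
    using r0c that sub by blast
  ultimately have "small v r"
    unfolding small_def using r(1) sub r0(2) by blast
  moreover have "{t \<in> Rf. fn t \<bullet> v = 0} \<subseteq> M"
    using r0(1) by (auto simp: M_def)
  then have "finite {t \<in> Rf. fn t \<bullet> v = 0}"
    using finM by (rule finite_subset)
  ultimately show ?thesis
    by (rule that)
qed

lemma small_K: "\<lbrakk>small v r; u \<in> ball v r\<rbrakk> \<Longrightarrow> u \<in> K"
  and small_ch: "\<lbrakk>small v r; u \<in> ball v r; g \<in> \<Gamma>; u \<in> ch g\<rbrakk> \<Longrightarrow> v \<in> ch g"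
  and small_fn: "\<lbrakk>small v r; u \<in> ball v r; t \<in> Rf; fn t \<bullet> u = 0\<rbrakk> \<Longrightarrow> fn t \<bullet> v = 0"
  and small_pos: "small v r \<Longrightarrow> r > 0"
  unfolding small_def by blast+

lemma small_sign:
  assumes s: "small v r" and t: "t \<in> Rf" "fn t \<bullet> v \<noteq> 0" and uw: "u \<in> ball v r" "w \<in> ball v r"
  shows "(fn t \<bullet> u) * (fn t \<bullet> w) > 0"
proof (rule ccontr)
  assume "\<not> ?thesis"
  then have "(fn t \<bullet> u) * (fn t \<bullet> w) \<le> 0"
    by simp
  then obtain x where x: "x \<in> closed_segment u w" "fn t \<bullet> x = 0"
    using segment_zero by metis
  have "x \<in> ball v r"
    using closed_segment_subset[OF uw convex_ball] x(1) by blast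
  then show False
    using small_fn[OF s _ t(1) x(2)] t(2) by simp
qed

lemma small_same_chamber:
  assumes s: "small v r" and uw: "u \<in> ball v r" "w \<in> ball v r"
    and sg: "\<And>t. \<lbrakk>t \<in> Rf; fn t \<bullet> v = 0\<rbrakk> \<Longrightarrow> (fn t \<bullet> u) * (fn t \<bullet> w) > 0"
    and g: "g \<in> \<Gamma>" "u \<in> ch g"
  shows "w \<in> ch g"
proof (rule segment_same_chamber[OF g])
  fix x assume x: "x \<in> closed_segment u w"
  have xb: "x \<in> ball v r"
    using closed_segment_subset[OF uw convex_ball] x by blast
  have "fn t \<bullet> x \<noteq> 0" if t: "t \<in> Rf" for t
  proof -
    have "(fn t \<bullet> u) * (fn t \<bullet> w) > 0"
      using sg[OF t] small_sign[OF s t _ uw] by blast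
    then have "(fn t \<bullet> u) * (fn t \<bullet> x) > 0"
      using x by (rule segment_positive)
    then show ?thesis by auto
  qed
  then show "gen x"
    using small_K[OF s xb] by (simp add: gen_def)
qed

lemma shrink_sign:
  assumes "fn t \<bullet> a = 0"
  shows "fn t \<bullet> (a + d *\<^sub>R (u - a)) = d * (fn t \<bullet> u)"
  using assms by (simp add: inner_add_right inner_diff_right)

lemma ball_shrink:
  fixes u a :: 'v
  assumes "u \<in> ball a r" "0 \<le> d" "d \<le> (1::real)"
  shows "a + d *\<^sub>R (u - a) \<in> ball a r"
proof -
  have "d * norm (u - a) \<le> 1 * norm (u - a)"
    using assms by (intro mult_right_mono) auto
  moreover have "dist a (a + d *\<^sub>R (u - a)) = d * norm (u - a)"
    using assms(2) by (simp add: dist_norm)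
  moreover have "norm (u - a) < r"
    using assms(1) by (simp add: dist_norm norm_minus_commute)
  ultimately show ?thesis
    by simp
qed

text \<open>
  A point \<open>u1\<close> on the segment from \<open>a\<close> to \<open>u\<close> lies in the same chamber as \<open>u\<close>. If it is close enough to
  \<open>a\<close>, its mirror image stays in the ball, and no mirror separates this image from \<open>w\<close>.
\<close>

lemma small_opposite_chamber:
  assumes s: "small a r" and uw: "u \<in> ball a r" "w \<in> ball a r" and gen: "gen u"
    and t: "t \<in> Rf" "(fn t \<bullet> u) * (fn t \<bullet> w) < 0"
    and only: "\<And>t'. \<lbrakk>t' \<in> Rf; fn t' \<bullet> a = 0\<rbrakk> \<Longrightarrow> \<exists>k. fn t' = k *\<^sub>R fn t"
    and g: "g \<in> \<Gamma>" "u \<in> ch g"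
  shows "w \<in> ch (gmul t g)"
proof -
  have ta: "fn t \<bullet> a = 0"
  proof (rule ccontr)
    assume "fn t \<bullet> a \<noteq> 0"
    then show False
      using small_sign[OF s t(1) _ uw] t(2) by simp
  qed
  have r: "r > 0"
    using small_pos[OF s] .
  obtain d0 where d0: "d0 > 0" "\<And>x. \<bar>x\<bar> \<le> d0 \<Longrightarrow> a + x *\<^sub>R (sk t u - a) \<in> ball a r"
    using small_shift[of "ball a r" a "sk t u - a"] r by auto
  define d where "d = min d0 1"
  have d: "0 < d" "d \<le> 1" "\<bar>d\<bar> \<le> d0"
    using d0(1) by (auto simp: d_def)
  define u1 where "u1 = a + d *\<^sub>R (u - a)"
  have u1b: "u1 \<in> ball a r"
    unfolding u1_def using ball_shrink[OF uw(1)] d by simp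
  have gu: "fn t' \<bullet> u \<noteq> 0" if "t' \<in> Rf" for t'
    using gen that unfolding gen_def by blast
  have u1g: "u1 \<in> ch g"
  proof (rule small_same_chamber[OF s uw(1) u1b _ g])
    fix t' assume t': "t' \<in> Rf" "fn t' \<bullet> a = 0"
    have "fn t' \<bullet> u1 = d * (fn t' \<bullet> u)"
      unfolding u1_def using t'(2) by (rule shrink_sign)
    then have "(fn t' \<bullet> u) * (fn t' \<bullet> u1) = d * ((fn t' \<bullet> u) * (fn t' \<bullet> u))"
      by simp
    moreover have "(fn t' \<bullet> u) * (fn t' \<bullet> u) > 0"
      using gu[OF t'(1)] by (metis not_real_square_gt_zero)
    ultimately show "(fn t' \<bullet> u) * (fn t' \<bullet> u1) > 0"
      by (simp only: mult_pos_pos d(1))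
  qed
  have "sk t a = a"
    using ta by (rule skew_reflection_wall)
  then have su1: "sk t u1 = a + d *\<^sub>R (sk t u - a)"
    unfolding u1_def using linear_skew_reflection[of "fn t" "ax t"]
    by (simp add: linear_add linear_diff linear_scale)
  have su1b: "sk t u1 \<in> ball a r"
    unfolding su1 using d0(2)[OF d(3)] .
  have "sk t u1 \<in> ch (gmul t g)"
    using ch_rep[OF g(1) Rf_\<Gamma>[OF t(1)] sk_rep[OF t(1)] ch_K[OF u1g]] u1g by blast
  then show ?thesis
  proof (rule small_same_chamber[OF s su1b uw(2) _ \<Gamma>_mul[OF Rf_\<Gamma>[OF t(1)] g(1)], rotated])
    fix t' assume t': "t' \<in> Rf" "fn t' \<bullet> a = 0"
    obtain k where k: "fn t' = k *\<^sub>R fn t"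
      using only[OF t'] by blast
    have "k \<noteq> 0"
      using k fn_nonzero[OF t'(1)] by auto
    have "fn t \<bullet> sk t u1 = - (d * (fn t \<bullet> u))"
      using skew_reflection_flip[OF fn_ax[OF t(1)], of u1] shrink_sign[OF ta, of d u]
      by (simp add: u1_def)
    then have "(fn t' \<bullet> sk t u1) * (fn t' \<bullet> w) = (k * k * d) * - ((fn t \<bullet> u) * (fn t \<bullet> w))"
      by (simp add: k)
    moreover have "k * k * d > 0"
      using \<open>k \<noteq> 0\<close> d(1) by (metis mult_pos_pos not_real_square_gt_zero)
    ultimately show "(fn t' \<bullet> sk t u1) * (fn t' \<bullet> w) > 0"
      using t(2) by (metis mult_pos_pos neg_0_less_iff_less)
  qed
qed

lemma generic_point:
  assumes "open W" "W \<noteq> {}" "W \<subseteq> K"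
  obtains z where "z \<in> W" "gen z"
proof -
  let ?N = "(\<lambda>t. {v. fn t \<bullet> v = 0}) ` Rf"
  have N: "subspace N \<and> \<not> UNIV \<subseteq> N" if "N \<in> ?N" for N
  proof -
    from that obtain t where t: "N = {v. fn t \<bullet> v = 0}" "t \<in> Rf"
      by (rule imageE)
    have "ax t \<notin> N"
      using fn_ax[OF t(2)] t(1) by simp
    then show ?thesis
      unfolding t(1) using subspace_hyperplane[of "fn t"] by blast
  qed
  have cnt: "countable ?N"
    using countable_Rf by simp
  have "W \<inter> UNIV \<noteq> {}"
    using assms(2) by simp
  then obtain z where z: "z \<in> W" "\<forall>N\<in>?N. z \<notin> N"
    using subspace_generic_point[OF subspace_UNIV assms(1) _ cnt N] by blast
  have "gen z"
    unfolding gen_def using z assms(3) by blast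
  then show ?thesis
    using that z(1) by blast
qed

text \<open>
  Inside a small ball at \<open>v\<close> there is a gallery between the two chambers which avoids all intersections
  of two mirrors, because these have codimension two. Each mirror that it crosses contains \<open>v\<close>, and \<open>k\<close>
  is the product of the reflections in these mirrors.
\<close>

lemma chambers_at_point:
  assumes dim: "2 \<le> DIM('v)" and gh: "g \<in> \<Gamma>" "h \<in> \<Gamma>" and v: "v \<in> ch g" "v \<in> ch h"
  obtains k where "k \<in> \<Gamma>" "k (\<pi> v) = \<pi> v" "gmul k g = h"
proof -
  have vK: "v \<in> K"
    using ch_K[OF v(1)] .
  obtain r where s: "small v r"
    using mirrors_locally_finite[OF vK] by metis
  have r: "r > 0" and bK: "ball v r \<subseteq> K"
    using s unfolding small_def by auto
  let ?L = "\<lambda>(t, t'). {u. fn t \<bullet> u = 0 \<and> fn t' \<bullet> u = 0}"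
  let ?I = "{(t, t') \<in> Rf \<times> Rf. \<nexists>k. fn t' = k *\<^sub>R fn t}"
  define Q where "Q = ball v r - \<Union>(?L ` ?I)"
  have conQ: "connected Q"
    unfolding Q_def
  proof (rule connected_minus_codim2[OF subspace_UNIV])
    show "2 \<le> dim (UNIV :: 'v set)"
      using dim by simp
    show "openin (top_of_set UNIV) (ball v r)"
      by simp
    show "0 \<notin> ball v r"
      using bK zero_K by blast
    show "closed_segment x y \<subseteq> ball v r" if "x \<in> ball v r" "y \<in> ball v r" for x y
      using that convex_ball by (rule closed_segment_subset)
    have "countable (Rf \<times> Rf)"
      using countable_Rf by simp
    then have "countable ?I"
      by (rule countable_subset[rotated]) auto
    then show "countable (?L ` ?I)"
      by simp
    fix M assume "M \<in> ?L ` ?I"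
    then obtain t t' where t: "t \<in> Rf" "t' \<in> Rf" "\<nexists>k. fn t' = k *\<^sub>R fn t"
      and M: "M = {u. fn t \<bullet> u = 0 \<and> fn t' \<bullet> u = 0}"
      by auto
    have "dim M + 2 = DIM('v)"
      unfolding M by (rule dim_two_hyperplanes[OF fn_nonzero[OF t(1)] t(3)])
    moreover have "subspace M"
      unfolding M by (auto simp: subspace_def inner_add_right)
    ultimately show "subspace M \<and> M \<subseteq> UNIV \<and> dim M + 2 \<le> dim (UNIV :: 'v set)"
      by simp
  qed
  \<comment> \<open>One element \<open>k\<close> has to serve all chambers at \<open>u\<close>; this makes the relation transitive.\<close>
  define R where "R u w \<longleftrightarrow> (\<exists>k\<in>\<Gamma>. k (\<pi> v) = \<pi> v \<and> (\<forall>g\<in>\<Gamma>. u \<in> ch g \<longrightarrow> w \<in> ch (gmul k g)))"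
    for u w
  have genQ: "u \<in> Q" if "u \<in> ball v r" "gen u" for u
    using that unfolding Q_def gen_def by auto
  have "v \<in> ball v r"
    using r by simp
  obtain u where u: "u \<in> ball v r" "u \<in> interior (ch g)"
    using ch_interior_dense[OF gh(1) v(1) open_ball \<open>v \<in> ball v r\<close>] .
  obtain w where w: "w \<in> ball v r" "w \<in> interior (ch h)"
    using ch_interior_dense[OF gh(2) v(2) open_ball \<open>v \<in> ball v r\<close>] .
  have gu: "gen u" and gw: "gen w"
    using interior_gen[OF gh(1) u(2)] interior_gen[OF gh(2) w(2)] .
  have "R u w"
  proof (rule connected_equivalence_relation_gen[where P = gen, OF conQ genQ[OF u(1) gu] genQ[OF w(1) gw] gu gw])
    fix x y z assume "R x y" "R y z"
    then obtain k l where k: "k \<in> \<Gamma>" "k (\<pi> v) = \<pi> v" "\<forall>g\<in>\<Gamma>. x \<in> ch g \<longrightarrow> y \<in> ch (gmul k g)"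
      and l: "l \<in> \<Gamma>" "l (\<pi> v) = \<pi> v" "\<forall>g\<in>\<Gamma>. y \<in> ch g \<longrightarrow> z \<in> ch (gmul l g)"
      unfolding R_def by blast
    have "z \<in> ch (gmul (gmul l k) g)" if g: "g \<in> \<Gamma>" "x \<in> ch g" for g
      using k(3) l(3) g \<Gamma>_mul[OF k(1) g(1)] gmul_assoc[OF l(1) k(1) g(1)] by simp
    moreover have "gmul l k (\<pi> v) = \<pi> v"
      using k(2) l(2) gmul_apply[OF \<pi>_points[OF vK]] by simp
    ultimately show "R x z"
      unfolding R_def using \<Gamma>_mul[OF l(1) k(1)] by blast
  next
    fix T a assume T: "openin (top_of_set Q) T" "a \<in> T"
    obtain W where W: "open W" "T = Q \<inter> W"
      using T(1) unfolding openin_open by blast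
    have "a \<in> W \<inter> ball v r"
      using T(2) W(2) unfolding Q_def by blast
    then have "W \<inter> ball v r \<noteq> {}" "W \<inter> ball v r \<subseteq> K" "open (W \<inter> ball v r)"
      using bK W(1) by auto
    then obtain z where "z \<in> W \<inter> ball v r" "gen z"
      using generic_point by metis
    then show "\<exists>z. z \<in> T \<and> gen z"
      using genQ W(2) by blast
  next
    fix a assume a: "a \<in> Q"
    have ab: "a \<in> ball v r"
      using a unfolding Q_def by blast
    obtain \<rho> where \<rho>: "small a \<rho>"
      using mirrors_locally_finite[of a] bK ab by blast
    have "R x y" if x: "x \<in> ball a \<rho>" "gen x" and y: "y \<in> ball a \<rho>" "gen y" for x y
    proof (cases "\<forall>t\<in>Rf. (fn t \<bullet> x) * (fn t \<bullet> y) > 0")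
      case True
      have "y \<in> ch (gmul gone g)" if g: "g \<in> \<Gamma>" "x \<in> ch g" for g
        using small_same_chamber[OF \<rho> x(1) y(1) _ g] True gmul_one(2)[OF g(1)] by simp
      then show ?thesis
        unfolding R_def using \<Gamma>_one gone_apply[OF \<pi>_points[OF vK]] by blast
    next
      case False
      then obtain t where t: "t \<in> Rf" "\<not> (fn t \<bullet> x) * (fn t \<bullet> y) > 0"
        by blast
      have "fn t \<bullet> x \<noteq> 0" "fn t \<bullet> y \<noteq> 0"
        using x(2) y(2) t(1) unfolding gen_def by auto
      then have neg: "(fn t \<bullet> x) * (fn t \<bullet> y) < 0"
        using t(2) by (simp add: not_less less_le)
      have ta: "fn t \<bullet> a = 0"
      proof (rule ccontr)
        assume "fn t \<bullet> a \<noteq> 0"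
        then show False
          using small_sign[OF \<rho> t(1) _ x(1) y(1)] neg by simp
      qed
      have tv: "t (\<pi> v) = \<pi> v"
        using small_fn[OF s ab t(1) ta] fix_fn[OF t(1) vK] by simp
      have "\<exists>k. fn t' = k *\<^sub>R fn t" if t': "t' \<in> Rf" "fn t' \<bullet> a = 0" for t'
      proof (rule ccontr)
        assume "\<nexists>k. fn t' = k *\<^sub>R fn t"
        then have "(t, t') \<in> ?I" "a \<in> ?L (t, t')"
          using t(1) t' ta by auto
        then show False
          using a unfolding Q_def by blast
      qed
      then have "y \<in> ch (gmul t g)" if g: "g \<in> \<Gamma>" "x \<in> ch g" for g
        using small_opposite_chamber[OF \<rho> x(1) y(1) x(2) t(1) neg _ g] by blast
      then show ?thesis
        unfolding R_def using Rf_\<Gamma>[OF t(1)] tv by blast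
    qed
    then show "\<exists>T. openin (top_of_set Q) T \<and> a \<in> T \<and> (\<forall>x\<in>T. \<forall>y\<in>T. gen x \<and> gen y \<longrightarrow> R x y)"
      using a small_pos[OF \<rho>] by (intro exI[of _ "Q \<inter> ball a \<rho>"]) (auto simp: openin_open_Int)
  qed
  then obtain k where k: "k \<in> \<Gamma>" "k (\<pi> v) = \<pi> v" "\<forall>g\<in>\<Gamma>. u \<in> ch g \<longrightarrow> w \<in> ch (gmul k g)"
    unfolding R_def by blast
  have "u \<in> ch g" "w \<in> ch h"
    using u(2) w(2) interior_subset[of "ch g"] interior_subset[of "ch h"] by auto
  then have "gmul k g = h"
    using gen_unique[OF gw \<Gamma>_mul[OF k(1) gh(1)] gh(2)] k(3) gh(1) by blast
  then show ?thesis
    using that k by blast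
qed

text \<open>
  The element that \<open>chambers_at_point\<close> provides for \<open>g\<close> and \<open>k g\<close> is \<open>k\<close>, by cancellation.
\<close>

lemma chamber_transition_fixes:
  assumes dim: "2 \<le> DIM('v)" and gk: "g \<in> \<Gamma>" "k \<in> \<Gamma>" and v: "v \<in> ch g" "v \<in> ch (gmul k g)"
  shows "k (\<pi> v) = \<pi> v"
proof -
  obtain l where l: "l \<in> \<Gamma>" "l (\<pi> v) = \<pi> v" "gmul l g = gmul k g"
    using chambers_at_point[OF dim gk(1) \<Gamma>_mul[OF gk(2,1)] v] .
  have "l = gmul (gmul l g) (ginv g)"
    using gmul_inv_right[OF gk(1) l(1)] by simp
  also have "\<dots> = k"
    unfolding l(3) using gmul_inv_right[OF gk(1) gk(2)] .
  finally show ?thesis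
    using l(2) by simp
qed

subsection \<open>Mirrors and chambers\<close>

text \<open>
  In projective space a hyperplane has many reflections, but \<open>\<Gamma>\<close> contains at most one of them: near a
  generic point of the mirror there are just two chambers, and both reflections exchange them.
\<close>

lemma fn_proportional_eq:
  assumes t: "t \<in> Rf" and t': "t' \<in> Rf" and p: "fn t' = k *\<^sub>R fn t"
  shows "t' = t"
proof -
  let ?U = "{v. fn t \<bullet> v = 0}"
  let ?N = "(\<lambda>r. {v. fn r \<bullet> v = 0}) ` {r \<in> Rf. \<nexists>k. fn r = k *\<^sub>R fn t}"
  have k: "k \<noteq> 0"
    using p fn_nonzero[OF t'] by auto
  have N: "subspace N \<and> \<not> ?U \<subseteq> N" if "N \<in> ?N" for N
  proof -
    from that obtain r where r: "N = {v. fn r \<bullet> v = 0}" "r \<in> {r \<in> Rf. \<nexists>k. fn r = k *\<^sub>R fn t}"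
      by (rule imageE)
    have "\<not> ?U \<subseteq> N"
    proof
      assume "?U \<subseteq> N"
      then have "fn r \<bullet> v = 0" if "fn t \<bullet> v = 0" for v
        using that r(1) by blast
      then obtain k where "fn r = k *\<^sub>R fn t"
        using fn_proportional[OF t] by metis
      then show False
        using r(2) by blast
    qed
    then show ?thesis
      using r(1) subspace_hyperplane[of "fn r"] by simp
  qed
  obtain e0 where "e0 \<in> K" "fn t \<bullet> e0 = 0"
    using mir_point[OF t] .
  then have "K \<inter> ?U \<noteq> {}"
    by blast
  moreover have "countable {r \<in> Rf. \<nexists>k. fn r = k *\<^sub>R fn t}"
    by (rule countable_subset[OF _ countable_Rf]) auto
  then have "countable ?N"
    by simp
  ultimately obtain e where e: "e \<in> K" "e \<in> ?U" "\<forall>N\<in>?N. e \<notin> N"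
    using subspace_generic_point[OF subspace_hyperplane[of "fn t"] open_K _ _ N] by blast
  have only: "\<exists>k. fn r = k *\<^sub>R fn t" if r: "r \<in> Rf" "fn r \<bullet> e = 0" for r
  proof (rule ccontr)
    assume "\<nexists>k. fn r = k *\<^sub>R fn t"
    then have "e \<notin> {v. fn r \<bullet> v = 0}"
      using r(1) e(3) by blast
    then show False
      using r(2) by simp
  qed
  obtain \<rho> where \<rho>: "small e \<rho>"
    using mirrors_locally_finite[OF e(1)] by metis
  have "ball e \<rho> \<noteq> {}" "ball e \<rho> \<subseteq> K"
    using small_pos[OF \<rho>] small_K[OF \<rho>] by auto
  then obtain u where u: "u \<in> ball e \<rho>" "gen u"
    using generic_point[OF open_ball] by metis
  obtain g where g: "g \<in> \<Gamma>" "u \<in> ch g"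
    using ch_cover[OF small_K[OF \<rho> u(1)]] by blast
  have tu: "fn t \<bullet> u \<noteq> 0"
    using u(2) t unfolding gen_def by blast
  \<comment> \<open>the point opposite to \<open>u\<close>\<close>
  define w where "w = e - (u - e)"
  have "dist e w = dist e u"
    by (simp add: w_def dist_norm norm_minus_commute)
  then have w: "w \<in> ball e \<rho>"
    using u(1) by simp
  have tw: "fn t \<bullet> w = - (fn t \<bullet> u)"
    using e(2) by (simp add: w_def inner_diff_right)
  have sq: "(fn t \<bullet> u) * (fn t \<bullet> u) > 0"
    using tu by (metis not_real_square_gt_zero)
  have "fn r \<bullet> w \<noteq> 0" if r: "r \<in> Rf" for r
  proof
    assume 0: "fn r \<bullet> w = 0"
    then obtain l where "fn r = l *\<^sub>R fn t"
      using only[OF r small_fn[OF \<rho> w r 0]] by blast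
    then show False
      using 0 tw tu fn_nonzero[OF r] by auto
  qed
  then have gw: "gen w"
    unfolding gen_def using small_K[OF \<rho> w] by blast
  have "w \<in> ch (gmul t g)"
    by (rule small_opposite_chamber[OF \<rho> u(1) w u(2) t _ only g]) (use tw sq in auto)
  moreover have "w \<in> ch (gmul t' g)"
  proof (rule small_opposite_chamber[OF \<rho> u(1) w u(2) t' _ _ g])
    have "(fn t' \<bullet> u) * (fn t' \<bullet> w) = - ((k * k) * ((fn t \<bullet> u) * (fn t \<bullet> u)))"
      by (simp add: p tw)
    moreover have "(k * k) * ((fn t \<bullet> u) * (fn t \<bullet> u)) > 0"
      using k sq by (metis mult_pos_pos not_real_square_gt_zero)
    ultimately show "(fn t' \<bullet> u) * (fn t' \<bullet> w) < 0"
      by linarith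
    fix r assume "r \<in> Rf" "fn r \<bullet> e = 0"
    then obtain l where "fn r = l *\<^sub>R fn t"
      using only by blast
    then have "fn r = (l / k) *\<^sub>R fn t'"
      using k by (simp add: p)
    then show "\<exists>k. fn r = k *\<^sub>R fn t'"
      by blast
  qed
  ultimately have eq: "gmul t' g = gmul t g"
    using gen_unique[OF gw] \<Gamma>_mul Rf_\<Gamma> t t' g(1) by blast
  have "t' = gmul (gmul t' g) (ginv g)"
    using gmul_inv_right[OF g(1) Rf_\<Gamma>[OF t']] by simp
  also have "\<dots> = t"
    unfolding eq using gmul_inv_right[OF g(1) Rf_\<Gamma>[OF t]] .
  finally show ?thesis .
qed

lemma mir_subset_eq:
  assumes t: "t \<in> Rf" "t' \<in> Rf" and m: "mir t \<subseteq> mir t'"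
  shows "t' = t"
proof -
  have "fn t' \<bullet> v = 0" if "v \<in> K" "fn t \<bullet> v = 0" for v
    using mir_fn[OF t(1) that(1)] mir_fn[OF t(2) that(1)] that m by blast
  then obtain k where "fn t' = k *\<^sub>R fn t"
    using fn_proportional[OF t(1), of "fn t'"] by blast
  then show ?thesis
    by (rule fn_proportional_eq[OF t])
qed

lemma mirrors_eq: "mirrors S \<Gamma> = mir ` Rf"
  unfolding mirrors_def using reflection_Rf by (auto simp: Rf_def)

text \<open>
  If a mirror had points of a chamber on both sides, then it would cross a segment between interior
  points. The crossing is an interior point, which is impossible. On a sphere the segment may pass
  through \<open>0\<close> and leave \<open>K\<close>; then \<open>0\<close> is interior to the convex set \<open>C\<close> that cuts out the chamber, and
  a small multiple of any vector over the mirror is interior to the chamber.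
\<close>

lemma chamber_side:
  assumes g: "g \<in> \<Gamma>" and uv: "u \<in> ch g" "v \<in> ch g" and t: "t \<in> Rf"
  shows "(fn t \<bullet> u) * (fn t \<bullet> v) \<ge> 0"
proof (rule ccontr)
  assume "\<not> ?thesis"
  then have neg: "(fn t \<bullet> u) * (fn t \<bullet> v) < 0"
    by simp
  obtain C where C: "closed C" "convex C" "ch g = K \<inter> C"
    using ch_cone[OF g] .
  have int: "interior (ch g) = K \<inter> interior C"
    unfolding C(3) using open_K by (simp add: interior_open)
  define c where "c = fn t \<bullet> u"
  have o: "open {x. c * (fn t \<bullet> x) > 0}" "open {x. c * (fn t \<bullet> x) < 0}"
    using open_halfspace_gt[of 0 "c *\<^sub>R fn t"] open_halfspace_lt[of "c *\<^sub>R fn t" 0] by simp_all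
  have "c \<noteq> 0"
    using neg by (auto simp: c_def)
  then have "c * c > 0"
    by (metis not_real_square_gt_zero)
  then have "u \<in> {x. c * (fn t \<bullet> x) > 0}" "v \<in> {x. c * (fn t \<bullet> x) < 0}"
    using neg by (auto simp: c_def)
  then obtain u' v' where u': "c * (fn t \<bullet> u') > 0" "u' \<in> interior (ch g)"
    and v': "c * (fn t \<bullet> v') < 0" "v' \<in> interior (ch g)"
    using ch_interior_dense[OF g uv(1) o(1)] ch_interior_dense[OF g uv(2) o(2)] by (metis mem_Collect_eq)
  have "(c * (fn t \<bullet> u')) * (c * (fn t \<bullet> v')) < 0"
    using u'(1) v'(1) by (rule mult_pos_neg)
  then have "(c * c) * ((fn t \<bullet> u') * (fn t \<bullet> v')) < 0"
    by (simp add: mult_ac)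
  then have "(fn t \<bullet> u') * (fn t \<bullet> v') \<le> 0"
    using \<open>c * c > 0\<close> by (auto simp: mult_less_0_iff mult_le_0_iff)
  then obtain x where x: "x \<in> closed_segment u' v'" "fn t \<bullet> x = 0"
    using segment_zero by metis
  have "closed_segment u' v' \<subseteq> interior C"
    using u'(2) v'(2) int C(2) by (intro closed_segment_subset convex_interior) auto
  then have xC: "x \<in> interior C"
    using x(1) by blast
  show False
  proof (cases "0 \<in> closed_segment u' v'")
    case False
    then have "x \<in> K"
      using segment_K[of u' v'] u'(2) v'(2) int x(1) by blast
    then show False
      using mirror_avoids_interior[OF g _ t, of x] xC x(2) int by blast
  next
    case True
    then have "0 \<in> interior C"
      using \<open>closed_segment u' v' \<subseteq> interior C\<close> by blast
    obtain e where e: "e \<in> K" "fn t \<bullet> e = 0"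
      using mir_point[OF t] .
    obtain d where d: "d > 0" "\<And>s. \<bar>s\<bar> \<le> d \<Longrightarrow> 0 + s *\<^sub>R e \<in> interior C"
      using small_shift[OF open_interior \<open>0 \<in> interior C\<close>] by blast
    have "d *\<^sub>R e \<in> interior (ch g)"
      using d(2)[of d] d(1) scale_K[OF e(1) d(1)] int by simp
    then show False
      using mirror_avoids_interior[OF g _ t, of "d *\<^sub>R e"] e(2) by simp
  qed
qed

lemma chamber_closed_ray:
  assumes g: "g \<in> \<Gamma>" and v: "v \<in> K"
    and d: "\<And>d. \<lbrakk>0 < d; d \<le> 1\<rbrakk> \<Longrightarrow> v + d *\<^sub>R (u - v) \<in> ch g"
  shows "v \<in> ch g"
proof (rule ccontr)
  assume n: "v \<notin> ch g"
  obtain C where C: "closed C" "convex C" "ch g = K \<inter> C"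
    using ch_cone[OF g] .
  have "open (- C)" "v \<in> - C"
    using C n v by auto
  then obtain e where e: "e > 0" "\<And>s. \<bar>s\<bar> \<le> e \<Longrightarrow> v + s *\<^sub>R (u - v) \<in> - C"
    using small_shift by metis
  have "v + min e 1 *\<^sub>R (u - v) \<in> - C" "v + min e 1 *\<^sub>R (u - v) \<in> ch g"
    using e(1) by (intro e(2) d; simp)+
  then show False
    using C(3) by blast
qed

end

section \<open>The tiling of a mirror by facets\<close>

locale mirror_model = coxeter_model S \<phi> \<pi> K \<Gamma> D
  for S :: "'a::euclidean_space geometry" and \<phi> :: "'a \<Rightarrow> 'v::euclidean_space"
    and \<pi> :: "'v \<Rightarrow> 'a" and K :: "'v set" and \<Gamma> :: "('a \<Rightarrow> 'a) set" and D :: "'a set" +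
  fixes s :: "'a \<Rightarrow> 'a"
  assumes s_Rf: "s \<in> Rf"
begin

abbreviation X :: "'a set"
  where "X \<equiv> mir s"

abbreviation X' :: "'v set"
  where "X' \<equiv> {v. fn s \<bullet> v = 0}"

lemma X_fn: "v \<in> K \<Longrightarrow> \<pi> v \<in> X \<longleftrightarrow> v \<in> X'"
  using mir_fn[OF s_Rf] by simp

lemma X_P: "X \<subseteq> P"
  by (auto simp: mir_def)

lemma dim_X': "dim X' + 1 = DIM('v)"
  using dim_hyperplane[OF fn_nonzero[OF s_Rf]] by simp

lemma dim_X'_pos: "1 \<le> dim X'"
proof -
  obtain e where "e \<in> K" "fn s \<bullet> e = 0"
    using mir_point[OF s_Rf] .
  then have "\<not> X' \<subseteq> {0}"
    using K_nonzero by auto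
  then have "dim X' \<noteq> 0"
    using dim_eq_0[of X'] by blast
  then show ?thesis by linarith
qed

lemma dim_ge_2: "2 \<le> DIM('v)"
  using dim_X' dim_X'_pos by simp

text \<open>
  The points of the mirror that lie on no other mirror. They are the relative interior points of its
  facets.
\<close>

definition genX :: "'v \<Rightarrow> bool"
  where "genX v \<longleftrightarrow> v \<in> K \<and> v \<in> X' \<and> (\<forall>t\<in>Rf. t \<noteq> s \<longrightarrow> fn t \<bullet> v \<noteq> 0)"

lemma genX_K: "genX v \<Longrightarrow> v \<in> K"
  and genX_X: "genX v \<Longrightarrow> fn s \<bullet> v = 0"
  and genX_fn: "\<lbrakk>genX v; t \<in> Rf; t \<noteq> s\<rbrakk> \<Longrightarrow> fn t \<bullet> v \<noteq> 0"
  by (auto simp: genX_def)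

text \<open>
  Near \<open>e\<close> the only mirror is \<open>X\<close>, so the chamber contains the part of the ball on one side of \<open>X\<close>, and
  therefore the part of \<open>X\<close> in the ball.
\<close>

lemma genX_neighbourhood:
  assumes e: "genX e" and r: "small e r" and g: "g \<in> \<Gamma>" "e \<in> ch g"
    and v: "v \<in> ball e r" "v \<in> X'"
  shows "v \<in> ch g"
proof -
  have "e \<in> ball e r"
    using small_pos[OF r] by simp
  then obtain u where u: "u \<in> ball e r" "u \<in> interior (ch g)"
    using ch_interior_dense[OF g open_ball] by blast
  have su: "fn s \<bullet> u \<noteq> 0"
    using mirror_avoids_interior[OF g(1) u(2) s_Rf] .
  have ug: "u \<in> ch g"
    using u(2) interior_subset[of "ch g"] by blast
  show ?thesis
  proof (rule chamber_closed_ray[OF g(1) small_K[OF r v(1)], of u])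
    fix d :: real assume d: "0 < d" "d \<le> 1"
    have "v + d *\<^sub>R (u - v) = (1 - d) *\<^sub>R v + d *\<^sub>R u"
      by (simp add: algebra_simps)
    then have vb: "v + d *\<^sub>R (u - v) \<in> ball e r"
      using convexD[OF convex_ball v(1) u(1), of "1 - d" d] d by simp
    show "v + d *\<^sub>R (u - v) \<in> ch g"
    proof (rule small_same_chamber[OF r u(1) vb _ g(1) ug])
      fix t assume t: "t \<in> Rf" "fn t \<bullet> e = 0"
      have "t = s"
        using genX_fn[OF e t(1)] t(2) by blast
      have "(fn s \<bullet> u) * (fn s \<bullet> (v + d *\<^sub>R (u - v))) = d * ((fn s \<bullet> u) * (fn s \<bullet> u))"
        using v(2) by (simp add: inner_add_right inner_diff_right)
      moreover have "(fn s \<bullet> u) * (fn s \<bullet> u) > 0"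
        using su by (metis not_real_square_gt_zero)
      ultimately show "(fn t \<bullet> u) * (fn t \<bullet> (v + d *\<^sub>R (u - v))) > 0"
        by (simp only: \<open>t = s\<close> mult_pos_pos d(1))
    qed
  qed
qed

lemma genX_segment:
  assumes g: "g \<in> \<Gamma>" "u \<in> ch g" and seg: "\<And>x. x \<in> closed_segment u v \<Longrightarrow> genX x"
  shows "v \<in> ch g"
proof (rule ccontr)
  assume nv: "v \<notin> ch g"
  obtain C where C: "closed C" "convex C" "ch g = K \<inter> C"
    using ch_cone[OF g(1)] .
  let ?B = "{B. \<exists>x r. x \<in> closed_segment u v \<and> x \<in> ch g \<and> small x r \<and> B = ball x r}"
  have oU: "open (\<Union>?B)"
    by (intro open_Union) auto
  have mem: "x \<in> \<Union>?B" if x: "x \<in> closed_segment u v" "x \<in> ch g" for x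
  proof -
    obtain r where r: "small x r"
      using mirrors_locally_finite[OF genX_K[OF seg[OF x(1)]]] by metis
    then have "ball x r \<in> ?B" "x \<in> ball x r"
      using x small_pos[OF r] by auto
    then show ?thesis by blast
  qed
  have dis: "\<Union>?B \<inter> - C \<inter> closed_segment u v = {}"
  proof (rule ccontr)
    assume "\<Union>?B \<inter> - C \<inter> closed_segment u v \<noteq> {}"
    then obtain y x r where y: "y \<in> closed_segment u v" "y \<notin> C" "y \<in> ball x r"
      and x: "x \<in> closed_segment u v" "x \<in> ch g" "small x r"
      by blast
    have "y \<in> X'"
      using genX_X[OF seg[OF y(1)]] by simp
    then have "y \<in> ch g"
      using genX_neighbourhood[OF seg[OF x(1)] x(3) g(1) x(2) y(3)] by blast
    then show False
      using y(2) C(3) by blast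
  qed
  have cov: "closed_segment u v \<subseteq> \<Union>?B \<union> - C"
  proof
    fix x assume x: "x \<in> closed_segment u v"
    show "x \<in> \<Union>?B \<union> - C"
    proof (cases "x \<in> ch g")
      case True
      then show ?thesis using mem[OF x] by blast
    next
      case False
      then show ?thesis using C(3) genX_K[OF seg[OF x]] by blast
    qed
  qed
  have "open (- C)"
    using C(1) by (rule open_Compl)
  then have "\<Union>?B \<inter> closed_segment u v = {} \<or> - C \<inter> closed_segment u v = {}"
    using connectedD[OF connected_segment(1)[of u v] oU _ dis cov] by simp
  moreover have "u \<in> \<Union>?B \<inter> closed_segment u v"
    using mem[of u] g(2) by simp
  moreover have "v \<in> - C \<inter> closed_segment u v"
    using nv C(3) genX_K[OF seg[of v]] by simp
  ultimately show False
    by blast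
qed

lemma genX_same_chamber:
  assumes g: "g \<in> \<Gamma>" "u \<in> ch g" and uv: "u \<in> X'" "v \<in> X'" and K: "closed_segment u v \<subseteq> K"
    and sg: "\<And>t. \<lbrakk>t \<in> Rf; t \<noteq> s\<rbrakk> \<Longrightarrow> (fn t \<bullet> u) * (fn t \<bullet> v) > 0"
  shows "v \<in> ch g"
proof (rule genX_segment[OF g])
  fix x assume x: "x \<in> closed_segment u v"
  have "closed_segment u v \<subseteq> X'"
    using uv subspace_imp_convex[OF subspace_hyperplane[of "fn s"]] by (intro closed_segment_subset)
  moreover have "fn t \<bullet> x \<noteq> 0" if "t \<in> Rf" "t \<noteq> s" for t
    using segment_positive[OF sg[OF that] x] by auto
  ultimately show "genX x"
    using x K unfolding genX_def by blast
qed

lemma stabiliser_scales_fn: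
  assumes h: "h \<in> \<Gamma>" "h ` X = X" and A: "rep h A"
  obtains k where "k \<noteq> 0" "\<And>v. fn s \<bullet> A v = k * (fn s \<bullet> v)"
proof -
  have "cj h s = s"
    using mir_subset_eq[OF s_Rf cj_Rf(1)[OF h(1) s_Rf]] cj_Rf(2)[OF h(1) s_Rf] h(2) by simp
  then show ?thesis
    using cj_fn[OF h(1) s_Rf A] that by metis
qed

lemma stabiliser_genX:
  assumes h: "h \<in> \<Gamma>" "h ` X = X" and A: "rep h A" and v: "genX v"
  shows "genX (A v)"
proof -
  obtain k where k: "\<And>v. fn s \<bullet> A v = k * (fn s \<bullet> v)"
    using stabiliser_scales_fn[OF h A] by metis
  have "fn t \<bullet> A v \<noteq> 0" if t: "t \<in> Rf" "t \<noteq> s" for t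
  proof -
    define r where "r = cj (ginv h) t"
    have r: "r \<in> Rf"
      using cj_Rf(1)[OF \<Gamma>_inv[OF h(1)] t(1)] by (simp add: r_def)
    have cr: "cj h r = t"
      using h(1) Rf_\<Gamma>[OF t(1)]
      by (intro \<Gamma>_ext) (auto simp: r_def cj_def \<Gamma>_mul \<Gamma>_inv gmul_apply \<Gamma>_points ginv_r ginv_l)
    have "r \<noteq> s"
    proof
      assume "r = s"
      then have "mir t = X"
        using cj_Rf(2)[OF h(1) s_Rf] cr h(2) by simp
      then show False
        using mir_subset_eq[OF s_Rf t(1)] t(2) by simp
    qed
    obtain l where "l \<noteq> 0" "\<And>v. fn t \<bullet> A v = l * (fn r \<bullet> v)"
      using cj_fn[OF h(1) r A] cr by metis
    then show ?thesis
      using genX_fn[OF v r \<open>r \<noteq> s\<close>] by simp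
  qed
  then show ?thesis
    unfolding genX_def using rep_K[OF A genX_K[OF v]] k genX_X[OF v] by simp
qed

text \<open>
  The chambers of \<open>g\<close> and \<open>h g\<close> both contain \<open>A x\<close>, which lies on no mirror but \<open>X\<close>, and because of
  \<open>k > 0\<close> they lie on the same side of \<open>X\<close>. So they coincide.
\<close>

lemma rigid:
  assumes h: "h \<in> \<Gamma>" and A: "rep h A" and k: "k > 0" "\<And>v. fn s \<bullet> A v = k * (fn s \<bullet> v)"
    and x: "genX x" "genX (A x)" and K: "closed_segment x (A x) \<subseteq> K"
    and sg: "\<And>t. \<lbrakk>t \<in> Rf; t \<noteq> s\<rbrakk> \<Longrightarrow> (fn t \<bullet> x) * (fn t \<bullet> A x) > 0"
  shows "h = gone"
proof -
  obtain g where g: "g \<in> \<Gamma>" "x \<in> ch g"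
    using ch_cover[OF genX_K[OF x(1)]] by blast
  note hg = \<Gamma>_mul[OF h g(1)]
  have 1: "A x \<in> ch g"
    using genX_same_chamber[OF g _ _ K sg] genX_X[OF x(1)] genX_X[OF x(2)] by simp
  have 2: "A x \<in> ch (gmul h g)"
    using ch_rep[OF g(1) h A genX_K[OF x(1)]] g(2) by blast
  obtain r where r: "small (A x) r"
    using mirrors_locally_finite[OF genX_K[OF x(2)]] by metis
  have "A x \<in> ball (A x) r"
    using small_pos[OF r] by simp
  then obtain u w where u: "u \<in> ball (A x) r" "u \<in> interior (ch g)"
    and w: "w \<in> ball (A x) r" "w \<in> interior (ch (gmul h g))"
    using ch_interior_dense[OF g(1) 1 open_ball] ch_interior_dense[OF hg 2 open_ball] by metis
  have ug: "u \<in> ch g" and wg: "w \<in> ch (gmul h g)"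
    using u(2) w(2) interior_subset[of "ch g"] interior_subset[of "ch (gmul h g)"] by auto
  have Au: "A u \<in> ch (gmul h g)"
    using ch_rep[OF g(1) h A ch_K[OF ug]] ug by blast
  have su: "fn s \<bullet> u \<noteq> 0" and sw: "fn s \<bullet> w \<noteq> 0"
    using mirror_avoids_interior[OF g(1) u(2) s_Rf] mirror_avoids_interior[OF hg w(2) s_Rf] .
  have "(fn s \<bullet> A u) * (fn s \<bullet> w) \<ge> 0"
    using chamber_side[OF hg Au wg s_Rf] .
  then have "k * ((fn s \<bullet> u) * (fn s \<bullet> w)) \<ge> 0"
    by (simp add: k(2))
  then have "(fn s \<bullet> u) * (fn s \<bullet> w) \<ge> 0"
    using k(1) by (simp add: zero_le_mult_iff)
  then have pos: "(fn s \<bullet> u) * (fn s \<bullet> w) > 0"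
    using su sw by (simp add: less_le)
  have "w \<in> ch g"
  proof (rule small_same_chamber[OF r u(1) w(1) _ g(1) ug])
    fix t assume "t \<in> Rf" "fn t \<bullet> A x = 0"
    then have "t = s"
      using genX_fn[OF x(2)] by blast
    then show "(fn t \<bullet> u) * (fn t \<bullet> w) > 0"
      using pos by simp
  qed
  then have eq: "gmul h g = g"
    using gen_unique[OF interior_gen[OF hg w(2)] hg g(1) wg] by blast
  have "h = gmul (gmul h g) (ginv g)"
    using gmul_inv_right[OF g(1) h] by simp
  also have "\<dots> = gone"
    unfolding eq using g(1) by (intro \<Gamma>_ext) (auto simp: \<Gamma>_mul \<Gamma>_inv \<Gamma>_one gmul_apply ginv_r gone_apply)
  finally show ?thesis .
qed

subsection \<open>Facets\<close>

lemma face_image: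
  assumes g: "g \<in> \<Gamma>" and C: "C \<subseteq> P" and f: "is_face S \<Gamma> C T"
  shows "is_face S \<Gamma> (g ` C) (g ` T)"
proof -
  obtain \<Y> where Y: "\<Y> \<noteq> {}" "\<Y> \<subseteq> mir ` Rf" "T = C \<inter> \<Inter>\<Y>" "T \<noteq> {}"
    using f unfolding is_face_def mirrors_eq by blast
  have "(\<lambda>Y. g ` Y) ` \<Y> \<subseteq> mir ` Rf"
  proof
    fix Z assume "Z \<in> (\<lambda>Y. g ` Y) ` \<Y>"
    then obtain t where "t \<in> Rf" "Z = g ` mir t"
      using Y(2) by blast
    then show "Z \<in> mir ` Rf"
      using cj_Rf[OF g] by blast
  qed
  moreover have "g ` T = g ` C \<inter> \<Inter>((\<lambda>Y. g ` Y) ` \<Y>)"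
  proof
    show "g ` T \<subseteq> g ` C \<inter> \<Inter>((\<lambda>Y. g ` Y) ` \<Y>)"
      using Y(3) by blast
    show "g ` C \<inter> \<Inter>((\<lambda>Y. g ` Y) ` \<Y>) \<subseteq> g ` T"
    proof
      fix y assume y: "y \<in> g ` C \<inter> \<Inter>((\<lambda>Y. g ` Y) ` \<Y>)"
      then obtain x where x: "x \<in> C" "y = g x"
        by blast
      have "x \<in> Z" if Z: "Z \<in> \<Y>" for Z
      proof -
        have "Z \<subseteq> P"
          using Z Y(2) by (auto simp: mir_def)
        have "y \<in> g ` Z"
          using y Z by simp
        then obtain z where z: "z \<in> Z" "g x = g z"
          using x(2) by auto
        then have "x = z"
          using \<Gamma>_inj[OF g _ _ z(2)] x(1) C \<open>Z \<subseteq> P\<close> by auto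
        then show ?thesis
          using z(1) by simp
      qed
      then show "y \<in> g ` T"
        using Y(3) x by auto
    qed
  qed
  ultimately show ?thesis
    unfolding is_face_def mirrors_eq using Y(1,4)
    by (intro conjI exI[of _ "(\<lambda>Y. g ` Y) ` \<Y>"]) auto
qed

lemma dimension_image:
  assumes g: "g \<in> \<Gamma>" and T: "T \<subseteq> P"
  shows "dimension_in S (g ` T) = dimension_in S T"
proof -
  obtain A where A: "rep g A"
    using \<Gamma>_rep[OF g] by blast
  obtain B where B: "rep (ginv g) B" "\<And>v. B (A v) = v" "\<And>v. A (B v) = v"
    using rep_inverse[OF \<Gamma>_isometries[OF g] A] by metis
  have "hat (g ` T) = A ` hat T"
  proof (intro equalityI subsetI)
    fix v assume "v \<in> hat (g ` T)"
    then have v: "v \<in> K" "\<pi> v \<in> g ` T"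
      by (auto simp: hat_def)
    have "\<pi> (B v) \<in> T"
      using rep_\<pi>[OF B(1) v(1)] v(2) ginv_l[OF g] T by auto
    then have "B v \<in> hat T"
      using rep_K[OF B(1) v(1)] by (simp add: hat_def)
    then show "v \<in> A ` hat T"
      using B(3)[of v] by (metis imageI)
  next
    fix v assume "v \<in> A ` hat T"
    then show "v \<in> hat (g ` T)"
      using rep_K[OF A] rep_\<pi>[OF A] by (auto simp: hat_def)
  qed
  moreover have "inj A"
    using B(2) by (metis injI)
  then have "dim (A ` hat T) = dim (hat T)"
    using dim_image_eq[OF rep_linear[OF A], of "hat T"] by (metis inj_on_subset subset_UNIV)
  moreover have "g ` T \<subseteq> P"
    using T \<Gamma>_points[OF g] by blast
  ultimately show ?thesis
    using dimension_hat[OF T] dimension_hat[of "g ` T"] by simp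
qed

lemma facet_image:
  assumes "g \<in> \<Gamma>" "C \<subseteq> P" "facet S \<Gamma> C T"
  shows "facet S \<Gamma> (g ` C) (g ` T)"
  using assms face_image[of g C T] dimension_image[of g T]
  unfolding facet_def is_face_def by auto

lemma ch_iff: "v \<in> K \<Longrightarrow> v \<in> ch g \<longleftrightarrow> \<pi> v \<in> g ` D"
  by (simp add: ch_def hat_def)

lemma chamber_P: "g \<in> \<Gamma> \<Longrightarrow> g ` D \<subseteq> P"
  using D_P \<Gamma>_points by blast

lemma facet_at_genX:
  assumes g: "g \<in> \<Gamma>" and v: "genX v" "v \<in> ch g"
  shows "facet S \<Gamma> (g ` D) (g ` D \<inter> X)"
proof -
  let ?H = "g ` D \<inter> X"
  have H: "?H \<subseteq> P"
    using X_P by blast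
  have vH: "\<pi> v \<in> ?H"
    using v genX_K[OF v(1)] genX_X[OF v(1)] ch_iff X_fn by simp
  have "is_face S \<Gamma> (g ` D) ?H"
    unfolding is_face_def mirrors_eq using vH s_Rf by (intro conjI exI[of _ "{X}"]) auto
  moreover have "dimension_in S ?H = dimension_in S P - 1"
  proof -
    obtain r where r: "small v r"
      using mirrors_locally_finite[OF genX_K[OF v(1)]] by metis
    have sub1: "X' \<inter> ball v r \<subseteq> hat ?H"
    proof
      fix u assume u: "u \<in> X' \<inter> ball v r"
      have "u \<in> ch g"
        using genX_neighbourhood[OF v(1) r g v(2)] u by blast
      then show "u \<in> hat ?H"
        using ch_K[of u g] ch_iff[of u g] X_fn[of u] u by (simp add: hat_def)
    qed
    have sub2: "hat ?H \<subseteq> X'"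
      using X_fn by (auto simp: hat_def)
    have "v \<in> X' \<inter> ball v r"
      using genX_X[OF v(1)] small_pos[OF r] by simp
    then have "dim (X' \<inter> ball v r) = dim X'"
      using dim_openin[OF openin_open_Int[OF open_ball] subspace_hyperplane[of "fn s"], of v r] by blast
    then have "dim (hat ?H) = dim X'"
      using dim_subset[OF sub1] dim_subset[OF sub2] by simp
    then show ?thesis
      using dimension_hat[OF H] dimension_points dim_X' by simp
  qed
  ultimately show ?thesis
    by (simp add: facet_def)
qed

text \<open>
  A facet spans the mirror, so it lies in no other mirror. A relative interior point \<open>p\<close> of the facet
  lies in no other mirror \<open>t\<close> either: the chamber is on one side of \<open>t\<close>, and prolonging segments of
  the facet beyond \<open>p\<close> shows that the whole facet would lie in \<open>t\<close>.
\<close>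

lemma facet_in_X:
  assumes g: "g \<in> \<Gamma>" and f: "facet S \<Gamma> (g ` D) H" and HX: "H \<subseteq> X"
  shows "H = g ` D \<inter> X" and "\<exists>v. genX v \<and> v \<in> ch g"
proof -
  obtain \<Y> where Y: "\<Y> \<noteq> {}" "\<Y> \<subseteq> mir ` Rf" "H = g ` D \<inter> \<Inter>\<Y>" "H \<noteq> {}"
    using f unfolding facet_def is_face_def mirrors_eq by blast
  have HP: "H \<subseteq> P"
    using HX X_P by blast
  have sub: "hat H \<subseteq> X'"
    using X_fn HX by (auto simp: hat_def)
  have "int (dim (hat H)) = int (dim X')"
    using f dimension_hat[OF HP] dimension_points dim_X' unfolding facet_def by simp
  then have "dim X' \<le> dim (span (hat H))"
    by simp
  moreover have "span (hat H) \<subseteq> X'"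
    using sub subspace_hyperplane by (rule span_minimal)
  ultimately have span: "span (hat H) = X'"
    using subspace_dim_equal[OF subspace_span subspace_hyperplane] by blast
  have vanish: "t = s" if t: "t \<in> Rf" "\<And>v. v \<in> hat H \<Longrightarrow> fn t \<bullet> v = 0" for t
  proof -
    have "span (hat H) \<subseteq> {v. fn t \<bullet> v = 0}"
      using t(2) by (intro span_minimal subspace_hyperplane) auto
    then have "fn t \<bullet> v = 0" if "fn s \<bullet> v = 0" for v
      using that span by blast
    then obtain k where "fn t = k *\<^sub>R fn s"
      using fn_proportional[OF s_Rf, of "fn t"] by blast
    then show ?thesis
      by (rule fn_proportional_eq[OF s_Rf t(1)])
  qed
  have "Y = X" if Y': "Y \<in> \<Y>" for Y
  proof -
    obtain t where t: "t \<in> Rf" "Y = mir t"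
      using Y' Y(2) by blast
    have "fn t \<bullet> v = 0" if "v \<in> hat H" for v
      using that Y(3) Y' mir_fn[OF t(1), of v] t(2) by (auto simp: hat_def)
    then show ?thesis
      using vanish[OF t(1)] t(2) by blast
  qed
  then have "\<Y> = {X}"
    using Y(1) by blast
  then show H: "H = g ` D \<inter> X"
    using Y(3) by simp
  obtain C where C: "closed C" "convex C" "ch g = K \<inter> C"
    using ch_cone[OF g] .
  let ?Q = "C \<inter> X'"
  have hatH: "hat H = K \<inter> ?Q"
  proof -
    have "v \<in> hat H \<longleftrightarrow> v \<in> K \<inter> ?Q" for v
      using ch_iff[of v g] X_fn[of v] C(3) unfolding H hat_def by blast
    then show ?thesis by blast
  qed
  have cQ: "convex ?Q"
    using C(2) subspace_imp_convex[OF subspace_hyperplane[of "fn s"]] by (rule convex_Int)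
  obtain x0 where x0: "x0 \<in> H"
    using Y(4) by blast
  define h0 where "h0 = \<phi> x0"
  have h0: "h0 \<in> K \<inter> ?Q"
    using x0 HP \<phi>_K[of x0] \<pi>_\<phi>[of x0] unfolding hatH[symmetric] by (auto simp: hat_def h0_def)
  then have "rel_interior ?Q \<noteq> {}"
    using rel_interior_eq_empty[OF cQ] by blast
  then obtain q where q: "q \<in> rel_interior ?Q"
    by blast
  obtain d where d: "d > 0" "\<And>t. \<bar>t\<bar> \<le> d \<Longrightarrow> h0 + t *\<^sub>R (q - h0) \<in> K"
    using small_shift[OF open_K] h0 by blast
  define e where "e = min d 1"
  have e: "0 < e" "e \<le> 1" "\<bar>e\<bar> \<le> d"
    using d(1) by (auto simp: e_def)
  define p where "p = h0 - e *\<^sub>R (h0 - q)"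
  have "p = h0 + e *\<^sub>R (q - h0)"
    by (simp add: p_def algebra_simps)
  then have pK: "p \<in> K"
    using d(2)[OF e(3)] by simp
  have pr: "p \<in> rel_interior ?Q"
    unfolding p_def using rel_interior_convex_shrink[OF cQ q _ e(1,2)] h0 by blast
  then have pQ: "p \<in> ?Q"
    using rel_interior_subset by blast
  obtain \<epsilon> where \<epsilon>: "\<epsilon> > 0" "ball p \<epsilon> \<inter> affine hull ?Q \<subseteq> ?Q"
    using pr unfolding mem_rel_interior_ball by blast
  have "fn t \<bullet> p \<noteq> 0" if t: "t \<in> Rf" "t \<noteq> s" for t
  proof
    assume tp: "fn t \<bullet> p = 0"
    have "fn t \<bullet> x = 0" if x: "x \<in> hat H" for x
    proof -
      have xQ: "x \<in> K" "x \<in> ?Q"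
        using x hatH by auto
      have "open (ball p \<epsilon> \<inter> K)" "p \<in> ball p \<epsilon> \<inter> K"
        using open_K pK \<epsilon>(1) by auto
      then obtain c where c: "c > 0" "\<And>t. \<bar>t\<bar> \<le> c \<Longrightarrow> p + t *\<^sub>R (p - x) \<in> ball p \<epsilon> \<inter> K"
        using small_shift by metis
      \<comment> \<open>The segment from \<open>x\<close> is prolonged beyond \<open>p\<close> within the facet.\<close>
      define y where "y = p + c *\<^sub>R (p - x)"
      have yb: "y \<in> ball p \<epsilon> \<inter> K"
        unfolding y_def using c by simp
      have "y = (1 + c) *\<^sub>R p + (- c) *\<^sub>R x"
        by (simp add: y_def algebra_simps)
      then have "y \<in> affine hull ?Q"
        using mem_affine[OF affine_affine_hull hull_inc[OF pQ] hull_inc[OF xQ(2)], of "1 + c" "- c"]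
        by simp
      then have "y \<in> ?Q"
        using \<epsilon>(2) yb by blast
      then have "y \<in> ch g" "x \<in> ch g"
        using yb xQ C(3) by auto
      then have "(fn t \<bullet> x) * (fn t \<bullet> y) \<ge> 0"
        using chamber_side[OF g _ _ t(1)] by blast
      moreover have "(fn t \<bullet> x) * (fn t \<bullet> y) = - (c * ((fn t \<bullet> x) * (fn t \<bullet> x)))"
        using tp by (simp add: y_def inner_add_right inner_diff_right)
      ultimately have "(fn t \<bullet> x) * (fn t \<bullet> x) \<le> 0"
        using c(1) by (simp add: mult_le_0_iff)
      then show ?thesis
        by (metis not_real_square_gt_zero not_less)
    qed
    then show False
      using vanish[OF t(1)] t(2) by blast
  qed
  then have "genX p"
    unfolding genX_def using pK pQ by blast
  moreover have "p \<in> ch g"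
    using pK pQ C(3) by blast
  ultimately show "\<exists>v. genX v \<and> v \<in> ch g"
    by blast
qed

section \<open>Orthogonal mirrors and labels\<close>

text \<open>The reflections in the mirrors orthogonal to \<open>X\<close>.\<close>

definition T :: "('a \<Rightarrow> 'a) set"
  where "T = {t \<in> Rf. t \<noteq> s \<and> t ` X = X}"

lemma T_Rf: "t \<in> T \<Longrightarrow> t \<in> Rf"
  and T_ne: "t \<in> T \<Longrightarrow> t \<noteq> s"
  and T_X: "t \<in> T \<Longrightarrow> t ` X = X"
  by (auto simp: T_def)

lemma fn_not_proportional: "\<lbrakk>t \<in> Rf; t \<noteq> s\<rbrakk> \<Longrightarrow> \<nexists>k. fn t = k *\<^sub>R fn s"
  using fn_proportional_eq[OF s_Rf] by blast

text \<open>
  The lift of \<open>t\<close> multiplies the functional of \<open>X\<close> by a factor, and this factor is \<open>1\<close> because the two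
  mirrors differ: there is a vector that \<open>t\<close> fixes and on which the functional of \<open>X\<close> does not vanish.
\<close>

lemma T_ax:
  assumes t: "t \<in> T"
  shows "fn s \<bullet> ax t = 0"
proof -
  note t' = T_Rf[OF t]
  obtain k where k: "\<And>v. fn s \<bullet> sk t v = k * (fn s \<bullet> v)"
    using stabiliser_scales_fn[OF Rf_\<Gamma>[OF t'] T_X[OF t] sk_rep[OF t']] by metis
  have "\<exists>v. fn t \<bullet> v = 0 \<and> fn s \<bullet> v \<noteq> 0"
  proof (rule ccontr)
    assume "\<not> ?thesis"
    then have "fn s \<bullet> v = 0" if "fn t \<bullet> v = 0" for v
      using that by blast
    then obtain c where "fn s = c *\<^sub>R fn t"
      using fn_proportional[OF t', of "fn s"] by blast
    then show False
      using fn_proportional_eq[OF t' s_Rf] T_ne[OF t] by blast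
  qed
  then obtain v where v: "fn t \<bullet> v = 0" "fn s \<bullet> v \<noteq> 0"
    by blast
  have "k = 1"
    using k[of v] v by (simp add: skew_reflection_wall)
  then have "fn s \<bullet> sk t (ax t) = fn s \<bullet> ax t"
    using k by simp
  then show ?thesis
    using fn_ax[OF t'] by (simp add: skew_reflection_def inner_diff_right)
qed

lemma T_side: "t \<in> T \<Longrightarrow> fn s \<bullet> sk t v = fn s \<bullet> v"
  by (simp add: skew_reflection_def inner_diff_right T_ax)

lemma stable_mirror_T:
  assumes r: "r \<in> Rf" "r \<noteq> s" and m: "s ` mir r = mir r"
  shows "r \<in> T"
proof -
  note s' = Rf_\<Gamma>[OF s_Rf] and r' = Rf_\<Gamma>[OF r(1)]
  have "cj s r = r"
    using mir_subset_eq[OF r(1) cj_Rf(1)[OF s' r(1)]] cj_Rf(2)[OF s' r(1)] m by simp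
  then have comm: "r (s x) = s (r x)" if "x \<in> P" for x
    using cj_apply[OF s' r' that] by simp
  have sub: "r x \<in> X" if "x \<in> X" for x
    using comm[of x] that \<Gamma>_points[OF r', of x] by (auto simp: mir_def)
  have "x \<in> r ` X" if x: "x \<in> X" for x
    using sub[OF x] Rf_involution(1)[OF r(1), of x] x X_P by (metis imageI subsetD)
  then show ?thesis
    unfolding T_def using r sub by blast
qed

lemma cj_involution:
  assumes t: "t \<in> Rf" and r: "r \<in> \<Gamma>"
  shows "cj t (cj t r) = r"
proof (rule \<Gamma>_ext[OF cj_\<Gamma>[OF Rf_\<Gamma>[OF t] cj_\<Gamma>[OF Rf_\<Gamma>[OF t] r]] r])
  fix x assume x: "x \<in> P"
  note t' = Rf_\<Gamma>[OF t]
  have tt: "t (t y) = y" if "y \<in> P" for y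
    using Rf_involution(1)[OF t that] .
  have tx: "t x \<in> P" and rx: "r x \<in> P"
    using \<Gamma>_points t' r x by auto
  have "cj t (cj t r) (t (t x)) = t (cj t r (t x))"
    by (rule cj_apply[OF t' cj_\<Gamma>[OF t' r] tx])
  also have "cj t r (t x) = t (r x)"
    by (rule cj_apply[OF t' r x])
  finally show "cj t (cj t r) x = r x"
    using tt[OF x] tt[OF rx] by simp
qed

definition RI :: "'a set \<Rightarrow> ('a \<Rightarrow> 'a) set"
  where "RI I = {t \<in> Rf. I \<subseteq> mir t}"

lemma mir_inj: "inj_on mir Rf"
  by (rule inj_onI) (use mir_subset_eq in blast)

lemma label_card: "label S \<Gamma> I = card (RI I)"
proof -
  have "{Y \<in> mirrors S \<Gamma>. I \<subseteq> Y} = mir ` RI I"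
    unfolding mirrors_eq RI_def by auto
  moreover have "inj_on mir (RI I)"
    by (rule inj_on_subset[OF mir_inj]) (auto simp: RI_def)
  ultimately show ?thesis
    unfolding label_def by (simp add: card_image)
qed

lemma finite_RI:
  assumes "x \<in> I" "x \<in> P"
  shows "finite (RI I)"
proof -
  have "finite {t \<in> Rf. fn t \<bullet> \<phi> x = 0}"
    using mirrors_locally_finite[OF \<phi>_K[OF assms(2)]] by metis
  moreover have "RI I \<subseteq> {t \<in> Rf. fn t \<bullet> \<phi> x = 0}"
    using assms mir_fn[OF _ \<phi>_K[OF assms(2)]] \<pi>_\<phi>[OF assms(2)] by (auto simp: RI_def)
  ultimately show ?thesis
    by (rule rev_finite_subset)
qed

lemma RI_cj:
  assumes t: "t \<in> RI I" and r: "r \<in> RI I"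
  shows "cj t r \<in> RI I"
proof -
  have t': "t \<in> Rf" "I \<subseteq> mir t" and r': "r \<in> Rf" "I \<subseteq> mir r"
    using t r by (auto simp: RI_def)
  have "x \<in> t ` mir r" if "x \<in> I" for x
  proof -
    have "t x = x" "x \<in> mir r"
      using that t'(2) r'(2) by (auto simp: mir_def)
    then show ?thesis by (metis imageI)
  qed
  then show ?thesis
    using cj_Rf[OF Rf_\<Gamma>[OF t'(1)] r'(1)] by (auto simp: RI_def)
qed

text \<open>
  Conjugation by \<open>t\<close> is an involution on the mirrors through \<open>I\<close>. Their functionals are combinations of
  those of \<open>s\<close> and \<open>t\<close>, on which \<open>t\<close> acts with the eigenvalues \<open>1\<close> and \<open>-1\<close>. So exactly two mirrors are
  fixed.
\<close>

lemma even_label_if_orthogonal: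
  assumes x: "x \<in> I" "x \<in> P" and IX: "I \<subseteq> X" and dim: "dim (hat I) + 2 = DIM('v)"
    and t: "t \<in> T" "I \<subseteq> mir t"
  shows "even (label S \<Gamma> I)"
proof -
  note t' = T_Rf[OF t(1)]
  have sI: "s \<in> RI I" and tI: "t \<in> RI I"
    using s_Rf t' IX t(2) by (auto simp: RI_def)
  have cs: "cj t s = s"
    using mir_subset_eq[OF s_Rf cj_Rf(1)[OF Rf_\<Gamma>[OF t'] s_Rf]]
      cj_Rf(2)[OF Rf_\<Gamma>[OF t'] s_Rf] T_X[OF t(1)] by simp
  have "t ` mir t = mir t"
    by (force simp: mir_def)
  then have ct: "cj t t = t"
    using mir_subset_eq[OF t' cj_Rf(1)[OF Rf_\<Gamma>[OF t'] t']] cj_Rf(2)[OF Rf_\<Gamma>[OF t'] t'] by simp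
  have "r = s \<or> r = t" if r: "r \<in> RI I" "cj t r = r" for r
  proof -
    have r': "r \<in> Rf" "I \<subseteq> mir r"
      using r(1) by (auto simp: RI_def)
    have "fn s \<bullet> v = 0 \<and> fn t \<bullet> v = 0 \<and> fn r \<bullet> v = 0" if v: "v \<in> hat I" for v
      using v mir_fn[OF s_Rf, of v] mir_fn[OF t', of v] mir_fn[OF r'(1), of v] IX t(2) r'(2)
      by (auto simp: hat_def)
    then obtain \<alpha> \<beta> where ab: "fn r = \<alpha> *\<^sub>R fn s + \<beta> *\<^sub>R fn t"
      using in_span_two_functionals_dim[OF fn_nonzero[OF s_Rf] fn_not_proportional[OF t' T_ne[OF t(1)]] dim]
      by metis
    obtain k where k: "\<And>v. fn r \<bullet> sk t v = k * (fn r \<bullet> v)"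
      using cj_fn[OF Rf_\<Gamma>[OF t'] r'(1) sk_rep[OF t']] r(2) by metis
    show ?thesis
    proof (cases "\<beta> = 0")
      case True
      then have "fn r = \<alpha> *\<^sub>R fn s"
        using ab by simp
      then have "r = s"
        by (rule fn_proportional_eq[OF s_Rf r'(1)])
      then show ?thesis by simp
    next
      case False
      have b: "fn r \<bullet> ax t = \<beta>"
        by (simp add: ab inner_add_left T_ax[OF t(1)] fn_ax[OF t'])
      have "fn r \<bullet> sk t (ax t) = - \<beta>"
        using b by (simp add: skew_reflection_def inner_diff_right fn_ax[OF t'])
      then have "k * \<beta> = (- 1) * \<beta>"
        using k[of "ax t"] b by simp
      then have "k = - 1"
        using False by (simp only: mult_cancel_right) simp
      have "fn r \<bullet> v = 0" if "fn t \<bullet> v = 0" for v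
        using k[of v] \<open>k = - 1\<close> that by (simp add: skew_reflection_wall)
      then obtain c where "fn r = c *\<^sub>R fn t"
        using fn_proportional[OF t', of "fn r"] by blast
      then show ?thesis
        using fn_proportional_eq[OF t' r'(1)] by blast
    qed
  qed
  then have "{r \<in> RI I. cj t r = r} = {s, t}"
    using sI tI cs ct by auto
  then have "card {r \<in> RI I. cj t r = r} = 2"
    using T_ne[OF t(1)] by simp
  moreover have "even (card (RI I)) \<longleftrightarrow> even (card {r \<in> RI I. cj t r = r})"
  proof (rule card_parity_fixed_points)
    show "finite (RI I)"
      using finite_RI[OF x] .
    show "cj t r \<in> RI I" if "r \<in> RI I" for r
      using RI_cj[OF tI that] .
    show "cj t (cj t r) = r" if "r \<in> RI I" for r
      using cj_involution[OF t' Rf_\<Gamma>[of r]] that by (auto simp: RI_def)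
  qed
  ultimately show ?thesis
    unfolding label_card by simp
qed

text \<open>
  Conjugation by \<open>s\<close> is an involution on the mirrors through \<open>I\<close> and fixes \<open>X\<close>. By parity it fixes
  another mirror, which is then orthogonal to \<open>X\<close>.
\<close>

lemma orthogonal_if_even_label:
  assumes x: "x \<in> I" "x \<in> P" and IX: "I \<subseteq> X" and ev: "even (label S \<Gamma> I)"
  obtains t where "t \<in> T" "I \<subseteq> mir t"
proof -
  have sI: "s \<in> RI I"
    using s_Rf IX by (auto simp: RI_def)
  have "s ` mir s = mir s"
    by (force simp: mir_def)
  then have cs: "cj s s = s"
    using mir_subset_eq[OF s_Rf cj_Rf(1)[OF Rf_\<Gamma>[OF s_Rf] s_Rf]]
      cj_Rf(2)[OF Rf_\<Gamma>[OF s_Rf] s_Rf] by simp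
  have "even (card (RI I)) \<longleftrightarrow> even (card {r \<in> RI I. cj s r = r})"
  proof (rule card_parity_fixed_points)
    show "finite (RI I)"
      using finite_RI[OF x] .
    show "cj s r \<in> RI I" if "r \<in> RI I" for r
      using RI_cj[OF sI that] .
    show "cj s (cj s r) = r" if "r \<in> RI I" for r
      using cj_involution[OF s_Rf Rf_\<Gamma>[of r]] that by (auto simp: RI_def)
  qed
  then have "even (card {r \<in> RI I. cj s r = r})"
    using ev unfolding label_card by simp
  then have "{r \<in> RI I. cj s r = r} \<noteq> {s}"
    by auto
  then obtain r where r: "r \<in> RI I" "cj s r = r" "r \<noteq> s"
    using sI cs by blast
  then have r': "r \<in> Rf" "I \<subseteq> mir r"
    by (auto simp: RI_def)
  have "s ` mir r = mir r"
    using cj_Rf(2)[OF Rf_\<Gamma>[OF s_Rf] r'(1)] r(2) by simp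
  then show ?thesis
    using that stable_mirror_T[OF r'(1) r(3)] r'(2) by blast
qed

section \<open>Edges of the facets of a mirror\<close>

text \<open>
  A point of \<open>X\<close> on at least one other mirror, such that all other mirrors through it have the same
  trace on \<open>X\<close>. These are the generic points of the hyperedges in \<open>X\<close>.
\<close>

definition edge :: "'v \<Rightarrow> ('a \<Rightarrow> 'a) \<Rightarrow> bool"
  where "edge e t \<longleftrightarrow> e \<in> K \<and> fn s \<bullet> e = 0 \<and> t \<in> Rf \<and> t \<noteq> s \<and> fn t \<bullet> e = 0 \<and>
    (\<forall>r\<in>Rf. r \<noteq> s \<and> fn r \<bullet> e = 0 \<longrightarrow>
      (\<exists>c. c \<noteq> 0 \<and> (\<forall>v. fn s \<bullet> v = 0 \<longrightarrow> fn r \<bullet> v = c * (fn t \<bullet> v))))"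

lemma edgeD:
  assumes "edge e t"
  shows "e \<in> K" "fn s \<bullet> e = 0" "t \<in> Rf" "t \<noteq> s" "fn t \<bullet> e = 0"
  using assms by (auto simp: edge_def)

lemma edge_trace:
  assumes "edge e t" "r \<in> Rf" "r \<noteq> s" "fn r \<bullet> e = 0"
  obtains c where "c \<noteq> 0" "\<forall>v. fn s \<bullet> v = 0 \<longrightarrow> fn r \<bullet> v = c * (fn t \<bullet> v)"
  using assms unfolding edge_def by blast

lemma edge_change:
  assumes e: "edge e t" and r: "r \<in> Rf" "r \<noteq> s" "fn r \<bullet> e = 0"
  shows "edge e r"
proof -
  obtain c where c: "c \<noteq> 0" "\<forall>v. fn s \<bullet> v = 0 \<longrightarrow> fn r \<bullet> v = c * (fn t \<bullet> v)"
    using edge_trace[OF e r] .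
  have "\<exists>d. d \<noteq> 0 \<and> (\<forall>v. fn s \<bullet> v = 0 \<longrightarrow> fn q \<bullet> v = d * (fn r \<bullet> v))"
    if q: "q \<in> Rf" "q \<noteq> s" "fn q \<bullet> e = 0" for q
  proof -
    obtain d where d: "d \<noteq> 0" "\<forall>v. fn s \<bullet> v = 0 \<longrightarrow> fn q \<bullet> v = d * (fn t \<bullet> v)"
      using edge_trace[OF e q] .
    show ?thesis
      using c d by (intro exI[of _ "d / c"]) simp
  qed
  then show ?thesis
    unfolding edge_def using edgeD[OF e] r by blast
qed

text \<open>
  The strata of codimension two in \<open>X\<close>: the intersections of two mirrors with different traces on \<open>X\<close>.
\<close>

definition thin :: "'v set set"
  where "thin = (\<lambda>(t, r). {v. fn s \<bullet> v = 0 \<and> fn t \<bullet> v = 0 \<and> fn r \<bullet> v = 0}) `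
    {(t, r) \<in> (Rf - {s}) \<times> (Rf - {s}).
      \<not> (\<exists>c. \<forall>v. fn s \<bullet> v = 0 \<longrightarrow> fn r \<bullet> v = c * (fn t \<bullet> v))}"

lemma generic_or_edge:
  assumes e: "e \<in> K" "e \<in> X'" "e \<notin> \<Union>thin"
  shows "genX e \<or> (\<exists>t. edge e t)"
proof (cases "genX e")
  case False
  then obtain t where t: "t \<in> Rf" "t \<noteq> s" "fn t \<bullet> e = 0"
    using e unfolding genX_def by blast
  have "\<exists>c. c \<noteq> 0 \<and> (\<forall>v. fn s \<bullet> v = 0 \<longrightarrow> fn r \<bullet> v = c * (fn t \<bullet> v))"
    if r: "r \<in> Rf" "r \<noteq> s" "fn r \<bullet> e = 0" for r
  proof -
    have "\<exists>c. \<forall>v. fn s \<bullet> v = 0 \<longrightarrow> fn r \<bullet> v = c * (fn t \<bullet> v)"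
    proof (rule ccontr)
      assume "\<nexists>c. \<forall>v. fn s \<bullet> v = 0 \<longrightarrow> fn r \<bullet> v = c * (fn t \<bullet> v)"
      then have "{v. fn s \<bullet> v = 0 \<and> fn t \<bullet> v = 0 \<and> fn r \<bullet> v = 0} \<in> thin"
        unfolding thin_def using t r by (intro image_eqI[of _ _ "(t, r)"]) auto
      then show False
        using e t r by blast
    qed
    then obtain c where c: "\<forall>v. fn s \<bullet> v = 0 \<longrightarrow> fn r \<bullet> v = c * (fn t \<bullet> v)"
      by blast
    have "c \<noteq> 0"
    proof
      assume "c = 0"
      then have "fn r \<bullet> v = 0" if "fn s \<bullet> v = 0" for v
        using c that by simp
      then obtain k where "fn r = k *\<^sub>R fn s"
        using fn_proportional[OF s_Rf, of "fn r"] by blast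
      then show False
        using fn_not_proportional[OF r(1,2)] by blast
    qed
    then show ?thesis
      using c by blast
  qed
  then have "edge e t"
    unfolding edge_def using e t by blast
  then show ?thesis by blast
qed simp

lemma thin_codim2:
  assumes "M \<in> thin"
  shows "subspace M \<and> M \<subseteq> X' \<and> dim M + 2 \<le> dim X'"
proof -
  obtain t r where t: "t \<in> Rf" "t \<noteq> s" and r: "r \<in> Rf" "r \<noteq> s"
    and n: "\<not> (\<exists>c. \<forall>v. fn s \<bullet> v = 0 \<longrightarrow> fn r \<bullet> v = c * (fn t \<bullet> v))"
    and M: "M = {v. fn s \<bullet> v = 0 \<and> fn t \<bullet> v = 0 \<and> fn r \<bullet> v = 0}"
    using assms unfolding thin_def by auto
  let ?N = "{v. fn s \<bullet> v = 0 \<and> fn t \<bullet> v = 0}"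
  have sM: "subspace M" and sN: "subspace ?N"
    unfolding M by (auto simp: subspace_def inner_add_right)
  have "dim ?N + 2 = DIM('v)"
    using dim_two_hyperplanes[OF fn_nonzero[OF s_Rf] fn_not_proportional[OF t]] .
  moreover have "dim M < dim ?N"
  proof (rule ccontr)
    assume "\<not> dim M < dim ?N"
    then have "M = ?N"
      using M by (intro subspace_dim_equal[OF sM sN]) auto
    then have "fn r \<bullet> v = 0" if "fn s \<bullet> v = 0" "fn t \<bullet> v = 0" for v
      using that M by blast
    then obtain \<alpha> \<beta> where "fn r = \<alpha> *\<^sub>R fn s + \<beta> *\<^sub>R fn t"
      using in_span_two_functionals by metis
    then have "fn r \<bullet> v = \<beta> * (fn t \<bullet> v)" if "fn s \<bullet> v = 0" for v
      using that by (simp add: inner_add_left)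
    then show False
      using n by blast
  qed
  ultimately have "dim M + 2 \<le> dim X'"
    using dim_X' by simp
  moreover have "M \<subseteq> X'"
    unfolding M by blast
  ultimately show ?thesis
    using sM by blast
qed

lemma genX_point:
  assumes "open W" "W \<inter> X' \<noteq> {}" "W \<inter> X' \<subseteq> K"
  obtains z where "z \<in> W" "genX z"
proof -
  let ?N = "(\<lambda>t. {v. fn t \<bullet> v = 0}) ` (Rf - {s})"
  have N: "subspace N \<and> \<not> X' \<subseteq> N" if "N \<in> ?N" for N
  proof -
    from that obtain t where t: "N = {v. fn t \<bullet> v = 0}" "t \<in> Rf - {s}"
      by (rule imageE)
    have "\<not> X' \<subseteq> N"
    proof
      assume "X' \<subseteq> N"
      then have "fn t \<bullet> v = 0" if "fn s \<bullet> v = 0" for v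
        using that t(1) by blast
      then obtain k where "fn t = k *\<^sub>R fn s"
        using fn_proportional[OF s_Rf, of "fn t"] by blast
      then show False
        using fn_not_proportional t(2) by blast
    qed
    then show ?thesis
      unfolding t(1) using subspace_hyperplane[of "fn t"] by blast
  qed
  have "countable ?N"
    using countable_Rf by simp
  then obtain z where z: "z \<in> W \<inter> X'" "\<forall>N\<in>?N. z \<notin> N"
    using subspace_generic_point[OF subspace_hyperplane[of "fn s"] assms(1,2) _ N] by blast
  have "genX z"
    unfolding genX_def using z assms(3) by blast
  then show ?thesis
    using that z(1) by blast
qed

text \<open>
  The points of \<open>Q\<close> which are neither generic nor on an edge form a union of strata of codimension two,
  and their complement is connected. So it suffices to know the transitive relation \<open>R\<close> near generic
  points and edges.
\<close>

lemma mirror_connectivity: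
  assumes dim: "2 \<le> dim X'" and Q: "openin (top_of_set X') Q" "Q \<subseteq> K"
    and seg: "\<And>u v. \<lbrakk>u \<in> Q; v \<in> Q; 0 \<notin> closed_segment u v\<rbrakk> \<Longrightarrow> closed_segment u v \<subseteq> Q"
    and trans: "\<And>x y z. \<lbrakk>R x y; R y z\<rbrakk> \<Longrightarrow> R x z"
    and step: "\<And>e r u v. \<lbrakk>e \<in> Q; genX e \<or> (\<exists>t. edge e t); small e r; u \<in> ball e r; v \<in> ball e r;
        genX u; genX v\<rbrakk> \<Longrightarrow> R u v"
    and ab: "a \<in> Q" "b \<in> Q" "genX a" "genX b"
  shows "R a b"
proof -
  have QX: "Q \<subseteq> X'"
    using openin_imp_subset[OF Q(1)] .
  define Q' where "Q' = Q - \<Union>thin"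
  have "countable ((Rf - {s}) \<times> (Rf - {s}))"
    using countable_Rf by simp
  then have "countable {(t, r) \<in> (Rf - {s}) \<times> (Rf - {s}).
      \<not> (\<exists>c. \<forall>v. fn s \<bullet> v = 0 \<longrightarrow> fn r \<bullet> v = c * (fn t \<bullet> v))}"
    by (rule countable_subset[rotated]) auto
  then have cth: "countable thin"
    unfolding thin_def by simp
  have conQ: "connected Q'"
    unfolding Q'_def
    by (rule connected_minus_codim2[OF subspace_hyperplane[of "fn s"] dim Q(1) _ seg cth thin_codim2])
      (use Q(2) zero_K in auto)
  have genQ: "u \<in> Q'" if "u \<in> Q" "genX u" for u
    using that unfolding Q'_def thin_def genX_def by auto
  show ?thesis
  proof (rule connected_equivalence_relation_gen[where P = genX,
        OF conQ genQ[OF ab(1,3)] genQ[OF ab(2,4)] ab(3,4) trans])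
    fix T a assume T: "openin (top_of_set Q') T" "a \<in> T"
    obtain W where W: "open W" "T = Q' \<inter> W"
      using T(1) unfolding openin_open by blast
    obtain W' where W': "open W'" "Q = X' \<inter> W'"
      using Q(1) unfolding openin_open by blast
    have "a \<in> (W \<inter> W') \<inter> X'"
      using T(2) W(2) W'(2) unfolding Q'_def by blast
    then have "(W \<inter> W') \<inter> X' \<noteq> {}"
      by blast
    moreover have "(W \<inter> W') \<inter> X' \<subseteq> K"
      using W'(2) Q(2) by blast
    ultimately obtain z where z: "z \<in> W \<inter> W'" "genX z"
      using genX_point[OF open_Int[OF W(1) W'(1)]] by metis
    then have "z \<in> Q"
      using W'(2) genX_X[of z] by blast
    then show "\<exists>z. z \<in> T \<and> genX z"
      using genQ z W(2) by blast
  next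
    fix a assume a: "a \<in> Q'"
    then have aQ: "a \<in> Q" "a \<in> K" "a \<in> X'"
      using Q(2) QX unfolding Q'_def by auto
    obtain r where r: "small a r"
      using mirrors_locally_finite[OF aQ(2)] by metis
    have "a \<notin> \<Union>thin"
      using a unfolding Q'_def by blast
    then have "genX a \<or> (\<exists>t. edge a t)"
      using generic_or_edge[OF aQ(2,3)] by blast
    then have "\<forall>x\<in>Q' \<inter> ball a r. \<forall>y\<in>Q' \<inter> ball a r. genX x \<and> genX y \<longrightarrow> R x y"
      using step[OF aQ(1) _ r] by blast
    then show "\<exists>T. openin (top_of_set Q') T \<and> a \<in> T \<and> (\<forall>x\<in>T. \<forall>y\<in>T. genX x \<and> genX y \<longrightarrow> R x y)"
      using a small_pos[OF r] openin_open_Int[OF open_ball, of Q' a r]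
      by (intro exI[of _ "Q' \<inter> ball a r"]) auto
  qed
qed

lemma edge_same_side:
  assumes e: "edge e t" and r: "small e r" and uv: "u \<in> ball e r" "v \<in> ball e r" "u \<in> X'" "v \<in> X'"
    and sg: "(fn t \<bullet> u) * (fn t \<bullet> v) > 0" and q: "q \<in> Rf" "q \<noteq> s"
  shows "(fn q \<bullet> u) * (fn q \<bullet> v) > 0"
proof (cases "fn q \<bullet> e = 0")
  case True
  obtain c where c: "c \<noteq> 0" "\<forall>v. fn s \<bullet> v = 0 \<longrightarrow> fn q \<bullet> v = c * (fn t \<bullet> v)"
    using edge_trace[OF e q True] .
  have "(fn q \<bullet> u) * (fn q \<bullet> v) = (c * c) * ((fn t \<bullet> u) * (fn t \<bullet> v))"
    using c(2) uv by simp
  moreover have "c * c > 0"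
    using c(1) by (metis not_real_square_gt_zero)
  ultimately show ?thesis
    by (simp only: mult_pos_pos sg)
next
  case False
  then show ?thesis
    using small_sign[OF r q(1) _ uv(1,2)] by blast
qed

lemma ball_segment_K:
  assumes "small e r" "u \<in> ball e r" "v \<in> ball e r"
  shows "closed_segment u v \<subseteq> K"
  using closed_segment_subset[OF assms(2,3) convex_ball] small_K[OF assms(1)] by blast

lemma edge_same_chamber:
  assumes e: "edge e t" and r: "small e r" and uv: "u \<in> ball e r" "v \<in> ball e r" "u \<in> X'" "v \<in> X'"
    and sg: "(fn t \<bullet> u) * (fn t \<bullet> v) > 0" and g: "g \<in> \<Gamma>" "u \<in> ch g"
  shows "v \<in> ch g"
  using genX_same_chamber[OF g uv(3,4) ball_segment_K[OF r uv(1,2)]] edge_same_side[OF e r uv sg]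
  by blast

lemma edge_in_chamber:
  assumes e: "edge e t" and r: "small e r" and u: "u \<in> ball e r" "genX u" and g: "g \<in> \<Gamma>" "u \<in> ch g"
    and v: "v \<in> ball e r" "v \<in> X'" "fn t \<bullet> v = 0"
  shows "v \<in> ch g"
proof (rule chamber_closed_ray[OF g(1) small_K[OF r v(1)], of u])
  fix d :: real assume d: "0 < d" "d \<le> 1"
  let ?w = "v + d *\<^sub>R (u - v)"
  have "?w = (1 - d) *\<^sub>R v + d *\<^sub>R u"
    by (simp add: algebra_simps)
  then have wb: "?w \<in> ball e r"
    using convexD[OF convex_ball v(1) u(1), of "1 - d" d] d by simp
  have wX: "?w \<in> X'"
    using v(2) genX_X[OF u(2)] by (simp add: inner_add_right inner_diff_right)
  have tu: "fn t \<bullet> u \<noteq> 0"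
    using genX_fn[OF u(2) edgeD(3,4)[OF e]] .
  have "(fn t \<bullet> u) * (fn t \<bullet> ?w) = d * ((fn t \<bullet> u) * (fn t \<bullet> u))"
    using v(3) by (simp add: inner_add_right inner_diff_right)
  moreover have "(fn t \<bullet> u) * (fn t \<bullet> u) > 0"
    using tu by (metis not_real_square_gt_zero)
  ultimately have "(fn t \<bullet> u) * (fn t \<bullet> ?w) > 0"
    by (simp only: mult_pos_pos d(1))
  then show "?w \<in> ch g"
    using edge_same_chamber[OF e r u(1) wb _ wX _ g] genX_X[OF u(2)] by simp
qed

text \<open>
  By continuity the image of a point stays in the ball if the point is close to the fixed point \<open>e\<close>, and
  between \<open>e\<close> and \<open>u\<close> no mirror other than \<open>X\<close> is met.
\<close>

lemma edge_shrink:
  assumes e: "edge e t" and r: "small e r" and u: "u \<in> ball e r" "genX u"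
    and A: "linear A" "A e = e"
  obtains d where "0 < d" "d \<le> 1" "e + d *\<^sub>R (u - e) \<in> ball e r" "genX (e + d *\<^sub>R (u - e))"
    "A (e + d *\<^sub>R (u - e)) \<in> ball e r"
proof -
  have "e \<in> ball e r"
    using small_pos[OF r] by simp
  then obtain d0 where d0: "d0 > 0" "\<And>x. \<bar>x\<bar> \<le> d0 \<Longrightarrow> e + x *\<^sub>R (A u - e) \<in> ball e r"
    using small_shift[OF open_ball] by metis
  define d where "d = min d0 1"
  have d: "0 < d" "d \<le> 1" "\<bar>d\<bar> \<le> d0"
    using d0(1) by (auto simp: d_def)
  let ?w = "e + d *\<^sub>R (u - e)"
  have wb: "?w \<in> ball e r"
    using ball_shrink[OF u(1)] d by simp
  have wX: "?w \<in> X'"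
    using edgeD(2)[OF e] genX_X[OF u(2)] by (simp add: inner_add_right inner_diff_right)
  have uX: "u \<in> X'"
    using genX_X[OF u(2)] by simp
  have tu: "fn t \<bullet> u \<noteq> 0"
    using genX_fn[OF u(2) edgeD(3,4)[OF e]] .
  have "(fn t \<bullet> u) * (fn t \<bullet> ?w) = d * ((fn t \<bullet> u) * (fn t \<bullet> u))"
    using shrink_sign[OF edgeD(5)[OF e]] by simp
  moreover have "(fn t \<bullet> u) * (fn t \<bullet> u) > 0"
    using tu by (metis not_real_square_gt_zero)
  ultimately have "(fn t \<bullet> u) * (fn t \<bullet> ?w) > 0"
    by (simp only: mult_pos_pos d(1))
  then have "fn q \<bullet> ?w \<noteq> 0" if "q \<in> Rf" "q \<noteq> s" for q
    using edge_same_side[OF e r u(1) wb uX wX _ that] by auto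
  then have "genX ?w"
    unfolding genX_def using small_K[OF r wb] wX by blast
  moreover have "A ?w = e + d *\<^sub>R (A u - e)"
    using A by (simp add: linear_add linear_diff linear_scale)
  then have "A ?w \<in> ball e r"
    using d0(2)[OF d(3)] by simp
  ultimately show ?thesis
    using that[of d] d(1,2) wb by blast
qed

text \<open>
  Signs as in the last assumptions mean that \<open>h\<close> preserves the sides of \<open>X\<close> and both parts of \<open>X\<close> at the
  edge, so \<open>rigid\<close> applies to a point close to \<open>e\<close>.
\<close>

lemma edge_rigid:
  assumes e: "edge e t" and r: "small e r" and u: "u \<in> ball e r" "genX u"
    and h: "h \<in> \<Gamma>" "h ` X = X" and A: "rep h A" "A e = e"
    and k: "k > 0" "\<And>v. fn s \<bullet> A v = k * (fn s \<bullet> v)"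
    and b: "b > 0" "\<And>v. fn s \<bullet> v = 0 \<Longrightarrow> fn t \<bullet> A v = b * (fn t \<bullet> v)"
  shows "h = gone"
proof -
  obtain d where d: "0 < d" "d \<le> 1" "e + d *\<^sub>R (u - e) \<in> ball e r" "genX (e + d *\<^sub>R (u - e))"
    "A (e + d *\<^sub>R (u - e)) \<in> ball e r"
    using edge_shrink[OF e r u rep_linear[OF A(1)] A(2)] .
  let ?w = "e + d *\<^sub>R (u - e)"
  have gA: "genX (A ?w)"
    using stabiliser_genX[OF h A(1) d(4)] .
  have tw: "fn t \<bullet> ?w \<noteq> 0"
    using genX_fn[OF d(4) edgeD(3,4)[OF e]] .
  have "(fn t \<bullet> ?w) * (fn t \<bullet> A ?w) = b * ((fn t \<bullet> ?w) * (fn t \<bullet> ?w))"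
    using b(2)[OF genX_X[OF d(4)]] by simp
  moreover have "(fn t \<bullet> ?w) * (fn t \<bullet> ?w) > 0"
    using tw by (metis not_real_square_gt_zero)
  ultimately have pos: "(fn t \<bullet> ?w) * (fn t \<bullet> A ?w) > 0"
    by (simp only: mult_pos_pos b(1))
  show ?thesis
    by (rule rigid[OF h(1) A(1) k d(4) gA ball_segment_K[OF r d(3,5)]])
      (use edge_same_side[OF e r d(3,5) _ _ pos] genX_X[OF d(4)] genX_X[OF gA] in auto)
qed

lemma edge_has_ball_point:
  assumes e: "edge e t" and r: "small e r"
  obtains u where "u \<in> ball e r" "genX u"
proof -
  have "e \<in> ball e r \<inter> X'"
    using edgeD(2)[OF e] small_pos[OF r] by simp
  then have "ball e r \<inter> X' \<noteq> {}"
    by blast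
  moreover have "ball e r \<inter> X' \<subseteq> K"
    using small_K[OF r] by blast
  ultimately show ?thesis
    using genX_point[OF open_ball] that by metis
qed

text \<open>
  The product of two such reflections fixes \<open>e\<close>, preserves the sides of \<open>X\<close>, and preserves the two parts
  of \<open>X\<close> at the edge, because each of the reflections exchanges them.
\<close>

lemma orthogonal_at_edge_unique:
  assumes e: "edge e t" and t: "t \<in> T" and q: "q \<in> T" "fn q \<bullet> e = 0"
  shows "q = t"
proof -
  note t' = T_Rf[OF t] and q' = T_Rf[OF q(1)]
  obtain r where r: "small e r"
    using mirrors_locally_finite[OF edgeD(1)[OF e]] by metis
  obtain u where u: "u \<in> ball e r" "genX u"
    using edge_has_ball_point[OF e r] .
  let ?h = "gmul t q" and ?A = "\<lambda>v. sk t (sk q v)"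
  have h: "?h \<in> \<Gamma>"
    using \<Gamma>_mul Rf_\<Gamma> t' q' by blast
  have "?h ` X = t ` q ` X"
    using X_P by (auto simp: gmul_apply subset_iff image_image intro!: image_eqI)
  then have hX: "?h ` X = X"
    using T_X t q(1) by simp
  have A: "rep ?h ?A"
    unfolding gmul_def by (rule rep_comp[OF sk_rep[OF t'] sk_rep[OF q']])
  have Ae: "?A e = e"
    using q(2) edgeD(5)[OF e] by (simp add: skew_reflection_wall)
  have k: "fn s \<bullet> ?A v = 1 * (fn s \<bullet> v)" for v
    by (simp add: T_side t q(1))
  obtain c where c: "c \<noteq> 0" "\<forall>v. fn s \<bullet> v = 0 \<longrightarrow> fn q \<bullet> v = c * (fn t \<bullet> v)"
    using edge_trace[OF e q' T_ne[OF q(1)] q(2)] .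
  have b: "fn t \<bullet> ?A v = 1 * (fn t \<bullet> v)" if v: "fn s \<bullet> v = 0" for v
  proof -
    have "fn s \<bullet> sk q v = 0"
      using T_side[OF q(1)] v by simp
    then have "c * (fn t \<bullet> sk q v) = fn q \<bullet> sk q v"
      using c(2) by simp
    also have "\<dots> = - (fn q \<bullet> v)"
      using skew_reflection_flip[OF fn_ax[OF q']] .
    also have "\<dots> = c * (- (fn t \<bullet> v))"
      using c(2) v by simp
    finally have "fn t \<bullet> sk q v = - (fn t \<bullet> v)"
      using c(1) by (simp only: mult_cancel_left) simp
    then show ?thesis
      using skew_reflection_flip[OF fn_ax[OF t'], of "sk q v"] by simp
  qed
  have "?h = gone"
    by (rule edge_rigid[OF e r u h hX A Ae _ k _ b]) auto
  then have "gmul (gmul t q) q = gmul gone q"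
    by simp
  moreover have "gmul (gmul t q) q = t"
    using gmul_assoc[OF Rf_\<Gamma>[OF t'] Rf_\<Gamma>[OF q'] Rf_\<Gamma>[OF q']] Rf_involution(2)[OF q']
      gmul_one(1)[OF Rf_\<Gamma>[OF t']] by simp
  ultimately show ?thesis
    using gmul_one(2)[OF Rf_\<Gamma>[OF q']] by simp
qed

text \<open>
  An involution that multiplies the functional of \<open>X\<close> by a positive factor leaves it invariant, so
  \<open>involution_is_skew_reflection\<close> applies.
\<close>

lemma involution_reflection:
  assumes h: "h \<in> \<Gamma>" "h ` X = X" "gmul h h = gone" and A: "rep h A"
    and sq: "\<And>v. A (A v) = v" and k: "k > 0" "\<And>v. fn s \<bullet> A v = k * (fn s \<bullet> v)"
    and fixed: "\<And>v. \<lbrakk>fn s \<bullet> v = 0; z \<bullet> v = 0\<rbrakk> \<Longrightarrow> A v = v"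
    and x: "fn s \<bullet> x = 0" "(z \<bullet> x) * (z \<bullet> A x) < 0"
    and e: "\<And>q u. \<lbrakk>q \<bullet> u = 1; A = skew_reflection q u\<rbrakk> \<Longrightarrow> \<exists>e\<in>K. q \<bullet> e = 0"
    and ne: "h \<noteq> s"
  shows "h \<in> T"
proof -
  obtain v0 where v0: "fn s \<bullet> v0 = 1"
    using fn_ax[OF s_Rf] by blast
  have "fn s \<bullet> v0 = k * (k * (fn s \<bullet> v0))"
    using sq[of v0] k(2)[of "A v0"] k(2)[of v0] by simp
  then have "k * k = 1"
    using v0 by simp
  then have "k = 1"
    using k(1) by (simp add: square_eq_1_iff)
  then have w: "fn s \<bullet> A v = fn s \<bullet> v" for v
    using k(2) by simp
  obtain q u where qu: "q \<bullet> u = 1" "fn s \<bullet> u = 0" "A = skew_reflection q u"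
    using involution_is_skew_reflection[OF rep_linear[OF A] sq w fixed x] .
  obtain e' where e': "e' \<in> K" "q \<bullet> e' = 0"
    using e[OF qu(1,3)] by blast
  have "reflection_in S (mir h) h"
    unfolding mir_def
    using skew_reflection_in(1)[OF \<Gamma>_isometries[OF h(1)] _ qu(1) e'] A qu(3) by simp
  then show ?thesis
    unfolding T_def Rf_def using h(1,2) ne by blast
qed

text \<open>
  If \<open>h\<close> exchanges the sides of \<open>X\<close>, then \<open>s h\<close> does not, and it has the same restriction to \<open>X\<close>.
\<close>

lemma side_preserving_version:
  assumes h: "h \<in> \<Gamma>" "h ` X = X" and A: "rep h A"
  obtains h' A' k where "h' \<in> \<Gamma>" "h' ` X = X" "rep h' A'" "k > 0"
    "\<forall>v. fn s \<bullet> A' v = k * (fn s \<bullet> v)" "\<forall>v. fn s \<bullet> v = 0 \<longrightarrow> A' v = A v"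
    "\<forall>x\<in>X. h' x = h x"
proof -
  obtain k where k: "k \<noteq> 0" "\<And>v. fn s \<bullet> A v = k * (fn s \<bullet> v)"
    using stabiliser_scales_fn[OF h A] by metis
  show ?thesis
  proof (cases "k > 0")
    case True
    show ?thesis
      by (rule that[OF h A True]) (use k in auto)
  next
    case False
    have hx: "h x \<in> X" if "x \<in> X" for x
      using h(2) that by blast
    have eq: "gmul s h x = h x" if "x \<in> X" for x
      using that hx[OF that] X_P gmul_apply[of x s h] by (auto simp: mir_def)
    have 1: "gmul s h \<in> \<Gamma>"
      using \<Gamma>_mul[OF Rf_\<Gamma>[OF s_Rf] h(1)] .
    have 2: "gmul s h ` X = X"
      using eq h(2) by (metis image_cong)
    have 3: "rep (gmul s h) (\<lambda>v. sk s (A v))"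
      unfolding gmul_def by (rule rep_comp[OF sk_rep[OF s_Rf] A])
    have 4: "- k > 0"
      using False k(1) by simp
    have 5: "\<forall>v. fn s \<bullet> sk s (A v) = - k * (fn s \<bullet> v)"
      using skew_reflection_flip[OF fn_ax[OF s_Rf]] k(2) by simp
    have 6: "\<forall>v. fn s \<bullet> v = 0 \<longrightarrow> sk s (A v) = A v"
      using k(2) by (simp add: skew_reflection_wall)
    show ?thesis
      using that[OF 1 2 3 4 5 6] eq by blast
  qed
qed

text \<open>
  Up to \<open>s\<close>, the element preserves the sides of \<open>X\<close>. Its square preserves both parts of \<open>X\<close> at the edge,
  so it is trivial by \<open>edge_rigid\<close>. An involution that fixes the edge pointwise, preserves the sides of
  \<open>X\<close> and flips \<open>X\<close> across the edge is a reflection.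
\<close>

lemma flip_gives_orthogonal:
  assumes e: "edge e t" and r: "small e r" and u: "u \<in> ball e r" "genX u"
    and h: "h \<in> \<Gamma>" "h ` X = X" and A: "rep h A" "A e = e"
    and fixed: "\<And>v. \<lbrakk>v \<in> K; fn s \<bullet> v = 0; fn t \<bullet> v = 0\<rbrakk> \<Longrightarrow> h (\<pi> v) = \<pi> v"
    and flip: "(fn t \<bullet> u) * (fn t \<bullet> A u) < 0"
  obtains q where "q \<in> T" "fn q \<bullet> e = 0"
proof -
  note eK = edgeD(1)[OF e] and se = edgeD(2)[OF e] and te = edgeD(5)[OF e]
  obtain h' A' k where h': "h' \<in> \<Gamma>" "h' ` X = X" and A': "rep h' A'" and k: "k > 0"
    "\<forall>v. fn s \<bullet> A' v = k * (fn s \<bullet> v)" and AA: "\<forall>v. fn s \<bullet> v = 0 \<longrightarrow> A' v = A v"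
    and hh: "\<forall>x\<in>X. h' x = h x"
    using side_preserving_version[OF h A(1)] .
  have A'e: "A' e = e"
    using AA se A(2) by simp
  let ?L = "{v. fn s \<bullet> v = 0 \<and> fn t \<bullet> v = 0}"
  have sL: "subspace ?L"
    by (auto simp: subspace_def inner_add_right)
  have "h' (\<pi> v) = \<pi> v" if v: "v \<in> K" "v \<in> ?L" for v
    using fixed[OF v(1)] v(2) hh X_fn[OF v(1)] by simp
  then obtain c where c: "c > 0" "\<And>v. v \<in> ?L \<Longrightarrow> A' v = c *\<^sub>R v"
    using fixed_scalar[OF A' sL open_K eK _ order_refl] se te by blast
  have "c *\<^sub>R e = 1 *\<^sub>R e"
    using c(2)[of e] A'e se te by simp
  then have "c = 1"
    using K_nonzero[OF eK] by (simp only: scaleR_cancel_right) simp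
  then have fix': "A' v = v" if "fn s \<bullet> v = 0" "fn t \<bullet> v = 0" for v
    using c(2)[of v] that by simp
  define z where "z = adjoint A' (fn t)"
  have z: "z \<bullet> v = fn t \<bullet> A' v" for v
    using adjoint_works[OF rep_linear[OF A'], of v "fn t"] by (simp add: z_def inner_commute)
  have "z \<bullet> v = 0" if "fn s \<bullet> v = 0" "fn t \<bullet> v = 0" for v
    using z[of v] fix'[OF that] that by simp
  then obtain \<alpha> b where ab: "z = \<alpha> *\<^sub>R fn s + b *\<^sub>R fn t"
    using in_span_two_functionals by metis
  \<comment> \<open>On \<open>X\<close> the functional of \<open>t\<close> is multiplied by \<open>b\<close>, and \<open>b < 0\<close> by the flip.\<close>
  have b: "fn t \<bullet> A' v = b * (fn t \<bullet> v)" if "fn s \<bullet> v = 0" for v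
    using z[of v] that by (simp add: ab inner_add_left)
  have tu: "fn t \<bullet> u \<noteq> 0"
    using genX_fn[OF u(2) edgeD(3,4)[OF e]] .
  have flip': "(fn t \<bullet> u) * (fn t \<bullet> A' u) < 0"
    using flip AA genX_X[OF u(2)] by simp
  then have "b * ((fn t \<bullet> u) * (fn t \<bullet> u)) < 0"
    using b[OF genX_X[OF u(2)]] by (simp add: mult.left_commute)
  then have "b \<noteq> 0"
    by auto
  then have bb: "b * b > 0"
    by (metis not_real_square_gt_zero)
  have hX2: "gmul h' h' ` X = X"
  proof -
    have "gmul h' h' ` X = h' ` h' ` X"
      using X_P by (auto simp: gmul_apply subset_iff image_image intro!: image_eqI)
    then show ?thesis using h'(2) by simp
  qed
  have rep2: "rep (gmul h' h') (\<lambda>v. A' (A' v))"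
    unfolding gmul_def by (rule rep_comp[OF A' A'])
  have sA: "fn s \<bullet> A' v = 0" if "fn s \<bullet> v = 0" for v
    using k(2) that by simp
  have inv: "gmul h' h' = gone"
  proof (rule edge_rigid[OF e r u \<Gamma>_mul[OF h'(1) h'(1)] hX2 rep2])
    show "A' (A' e) = e"
      using A'e by simp
    show "0 < k * k"
      using k(1) by simp
    show "fn s \<bullet> A' (A' v) = k * k * (fn s \<bullet> v)" for v
      using k(2) by simp
    show "0 < b * b"
      using bb .
    show "fn t \<bullet> A' (A' v) = b * b * (fn t \<bullet> v)" if "fn s \<bullet> v = 0" for v
      using b[OF sA[OF that]] b[OF that] by simp
  qed
  have "gmul h' h' x = x" if "x \<in> P" for x
    using inv gone_apply[OF that] by simp
  then obtain d where d: "d > 0" "\<And>v. A' (A' v) = d *\<^sub>R v"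
    using rep_identity_scalar[OF rep2] by blast
  have "d *\<^sub>R e = 1 *\<^sub>R e"
    using d(2)[of e] A'e by simp
  then have "d = 1"
    using K_nonzero[OF eK] by (simp only: scaleR_cancel_right) simp
  then have sq: "A' (A' v) = v" for v
    using d(2) by simp
  have uX: "\<pi> u \<in> X"
    using X_fn[OF genX_K[OF u(2)]] genX_X[OF u(2)] by simp
  have ne: "h' \<noteq> s"
  proof
    assume "h' = s"
    then have "\<pi> (A' u) = \<pi> u"
      using rep_\<pi>[OF A' genX_K[OF u(2)]] uX by (simp add: mir_def)
    then obtain c where "c > 0" "A' u = c *\<^sub>R u"
      using same_ray[OF rep_K[OF A' genX_K[OF u(2)]] genX_K[OF u(2)]] by blast
    then have "(fn t \<bullet> u) * (fn t \<bullet> A' u) = c * ((fn t \<bullet> u) * (fn t \<bullet> u))" "c > 0"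
      by simp_all
    moreover have "(fn t \<bullet> u) * (fn t \<bullet> u) \<ge> 0"
      by simp
    ultimately have "(fn t \<bullet> u) * (fn t \<bullet> A' u) \<ge> 0"
      by (simp only: mult_nonneg_nonneg less_imp_le)
    then show False
      using flip' by simp
  qed
  have qe: "q \<bullet> e = 0" if "q \<bullet> w = 1" "A' = skew_reflection q w" for q w
  proof -
    have "w \<noteq> 0"
      using that(1) by auto
    moreover have "(2 * (q \<bullet> e)) *\<^sub>R w = 0"
      using A'e that(2) by (simp add: skew_reflection_def)
    ultimately show ?thesis
      by simp
  qed
  have T: "h' \<in> T"
  proof (rule involution_reflection[OF h' inv A' sq k(1) _ fix' genX_X[OF u(2)] flip' _ ne])
    show "fn s \<bullet> A' v = k * (fn s \<bullet> v)" for v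
      using k(2) by simp
    show "\<exists>e\<in>K. q \<bullet> e = 0" if "q \<bullet> w = 1" "A' = skew_reflection q w" for q w
      using qe[OF that] eK by blast
  qed
  moreover have "fn h' \<bullet> e = 0"
  proof -
    have "h' (\<pi> e) = \<pi> e"
      using rep_\<pi>[OF A' eK] A'e by simp
    then show ?thesis
      using fix_fn[OF T_Rf[OF T] eK] by blast
  qed
  ultimately show ?thesis
    by (rule that)
qed

section \<open>Separation by orthogonal mirrors\<close>

definition sepv :: "'v \<Rightarrow> 'v \<Rightarrow> ('a \<Rightarrow> 'a) set"
  where "sepv u v = {t \<in> T. (fn t \<bullet> u) * (fn t \<bullet> v) < 0}"

lemma genX_T: "\<lbrakk>genX v; t \<in> T\<rbrakk> \<Longrightarrow> fn t \<bullet> v \<noteq> 0"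
  using genX_fn T_Rf T_ne by blast

lemma not_sepv_pos:
  assumes "genX u" "genX v" "t \<in> T" "t \<notin> sepv u v"
  shows "(fn t \<bullet> u) * (fn t \<bullet> v) > 0"
proof -
  have "fn t \<bullet> u \<noteq> 0" "fn t \<bullet> v \<noteq> 0"
    using genX_T assms by blast+
  then have "(fn t \<bullet> u) * (fn t \<bullet> v) \<noteq> 0"
    by simp
  moreover have "\<not> (fn t \<bullet> u) * (fn t \<bullet> v) < 0"
    using assms(3,4) unfolding sepv_def by blast
  ultimately show ?thesis
    by linarith
qed

lemma sepv_empty_iff:
  assumes "genX u" "genX v"
  shows "sepv u v = {} \<longleftrightarrow> (\<forall>t\<in>T. (fn t \<bullet> u) * (fn t \<bullet> v) > 0)"
proof
  show "\<forall>t\<in>T. (fn t \<bullet> u) * (fn t \<bullet> v) > 0" if "sepv u v = {}"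
    using not_sepv_pos[OF assms] that by blast
  show "sepv u v = {}" if "\<forall>t\<in>T. (fn t \<bullet> u) * (fn t \<bullet> v) > 0"
    using that unfolding sepv_def by fastforce
qed

text \<open>
  Only an orthogonal mirror through \<open>e\<close> can separate points near \<open>e\<close>, and there is at most one. If it
  does separate them, then reflecting \<open>v\<close> in it brings \<open>v\<close> to the domain of \<open>u\<close>; the image of \<open>v\<close> may
  leave the ball, so this is checked for a point of the segment from \<open>e\<close> to \<open>v\<close> first.
\<close>

lemma edge_step_near:
  assumes e: "genX e \<or> (\<exists>t. edge e t)" and r: "small e r" and uv: "u \<in> ball e r" "v \<in> ball e r"
    and g: "genX u" "genX v"
  shows "sepv u v = {} \<or> (\<exists>t\<in>T. sepv u v = {t} \<and> sepv u (sk t v) = {})"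
proof (cases "\<exists>t\<in>T. fn t \<bullet> e = 0")
  case False
  have "(fn t \<bullet> u) * (fn t \<bullet> v) > 0" if "t \<in> T" for t
    using small_sign[OF r T_Rf[OF that] _ uv] that False by blast
  then show ?thesis
    using sepv_empty_iff[OF g] by blast
next
  case True
  then obtain t where t: "t \<in> T" "fn t \<bullet> e = 0"
    by blast
  note t' = T_Rf[OF t(1)]
  have "\<not> genX e"
    using genX_T[OF _ t(1)] t(2) by blast
  then obtain t0 where "edge e t0"
    using e by blast
  then have et: "edge e t"
    using edge_change[OF _ t' T_ne[OF t(1)] t(2)] by blast
  have other: "fn q \<bullet> e \<noteq> 0" if "q \<in> T" "q \<noteq> t" for q
    using orthogonal_at_edge_unique[OF et t(1) that(1)] that(2) by blast
  have pos: "(fn q \<bullet> u) * (fn q \<bullet> v) > 0" if "q \<in> T" "q \<noteq> t" for q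
    using small_sign[OF r T_Rf[OF that(1)] other[OF that] uv] .
  show ?thesis
  proof (cases "(fn t \<bullet> u) * (fn t \<bullet> v) > 0")
    case True
    then show ?thesis
      using sepv_empty_iff[OF g] pos by metis
  next
    case False
    then have neg: "(fn t \<bullet> u) * (fn t \<bullet> v) < 0"
      using not_sepv_pos[OF g t(1)] unfolding sepv_def by blast
    have 1: "sepv u v = {t}"
    proof
      show "sepv u v \<subseteq> {t}"
        using pos unfolding sepv_def by fastforce
      show "{t} \<subseteq> sepv u v"
        using neg t(1) unfolding sepv_def by blast
    qed
    have ske: "sk t e = e"
      using t(2) by (rule skew_reflection_wall)
    have gsv: "genX (sk t v)"
      using stabiliser_genX[OF Rf_\<Gamma>[OF t'] T_X[OF t(1)] sk_rep[OF t'] g(2)] .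
    obtain d where d: "0 < d" "d \<le> 1" "e + d *\<^sub>R (v - e) \<in> ball e r"
      "genX (e + d *\<^sub>R (v - e))" "sk t (e + d *\<^sub>R (v - e)) \<in> ball e r"
      using edge_shrink[OF et r uv(2) g(2) linear_skew_reflection ske] .
    let ?w = "e + d *\<^sub>R (v - e)"
    have "(fn q \<bullet> u) * (fn q \<bullet> sk t v) > 0" if q: "q \<in> T" for q
    proof (cases "q = t")
      case True
      then show ?thesis
        using neg skew_reflection_flip[OF fn_ax[OF t'], of v] by simp
    next
      case False
      note q' = T_Rf[OF q]
      have 1: "(fn q \<bullet> u) * (fn q \<bullet> sk t ?w) > 0"
        using small_sign[OF r q' other[OF q False] uv(1) d(5)] .
      \<comment> \<open>Instead of \<open>sk t v\<close>, which may lie outside the ball, \<open>v\<close> is compared with \<open>?w\<close> by means of the mirror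
        of \<open>p\<close>, the image of that of \<open>q\<close> under \<open>t\<close>.\<close>
      define p where "p = cj t q"
      have p: "p \<in> Rf"
        using cj_Rf(1)[OF Rf_\<Gamma>[OF t'] q'] by (simp add: p_def)
      have cp: "cj t p = q"
        unfolding p_def by (rule cj_involution[OF t' Rf_\<Gamma>[OF q']])
      obtain k where k: "k \<noteq> 0" "\<And>v. fn q \<bullet> sk t v = k * (fn p \<bullet> v)"
        using cj_fn[OF Rf_\<Gamma>[OF t'] p sk_rep[OF t']] cp by metis
      have "fn p \<bullet> e \<noteq> 0"
        using other[OF q False] k(2)[of e] ske by auto
      then have "(fn p \<bullet> ?w) * (fn p \<bullet> v) > 0"
        using small_sign[OF r p _ d(3) uv(2)] by blast
      moreover have "k * k > 0"
        using k(1) by (metis not_real_square_gt_zero)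
      ultimately have "(k * k) * ((fn p \<bullet> ?w) * (fn p \<bullet> v)) > 0"
        by (simp only: mult_pos_pos)
      moreover have "(fn q \<bullet> sk t ?w) * (fn q \<bullet> sk t v) = (k * k) * ((fn p \<bullet> ?w) * (fn p \<bullet> v))"
        unfolding k(2) by (simp only: mult_ac)
      ultimately have 2: "(fn q \<bullet> sk t ?w) * (fn q \<bullet> sk t v) > 0"
        by (simp only:)
      show ?thesis
        by (rule sign_transfer[OF 1 2])
    qed
    then have "sepv u (sk t v) = {}"
      using sepv_empty_iff[OF g(1) gsv] by blast
    then show ?thesis
      using 1 t(1) by blast
  qed
qed

section \<open>The stabiliser of a mirror\<close>

definition \<Gamma>X :: "('a \<Rightarrow> 'a) set"
  where "\<Gamma>X = {g \<in> \<Gamma>. g ` X = X}"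

definition GX :: "('a \<Rightarrow> 'a) monoid"
  where "GX = (BijGroup P)\<lparr>carrier := \<Gamma>X\<rparr>"

lemma \<Gamma>XD: "g \<in> \<Gamma>X \<Longrightarrow> g \<in> \<Gamma>" "g \<in> \<Gamma>X \<Longrightarrow> g ` X = X"
  by (auto simp: \<Gamma>X_def)

lemma \<Gamma>X_X: "\<lbrakk>g \<in> \<Gamma>X; x \<in> X\<rbrakk> \<Longrightarrow> g x \<in> X"
  using \<Gamma>XD(2) by blast

lemma gmul_image: "A \<subseteq> P \<Longrightarrow> gmul g h ` A = g ` h ` A"
  by (auto simp: gmul_apply subset_iff image_image intro!: image_eqI)

lemma \<Gamma>X_mul: "\<lbrakk>g \<in> \<Gamma>X; h \<in> \<Gamma>X\<rbrakk> \<Longrightarrow> gmul g h \<in> \<Gamma>X"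
  by (simp add: \<Gamma>X_def \<Gamma>_mul gmul_image[OF X_P])

lemma \<Gamma>X_one: "gone \<in> \<Gamma>X"
proof -
  have "gone ` X = X"
    using X_P by (force simp: gone_def)
  then show ?thesis
    by (simp add: \<Gamma>X_def \<Gamma>_one)
qed

lemma \<Gamma>X_inv: "g \<in> \<Gamma>X \<Longrightarrow> ginv g \<in> \<Gamma>X"
proof -
  assume g: "g \<in> \<Gamma>X"
  have "ginv g ` g ` X = X"
    using ginv_l[OF \<Gamma>XD(1)[OF g]] X_P by (force simp: image_image)
  then show ?thesis
    using \<Gamma>_inv \<Gamma>XD[OF g] by (simp add: \<Gamma>X_def)
qed

lemma BijGroup_mult: "\<lbrakk>g \<in> \<Gamma>; h \<in> \<Gamma>\<rbrakk> \<Longrightarrow> g \<otimes>\<^bsub>BijGroup P\<^esub> h = gmul g h"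
  using \<Gamma>_Bij by (simp add: BijGroup_def gmul_def)

lemma \<Gamma>X_subgroup: "subgroup \<Gamma>X (BijGroup P)"
proof
  show "\<Gamma>X \<subseteq> carrier (BijGroup P)"
    using \<Gamma>_Bij \<Gamma>XD(1) by (auto simp: BijGroup_def)
  show "g \<otimes>\<^bsub>BijGroup P\<^esub> h \<in> \<Gamma>X" if "g \<in> \<Gamma>X" "h \<in> \<Gamma>X" for g h
    using that \<Gamma>X_mul BijGroup_mult \<Gamma>XD(1) by simp
  show "\<one>\<^bsub>BijGroup P\<^esub> \<in> \<Gamma>X"
    using \<Gamma>X_one by (simp add: BijGroup_def gone_def)
  show "inv\<^bsub>BijGroup P\<^esub> g \<in> \<Gamma>X" if "g \<in> \<Gamma>X" for g
    using ginv_eq[OF \<Gamma>_Bij] \<Gamma>X_inv \<Gamma>XD(1) that by simp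
qed

lemma group_GX: "group GX"
  unfolding GX_def by (rule subgroup.subgroup_is_group[OF \<Gamma>X_subgroup group_BijGroup])

lemma GX_carrier: "carrier GX = \<Gamma>X"
  and GX_one: "\<one>\<^bsub>GX\<^esub> = gone"
  by (simp_all add: GX_def BijGroup_def gone_def)

lemma GX_mult: "\<lbrakk>g \<in> \<Gamma>X; h \<in> \<Gamma>X\<rbrakk> \<Longrightarrow> g \<otimes>\<^bsub>GX\<^esub> h = gmul g h"
  using BijGroup_mult \<Gamma>XD(1) by (simp add: GX_def)

lemma GX_inv: "g \<in> \<Gamma>X \<Longrightarrow> inv\<^bsub>GX\<^esub> g = ginv g"
  using group.m_inv_consistent[OF group_BijGroup \<Gamma>X_subgroup] ginv_eq[OF \<Gamma>_Bij] \<Gamma>XD(1)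
  by (simp add: GX_def)

lemma GX_conj: "\<lbrakk>g \<in> \<Gamma>X; t \<in> \<Gamma>X\<rbrakk> \<Longrightarrow> g \<otimes>\<^bsub>GX\<^esub> t \<otimes>\<^bsub>GX\<^esub> inv\<^bsub>GX\<^esub> g = cj g t"
  by (simp add: GX_mult GX_inv \<Gamma>X_mul \<Gamma>X_inv cj_def)

lemma T_\<Gamma>X: "T \<subseteq> \<Gamma>X"
  unfolding T_def \<Gamma>X_def using Rf_\<Gamma> by blast

lemma cj_T:
  assumes g: "g \<in> \<Gamma>X" and t: "t \<in> T"
  shows "cj g t \<in> T"
proof -
  note g' = \<Gamma>XD(1)[OF g] and t' = T_Rf[OF t]
  have "cj g t \<in> \<Gamma>X"
    unfolding cj_def using g t T_\<Gamma>X by (intro \<Gamma>X_mul \<Gamma>X_inv) auto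
  moreover have "cj g t \<noteq> s"
  proof
    assume "cj g t = s"
    then have "g ` mir t = X"
      using cj_Rf(2)[OF g' t'] by simp
    have "mir t \<subseteq> X"
    proof
      fix x assume x: "x \<in> mir t"
      then have "g x \<in> g ` X"
        using \<open>g ` mir t = X\<close> \<Gamma>XD(2)[OF g] by blast
      then obtain y where y: "y \<in> X" "g x = g y"
        by blast
      then have "x = y"
        using \<Gamma>_inj[OF g'] x X_P by (auto simp: mir_def)
      then show "x \<in> X"
        using y(1) by simp
    qed
    then show False
      using mir_subset_eq[OF t' s_Rf] T_ne[OF t] by blast
  qed
  ultimately show ?thesis
    unfolding T_def using cj_Rf(1)[OF g' t'] \<Gamma>XD(2) by blast
qed

lemma cj_cancel: "\<lbrakk>g \<in> \<Gamma>; t \<in> \<Gamma>\<rbrakk> \<Longrightarrow> cj g (cj (ginv g) t) = t"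
  by (rule \<Gamma>_ext) (auto simp: cj_def \<Gamma>_mul \<Gamma>_inv gmul_apply \<Gamma>_points ginv_r ginv_l)

lemma genX_scale:
  assumes "genX v" "c > 0"
  shows "genX (c *\<^sub>R v)"
  using assms scale_K[of v c] unfolding genX_def by auto

lemma genX_\<phi>\<pi>:
  assumes v: "genX v"
  obtains c where "c > 0" "\<phi> (\<pi> v) = c *\<^sub>R v" "genX (\<phi> (\<pi> v))"
proof -
  obtain c where "c > 0" "\<phi> (\<pi> v) = c *\<^sub>R v"
    using \<phi>_\<pi>[OF genX_K[OF v]] by blast
  then show ?thesis
    using that genX_scale[OF v] by metis
qed

definition Pts :: "'a set"
  where "Pts = {x \<in> X. genX (\<phi> x)}"

definition sepx :: "'a \<Rightarrow> 'a \<Rightarrow> ('a \<Rightarrow> 'a) set"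
  where "sepx x y = sepv (\<phi> x) (\<phi> y)"

lemma sepv_scale:
  assumes "a > 0" "b > 0"
  shows "sepv (a *\<^sub>R u) (b *\<^sub>R v) = sepv u v"
proof -
  have "(fn t \<bullet> (a *\<^sub>R u)) * (fn t \<bullet> (b *\<^sub>R v)) < 0 \<longleftrightarrow> (fn t \<bullet> u) * (fn t \<bullet> v) < 0" for t
  proof -
    have "(fn t \<bullet> (a *\<^sub>R u)) * (fn t \<bullet> (b *\<^sub>R v)) = (a * b) * ((fn t \<bullet> u) * (fn t \<bullet> v))"
      by simp
    moreover have "a * b > 0"
      using assms by simp
    ultimately show ?thesis
      by (simp only: pos_mult_neg_iff)
  qed
  then show ?thesis
    unfolding sepv_def by blast
qed

lemma Pts_\<pi>: "genX v \<Longrightarrow> \<pi> v \<in> Pts"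
  unfolding Pts_def using X_fn[OF genX_K] genX_X by (auto elim: genX_\<phi>\<pi>)

lemma sepx_\<pi>:
  assumes "genX u" "genX v"
  shows "sepx (\<pi> u) (\<pi> v) = sepv u v"
proof -
  obtain a where a: "a > 0" "\<phi> (\<pi> u) = a *\<^sub>R u"
    using genX_\<phi>\<pi>[OF assms(1)] by metis
  obtain b where b: "b > 0" "\<phi> (\<pi> v) = b *\<^sub>R v"
    using genX_\<phi>\<pi>[OF assms(2)] by metis
  show ?thesis
    unfolding sepx_def a(2) b(2) by (rule sepv_scale[OF a(1) b(1)])
qed

lemma PtsD: "x \<in> Pts \<Longrightarrow> x \<in> X" "x \<in> Pts \<Longrightarrow> genX (\<phi> x)" "x \<in> Pts \<Longrightarrow> x \<in> P"
  "x \<in> Pts \<Longrightarrow> \<pi> (\<phi> x) = x"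
  using X_P \<pi>_\<phi> by (auto simp: Pts_def)

lemma act_\<pi>: "\<lbrakk>rep g A; x \<in> Pts\<rbrakk> \<Longrightarrow> g x = \<pi> (A (\<phi> x))"
  using rep_\<pi>[of g A "\<phi> x"] genX_K PtsD by simp

lemma sepv_act:
  assumes g: "g \<in> \<Gamma>X" and A: "rep g A" and t: "t \<in> T"
  shows "cj g t \<in> sepv (A u) (A v) \<longleftrightarrow> t \<in> sepv u v"
proof -
  obtain k where k: "k \<noteq> 0" "\<And>v. fn (cj g t) \<bullet> A v = k * (fn t \<bullet> v)"
    using cj_fn[OF \<Gamma>XD(1)[OF g] T_Rf[OF t] A] by metis
  have "(fn (cj g t) \<bullet> A u) * (fn (cj g t) \<bullet> A v) = (k * k) * ((fn t \<bullet> u) * (fn t \<bullet> v))"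
    unfolding k(2) by (simp only: mult_ac)
  moreover have "k * k > 0"
    using k(1) by (metis not_real_square_gt_zero)
  ultimately have "(fn (cj g t) \<bullet> A u) * (fn (cj g t) \<bullet> A v) < 0 \<longleftrightarrow> (fn t \<bullet> u) * (fn t \<bullet> v) < 0"
    by (simp only: pos_mult_neg_iff)
  then show ?thesis
    unfolding sepv_def using cj_T[OF g t] t by blast
qed

text \<open>
  The mirrors orthogonal to \<open>X\<close> form a system of walls on the set of the generic points of \<open>X\<close>, and the
  stabiliser of \<open>X\<close> acts on it.
\<close>

lemma walled: "walled_action GX (\<lambda>g x. g x) Pts T sepx"
proof (intro walled_action.intro group_GX walled_action_axioms.intro)
  fix g x assume "g \<in> carrier GX" and x: "x \<in> Pts"
  then have g: "g \<in> \<Gamma>X"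
    by (simp add: GX_carrier)
  obtain A where A: "rep g A"
    using \<Gamma>_rep[OF \<Gamma>XD(1)[OF g]] by blast
  show "g x \<in> Pts"
    unfolding act_\<pi>[OF A x] by (rule Pts_\<pi>[OF stabiliser_genX[OF \<Gamma>XD[OF g] A PtsD(2)[OF x]]])
next
  show "\<one>\<^bsub>GX\<^esub> x = x" if "x \<in> Pts" for x
    using gone_apply[OF PtsD(3)[OF that]] by (simp add: GX_one)
next
  show "(g \<otimes>\<^bsub>GX\<^esub> h) x = g (h x)" if "g \<in> carrier GX" "h \<in> carrier GX" "x \<in> Pts" for g h x
    using that gmul_apply[OF PtsD(3)] by (simp add: GX_carrier GX_mult)
next
  show "T \<subseteq> carrier GX"
    using T_\<Gamma>X by (simp add: GX_carrier)
next
  show "t \<otimes>\<^bsub>GX\<^esub> t = \<one>\<^bsub>GX\<^esub>" if "t \<in> T" for t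
    using that T_\<Gamma>X Rf_involution(2)[OF T_Rf[OF that]] GX_mult[of t t] GX_one by auto
next
  show "g \<otimes>\<^bsub>GX\<^esub> t \<otimes>\<^bsub>GX\<^esub> inv\<^bsub>GX\<^esub> g \<in> T" if "g \<in> carrier GX" "t \<in> T" for g t
    using that cj_T GX_conj T_\<Gamma>X by (auto simp: GX_carrier)
next
  show "sepx x y \<subseteq> T" for x y
    by (auto simp: sepx_def sepv_def)
next
  show "sepx x y = sepx y x" for x y
    by (simp add: sepx_def sepv_def mult.commute)
next
  fix x y z assume x: "x \<in> Pts" "y \<in> Pts" "z \<in> Pts"
  have *: "t \<in> sepx x z \<longleftrightarrow> t \<in> (sepx x y - sepx y z) \<union> (sepx y z - sepx x y)" if t: "t \<in> T" for t
  proof -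
    have "fn t \<bullet> \<phi> x \<noteq> 0" "fn t \<bullet> \<phi> y \<noteq> 0" "fn t \<bullet> \<phi> z \<noteq> 0"
      using genX_T[OF PtsD(2) t] x by blast+
    then show ?thesis
      using t by (auto simp: sepx_def sepv_def mult_less_0_iff)
  qed
  have "sepx x z \<subseteq> T" "sepx x y \<subseteq> T" "sepx y z \<subseteq> T"
    by (auto simp: sepx_def sepv_def)
  then show "sepx x z = (sepx x y - sepx y z) \<union> (sepx y z - sepx x y)"
    using * by blast
next
  fix g x y t assume "g \<in> carrier GX" and xy: "x \<in> Pts" "y \<in> Pts" and t: "t \<in> T"
  then have g: "g \<in> \<Gamma>X"
    by (simp add: GX_carrier)
  obtain A where A: "rep g A"
    using \<Gamma>_rep[OF \<Gamma>XD(1)[OF g]] by blast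
  have gen: "genX (A (\<phi> x))" "genX (A (\<phi> y))"
    using stabiliser_genX[OF \<Gamma>XD[OF g] A] PtsD(2) xy by blast+
  have "g \<otimes>\<^bsub>GX\<^esub> t \<otimes>\<^bsub>GX\<^esub> inv\<^bsub>GX\<^esub> g = cj g t"
    using GX_conj[OF g] t T_\<Gamma>X by blast
  moreover have "sepx (g x) (g y) = sepv (A (\<phi> x)) (A (\<phi> y))"
    unfolding act_\<pi>[OF A xy(1)] act_\<pi>[OF A xy(2)] by (rule sepx_\<pi>[OF gen])
  ultimately show "g \<otimes>\<^bsub>GX\<^esub> t \<otimes>\<^bsub>GX\<^esub> inv\<^bsub>GX\<^esub> g \<in> sepx (g x) (g y) \<longleftrightarrow> t \<in> sepx x y"
    using sepv_act[OF g A t] by (simp add: sepx_def)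
next
  fix t x assume t: "t \<in> T" and x: "x \<in> Pts"
  note t' = T_Rf[OF t] and g = PtsD(2)[OF x]
  have gs: "genX (sk t (\<phi> x))"
    by (rule stabiliser_genX[OF Rf_\<Gamma>[OF t'] T_X[OF t] sk_rep[OF t'] g])
  have "(fn t \<bullet> \<phi> x) * (fn t \<bullet> \<phi> x) > 0"
    using genX_T[OF g t] by (metis not_real_square_gt_zero)
  then have "t \<in> sepv (\<phi> x) (sk t (\<phi> x))"
    using t skew_reflection_flip[OF fn_ax[OF t'], of "\<phi> x"] by (simp add: sepv_def)
  moreover have "sepx x (t x) = sepv (\<phi> x) (sk t (\<phi> x))"
    using sepx_\<pi>[OF g gs] act_\<pi>[OF sk_rep[OF t'] x] PtsD(4)[OF x] by simp
  ultimately show "t \<in> sepx x (t x)"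
    by simp
qed

text \<open>
  By \<open>edge_step_near\<close> any two generic points close to a generic point or to an edge are near in the sense
  of the system of walls, and by \<open>mirror_connectivity\<close> this suffices.
\<close>

lemma near_chain:
  assumes dim: "2 \<le> dim X'" and xy: "x \<in> Pts" "y \<in> Pts"
  shows "(walled_action.near (\<lambda>g x. g x) Pts sepx)\<^sup>*\<^sup>* x y"
proof -
  interpret W: walled_action GX "\<lambda>g x. g x" Pts T sepx
    by (rule walled)
  define R where "R u v \<longleftrightarrow> W.near\<^sup>*\<^sup>* (\<pi> u) (\<pi> v)" for u v
  have "R (\<phi> x) (\<phi> y)"
  proof (rule mirror_connectivity[OF dim, of "X' \<inter> K"])
    show "openin (top_of_set X') (X' \<inter> K)"
      using open_K by (rule openin_open_Int)
    show "X' \<inter> K \<subseteq> K"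
      by blast
    show "closed_segment a b \<subseteq> X' \<inter> K"
      if ab: "a \<in> X' \<inter> K" "b \<in> X' \<inter> K" and 0: "0 \<notin> closed_segment a b" for a b
    proof -
      have "closed_segment a b \<subseteq> X'"
        using ab subspace_imp_convex[OF subspace_hyperplane[of "fn s"]]
        by (intro closed_segment_subset) auto
      then show ?thesis
        using segment_K[OF _ _ 0] ab by blast
    qed
    show "R a c" if "R a b" "R b c" for a b c
      using that unfolding R_def by (rule rtranclp_trans)
    fix e r u v
    assume e: "genX e \<or> (\<exists>t. edge e t)" and r: "small e r" and uv: "u \<in> ball e r" "v \<in> ball e r"
      and g: "genX u" "genX v"
    have "W.near (\<pi> u) (\<pi> v)"
    proof -
      from edge_step_near[OF e r uv g]
      have "sepx (\<pi> u) (\<pi> v) = {} \<or> (\<exists>t. sepx (\<pi> u) (\<pi> v) = {t} \<and> sepx (\<pi> u) (t (\<pi> v)) = {})"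
      proof
        assume "sepv u v = {}"
        then show ?thesis
          using sepx_\<pi>[OF g] by simp
      next
        assume "\<exists>t\<in>T. sepv u v = {t} \<and> sepv u (sk t v) = {}"
        then obtain t where t: "t \<in> T" "sepv u v = {t}" "sepv u (sk t v) = {}"
          by blast
        note t' = T_Rf[OF t(1)]
        have gs: "genX (sk t v)"
          by (rule stabiliser_genX[OF Rf_\<Gamma>[OF t'] T_X[OF t(1)] sk_rep[OF t'] g(2)])
        have "sepx (\<pi> u) (t (\<pi> v)) = {}"
          using sepx_\<pi>[OF g(1) gs] rep_\<pi>[OF sk_rep[OF t'] genX_K[OF g(2)]] t(3) by simp
        then show ?thesis
          using sepx_\<pi>[OF g] t(2) by blast
      qed
      then show ?thesis
        unfolding W.near_def using Pts_\<pi> g by blast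
    qed
    then show "R u v"
      unfolding R_def by blast
  qed (use xy PtsD genX_K genX_X in auto)
  then show ?thesis
    unfolding R_def using PtsD(4) xy by simp
qed

definition W :: "('a \<Rightarrow> 'a) set"
  where "W = generate GX T"

lemma W_normal: "W \<lhd> GX"
proof -
  interpret GX: group GX
    by (rule group_GX)
  show ?thesis
    unfolding W_def
    using T_\<Gamma>X cj_T GX_conj by (intro GX.normal_generateI) (auto simp: GX_carrier)
qed

lemma W_\<Gamma>X: "W \<subseteq> \<Gamma>X"
  using normal_imp_subgroup[OF W_normal] subgroup.subset GX_carrier by blast

text \<open>
  Here the cone over \<open>X\<close> lies in a line. An element that moves the point acts on this line, up to a
  positive factor, by \<open>-1\<close>. Its side-preserving version has a square which fixes the generic point \<open>v\<close>
  and is therefore trivial, and so it is a reflection.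
\<close>

lemma two_point_mirror:
  assumes dim: "dim X' = 1" and v: "genX v" and g: "g \<in> \<Gamma>X" "g (\<pi> v) \<noteq> \<pi> v"
  obtains t where "t \<in> T" "t (\<pi> v) \<noteq> \<pi> v"
proof -
  note vK = genX_K[OF v]
  have vX: "v \<in> X'"
    using genX_X[OF v] by simp
  have line: "\<exists>c. w = c *\<^sub>R v" if w: "w \<in> X'" for w
  proof -
    have "independent {v}"
      using K_nonzero[OF vK] by simp
    then have "X' \<subseteq> span {v}"
      using card_ge_dim_independent[of "{v}" X'] dim vX by simp
    then show ?thesis
      using w by (auto simp: span_singleton)
  qed
  obtain A where A: "rep g A"
    using \<Gamma>_rep[OF \<Gamma>XD(1)[OF g(1)]] by blast
  obtain h A1 k where h: "h \<in> \<Gamma>" "h ` X = X" and A1: "rep h A1" and k: "k > 0"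
    "\<forall>v. fn s \<bullet> A1 v = k * (fn s \<bullet> v)" and AA: "\<forall>v. fn s \<bullet> v = 0 \<longrightarrow> A1 v = A v"
    and hh: "\<forall>x\<in>X. h x = g x"
    using side_preserving_version[OF \<Gamma>XD[OF g(1)] A] .
  have \<pi>X: "\<pi> v \<in> X"
    using X_fn[OF vK] vX by simp
  have hv: "h (\<pi> v) \<noteq> \<pi> v"
    using hh \<pi>X g(2) by simp
  have A1v: "genX (A1 v)"
    by (rule stabiliser_genX[OF h A1 v])
  obtain c where c: "A1 v = c *\<^sub>R v"
    using line genX_X[OF A1v] by blast
  have c0: "c < 0"
  proof (rule ccontr)
    assume "\<not> c < 0"
    moreover have "c \<noteq> 0"
      using c K_nonzero[OF genX_K[OF A1v]] by auto
    ultimately have "c > 0"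
      by simp
    then have "h (\<pi> v) = \<pi> v"
      using rep_\<pi>[OF A1 vK] c \<pi>_scale[OF vK] by simp
    then show False
      using hv by blast
  qed
  have cc: "c * c > 0"
    using c0 by (simp add: mult_neg_neg)
  have A2v: "A1 (A1 v) = (c * c) *\<^sub>R v"
    unfolding c using rep_linear[OF A1] c by (simp add: linear_scale)
  have rep2: "rep (gmul h h) (\<lambda>v. A1 (A1 v))"
    unfolding gmul_def by (rule rep_comp[OF A1 A1])
  have inv: "gmul h h = gone"
  proof (rule rigid[OF \<Gamma>_mul[OF h(1) h(1)] rep2 _ _ v])
    show "0 < k * k"
      using k(1) by simp
    show "fn s \<bullet> A1 (A1 v) = k * k * (fn s \<bullet> v)" for v
      using k(2) by simp
    show "genX (A1 (A1 v))"
      unfolding A2v by (rule genX_scale[OF v cc])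
    show "closed_segment v (A1 (A1 v)) \<subseteq> K"
    proof
      fix x assume "x \<in> closed_segment v (A1 (A1 v))"
      then obtain a where a: "0 \<le> a" "a \<le> 1" "x = (1 - a) *\<^sub>R v + a *\<^sub>R ((c * c) *\<^sub>R v)"
        unfolding A2v by (auto simp: closed_segment_def)
      have "x = ((1 - a) + a * (c * c)) *\<^sub>R v"
        unfolding a(3) by (simp add: scaleR_left_distrib)
      moreover have "(1 - a) + a * (c * c) > 0"
        using a(1,2) cc by (cases "a = 0") (auto intro: add_nonneg_pos)
      ultimately show "x \<in> K"
        using scale_K[OF vK] by metis
    qed
    show "(fn t \<bullet> v) * (fn t \<bullet> A1 (A1 v)) > 0" if "t \<in> Rf" "t \<noteq> s" for t
    proof -
      have "(fn t \<bullet> v) * (fn t \<bullet> A1 (A1 v)) = (c * c) * ((fn t \<bullet> v) * (fn t \<bullet> v))"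
        unfolding A2v by simp
      moreover have "(fn t \<bullet> v) * (fn t \<bullet> v) > 0"
        using genX_fn[OF v that] by (metis not_real_square_gt_zero)
      ultimately show ?thesis
        by (simp only: mult_pos_pos cc)
    qed
  qed
  have "gmul h h x = x" if "x \<in> P" for x
    using inv gone_apply[OF that] by simp
  then obtain d where d: "d > 0" "\<And>v. A1 (A1 v) = d *\<^sub>R v"
    using rep_identity_scalar[OF rep2] by blast
  define A' where "A' = (\<lambda>v. (1 / sqrt d) *\<^sub>R A1 v)"
  have sd: "sqrt d > 0" "sqrt d * sqrt d = d"
    using d(1) by simp_all
  have A': "rep h A'"
    unfolding A'_def using rep_scale[OF A1, of "1 / sqrt d"] sd(1) by simp
  have sq: "A' (A' v) = v" for v
    unfolding A'_def using rep_linear[OF A1] d sd by (simp add: linear_scale)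
  define b where "b = c / sqrt d"
  have b: "A' v = b *\<^sub>R v" "b < 0"
    unfolding A'_def b_def using c c0 sd(1) by (simp_all add: divide_neg_pos)
  have mv: "b *\<^sub>R v \<in> K"
    using rep_K[OF A' vK] b(1) by simp
  have minus: "- v \<in> K"
    using scale_K[OF mv, of "- 1 / b"] b(2) by (simp add: divide_neg_neg)
  have "h \<in> T"
  proof (rule involution_reflection[OF h inv A' sq, where z = v and x = v])
    show "0 < k / sqrt d"
      using k(1) sd(1) by simp
    show "fn s \<bullet> A' w = k / sqrt d * (fn s \<bullet> w)" for w
      unfolding A'_def using k(2) by simp
    show "A' w = w" if w: "fn s \<bullet> w = 0" "v \<bullet> w = 0" for w
    proof -
      obtain a where "w = a *\<^sub>R v"
        using line[of w] w(1) by auto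
      then have "w = 0"
        using w(2) K_nonzero[OF vK] by auto
      then show ?thesis
        using rep_linear[OF A'] by (simp add: linear_0)
    qed
    show "fn s \<bullet> v = 0"
      by (rule genX_X[OF v])
    have "(v \<bullet> v) * (v \<bullet> A' v) = b * ((v \<bullet> v) * (v \<bullet> v))"
      by (simp add: b(1))
    moreover have "(v \<bullet> v) * (v \<bullet> v) > 0"
      using K_nonzero[OF vK] by simp
    ultimately show "(v \<bullet> v) * (v \<bullet> A' v) < 0"
      by (simp only: mult_neg_pos b(2))
    show "h \<noteq> s"
      using hv \<pi>X by (auto simp: mir_def)
    fix q u :: 'v
    \<comment> \<open>A reflection needs a nonempty mirror, that is, a vector of \<open>K\<close> in the kernel of \<open>q\<close>. Since \<open>K\<close>
      contains \<open>v\<close> and \<open>- v\<close>, it contains a segment from near \<open>v\<close> to near \<open>- v\<close> that meets this kernel.\<close>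
    assume "q \<bullet> u = 1"
    have "dim {w. q \<bullet> w = 0} \<ge> 1"
      using dim_hyperplane[of q] \<open>q \<bullet> u = 1\<close> dim_ge_2 by fastforce
    then have "\<not> {w. q \<bullet> w = 0} \<subseteq> {0}"
      using dim_eq_0[of "{w. q \<bullet> w = 0}"] by linarith
    then obtain w where w: "q \<bullet> w = 0" "w \<noteq> 0"
      by auto
    show "\<exists>e\<in>K. q \<bullet> e = 0"
    proof (cases "\<exists>a. w = a *\<^sub>R v")
      case True
      then obtain a where "w = a *\<^sub>R v"
        by blast
      then have "q \<bullet> v = 0"
        using w by auto
      then show ?thesis
        using vK by blast
    next
      case False
      obtain d1 where d1: "d1 > 0" "\<And>x. \<bar>x\<bar> \<le> d1 \<Longrightarrow> v + x *\<^sub>R w \<in> K"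
        using small_shift[OF open_K vK] by blast
      obtain d2 where d2: "d2 > 0" "\<And>x. \<bar>x\<bar> \<le> d2 \<Longrightarrow> - v + x *\<^sub>R w \<in> K"
        using small_shift[OF open_K minus] by blast
      define \<epsilon> where "\<epsilon> = min d1 d2"
      have \<epsilon>: "\<epsilon> > 0" "\<bar>\<epsilon>\<bar> \<le> d1" "\<bar>\<epsilon>\<bar> \<le> d2"
        using d1(1) d2(1) by (auto simp: \<epsilon>_def)
      let ?p = "v + \<epsilon> *\<^sub>R w" and ?m = "- v + \<epsilon> *\<^sub>R w"
      have pt: "(1 - x) *\<^sub>R ?p + x *\<^sub>R ?m = (1 - 2 * x) *\<^sub>R v + \<epsilon> *\<^sub>R w" for x
      proof -
        have "1 - 2 * x = (1 - x) - x"
          by simp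
        then show ?thesis
          by (simp only: scaleR_left_diff_distrib) (simp add: algebra_simps)
      qed
      have "0 \<notin> closed_segment ?p ?m"
      proof
        assume "0 \<in> closed_segment ?p ?m"
        then obtain x where "(1 - 2 * x) *\<^sub>R v + \<epsilon> *\<^sub>R w = 0"
          unfolding closed_segment_def using pt by force
        then have "\<epsilon> *\<^sub>R w = (2 * x - 1) *\<^sub>R v"
          by (simp add: eq_neg_iff_add_eq_0[symmetric] algebra_simps)
        then have "(1 / \<epsilon>) *\<^sub>R (\<epsilon> *\<^sub>R w) = (1 / \<epsilon>) *\<^sub>R ((2 * x - 1) *\<^sub>R v)"
          by simp
        then have "w = ((2 * x - 1) / \<epsilon>) *\<^sub>R v"
          using \<epsilon>(1) by simp
        then show False
          using False by blast
      qed
      then have "closed_segment ?p ?m \<subseteq> K"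
        using segment_K d1(2)[OF \<epsilon>(2)] d2(2)[OF \<epsilon>(3)] by blast
      moreover have "\<epsilon> *\<^sub>R w \<in> closed_segment ?p ?m"
        unfolding closed_segment_def using pt[of "1/2"] by (intro CollectI exI[of _ "1/2"]) simp
      ultimately have "\<epsilon> *\<^sub>R w \<in> K"
        by blast
      then show ?thesis
        using w(1) by (intro bexI[of _ "\<epsilon> *\<^sub>R w"]) simp_all
    qed
  qed
  then show ?thesis
    using that hv by blast
qed

section \<open>Rolling\<close>

lemma genX_two_chambers:
  assumes w: "genX w" and k: "k \<in> \<Gamma>" "w \<in> ch k" and k': "k' \<in> \<Gamma>" "w \<in> ch k'"
  shows "k' = k \<or> k' = gmul s k"
proof -
  obtain r where r: "small w r"
    using mirrors_locally_finite[OF genX_K[OF w]] by metis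
  have wb: "w \<in> ball w r"
    using small_pos[OF r] by simp
  obtain u where u: "u \<in> ball w r" "u \<in> interior (ch k)"
    using ch_interior_dense[OF k open_ball wb] .
  obtain u' where u': "u' \<in> ball w r" "u' \<in> interior (ch k')"
    using ch_interior_dense[OF k' open_ball wb] .
  have uk: "u \<in> ch k" "u' \<in> ch k'"
    using u(2) u'(2) interior_subset[of "ch k"] interior_subset[of "ch k'"] by auto
  note g' = interior_gen[OF k'(1) u'(2)]
  have only: "t = s" if "t \<in> Rf" "fn t \<bullet> w = 0" for t
    using genX_fn[OF w that(1)] that(2) by blast
  have "fn s \<bullet> u \<noteq> 0" "fn s \<bullet> u' \<noteq> 0"
    using mirror_avoids_interior[OF k(1) u(2) s_Rf] mirror_avoids_interior[OF k'(1) u'(2) s_Rf] .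
  then consider "(fn s \<bullet> u) * (fn s \<bullet> u') > 0" | "(fn s \<bullet> u) * (fn s \<bullet> u') < 0"
    by (metis linorder_neqE_linordered_idom mult_eq_0_iff)
  then show ?thesis
  proof cases
    case 1
    have "u' \<in> ch k"
      by (rule small_same_chamber[OF r u(1) u'(1) _ k(1) uk(1)]) (use only 1 in auto)
    then show ?thesis
      using gen_unique[OF g' k'(1) k(1) uk(2)] by blast
  next
    case 2
    have "\<exists>c. fn t = c *\<^sub>R fn s" if "t \<in> Rf" "fn t \<bullet> w = 0" for t
      using only[OF that] by (intro exI[of _ 1]) simp
    then have "u' \<in> ch (gmul s k)"
      using small_opposite_chamber[OF r u(1) u'(1) interior_gen[OF k(1) u(2)] s_Rf 2 _ k(1) uk(1)]
      by blast
    then show ?thesis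
      using gen_unique[OF g' k'(1) \<Gamma>_mul[OF Rf_\<Gamma>[OF s_Rf] k(1)] uk(2)] by blast
  qed
qed

lemma facet_other_side: "k \<in> \<Gamma> \<Longrightarrow> k ` D \<inter> X \<subseteq> gmul s k ` D \<inter> X"
proof
  fix x assume k: "k \<in> \<Gamma>" and x: "x \<in> k ` D \<inter> X"
  then obtain y where y: "y \<in> D" "x = k y"
    by blast
  have "gmul s k y = s x"
    using y D_P gmul_apply[of y s k] by auto
  also have "\<dots> = x"
    using x by (simp add: mir_def)
  finally show "x \<in> gmul s k ` D \<inter> X"
    using x y(1) by (metis IntE IntI imageI)
qed

lemma facet_unique:
  assumes w: "genX w" and k: "k \<in> \<Gamma>" "w \<in> ch k" and k': "k' \<in> \<Gamma>" "w \<in> ch k'"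
  shows "k ` D \<inter> X = k' ` D \<inter> X"
proof (rule equalityI)
  have *: "k ` D \<inter> X \<subseteq> k' ` D \<inter> X"
    if "genX w" "k \<in> \<Gamma>" "w \<in> ch k" "k' \<in> \<Gamma>" "w \<in> ch k'" for k k'
    using genX_two_chambers[OF that] facet_other_side[OF that(2)] by auto
  show "k ` D \<inter> X \<subseteq> k' ` D \<inter> X" "k' ` D \<inter> X \<subseteq> k ` D \<inter> X"
    using * assms by blast+
qed

text \<open>
  Let \<open>v\<close> be across the edge, in the chamber of \<open>g2 = h g\<close>, and let \<open>I\<close> be the hyperedge. Both chambers
  contain \<open>I\<close> near \<open>e\<close>, so \<open>h\<close> fixes \<open>I\<close>, and the facet of the second chamber in \<open>X\<close> is the image of a
  facet \<open>G'\<close> of the first. If \<open>G'\<close> were the old facet \<open>H\<close>, then \<open>h\<close> would preserve \<open>X\<close> and flip it across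
  \<open>I\<close>, which \<open>flip_gives_orthogonal\<close> excludes. The label of \<open>I\<close> is odd because no orthogonal mirror
  passes through \<open>e\<close>. So \<open>h\<close> provides a rolling step.
\<close>

lemma roll_facet:
  assumes et: "edge e t" and noT: "\<And>q. q \<in> T \<Longrightarrow> fn q \<bullet> e \<noteq> 0" and r: "small e r"
    and uv: "u \<in> ball e r" "v \<in> ball e r" "genX u" "genX v"
    and g: "g \<in> \<Gamma>" and f: "facet S \<Gamma> (g ` D) H" "H \<subseteq> X" and uH: "\<pi> u \<in> H"
  shows "\<pi> v \<in> H \<or> (\<exists>C'' H''. roll_step S \<Gamma> X (g ` D, H) (C'', H'') \<and> \<pi> v \<in> H'')"
proof -
  note eK = edgeD(1)[OF et] and se = edgeD(2)[OF et] and t = edgeD(3,4)[OF et] and te = edgeD(5)[OF et]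
  have HX: "H = g ` D \<inter> X"
    by (rule facet_in_X(1)[OF g f])
  have uK: "u \<in> K" "v \<in> K" and uX: "u \<in> X'" "v \<in> X'" and \<pi>X: "\<pi> u \<in> X" "\<pi> v \<in> X"
    using genX_K genX_X X_fn uv(3,4) by auto
  have ug: "u \<in> ch g"
    using uH HX ch_iff[OF uK(1)] by blast
  have tuv: "fn t \<bullet> u \<noteq> 0" "fn t \<bullet> v \<noteq> 0"
    using genX_fn t uv(3,4) by blast+
  then consider "(fn t \<bullet> u) * (fn t \<bullet> v) > 0" | "(fn t \<bullet> u) * (fn t \<bullet> v) < 0"
    by (metis linorder_neqE_linordered_idom mult_eq_0_iff)
  then show ?thesis
  proof cases
    case 1
    have "v \<in> ch g"
      using edge_same_chamber[OF et r uv(1,2) uX 1 g ug] .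
    then show ?thesis
      using HX ch_iff[OF uK(2)] \<pi>X by blast
  next
    case 2
    obtain g2 where g2: "g2 \<in> \<Gamma>" "v \<in> ch g2"
      using ch_cover[OF uK(2)] by blast
    define h where "h = gmul g2 (ginv g)"
    have h: "h \<in> \<Gamma>"
      unfolding h_def using \<Gamma>_mul \<Gamma>_inv g g2(1) by blast
    have hg: "gmul h g = g2"
      unfolding h_def using gmul_inv_right'[OF g g2(1)] .
    \<comment> \<open>\<open>H2\<close> is the next facet, and \<open>I\<close> is the hyperedge between \<open>H\<close> and \<open>H2\<close>.\<close>
    define H2 where "H2 = g2 ` D \<inter> X"
    have f2: "facet S \<Gamma> (g2 ` D) H2"
      unfolding H2_def by (rule facet_at_genX[OF g2(1) uv(4) g2(2)])
    define I where "I = g ` D \<inter> (X \<inter> mir t)"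
    let ?L = "{w. fn s \<bullet> w = 0 \<and> fn t \<bullet> w = 0}"
    have sL: "subspace ?L"
      by (auto simp: subspace_def inner_add_right)
    have IP: "I \<subseteq> P"
      unfolding I_def using X_P by blast
    have L1: "w \<in> ch g" if "w \<in> ball e r" "w \<in> ?L" for w
      using edge_in_chamber[OF et r uv(1,3) g ug that(1)] that(2) by blast
    have L2: "w \<in> ch g2" if "w \<in> ball e r" "w \<in> ?L" for w
      using edge_in_chamber[OF et r uv(2,4) g2 that(1)] that(2) by blast
    have eb: "e \<in> ball e r" "e \<in> ?L"
      using small_pos[OF r] se te by auto
    have hatI: "hat I = ch g \<inter> ?L"
    proof (intro equalityI subsetI)
      fix w assume "w \<in> hat I"
      then have w: "w \<in> K" "\<pi> w \<in> g ` D" "\<pi> w \<in> X" "\<pi> w \<in> mir t"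
        by (auto simp: hat_def I_def)
      then show "w \<in> ch g \<inter> ?L"
        using ch_iff[OF w(1)] X_fn[OF w(1)] mir_fn[OF t(1) w(1)] by auto
    next
      fix w assume w: "w \<in> ch g \<inter> ?L"
      then have wK: "w \<in> K"
        using ch_K by blast
      then show "w \<in> hat I"
        using w ch_iff[OF wK] X_fn[OF wK] mir_fn[OF t(1) wK] by (auto simp: hat_def I_def)
    qed
    have eI: "\<pi> e \<in> I"
      using L1[OF eb] eb(2) hatI by (auto simp: hat_def)
    have "is_face S \<Gamma> (g ` D) I"
      unfolding is_face_def mirrors_eq using eI s_Rf t(1)
      by (intro conjI exI[of _ "{X, mir t}"]) (auto simp: I_def)
    moreover have dimI: "dim (hat I) + 2 = DIM('v)"
    proof -
      have 1: "dim ?L + 2 = DIM('v)"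
        using dim_two_hyperplanes[OF fn_nonzero[OF s_Rf] fn_not_proportional[OF t]] .
      have "?L \<inter> ball e r \<subseteq> hat I"
        unfolding hatI using L1 by blast
      then have "dim (?L \<inter> ball e r) \<le> dim (hat I)"
        by (rule dim_subset)
      moreover have "dim (?L \<inter> ball e r) = dim ?L"
        using dim_openin[OF openin_open_Int[OF open_ball] sL, of e r] eb by blast
      moreover have "dim (hat I) \<le> dim ?L"
        unfolding hatI by (rule dim_subset) blast
      ultimately show ?thesis
        using 1 by linarith
    qed
    then have "dimension_in S I = dimension_in S P - 2"
      using dimension_hat[OF IP] dimension_points by simp
    ultimately have hy: "hyperedge S \<Gamma> (g ` D) I"
      unfolding hyperedge_def by blast
    have IH: "I \<subseteq> H"
      unfolding HX I_def by blast
    have IX: "I \<subseteq> X"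
      unfolding I_def by blast
    have odd: "odd (label S \<Gamma> I)"
    proof
      assume "even (label S \<Gamma> I)"
      then obtain q where q: "q \<in> T" "I \<subseteq> mir q"
        using orthogonal_if_even_label[OF eI _ IX] eI IP by blast
      then have "fn q \<bullet> e = 0"
        using eI mir_fn[OF T_Rf[OF q(1)] eK] by blast
      then show False
        using noT[OF q(1)] by blast
    qed
    have hfix: "h (\<pi> w) = \<pi> w" if w: "w \<in> ball e r" "w \<in> ?L" for w
      using chamber_transition_fixes[OF dim_ge_2 g h L1[OF w]] L2[OF w] hg by simp
    have he: "h (\<pi> e) = \<pi> e"
      using hfix[OF eb] .
    obtain A where A: "rep h A" "A e = e"
      using rep_fixing_point[OF \<Gamma>_isometries[OF h] eK he] .
    have bK: "ball e r \<subseteq> K"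
      using small_K[OF r] by blast
    obtain c where c: "c > 0" "\<And>w. w \<in> ?L \<Longrightarrow> A w = c *\<^sub>R w"
      using fixed_scalar[OF A(1) sL open_ball eb bK hfix] by blast
    have hL: "h (\<pi> w) = \<pi> w" if w: "w \<in> K" "fn s \<bullet> w = 0" "fn t \<bullet> w = 0" for w
      using rep_\<pi>[OF A(1) w(1)] c(2)[of w] w \<pi>_scale[OF w(1) c(1)] by simp
    have hI: "h x = x" if x: "x \<in> I" for x
    proof -
      have xP: "x \<in> P"
        using x IP by blast
      have "\<phi> x \<in> hat I"
        using x \<phi>_K[OF xP] \<pi>_\<phi>[OF xP] by (simp add: hat_def)
      then show ?thesis
        using hL[OF \<phi>_K[OF xP]] hatI \<pi>_\<phi>[OF xP] by simp
    qed
    define G' where "G' = ginv h ` H2"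
    have g2D: "g2 ` D = h ` g ` D"
      unfolding hg[symmetric] using D_P by (force simp: gmul_def compose_def image_image)
    have gD: "ginv h ` (g2 ` D) = g ` D"
      unfolding g2D using ginv_l[OF h] chamber_P[OF g] by (force simp: image_image)
    have fG: "facet S \<Gamma> (g ` D) G'"
      using facet_image[OF \<Gamma>_inv[OF h] chamber_P[OF g2(1)] f2] unfolding gD G'_def .
    have H2P: "H2 \<subseteq> P"
      unfolding H2_def using X_P by blast
    have hG: "h ` G' = H2"
      unfolding G'_def using ginv_r[OF h] H2P by (force simp: image_image)
    have IG: "I \<subseteq> G'"
    proof
      fix x assume x: "x \<in> I"
      have "x \<in> g2 ` D"
        unfolding g2D using hI[OF x] x unfolding I_def by (metis IntD1 imageI)
      then have "x \<in> H2"
        using x IX unfolding H2_def by blast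
      moreover have "ginv h x = x"
        using ginv_l[OF h, of x] hI[OF x] x IP by auto
      ultimately show "x \<in> G'"
        unfolding G'_def by (metis imageI)
    qed
    have vH: "\<pi> v \<notin> H"
    proof
      assume "\<pi> v \<in> H"
      then have "v \<in> ch g"
        using HX ch_iff[OF uK(2)] by blast
      then show False
        using chamber_side[OF g ug _ t(1), of v] 2 by simp
    qed
    have vH2: "\<pi> v \<in> H2"
      unfolding H2_def using g2(2) ch_iff[OF uK(2)] \<pi>X by blast
    have GH: "G' \<noteq> H"
    proof
      assume "G' = H"
      then have hH: "h ` H = H2"
        using hG by simp
      obtain \<rho> where \<rho>: "small u \<rho>"
        using mirrors_locally_finite[OF uK(1)] by metis
      define z where "z = adjoint A (fn s)"
      have z: "z \<bullet> w = fn s \<bullet> A w" for w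
        using adjoint_works[OF rep_linear[OF A(1)], of w "fn s"] by (simp add: z_def inner_commute)
      \<comment> \<open>Since \<open>h\<close> maps the facet \<open>H\<close>, a neighbourhood of \<open>u\<close> in \<open>X\<close>, into \<open>X\<close>, it preserves \<open>X\<close>.\<close>
      have "z \<bullet> w = 0" if w: "w \<in> ball u \<rho>" "fn s \<bullet> w = 0" for w
      proof -
        have wK: "w \<in> K"
          using small_K[OF \<rho> w(1)] .
        have "w \<in> ch g"
          using genX_neighbourhood[OF uv(3) \<rho> g ug w(1)] w(2) by simp
        then have "\<pi> w \<in> H"
          unfolding HX using ch_iff[OF wK] X_fn[OF wK] w(2) by simp
        then have "h (\<pi> w) \<in> X"
          using hH unfolding H2_def by blast
        then show ?thesis
          using X_fn[OF rep_K[OF A(1) wK]] rep_\<pi>[OF A(1) wK] z by simp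
      qed
      moreover have "u \<in> ball u \<rho>" "fn s \<bullet> u = 0"
        using small_pos[OF \<rho>] genX_X[OF uv(3)] by auto
      ultimately obtain k where k: "z = k *\<^sub>R fn s"
        using functional_proportional[OF open_ball] by metis
      have "h x \<in> X" if x: "x \<in> X" for x
      proof -
        have xP: "x \<in> P"
          using x X_P by blast
        have "fn s \<bullet> \<phi> x = 0"
          using X_fn[OF \<phi>_K[OF xP]] \<pi>_\<phi>[OF xP] x by simp
        then have "fn s \<bullet> A (\<phi> x) = 0"
          using z[of "\<phi> x"] k by simp
        then show ?thesis
          using X_fn[OF rep_K[OF A(1) \<phi>_K[OF xP]]] rep_\<pi>[OF A(1) \<phi>_K[OF xP]] \<pi>_\<phi>[OF xP] by simp
      qed
      then have "mir (cj h s) \<subseteq> X"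
        unfolding cj_Rf(2)[OF h s_Rf] by (rule image_subsetI)
      then have "s = cj h s"
        by (rule mir_subset_eq[OF cj_Rf(1)[OF h s_Rf] s_Rf])
      then have hX: "h ` X = X"
        using cj_Rf(2)[OF h s_Rf] by simp
      have Au: "A u \<in> ch g2"
        using ch_rep[OF g h A(1) uK(1)] ug hg by simp
      have "genX (A u)"
        using stabiliser_genX[OF h hX A(1) uv(3)] .
      then have "fn t \<bullet> A u \<noteq> 0"
        using genX_fn t by blast
      moreover have "(fn t \<bullet> A u) * (fn t \<bullet> v) \<ge> 0"
        using chamber_side[OF g2(1) Au g2(2) t(1)] .
      ultimately have "(fn t \<bullet> u) * (fn t \<bullet> A u) < 0"
        using 2 tuv by (auto simp: mult_less_0_iff zero_le_mult_iff)
      then obtain q where "q \<in> T" "fn q \<bullet> e = 0"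
        using flip_gives_orthogonal[OF et r uv(1,3) h hX A hL] by blast
      then show False
        using noT by blast
    qed
    have "roll_step S \<Gamma> X (g ` D, H) (h ` g ` D, h ` G')"
    proof (rule roll_step.intros[OF f hy IH odd fG GH IG h])
      show "\<forall>x\<in>I. h x = x"
        using hI by blast
      show "h ` G' \<subseteq> X"
        unfolding hG H2_def by blast
      show "h ` G' \<noteq> H"
        unfolding hG using vH vH2 by blast
    qed
    then show ?thesis
      using vH2 unfolding hG by blast
  qed
qed

text \<open>
  Both facets contain \<open>I\<close>, and each lies on one side of every mirror. So a mirror which separates them
  contains \<open>I\<close>; if it is orthogonal to \<open>X\<close>, then the label of \<open>I\<close> is even.
\<close>

lemma roll_step_same_side:
  assumes g: "g \<in> \<Gamma>" and st: "roll_step S \<Gamma> X (g ` D, H) (C'', H'')"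
  obtains g'' where "g'' \<in> \<Gamma>" "C'' = g'' ` D" "facet S \<Gamma> C'' H''" "H'' \<subseteq> X"
    "\<forall>u v. genX u \<and> genX v \<and> \<pi> u \<in> H \<and> \<pi> v \<in> H'' \<longrightarrow> sepv u v = {}"
proof -
  from st obtain I G' \<gamma> where f: "facet S \<Gamma> (g ` D) H" "H \<subseteq> X" and hy: "hyperedge S \<Gamma> (g ` D) I"
    and IH: "I \<subseteq> H" and od: "odd (label S \<Gamma> I)" and fG: "facet S \<Gamma> (g ` D) G'"
    and IG: "I \<subseteq> G'" and \<gamma>: "\<gamma> \<in> \<Gamma>" "\<forall>x\<in>I. \<gamma> x = x" and GX: "\<gamma> ` G' \<subseteq> X"
    and C'': "C'' = \<gamma> ` g ` D" "H'' = \<gamma> ` G'"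
    by cases auto
  have gg: "gmul \<gamma> g \<in> \<Gamma>"
    using \<Gamma>_mul[OF \<gamma>(1) g] .
  have C2: "C'' = gmul \<gamma> g ` D"
    unfolding C''(1) using D_P by (force simp: gmul_def compose_def image_image)
  have f2: "facet S \<Gamma> C'' H''"
    unfolding C'' by (rule facet_image[OF \<gamma>(1) chamber_P[OF g] fG])
  have H2X: "H'' \<subseteq> X"
    using GX C''(2) by simp
  have H1: "H = g ` D \<inter> X"
    by (rule facet_in_X(1)[OF g f])
  have H2: "H'' = gmul \<gamma> g ` D \<inter> X"
    using facet_in_X(1)[OF gg _ H2X] f2 C2 by simp
  have IX: "I \<subseteq> X"
    using IH f(2) by blast
  have IP: "I \<subseteq> P"
    using IX X_P by blast
  obtain x0 where x0: "x0 \<in> I"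
    using hy unfolding hyperedge_def is_face_def by blast
  have dimI: "dim (hat I) + 2 = DIM('v)"
    using hy dimension_hat[OF IP] dimension_points unfolding hyperedge_def by linarith
  have "sepv u v = {}" if u: "genX u" "\<pi> u \<in> H" and v: "genX v" "\<pi> v \<in> H''" for u v
  proof (rule ccontr)
    assume "sepv u v \<noteq> {}"
    then obtain t where t: "t \<in> T" "(fn t \<bullet> u) * (fn t \<bullet> v) < 0"
      unfolding sepv_def by blast
    note t' = T_Rf[OF t(1)]
    have uch: "u \<in> ch g" and vch: "v \<in> ch (gmul \<gamma> g)"
      using u v H1 H2 ch_iff[OF genX_K] by auto
    have "x \<in> mir t" if x: "x \<in> I" for x
    proof -
      have xP: "x \<in> P"
        using x IP by blast
      have "x \<in> H"
        using x IH by blast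
      moreover have "x \<in> H''"
        unfolding C''(2) using x IG \<gamma>(2) by (metis imageI subsetD)
      ultimately have "\<phi> x \<in> ch g" "\<phi> x \<in> ch (gmul \<gamma> g)"
        using H1 H2 ch_iff[OF \<phi>_K[OF xP]] \<pi>_\<phi>[OF xP] by auto
      then have "(fn t \<bullet> u) * (fn t \<bullet> \<phi> x) \<ge> 0" "(fn t \<bullet> v) * (fn t \<bullet> \<phi> x) \<ge> 0"
        using chamber_side[OF g uch _ t'] chamber_side[OF gg vch _ t'] by auto
      then have "fn t \<bullet> \<phi> x = 0"
        using t(2) by (auto simp: mult_less_0_iff zero_le_mult_iff)
      then show ?thesis
        using mir_fn[OF t' \<phi>_K[OF xP]] \<pi>_\<phi>[OF xP] by simp
    qed
    then have "even (label S \<Gamma> I)"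
      using even_label_if_orthogonal[OF x0 _ IX dimI t(1)] x0 IP by blast
    then show False
      using od by blast
  qed
  then show ?thesis
    using that[OF gg C2 f2 H2X] by blast
qed

end

locale rolling_model = mirror_model S \<phi> \<pi> K \<Gamma> D s
  for S :: "'a::euclidean_space geometry" and \<phi> :: "'a \<Rightarrow> 'v::euclidean_space"
    and \<pi> :: "'v \<Rightarrow> 'a" and K :: "'v set" and \<Gamma> :: "('a \<Rightarrow> 'a) set" and D :: "'a set"
    and s :: "'a \<Rightarrow> 'a" +
  fixes c0 :: "'a \<Rightarrow> 'a" and F :: "'a set"
  assumes c0: "c0 \<in> \<Gamma>" and F_facet: "facet S \<Gamma> (c0 ` D) F" and F_X: "F \<subseteq> X"
begin

abbreviation C :: "'a set"
  where "C \<equiv> c0 ` D"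

abbreviation \<R> :: "'a set set"
  where "\<R> \<equiv> rolled_facets S \<Gamma> X C F"

abbreviation B :: "'a set"
  where "B \<equiv> rolled_domain S \<Gamma> X C F"

definition v0 :: 'v
  where "v0 = (SOME v. genX v \<and> v \<in> ch c0)"

lemma v0: "genX v0" "v0 \<in> ch c0"
  using someI_ex[OF facet_in_X(2)[OF c0 F_facet F_X]] unfolding v0_def by blast+

lemma F_eq: "F = C \<inter> X"
  by (rule facet_in_X(1)[OF c0 F_facet F_X])

lemma \<pi>_v0: "\<pi> v0 \<in> F"
  using v0 ch_iff[OF genX_K[OF v0(1)]] X_fn[OF genX_K[OF v0(1)]] genX_X[OF v0(1)] unfolding F_eq by simp

lemma reached_facet:
  assumes "(roll_step S \<Gamma> X)\<^sup>*\<^sup>* (C, F) (C', H)"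
  shows "\<exists>g\<in>\<Gamma>. C' = g ` D \<and> facet S \<Gamma> C' H \<and> H \<subseteq> X \<and>
    (\<forall>v. genX v \<and> \<pi> v \<in> H \<longrightarrow> sepv v0 v = {})"
  using assms
proof (induction rule: rtranclp_induct2)
  case refl
  have "sepv v0 v = {}" if v: "genX v" "\<pi> v \<in> F" for v
  proof -
    have "v \<in> ch c0"
      using v ch_iff[OF genX_K[OF v(1)]] unfolding F_eq by blast
    then have "(fn t \<bullet> v0) * (fn t \<bullet> v) \<ge> 0" if "t \<in> T" for t
      using chamber_side[OF c0 v0(2) _ T_Rf[OF that]] by blast
    then show ?thesis
      unfolding sepv_def by fastforce
  qed
  then show ?case
    using c0 F_facet F_X by blast
next
  case (step C1 H1 C2 H2)
  then obtain g where g: "g \<in> \<Gamma>" "C1 = g ` D" "facet S \<Gamma> C1 H1" "H1 \<subseteq> X"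
    and g0: "\<forall>v. genX v \<and> \<pi> v \<in> H1 \<longrightarrow> sepv v0 v = {}"
    by blast
  obtain g2 where g2: "g2 \<in> \<Gamma>" "C2 = g2 ` D" "facet S \<Gamma> C2 H2" "H2 \<subseteq> X"
    and sep: "\<forall>u v. genX u \<and> genX v \<and> \<pi> u \<in> H1 \<and> \<pi> v \<in> H2 \<longrightarrow> sepv u v = {}"
    using roll_step_same_side[OF g(1)] step.hyps(2) g(2) by blast
  obtain u where u: "genX u" "u \<in> ch g"
    using facet_in_X(2)[OF g(1) _ g(4)] g(2,3) by blast
  have H1: "H1 = g ` D \<inter> X"
    using facet_in_X(1)[OF g(1) _ g(4)] g(2,3) by blast
  have uH: "\<pi> u \<in> H1"
    using u ch_iff[OF genX_K[OF u(1)]] X_fn[OF genX_K[OF u(1)]] genX_X[OF u(1)] unfolding H1 by simp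
  have "sepv v0 v = {}" if v: "genX v" "\<pi> v \<in> H2" for v
  proof -
    have 1: "\<forall>t\<in>T. (fn t \<bullet> v0) * (fn t \<bullet> u) > 0"
      using g0 u uH sepv_empty_iff[OF v0(1) u(1)] by blast
    have 2: "\<forall>t\<in>T. (fn t \<bullet> u) * (fn t \<bullet> v) > 0"
      using sep u uH v sepv_empty_iff[OF u(1) v(1)] by blast
    have "\<forall>t\<in>T. (fn t \<bullet> v0) * (fn t \<bullet> v) > 0"
      using sign_transfer 1 2 by blast
    then show ?thesis
      using sepv_empty_iff[OF v0(1) v(1)] by blast
  qed
  then show ?case
    using g2 by blast
qed

lemma rolled_facet:
  assumes "H \<in> \<R>"
  obtains C' g where "(roll_step S \<Gamma> X)\<^sup>*\<^sup>* (C, F) (C', H)" "g \<in> \<Gamma>" "C' = g ` D"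
    "facet S \<Gamma> C' H" "H \<subseteq> X" "\<forall>v. genX v \<and> \<pi> v \<in> H \<longrightarrow> sepv v0 v = {}"
proof -
  obtain C' where "(roll_step S \<Gamma> X)\<^sup>*\<^sup>* (C, F) (C', H)"
    using assms unfolding rolled_facets_def by blast
  then show ?thesis
    using reached_facet that by blast
qed

lemma F_rolled: "F \<in> \<R>"
  unfolding rolled_facets_def by blast

lemma rolled_facet_X: "H \<in> \<R> \<Longrightarrow> H \<subseteq> X"
  using rolled_facet by blast

lemma B_X: "B \<subseteq> X"
  unfolding rolled_domain_def using rolled_facet_X by blast

text \<open>
  The points of \<open>X\<close> which no orthogonal mirror separates from \<open>F\<close> form the domain \<open>Q\<close>. No orthogonal
  mirror meets \<open>Q\<close>, so rolling crosses every edge in \<open>Q\<close>, and \<open>mirror_connectivity\<close> leads from \<open>F\<close> to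
  each facet in \<open>Q\<close>.
\<close>

lemma unseparated_rolled:
  assumes dim: "2 \<le> dim X'" and v: "genX v" "sepv v0 v = {}"
  shows "\<exists>H\<in>\<R>. \<pi> v \<in> H"
proof -
  \<comment> \<open>the cone over the domain of \<open>X\<close> that contains \<open>v0\<close>\<close>
  define Q where "Q = {w \<in> K. fn s \<bullet> w = 0 \<and> (\<forall>t\<in>T. (fn t \<bullet> v0) * (fn t \<bullet> w) > 0)}"
  have opQ: "openin (top_of_set X') Q"
    unfolding openin_contains_ball
  proof (intro conjI ballI)
    show "Q \<subseteq> X'"
      unfolding Q_def by blast
    fix e assume e: "e \<in> Q"
    then have eK: "e \<in> K"
      unfolding Q_def by blast
    obtain r where r: "small e r"
      using mirrors_locally_finite[OF eK] by metis
    have "w \<in> Q" if w: "w \<in> ball e r" "w \<in> X'" for w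
    proof -
      have "(fn t \<bullet> v0) * (fn t \<bullet> w) > 0" if t: "t \<in> T" for t
      proof -
        have 1: "(fn t \<bullet> v0) * (fn t \<bullet> e) > 0"
          using e t unfolding Q_def by blast
        then have "fn t \<bullet> e \<noteq> 0"
          by auto
        moreover have "e \<in> ball e r"
          using small_pos[OF r] by simp
        ultimately have "(fn t \<bullet> e) * (fn t \<bullet> w) > 0"
          using small_sign[OF r T_Rf[OF t] _ _ w(1)] by blast
        then show ?thesis
          using 1 sign_transfer by blast
      qed
      then show ?thesis
        unfolding Q_def using w(2) small_K[OF r w(1)] by blast
    qed
    then show "\<exists>\<epsilon>>0. ball e \<epsilon> \<inter> X' \<subseteq> Q"
      using small_pos[OF r] by blast
  qed
  have QK: "Q \<subseteq> K"
    unfolding Q_def by blast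
  have seg: "closed_segment a b \<subseteq> Q" if ab: "a \<in> Q" "b \<in> Q" and 0: "0 \<notin> closed_segment a b" for a b
  proof
    fix x assume x: "x \<in> closed_segment a b"
    have "closed_segment a b \<subseteq> K"
      using segment_K[OF _ _ 0] ab QK by blast
    moreover have "closed_segment a b \<subseteq> X'"
      using ab subspace_imp_convex[OF subspace_hyperplane[of "fn s"]] unfolding Q_def
      by (intro closed_segment_subset) auto
    moreover have "(fn t \<bullet> v0) * (fn t \<bullet> x) > 0" if t: "t \<in> T" for t
    proof -
      have 1: "(fn t \<bullet> v0) * (fn t \<bullet> a) > 0" and 2: "(fn t \<bullet> v0) * (fn t \<bullet> b) > 0"
        using ab t unfolding Q_def by blast+
      have "(fn t \<bullet> a) * (fn t \<bullet> b) > 0"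
        using sign_transfer[of "fn t \<bullet> a" "fn t \<bullet> v0" "fn t \<bullet> b"] 1 2 by (simp add: mult.commute)
      then have "(fn t \<bullet> a) * (fn t \<bullet> x) > 0"
        using x by (rule segment_positive)
      then show ?thesis
        using 1 sign_transfer by blast
    qed
    ultimately show "x \<in> Q"
      unfolding Q_def using x by blast
  qed
  define R where "R u w \<longleftrightarrow> ((\<exists>H\<in>\<R>. \<pi> u \<in> H) \<longrightarrow> (\<exists>H\<in>\<R>. \<pi> w \<in> H))" for u w
  have "R v0 v"
  proof (rule mirror_connectivity[OF dim opQ QK seg _ _ _ _ v0(1) v(1)])
    show "R x y \<Longrightarrow> R y z \<Longrightarrow> R x z" for x y z
      unfolding R_def by blast
    have sq: "(fn t \<bullet> v0) * (fn t \<bullet> v0) > 0" if "t \<in> T" for t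
      using genX_T[OF v0(1) that] by (metis not_real_square_gt_zero)
    then show "v0 \<in> Q"
      unfolding Q_def using genX_K[OF v0(1)] genX_X[OF v0(1)] by blast
    show "v \<in> Q"
      unfolding Q_def using genX_K[OF v(1)] genX_X[OF v(1)] v(2) sepv_empty_iff[OF v0(1) v(1)] by blast
    fix e r u w
    assume e: "e \<in> Q" "genX e \<or> (\<exists>t. edge e t)" and r: "small e r"
      and uw: "u \<in> ball e r" "w \<in> ball e r" "genX u" "genX w"
    have noT: "fn q \<bullet> e \<noteq> 0" if "q \<in> T" for q
      using e(1) that unfolding Q_def by force
    show "R u w"
      unfolding R_def
    proof
      assume "\<exists>H\<in>\<R>. \<pi> u \<in> H"
      then obtain H where H: "H \<in> \<R>" "\<pi> u \<in> H"
        by blast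
      obtain C' g where C': "(roll_step S \<Gamma> X)\<^sup>*\<^sup>* (C, F) (C', H)" and g: "g \<in> \<Gamma>" "C' = g ` D"
        and f: "facet S \<Gamma> C' H" "H \<subseteq> X" and "\<forall>v. genX v \<and> \<pi> v \<in> H \<longrightarrow> sepv v0 v = {}"
        using rolled_facet[OF H(1)] .
      have f': "facet S \<Gamma> (g ` D) H"
        using f(1) g(2) by simp
      from e(2) show "\<exists>H\<in>\<R>. \<pi> w \<in> H"
      proof
        assume ge: "genX e"
        have HX: "H = g ` D \<inter> X"
          by (rule facet_in_X(1)[OF g(1) f' f(2)])
        have "u \<in> ch g"
          using H(2) HX ch_iff[OF genX_K[OF uw(3)]] by blast
        moreover have "u \<in> X'" "w \<in> X'"
          using genX_X uw(3,4) by auto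
        moreover have "(fn t \<bullet> u) * (fn t \<bullet> w) > 0" if "t \<in> Rf" "t \<noteq> s" for t
          using small_sign[OF r that(1) genX_fn[OF ge that] uw(1,2)] .
        ultimately have "w \<in> ch g"
          using genX_same_chamber[OF g(1) _ _ _ ball_segment_K[OF r uw(1,2)]] by blast
        then have "\<pi> w \<in> H"
          unfolding HX using ch_iff[OF genX_K[OF uw(4)]] X_fn[OF genX_K[OF uw(4)]] genX_X[OF uw(4)]
          by simp
        then show ?thesis
          using H(1) by blast
      next
        assume "\<exists>t. edge e t"
        then obtain t where t: "edge e t"
          by blast
        have "\<pi> w \<in> H \<or> (\<exists>C'' H''. roll_step S \<Gamma> X (g ` D, H) (C'', H'') \<and> \<pi> w \<in> H'')"
          by (rule roll_facet[OF t noT r uw g(1) f' f(2) H(2)])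
        then show ?thesis
        proof
          assume "\<pi> w \<in> H"
          then show ?thesis
            using H(1) by blast
        next
          assume "\<exists>C'' H''. roll_step S \<Gamma> X (g ` D, H) (C'', H'') \<and> \<pi> w \<in> H''"
          then obtain C'' H'' where st: "roll_step S \<Gamma> X (g ` D, H) (C'', H'')" "\<pi> w \<in> H''"
            by blast
          have "(roll_step S \<Gamma> X)\<^sup>*\<^sup>* (C, F) (C'', H'')"
            using C' st(1) unfolding g(2) by (rule rtranclp.rtrancl_into_rtrancl)
          then have "H'' \<in> \<R>"
            unfolding rolled_facets_def by blast
          then show ?thesis
            using st(2) by blast
        qed
      qed
    qed
  qed
  then show ?thesis
    unfolding R_def using F_rolled \<pi>_v0 by blast
qed

section \<open>The semidirect product\<close>

lemma other_point_unique:
  assumes dim: "dim X' = 1" and y: "y \<in> X" "y \<noteq> \<pi> v0" and z: "z \<in> X" "z \<noteq> \<pi> v0"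
  shows "y = z"
proof -
  have ray: "\<exists>c<0. \<phi> y = c *\<^sub>R v0" if y: "y \<in> X" "y \<noteq> \<pi> v0" for y
  proof -
    have yP: "y \<in> P"
      using y X_P by blast
    note yK = \<phi>_K[OF yP]
    have "independent {v0}"
      using K_nonzero[OF genX_K[OF v0(1)]] by simp
    then have "X' \<subseteq> span {v0}"
      using card_ge_dim_independent[of "{v0}" X'] dim genX_X[OF v0(1)] by simp
    moreover have "\<phi> y \<in> X'"
      using X_fn[OF yK] \<pi>_\<phi>[OF yP] y(1) by simp
    ultimately obtain c where c: "\<phi> y = c *\<^sub>R v0"
      by (auto simp: span_singleton)
    have "c \<noteq> 0"
      using c K_nonzero[OF yK] by auto
    moreover have "\<not> c > 0"
      using \<pi>_scale[OF genX_K[OF v0(1)], of c] c \<pi>_\<phi>[OF yP] y(2) by auto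
    ultimately show ?thesis
      using c by (intro exI[of _ c]) auto
  qed
  obtain a where a: "a < 0" "\<phi> y = a *\<^sub>R v0"
    using ray y by blast
  obtain b where b: "b < 0" "\<phi> z = b *\<^sub>R v0"
    using ray z by blast
  have yz: "y \<in> P" "z \<in> P"
    using y(1) z(1) X_P by auto
  have "\<phi> y = (a / b) *\<^sub>R \<phi> z" "a / b > 0"
    using a b by (auto simp: divide_neg_neg)
  then have "\<pi> (\<phi> y) = \<pi> (\<phi> z)"
    using \<pi>_scale[OF \<phi>_K[OF yz(2)]] by simp
  then show ?thesis
    using \<pi>_\<phi> yz by simp
qed

lemma fix_X:
  assumes dim: "dim X' = 1" and g: "g \<in> \<Gamma>X" "g (\<pi> v0) = \<pi> v0" and x: "x \<in> X"
  shows "g x = x"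
proof (cases "x = \<pi> v0")
  case False
  have xP: "x \<in> P"
    using x X_P by blast
  have "g x \<noteq> \<pi> v0"
    using \<Gamma>_inj[OF \<Gamma>XD(1)[OF g(1)] xP \<pi>_points[OF genX_K[OF v0(1)]]] g(2) False by auto
  then show ?thesis
    using other_point_unique[OF dim \<Gamma>X_X[OF g(1) x] _ x False] by blast
qed (use g in simp)

text \<open>
  An element of the stabiliser of \<open>X\<close> permutes the domains cut out by the orthogonal mirrors. If it maps
  one point of the domain of \<open>F\<close> into this domain, it preserves the domain, and the rolled facets are
  the facets in it.
\<close>

lemma stabiliser_rolled:
  assumes dim: "2 \<le> dim X'" and h: "h \<in> \<Gamma>X" and s0: "sepx (\<pi> v0) (h (\<pi> v0)) = {}" and H: "H \<in> \<R>"
  shows "h ` H \<in> \<R>"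
proof -
  note h' = \<Gamma>XD[OF h]
  obtain A where A: "rep h A"
    using \<Gamma>_rep[OF h'(1)] by blast
  obtain C' g where g: "g \<in> \<Gamma>" "C' = g ` D" and f: "facet S \<Gamma> C' H" "H \<subseteq> X"
    and sep: "\<forall>v. genX v \<and> \<pi> v \<in> H \<longrightarrow> sepv v0 v = {}"
    using rolled_facet[OF H] by metis
  have HX: "H = g ` D \<inter> X"
    using facet_in_X(1)[OF g(1) _ f(2)] f(1) g(2) by blast
  obtain v where v: "genX v" "v \<in> ch g"
    using facet_in_X(2)[OF g(1) _ f(2)] f(1) g(2) by blast
  have "\<pi> v \<in> H"
    unfolding HX using v ch_iff[OF genX_K[OF v(1)]] X_fn[OF genX_K[OF v(1)]] genX_X[OF v(1)] by simp
  then have "sepv v0 v = {}"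
    using sep v(1) by blast
  then have p1: "\<forall>t\<in>T. t \<notin> sepv v0 v"
    by blast
  have Av: "genX (A v)" "genX (A v0)"
    using stabiliser_genX[OF h' A] v(1) v0(1) by blast+
  have "sepv v0 (A v0) = {}"
    using s0 sepx_\<pi>[OF v0(1) Av(2)] rep_\<pi>[OF A genX_K[OF v0(1)]] by simp
  then have p2: "\<forall>t\<in>T. (fn t \<bullet> v0) * (fn t \<bullet> A v0) > 0"
    using sepv_empty_iff[OF v0(1) Av(2)] by blast
  have p3: "(fn t \<bullet> A v0) * (fn t \<bullet> A v) > 0" if t: "t \<in> T" for t
  proof -
    have q: "cj (ginv h) t \<in> T"
      by (rule cj_T[OF \<Gamma>X_inv[OF h] t])
    have "cj h (cj (ginv h) t) = t"
      by (rule cj_cancel[OF h'(1) Rf_\<Gamma>[OF T_Rf[OF t]]])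
    then have "t \<notin> sepv (A v0) (A v)"
      using sepv_act[OF h A q, of v0 v] p1 q by simp
    then show ?thesis
      by (rule not_sepv_pos[OF Av(2,1) t])
  qed
  have "\<forall>t\<in>T. (fn t \<bullet> v0) * (fn t \<bullet> A v) > 0"
    using sign_transfer p2 p3 by blast
  then have "sepv v0 (A v) = {}"
    using sepv_empty_iff[OF v0(1) Av(1)] by blast
  then obtain H' where H': "H' \<in> \<R>" "\<pi> (A v) \<in> H'"
    using unseparated_rolled[OF dim Av(1)] by blast
  obtain C2 g2 where g2: "g2 \<in> \<Gamma>" "C2 = g2 ` D" and f2: "facet S \<Gamma> C2 H'" "H' \<subseteq> X"
    using rolled_facet[OF H'(1)] by metis
  have H2X: "H' = g2 ` D \<inter> X"
    using facet_in_X(1)[OF g2(1) _ f2(2)] f2(1) g2(2) by blast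
  have 1: "A v \<in> ch g2"
    using H'(2) H2X ch_iff[OF genX_K[OF Av(1)]] by blast
  have 2: "A v \<in> ch (gmul h g)"
    using ch_rep[OF g(1) h'(1) A genX_K[OF v(1)]] v(2) by blast
  have "H' = gmul h g ` D \<inter> X"
    unfolding H2X by (rule facet_unique[OF Av(1) g2(1) 1 \<Gamma>_mul[OF h'(1) g(1)] 2])
  also have "gmul h g ` D = h ` (g ` D)"
    by (rule gmul_image[OF D_P])
  also have "h ` (g ` D) \<inter> X = h ` H"
  proof
    show "h ` H \<subseteq> h ` (g ` D) \<inter> X"
      unfolding HX using \<Gamma>X_X[OF h] by blast
    show "h ` (g ` D) \<inter> X \<subseteq> h ` H"
    proof
      fix y assume y: "y \<in> h ` (g ` D) \<inter> X"
      then obtain x where x: "x \<in> g ` D" "y = h x"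
        by blast
      have xP: "x \<in> P"
        using x chamber_P[OF g(1)] by blast
      have "y \<in> h ` X"
        using y h'(2) by simp
      then obtain x' where x': "x' \<in> X" "y = h x'"
        by blast
      have "x = x'"
        using \<Gamma>_inj[OF h'(1) xP] x' x X_P by auto
      then show "y \<in> h ` H"
        unfolding HX using x x' by blast
    qed
  qed
  finally show ?thesis
    using H'(1) by simp
qed

lemma B_image: "g ` B = \<Union>((\<lambda>H. g ` H) ` \<R>)"
  unfolding rolled_domain_def by blast

lemma stabiliser_B:
  assumes dim: "2 \<le> dim X'" and h: "h \<in> \<Gamma>X" and s0: "sepx (\<pi> v0) (h (\<pi> v0)) = {}"
  shows "h ` B = B"
proof -
  interpret W: walled_action GX "\<lambda>g x. g x" Pts T sepx
    by (rule walled)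
  have sub: "g ` B \<subseteq> B" if g: "g \<in> \<Gamma>X" "sepx (\<pi> v0) (g (\<pi> v0)) = {}" for g
  proof -
    have "g ` H \<subseteq> B" if "H \<in> \<R>" for H
      using stabiliser_rolled[OF dim g that] unfolding rolled_domain_def by blast
    then show ?thesis
      unfolding B_image by blast
  qed
  have x0: "\<pi> v0 \<in> Pts"
    by (rule Pts_\<pi>[OF v0(1)])
  note ih = \<Gamma>X_inv[OF h]
  have hx: "h (\<pi> v0) \<in> Pts"
    using W.act_closed h x0 by (simp add: GX_carrier)
  have "sepx (ginv h (\<pi> v0)) (ginv h (h (\<pi> v0))) = {}"
    using W.sep_image[OF _ x0 hx, of "ginv h"] ih s0 by (simp add: GX_carrier)
  moreover have "ginv h (h (\<pi> v0)) = \<pi> v0"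
    using ginv_l[OF \<Gamma>XD(1)[OF h] PtsD(3)[OF x0]] .
  moreover have "ginv h (\<pi> v0) \<in> Pts"
    using W.act_closed ih x0 by (simp add: GX_carrier)
  ultimately have "sepx (\<pi> v0) (ginv h (\<pi> v0)) = {}"
    using W.sep_sym[OF x0] by metis
  then have "ginv h ` B \<subseteq> B"
    using sub ih by blast
  then have "h ` ginv h ` B \<subseteq> h ` B"
    by blast
  moreover have "h ` ginv h ` B = B"
    using ginv_r[OF \<Gamma>XD(1)[OF h]] B_X X_P by (force simp: image_image)
  ultimately show ?thesis
    using sub[OF h s0] by blast
qed

text \<open>These elements induce the deck transformations.\<close>

definition St :: "('a \<Rightarrow> 'a) set"
  where "St = {g \<in> \<Gamma>X. g ` B = B}"

lemma St_\<Gamma>X: "g \<in> St \<Longrightarrow> g \<in> \<Gamma>X" and St_B: "g \<in> St \<Longrightarrow> g ` B = B"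
  by (auto simp: St_def)

lemma B_P: "B \<subseteq> P"
  using B_X X_P by blast

lemma St_inv: "g \<in> St \<Longrightarrow> ginv g \<in> St"
proof -
  assume g: "g \<in> St"
  have "ginv g ` g ` B = B"
    using ginv_l[OF \<Gamma>XD(1)[OF St_\<Gamma>X[OF g]]] B_P by (force simp: image_image)
  then show ?thesis
    using g \<Gamma>X_inv by (simp add: St_def)
qed

lemma St_mul: "\<lbrakk>g \<in> St; h \<in> St\<rbrakk> \<Longrightarrow> gmul g h \<in> St"
  by (simp add: St_def \<Gamma>X_mul gmul_image[OF B_P])

lemma St_subgroup: "subgroup St GX"
proof (rule group.subgroupI[OF group_GX])
  show "St \<subseteq> carrier GX"
    by (auto simp: St_def GX_carrier)
  have "gone ` B = B"
    using B_P by (force simp: gone_def)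
  then show "St \<noteq> {}"
    using \<Gamma>X_one unfolding St_def by blast
  show "inv\<^bsub>GX\<^esub> g \<in> St" if "g \<in> St" for g
    using St_inv[OF that] GX_inv[OF St_\<Gamma>X[OF that]] by simp
  show "g \<otimes>\<^bsub>GX\<^esub> h \<in> St" if "g \<in> St" "h \<in> St" for g h
    using St_mul[OF that] GX_mult St_\<Gamma>X that by simp
qed

text \<open>A hyperedge would have dimension \<open>-1\<close>, but faces are nonempty.\<close>

lemma B_trivial_one_dim:
  assumes dim: "dim X' = 1"
  shows "\<R> = {F}"
proof -
  have no: "\<not> roll_step S \<Gamma> X (C, F) (C'', H'')" for C'' H''
  proof
    assume "roll_step S \<Gamma> X (C, F) (C'', H'')"
    then obtain I where hy: "hyperedge S \<Gamma> C I" and IF: "I \<subseteq> F"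
      by cases auto
    have IP: "I \<subseteq> P"
      using IF F_X X_P by blast
    obtain x where x: "x \<in> I"
      using hy unfolding hyperedge_def is_face_def by blast
    have xP: "x \<in> P"
      using x IP by blast
    have "dim (hat I) = 0"
      using hy dimension_hat[OF IP] dimension_points dim_X' dim unfolding hyperedge_def by linarith
    then have "hat I \<subseteq> {0}"
      by (rule iffD1[OF dim_eq_0])
    moreover have "\<phi> x \<in> hat I"
      using x \<phi>_K[OF xP] \<pi>_\<phi>[OF xP] by (simp add: hat_def)
    ultimately show False
      using K_nonzero[OF \<phi>_K[OF xP]] by blast
  qed
  have "C' = C \<and> H = F" if "(roll_step S \<Gamma> X)\<^sup>*\<^sup>* (C, F) (C', H)" for C' H
    using that
  proof (induction rule: rtranclp_induct2)
    case refl
    then show ?case by simp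
  next
    case (step a b c d)
    then show ?case using no by blast
  qed
  then show ?thesis
    unfolding rolled_facets_def by blast
qed

lemma dim_cases: "dim X' = 1 \<or> 2 \<le> dim X'"
  using dim_X'_pos by linarith

text \<open>
  As \<open>B\<close> is preserved, the generic point \<open>v0\<close> of \<open>F\<close> goes to a rolled facet, so no orthogonal mirror
  separates it from its image, and \<open>stabiliser_rolled\<close> applies.
\<close>

lemma St_permutes:
  assumes g: "g \<in> St" and H: "H \<in> \<R>"
  shows "g ` H \<in> \<R>"
  using dim_cases
proof
  assume "dim X' = 1"
  then have "\<R> = {F}"
    by (rule B_trivial_one_dim)
  then show ?thesis
    using H St_B[OF g] unfolding rolled_domain_def by simp
next
  assume dim: "2 \<le> dim X'"
  have x0: "\<pi> v0 \<in> B"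
    using \<pi>_v0 F_rolled unfolding rolled_domain_def by blast
  then have "g (\<pi> v0) \<in> B"
    using St_B[OF g] by blast
  then obtain H' where H': "H' \<in> \<R>" "g (\<pi> v0) \<in> H'"
    unfolding rolled_domain_def by blast
  obtain C' g' where "\<forall>v. genX v \<and> \<pi> v \<in> H' \<longrightarrow> sepv v0 v = {}"
    using rolled_facet[OF H'(1)] by metis
  note sep = this
  obtain A where A: "rep g A"
    using \<Gamma>_rep[OF \<Gamma>XD(1)[OF St_\<Gamma>X[OF g]]] by blast
  have gA: "genX (A v0)"
    by (rule stabiliser_genX[OF \<Gamma>XD[OF St_\<Gamma>X[OF g]] A v0(1)])
  have "sepv v0 (A v0) = {}"
    using sep gA H'(2) rep_\<pi>[OF A genX_K[OF v0(1)]] by simp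
  then have "sepx (\<pi> v0) (g (\<pi> v0)) = {}"
    using sepx_\<pi>[OF v0(1) gA] rep_\<pi>[OF A genX_K[OF v0(1)]] by simp
  then show ?thesis
    using stabiliser_rolled[OF dim St_\<Gamma>X[OF g] _ H] by blast
qed

text \<open>
  Some \<open>w\<close> moves the image of \<open>v0\<close> under \<open>g\<close> back to the domain of \<open>v0\<close>. If \<open>X\<close> is zero-dimensional, the
  only nontrivial motion of \<open>X\<close> exchanges its two points and is given by a reflection in \<open>T\<close>.
\<close>

lemma W_transitive:
  assumes g: "g \<in> \<Gamma>X"
  shows "\<exists>w\<in>W. gmul w g \<in> St"
  using dim_cases
proof
  assume dim: "dim X' = 1"
  have pw: "h \<in> St" if h: "h \<in> \<Gamma>X" "h (\<pi> v0) = \<pi> v0" for h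
  proof -
    have "h x = x" if "x \<in> B" for x
      using fix_X[OF dim h] that B_X by blast
    then have "h ` B = B"
      by simp
    then show ?thesis
      using h(1) by (simp add: St_def)
  qed
  have one: "gone \<in> W"
    using generate.one[of GX T] by (simp add: W_def GX_one)
  have x0P: "\<pi> v0 \<in> P" "\<pi> v0 \<in> X"
    using PtsD[OF Pts_\<pi>[OF v0(1)]] by auto
  show ?thesis
  proof (cases "g (\<pi> v0) = \<pi> v0")
    case True
    then have "gmul gone g \<in> St"
      using pw[OF g] gmul_one(2)[OF \<Gamma>XD(1)[OF g]] by simp
    then show ?thesis
      using one by blast
  next
    case False
    obtain t where t: "t \<in> T" "t (\<pi> v0) \<noteq> \<pi> v0"
      using two_point_mirror[OF dim v0(1) g False] .
    have tX: "t \<in> \<Gamma>X"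
      using t(1) T_\<Gamma>X by blast
    have "gmul t g (\<pi> v0) = \<pi> v0"
    proof (rule ccontr)
      assume n: "gmul t g (\<pi> v0) \<noteq> \<pi> v0"
      have gx: "g (\<pi> v0) \<in> X"
        by (rule \<Gamma>X_X[OF g x0P(2)])
      have "t (g (\<pi> v0)) \<noteq> \<pi> v0"
        using n gmul_apply[OF x0P(1)] by simp
      moreover have "g (\<pi> v0) = t (\<pi> v0)"
        using other_point_unique[OF dim gx False \<Gamma>X_X[OF tX x0P(2)] t(2)] .
      ultimately show False
        using Rf_involution(1)[OF T_Rf[OF t(1)] x0P(1)] by simp
    qed
    then have "gmul t g \<in> St"
      using pw \<Gamma>X_mul[OF tX g] by blast
    then show ?thesis
      using t(1) generate.incl[of t T GX] unfolding W_def by blast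
  qed
next
  assume dim: "2 \<le> dim X'"
  interpret W: walled_action GX "\<lambda>g x. g x" Pts T sepx
    by (rule walled)
  have x0: "\<pi> v0 \<in> Pts"
    by (rule Pts_\<pi>[OF v0(1)])
  have gx: "g (\<pi> v0) \<in> Pts"
    using W.act_closed g x0 by (simp add: GX_carrier)
  obtain w where w: "w \<in> W" "sepx (\<pi> v0) (w (g (\<pi> v0))) = {}"
    using W.generate_transitive[OF x0 near_chain[OF dim x0] gx] unfolding W_def by blast
  have wX: "w \<in> \<Gamma>X"
    using w(1) W_\<Gamma>X by blast
  have "sepx (\<pi> v0) (gmul w g (\<pi> v0)) = {}"
    using w(2) gmul_apply[OF PtsD(3)[OF x0]] by simp
  then have "gmul w g \<in> St"
    using stabiliser_B[OF dim \<Gamma>X_mul[OF wX g]] \<Gamma>X_mul[OF wX g] by (simp add: St_def)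
  then show ?thesis
    using w(1) by blast
qed

text \<open>
  If \<open>w\<close> preserves \<open>B\<close>, then no orthogonal mirror separates \<open>v0\<close> from its image, so \<open>w = 1\<close>. If \<open>X\<close> is
  zero-dimensional, the image of \<open>v0\<close> belongs to \<open>C\<close> and to its image under \<open>w\<close>, hence is fixed by \<open>w\<close>.
\<close>

lemma W_free:
  assumes w: "w \<in> W" "w \<in> St" and x: "x \<in> X"
  shows "w x = x"
  using dim_cases
proof
  assume dim: "dim X' = 1"
  have B: "B = F"
    using B_trivial_one_dim[OF dim] unfolding rolled_domain_def by simp
  note wX = St_\<Gamma>X[OF w(2)]
  have "w (\<pi> v0) = \<pi> v0"
  proof -
    obtain A where A: "rep w A"
      using \<Gamma>_rep[OF \<Gamma>XD(1)[OF wX]] by blast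
    note v0K = genX_K[OF v0(1)]
    have "w (\<pi> v0) \<in> F"
      using St_B[OF w(2)] \<pi>_v0 unfolding B by blast
    then have 1: "A v0 \<in> ch c0"
      using rep_\<pi>[OF A v0K] ch_iff[OF rep_K[OF A v0K]] unfolding F_eq by simp
    have 2: "A v0 \<in> ch (gmul w c0)"
      using ch_rep[OF c0 \<Gamma>XD(1)[OF wX] A v0K] v0(2) by blast
    have "w (\<pi> (A v0)) = \<pi> (A v0)"
      by (rule chamber_transition_fixes[OF dim_ge_2 c0 \<Gamma>XD(1)[OF wX] 1 2])
    then have "w (w (\<pi> v0)) = w (\<pi> v0)"
      using rep_\<pi>[OF A v0K] by simp
    then show ?thesis
      using \<Gamma>_inj[OF \<Gamma>XD(1)[OF wX]] \<Gamma>_points[OF \<Gamma>XD(1)[OF wX]] \<pi>_points[OF v0K] by blast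
  qed
  then show ?thesis
    by (rule fix_X[OF dim wX _ x])
next
  assume dim: "2 \<le> dim X'"
  interpret W: walled_action GX "\<lambda>g x. g x" Pts T sepx
    by (rule walled)
  have x0: "\<pi> v0 \<in> Pts"
    by (rule Pts_\<pi>[OF v0(1)])
  note wX = St_\<Gamma>X[OF w(2)]
  have "w (\<pi> v0) \<in> B"
    using St_B[OF w(2)] \<pi>_v0 F_rolled unfolding rolled_domain_def by blast
  then obtain H where H: "H \<in> \<R>" "w (\<pi> v0) \<in> H"
    unfolding rolled_domain_def by blast
  obtain C' g where sep: "\<forall>v. genX v \<and> \<pi> v \<in> H \<longrightarrow> sepv v0 v = {}"
    using rolled_facet[OF H(1)] by metis
  obtain A where A: "rep w A"
    using \<Gamma>_rep[OF \<Gamma>XD(1)[OF wX]] by blast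
  have gA: "genX (A v0)"
    by (rule stabiliser_genX[OF \<Gamma>XD[OF wX] A v0(1)])
  have "sepv v0 (A v0) = {}"
    using sep gA H(2) rep_\<pi>[OF A genX_K[OF v0(1)]] by simp
  then have "sepx (\<pi> v0) (w (\<pi> v0)) = {}"
    using sepx_\<pi>[OF v0(1) gA] rep_\<pi>[OF A genX_K[OF v0(1)]] by simp
  then have "w = \<one>\<^bsub>GX\<^esub>"
    using W.generate_free[OF x0 near_chain[OF dim x0]] w(1) unfolding W_def by blast
  then show ?thesis
    using gone_apply x X_P by (auto simp: GX_one)
qed

subsection \<open>Restriction to the mirror\<close>

definition \<rho> :: "('a \<Rightarrow> 'a) \<Rightarrow> 'a \<Rightarrow> 'a"
  where "\<rho> g = restrict g X"

lemma \<rho>_apply: "x \<in> X \<Longrightarrow> \<rho> g x = g x"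
  by (simp add: \<rho>_def)

lemma \<rho>_Bij:
  assumes g: "g \<in> \<Gamma>X"
  shows "\<rho> g \<in> Bij X"
proof -
  have "inj_on g X"
    using \<Gamma>_inj[OF \<Gamma>XD(1)[OF g]] X_P by (meson inj_onI subsetD)
  then have "bij_betw (\<rho> g) X X"
    using \<Gamma>XD(2)[OF g] by (simp add: bij_betw_def \<rho>_def)
  then show ?thesis
    by (simp add: Bij_def \<rho>_def)
qed

lemma \<rho>_group_hom: "group_hom GX (BijGroup X) \<rho>"
proof (intro group_hom.intro group_GX group_BijGroup group_hom_axioms.intro)
  have "\<rho> (gmul g h) = compose X (\<rho> g) (\<rho> h)" if "g \<in> \<Gamma>X" "h \<in> \<Gamma>X" for g h
  proof
    fix x
    show "\<rho> (gmul g h) x = compose X (\<rho> g) (\<rho> h) x"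
      using that \<Gamma>X_X[OF that(2)] X_P gmul_apply[of x g h]
      by (auto simp: \<rho>_def compose_def)
  qed
  then show "\<rho> \<in> hom GX (BijGroup X)"
    using \<rho>_Bij GX_mult by (auto simp: hom_def GX_carrier BijGroup_def)
qed

lemma Gamma_star_eq: "Gamma_star \<Gamma> X = \<rho> ` \<Gamma>X"
  unfolding Gamma_star_def \<Gamma>X_def \<rho>_def by blast

abbreviation HX :: "('a \<Rightarrow> 'a) monoid"
  where "HX \<equiv> (BijGroup X)\<lparr>carrier := Gamma_star \<Gamma> X\<rparr>"

lemma Gamma_star_subgroup: "subgroup (Gamma_star \<Gamma> X) (BijGroup X)"
  using group_hom.img_is_subgroup[OF \<rho>_group_hom] by (simp add: Gamma_star_eq GX_carrier)

lemma \<rho>_group_hom_star: "group_hom GX HX \<rho>"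
proof (intro group_hom.intro group_GX group_hom_axioms.intro)
  show "group HX"
    by (rule subgroup.subgroup_is_group[OF Gamma_star_subgroup group_BijGroup])
  have "\<rho> \<in> hom GX (BijGroup X)"
    using group_hom.homh[OF \<rho>_group_hom] .
  then show "\<rho> \<in> hom GX HX"
    by (auto simp: hom_def GX_carrier Gamma_star_eq)
qed

lemma Delta_eq:
  assumes orth: "\<And>t. t \<in> Rf \<Longrightarrow> orthogonal_mirrors S \<Gamma> X (mir t) \<longleftrightarrow> X \<noteq> mir t \<and> t ` X = X"
  shows "Delta S \<Gamma> X = \<rho> ` W"
proof -
  have "t \<in> \<Gamma> \<and> (\<exists>Z. reflection_in S Z t \<and> orthogonal_mirrors S \<Gamma> X Z) \<longleftrightarrow> t \<in> T" for t
  proof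
    assume "t \<in> \<Gamma> \<and> (\<exists>Z. reflection_in S Z t \<and> orthogonal_mirrors S \<Gamma> X Z)"
    then obtain Z where Z: "t \<in> \<Gamma>" "reflection_in S Z t" "orthogonal_mirrors S \<Gamma> X Z"
      by blast
    note r = reflection_Rf[OF Z(1,2)]
    then have "X \<noteq> mir t" "t ` X = X"
      using orth[OF r(1)] Z(3) by auto
    then show "t \<in> T"
      unfolding T_def using r(1) by auto
  next
    assume t: "t \<in> T"
    have "X \<noteq> mir t"
      using mir_subset_eq[OF s_Rf T_Rf[OF t]] T_ne[OF t] by blast
    then have "orthogonal_mirrors S \<Gamma> X (mir t)"
      using orth[OF T_Rf[OF t]] T_X[OF t] by blast
    then show "t \<in> \<Gamma> \<and> (\<exists>Z. reflection_in S Z t \<and> orthogonal_mirrors S \<Gamma> X Z)"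
      using T_Rf[OF t] unfolding Rf_def by blast
  qed
  then have "{restrict t X |t. t \<in> \<Gamma> \<and> (\<exists>Z. reflection_in S Z t \<and> orthogonal_mirrors S \<Gamma> X Z)} = \<rho> ` T"
    unfolding \<rho>_def by blast
  then have "Delta S \<Gamma> X = generate (BijGroup X) (\<rho> ` T)"
    unfolding Delta_def by simp
  then show ?thesis
    unfolding W_def using group_hom.generate_img[OF \<rho>_group_hom] T_\<Gamma>X by (simp add: GX_carrier)
qed

lemma continuous_\<Gamma>:
  assumes g: "g \<in> \<Gamma>"
  shows "continuous_on P g"
proof -
  obtain A where A: "rep g A"
    using \<Gamma>_rep[OF g] by blast
  have "continuous_on UNIV A"
    using rep_linear[OF A] by (simp add: linear_continuous_on linear_conv_bounded_linear)
  then have "continuous_on P (\<lambda>x. A (\<phi> x))"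
    using continuous_on_compose2[OF _ continuous_\<phi>] by blast
  then have "continuous_on P (\<lambda>x. \<pi> (A (\<phi> x)))"
    using rep_K[OF A] \<phi>_K by (intro continuous_on_compose2[OF continuous_\<pi>]) auto
  moreover have "\<pi> (A (\<phi> x)) = g x" if "x \<in> P" for x
    using rep_\<pi>[OF A \<phi>_K[OF that]] \<pi>_\<phi>[OF that] by simp
  ultimately show ?thesis
    by (rule continuous_on_eq)
qed

lemma homeomorphic_restriction:
  assumes g: "g \<in> \<Gamma>" and E: "E \<subseteq> P" "g ` E = E" and f: "\<And>x. x \<in> E \<Longrightarrow> f x = g x"
  shows "homeomorphic_map (top_of_set E) (top_of_set E) f"
proof -
  have inv: "ginv g x \<in> E" if "x \<in> E" for x
  proof -
    have "x \<in> g ` E"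
      using that E(2) by simp
    then obtain y where "y \<in> E" "x = g y"
      by blast
    then show ?thesis
      using ginv_l[OF g] E(1) by auto
  qed
  have cf: "continuous_on E f"
    using continuous_on_subset[OF continuous_\<Gamma>[OF g] E(1)] f by (metis continuous_on_eq)
  have ci: "continuous_on E (ginv g)"
    by (rule continuous_on_subset[OF continuous_\<Gamma>[OF \<Gamma>_inv[OF g]] E(1)])
  have "homeomorphic_maps (top_of_set E) (top_of_set E) f (ginv g)"
    unfolding homeomorphic_maps_def
  proof (intro conjI)
    show "continuous_map (top_of_set E) (top_of_set E) f"
      using cf f E(2) by auto
    show "continuous_map (top_of_set E) (top_of_set E) (ginv g)"
      using ci inv by auto
    show "\<forall>x\<in>topspace (top_of_set E). ginv g (f x) = x"
      using f ginv_l[OF g] E(1) by auto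
    show "\<forall>x\<in>topspace (top_of_set E). f (ginv g x) = x"
      using f inv ginv_r[OF g] E(1) by auto
  qed
  then show ?thesis
    by (rule homeomorphic_maps_imp_map)
qed

text \<open>
  An identification \<open>\<gamma>\<close> of a facet of \<open>C\<close> with a rolled facet \<open>H\<close> turns into one with the rolled facet
  \<open>g ` H\<close> after composition with \<open>g\<close>. So a point and its image under \<open>g\<close> correspond to the same points
  of \<open>C\<close>.
\<close>

lemma roll_map_St:
  assumes g: "g \<in> St" and x: "x \<in> X"
  shows "roll_map S \<Gamma> X C F (g x) = roll_map S \<Gamma> X C F x"
proof -
  define Q where "Q x y \<longleftrightarrow> (\<exists>H\<in>\<R>. \<exists>F\<^sub>i. \<exists>\<gamma>\<in>\<Gamma>.
       facet S \<Gamma> C F\<^sub>i \<and> F\<^sub>i \<inter> Xi' S \<Gamma> C \<subseteq> Omega S \<Gamma> C F \<and> \<gamma> ` F\<^sub>i = H \<and> y \<in> F\<^sub>i \<and> \<gamma> y = x)" for x y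
  have QQ: "Q (h x) y" if h: "h \<in> St" and q: "Q x y" for h x y
  proof -
    note h' = \<Gamma>XD(1)[OF St_\<Gamma>X[OF h]]
    obtain H F\<^sub>i \<gamma> where H: "H \<in> \<R>" and \<gamma>: "\<gamma> \<in> \<Gamma>" and f: "facet S \<Gamma> C F\<^sub>i"
      "F\<^sub>i \<inter> Xi' S \<Gamma> C \<subseteq> Omega S \<Gamma> C F" and im: "\<gamma> ` F\<^sub>i = H" and y: "y \<in> F\<^sub>i" "\<gamma> y = x"
      using q unfolding Q_def by blast
    have FP: "F\<^sub>i \<subseteq> P"
      using f(1) chamber_P[OF c0] unfolding facet_def is_face_def by blast
    have "gmul h \<gamma> ` F\<^sub>i = h ` H"
      using gmul_image[OF FP] im by simp
    moreover have "gmul h \<gamma> y = h x"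
      using gmul_apply[of y h \<gamma>] FP y by auto
    ultimately show ?thesis
      unfolding Q_def using St_permutes[OF h H] \<Gamma>_mul[OF h' \<gamma>] f y(1) by blast
  qed
  have "Q (g x) y \<longleftrightarrow> Q x y" for y
  proof
    assume "Q (g x) y"
    then have "Q (ginv g (g x)) y"
      by (rule QQ[OF St_inv[OF g]])
    then show "Q x y"
      using ginv_l[OF \<Gamma>XD(1)[OF St_\<Gamma>X[OF g]]] x X_P by auto
  qed (rule QQ[OF g])
  then show ?thesis
    unfolding roll_map_def Q_def[symmetric] by simp
qed

text \<open>
  A deck transformation preserves \<open>B\<close> by definition. Conversely, an element of \<open>St\<close> acts on \<open>X\<close> by a
  homeomorphism, so it preserves the interior of \<open>B\<close> in \<open>X\<close>, and it is compatible with the covering by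
  \<open>roll_map_St\<close>.
\<close>

lemma Deck_eq: "Deck S \<Gamma> X C F = \<rho> ` St"
proof (intro equalityI subsetI)
  fix g' assume "g' \<in> Deck S \<Gamma> X C F"
  then have g': "g' \<in> Gamma_star \<Gamma> X" "g' ` B = B"
    unfolding Deck_def by auto
  then obtain g where g: "g \<in> \<Gamma>X" "g' = \<rho> g"
    unfolding Gamma_star_eq by blast
  have "\<rho> g ` B = g ` B"
    using B_X \<rho>_apply by (intro image_cong) auto
  then have "g \<in> St"
    using g g'(2) by (simp add: St_def)
  then show "g' \<in> \<rho> ` St"
    using g(2) by blast
next
  fix g' assume "g' \<in> \<rho> ` St"
  then obtain g where g: "g \<in> St" "g' = \<rho> g"
    by blast
  note gX = St_\<Gamma>X[OF g(1)]
  have \<rho>B: "\<rho> g ` B = B"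
    using B_X \<rho>_apply St_B[OF g(1)] by (metis image_cong subsetD)
  let ?fr = "top_of_set X frontier_of B"
  define E where "E = rolled_interior S \<Gamma> X C F"
  have E: "E = B - ?fr"
    by (simp add: E_def rolled_interior_def)
  have EX: "E \<subseteq> X"
    using E B_X by blast
  have hom: "homeomorphic_map (top_of_set X) (top_of_set X) g"
    by (rule homeomorphic_restriction[OF \<Gamma>XD(1)[OF gX] X_P \<Gamma>XD(2)[OF gX]]) simp
  have "top_of_set X frontier_of (g ` B) = g ` ?fr"
    using B_X by (intro homeomorphic_map_frontier_of[OF hom]) simp
  then have gfr: "g ` ?fr = ?fr"
    using St_B[OF g(1)] by simp
  have frX: "?fr \<subseteq> X"
    using frontier_of_subset_topspace[of "top_of_set X" B] by simp
  have "inj_on g X"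
    using \<Gamma>_inj[OF \<Gamma>XD(1)[OF gX]] X_P by (meson inj_onI subsetD)
  then have "g ` (B - ?fr) = g ` B - g ` ?fr"
    using B_X frX by (rule inj_on_image_set_diff[OF _ order_trans[OF Diff_subset]])
  then have gE: "g ` E = E"
    unfolding E gfr St_B[OF g(1)] .
  have EP: "E \<subseteq> P"
    using EX X_P by blast
  have ap: "restrict (\<rho> g) E x = g x" if "x \<in> E" for x
    using that EX \<rho>_apply by auto
  have "homeomorphic_map (top_of_set E) (top_of_set E) (restrict (\<rho> g) E)"
    by (rule homeomorphic_restriction[OF \<Gamma>XD(1)[OF gX] EP gE ap])
  moreover have "roll_map S \<Gamma> X C F (restrict (\<rho> g) E x) = roll_map S \<Gamma> X C F x" if "x \<in> E" for x
    unfolding ap[OF that] using roll_map_St[OF g(1)] that EX by blast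
  ultimately have "restrict (\<rho> g) E \<in> deck_transformations (roll_map S \<Gamma> X C F) E"
    unfolding deck_transformations_def by auto
  then show "g' \<in> Deck S \<Gamma> X C F"
    unfolding Deck_def g(2) Gamma_star_eq using gX \<rho>B by (auto simp: E_def)
qed

theorem semidirect:
  assumes orth: "\<And>t. t \<in> Rf \<Longrightarrow> orthogonal_mirrors S \<Gamma> X (mir t) \<longleftrightarrow> X \<noteq> mir t \<and> t ` X = X"
  shows "is_semidirect_product HX (Deck S \<Gamma> X C F) (Delta S \<Gamma> X)"
proof -
  interpret h: group_hom GX HX \<rho>
    by (rule \<rho>_group_hom_star)
  have surj: "\<rho> ` carrier GX = carrier HX"
    by (simp add: Gamma_star_eq GX_carrier)
  have D: "subgroup (\<rho> ` St) HX"
    by (rule h.subgroup_img_is_subgroup[OF St_subgroup])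
  have N: "\<rho> ` W \<lhd> HX"
    by (rule normal.surj_hom_normal_subgroup[OF W_normal h.group_hom_axioms surj])
  have WG: "subgroup W GX"
    by (rule normal_imp_subgroup[OF W_normal])
  have "f = \<one>\<^bsub>HX\<^esub>" if f: "f \<in> \<rho> ` St" "f \<in> \<rho> ` W" for f
  proof -
    obtain w where w: "w \<in> W" "f = \<rho> w"
      using f(2) by blast
    obtain d where d: "d \<in> St" "f = \<rho> d"
      using f(1) by blast
    have "w x = d x" if "x \<in> X" for x
      using w(2) d(2) \<rho>_apply[OF that] by metis
    then have "w ` B = d ` B"
      using B_X by (intro image_cong) auto
    then have "w \<in> St"
      using St_B[OF d(1)] w(1) W_\<Gamma>X by (auto simp: St_def)
    then have "\<rho> w = (\<lambda>x\<in>X. x)"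
      using W_free[OF w(1)] by (auto simp: \<rho>_def restrict_def)
    then show ?thesis
      using w(2) by (simp add: BijGroup_def)
  qed
  then have I: "\<rho> ` St \<inter> \<rho> ` W = {\<one>\<^bsub>HX\<^esub>}"
    using subgroup.one_closed[OF D] subgroup.one_closed[OF normal_imp_subgroup[OF N]] by blast
  have P: "\<rho> ` St <#>\<^bsub>HX\<^esub> \<rho> ` W = carrier HX"
  proof
    show "\<rho> ` St <#>\<^bsub>HX\<^esub> \<rho> ` W \<subseteq> carrier HX"
      by (rule h.H.set_mult_closed[OF subgroup.subset[OF D]
            subgroup.subset[OF normal_imp_subgroup[OF N]]])
    show "carrier HX \<subseteq> \<rho> ` St <#>\<^bsub>HX\<^esub> \<rho> ` W"
    proof
      fix f assume "f \<in> carrier HX"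
      then obtain g where g: "g \<in> \<Gamma>X" "f = \<rho> g"
        using surj by (auto simp: GX_carrier)
      obtain w where w: "w \<in> W" "gmul w g \<in> St"
        using W_transitive[OF g(1)] by blast
      have wX: "w \<in> \<Gamma>X"
        using w(1) W_\<Gamma>X by blast
      define d where "d = gmul w g"
      have dX: "d \<in> \<Gamma>X"
        unfolding d_def using \<Gamma>X_mul[OF wX g(1)] .
      \<comment> \<open>\<open>g = w\<^sup>-\<^sup>1 d = d (d\<^sup>-\<^sup>1 w\<^sup>-\<^sup>1 d)\<close>\<close>
      define n where "n = inv\<^bsub>GX\<^esub> d \<otimes>\<^bsub>GX\<^esub> inv\<^bsub>GX\<^esub> w \<otimes>\<^bsub>GX\<^esub> d"
      have c: "d \<in> carrier GX" "w \<in> carrier GX" "g \<in> carrier GX"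
        using dX wX g(1) by (simp_all add: GX_carrier)
      have "n \<in> W"
        unfolding n_def
        using normal.inv_op_closed1[OF W_normal c(1) subgroup.m_inv_closed[OF WG w(1)]] .
      have "d \<otimes>\<^bsub>GX\<^esub> n = inv\<^bsub>GX\<^esub> w \<otimes>\<^bsub>GX\<^esub> d"
        unfolding n_def using c by (simp add: h.G.m_assoc[symmetric])
      also have "d = w \<otimes>\<^bsub>GX\<^esub> g"
        unfolding d_def using GX_mult[OF wX g(1)] by simp
      also have "inv\<^bsub>GX\<^esub> w \<otimes>\<^bsub>GX\<^esub> (w \<otimes>\<^bsub>GX\<^esub> g) = g"
        using c by (simp add: h.G.m_assoc[symmetric])
      finally have "\<rho> (d \<otimes>\<^bsub>GX\<^esub> n) = f"
        using g(2) d_def GX_mult[OF wX g(1)] by simp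
      moreover have "n \<in> carrier GX"
        using \<open>n \<in> W\<close> W_\<Gamma>X by (auto simp: GX_carrier)
      ultimately have "f = \<rho> d \<otimes>\<^bsub>HX\<^esub> \<rho> n"
        using h.hom_mult[OF c(1)] by metis
      then show "f \<in> \<rho> ` St <#>\<^bsub>HX\<^esub> \<rho> ` W"
        unfolding set_mult_def using w(2) \<open>n \<in> W\<close> by (auto simp: d_def)
    qed
  qed
  have De: "Delta S \<Gamma> X = \<rho> ` W"
    by (rule Delta_eq) (rule orth)
  show ?thesis
    unfolding is_semidirect_product_def Deck_eq De
    using h.H.group_axioms D N I P by blast
qed

end

context coxeter_model
begin

lemma semidirect_product:
  assumes X: "X \<in> mirrors S \<Gamma>" and C: "C \<in> chambers \<Gamma> D" and F: "facet S \<Gamma> C F" "F \<subseteq> X"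
    and orth: "\<And>s t. \<lbrakk>s \<in> Rf; t \<in> Rf\<rbrakk> \<Longrightarrow>
      orthogonal_mirrors S \<Gamma> (mir s) (mir t) \<longleftrightarrow> mir s \<noteq> mir t \<and> t ` mir s = mir s"
  shows "is_semidirect_product ((BijGroup X)\<lparr>carrier := Gamma_star \<Gamma> X\<rparr>)
           (Deck S \<Gamma> X C F) (Delta S \<Gamma> X)"
proof -
  obtain r where r: "r \<in> Rf" "X = mir r"
    using X unfolding mirrors_eq by blast
  obtain k where k: "k \<in> \<Gamma>" "C = k ` D"
    using C unfolding chambers_def by blast
  interpret rolling_model S \<phi> \<pi> K \<Gamma> D r k F
    by unfold_locales (use r k F in auto)
  show ?thesis
    unfolding r(2) k(2) by (rule semidirect) (rule orth[OF r(1)])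
qed

lemma involution_image:
  assumes t: "t \<in> Rf" and Y: "Y \<subseteq> P" and sub: "\<And>x. x \<in> Y \<Longrightarrow> t x \<in> Y"
  shows "t ` Y = Y"
proof
  show "Y \<subseteq> t ` Y"
  proof
    fix x assume x: "x \<in> Y"
    have "t (t x) = x"
      using Rf_involution(1)[OF t] x Y by blast
    then show "x \<in> t ` Y"
      using sub[OF x] by (metis imageI)
  qed
qed (use sub in blast)

text \<open>
  Conjugation by \<open>t\<close> maps \<open>s\<close> to the reflection in the image of its mirror, and a mirror has only one
  reflection in \<open>\<Gamma>\<close>.
\<close>

lemma commuting_iff:
  assumes s: "s \<in> Rf" and t: "t \<in> Rf"
  shows "t ` mir s = mir s \<longleftrightarrow> (\<forall>x\<in>P. s (t x) = t (s x))"
proof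
  note s' = Rf_\<Gamma>[OF s] and t' = Rf_\<Gamma>[OF t]
  assume "t ` mir s = mir s"
  then have "cj t s = s"
    using mir_subset_eq[OF s cj_Rf(1)[OF t' s]] cj_Rf(2)[OF t' s] by simp
  then show "\<forall>x\<in>P. s (t x) = t (s x)"
    using cj_apply[OF t' s'] by simp
next
  assume c: "\<forall>x\<in>P. s (t x) = t (s x)"
  show "t ` mir s = mir s"
  proof (rule involution_image[OF t])
    show "mir s \<subseteq> P"
      by (auto simp: mir_def)
    show "t x \<in> mir s" if "x \<in> mir s" for x
      using that c \<Gamma>_points[OF Rf_\<Gamma>[OF t]] by (auto simp: mir_def)
  qed
qed

text \<open>
  In the Euclidean, spherical and Lobachevsky geometries a reflection moves each point along the normal
  \<open>a'\<close> of its mirror. So it changes the function \<open>form S a\<close> by multiples of \<open>form S a a'\<close>, and it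
  preserves the mirror with the normal \<open>a\<close> iff this number vanishes. If both mirrors were the same, the
  function which defines them would be preserved by the reflection and, up to a positive factor, negated.
\<close>

lemma orthogonal_iff_stable:
  assumes along: "\<And>Z t a b x. \<lbrakk>reflection_in S Z t; (a, b) \<in> normals S Z; x \<in> P\<rbrakk> \<Longrightarrow>
      \<exists>l. t x = x + l *\<^sub>R a"
    and lin: "\<And>a a' x l. form S a (x + l *\<^sub>R a') = form S a x + l * form S a a'"
    and s: "s \<in> Rf" and t: "t \<in> Rf"
  shows "(\<exists>(a, b)\<in>normals S (mir s). \<exists>(a', b')\<in>normals S (mir t). form S a a' = 0) \<longleftrightarrow>
    mir s \<noteq> mir t \<and> t ` mir s = mir s"
proof
  have rt: "reflection_in S (mir t) t"
    using t by (simp add: Rf_def)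
  have mP: "mir s \<subseteq> P"
    by (auto simp: mir_def)
  note t' = Rf_\<Gamma>[OF t]
  {
    assume "\<exists>(a, b)\<in>normals S (mir s). \<exists>(a', b')\<in>normals S (mir t). form S a a' = 0"
    then obtain a b a' b' where ab: "(a, b) \<in> normals S (mir s)" "(a', b') \<in> normals S (mir t)"
      "form S a a' = 0"
      by blast
    have inv: "form S a (t x) = form S a x" if x: "x \<in> P" for x
    proof -
      obtain l where "t x = x + l *\<^sub>R a'"
        using along[OF rt ab(2) x] by blast
      then show ?thesis
        using lin ab(3) by simp
    qed
    have "mir s = hyperplane_eq S a b"
      using ab(1) by (simp add: normals_def)
    then have mem: "x \<in> mir s \<longleftrightarrow> x \<in> P \<and> form S a x = b" for x
      by (simp add: hyperplane_eq_def)
    have "t ` mir s = mir s"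
    proof (rule involution_image[OF t mP])
      show "t x \<in> mir s" if "x \<in> mir s" for x
        using that inv[of x] \<Gamma>_points[OF t', of x] unfolding mem by simp
    qed
    moreover have "mir s \<noteq> mir t"
    proof
      assume eq: "mir s = mir t"
      have ab0: "a \<noteq> 0" "S = Euclidean \<or> b = 0"
        using ab(1) by (auto simp: normals_def)
      obtain w where w: "w \<noteq> 0" "\<forall>x\<in>P. form S a x - b = w \<bullet> \<phi> x"
        using hyperplane_functional[OF ab0] by blast
      have "w \<bullet> v = 0" if v: "v \<in> K" "fn t \<bullet> v = 0" for v
      proof -
        have "\<pi> v \<in> mir s"
          unfolding eq using mir_fn[OF t v(1)] v(2) by simp
        then have "w \<bullet> \<phi> (\<pi> v) = 0"
          using mem w(2) by auto
        moreover obtain c where "c > 0" "w \<bullet> \<phi> (\<pi> v) = c * (w \<bullet> v)"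
          using functional_sign[OF v(1)] .
        ultimately show ?thesis by simp
      qed
      then obtain k where k: "w = k *\<^sub>R fn t"
        using fn_proportional[OF t, of w] by blast
      obtain v where v: "v \<in> K" "w \<bullet> v \<noteq> 0"
        using K_not_in_hyperplane[OF w(1) open_K K_nonempty] .
      define x where "x = \<pi> v"
      have xP: "x \<in> P"
        using \<pi>_points[OF v(1)] by (simp add: x_def)
      have "w \<bullet> \<phi> (t x) = w \<bullet> \<phi> x"
        using inv[OF xP] w(2) xP \<Gamma>_points[OF t' xP] by (metis)
      moreover have "t x = \<pi> (sk t v)"
        using rep_\<pi>[OF sk_rep[OF t] v(1)] by (simp add: x_def)
      moreover obtain c where c: "c > 0" "w \<bullet> \<phi> (\<pi> (sk t v)) = c * (w \<bullet> sk t v)"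
        using functional_sign[OF rep_K[OF sk_rep[OF t] v(1)]] .
      moreover obtain d where d: "d > 0" "w \<bullet> \<phi> (\<pi> v) = d * (w \<bullet> v)"
        using functional_sign[OF v(1)] .
      moreover have "w \<bullet> sk t v = - (w \<bullet> v)"
        using skew_reflection_flip[OF fn_ax[OF t], of v] by (simp add: k)
      ultimately have "(c + d) * (w \<bullet> v) = 0"
        by (simp add: x_def algebra_simps)
      then show False
        using c(1) d(1) v(2) by simp
    qed
    ultimately show "mir s \<noteq> mir t \<and> t ` mir s = mir s"
      by blast
  next
    assume st: "mir s \<noteq> mir t \<and> t ` mir s = mir s"
    have "is_hyperplane S (mir s)" "is_hyperplane S (mir t)"
      using s t by (auto simp: Rf_def reflection_in_def)
    then obtain a b a' b' where ab: "(a, b) \<in> normals S (mir s)" "(a', b') \<in> normals S (mir t)"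
      unfolding is_hyperplane_def by fast
    have "\<not> mir s \<subseteq> mir t"
      using mir_subset_eq[OF s t] st by blast
    then obtain x where x: "x \<in> mir s" "x \<notin> mir t"
      by blast
    have xP: "x \<in> P"
      using x(1) mP by blast
    obtain l where l: "t x = x + l *\<^sub>R a'"
      using along[OF rt ab(2) xP] by blast
    have "t x \<noteq> x"
      using x(2) xP by (simp add: mir_def)
    then have "l \<noteq> 0"
      using l by auto
    have "mir s = hyperplane_eq S a b"
      using ab(1) by (simp add: normals_def)
    then have "form S a x = b" "form S a (t x) = b"
      using x(1) st by (auto simp: hyperplane_eq_def)
    then have "l * form S a a' = 0"
      using l lin by simp
    then have "form S a a' = 0"
      using \<open>l \<noteq> 0\<close> by simp
    then show "\<exists>(a, b)\<in>normals S (mir s). \<exists>(a', b')\<in>normals S (mir t). form S a a' = 0"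
      using ab by blast
  }
qed

end

section \<open>The four geometries\<close>

lemma preserving_subgroup:
  "subgroup {f \<in> Bij X. \<forall>x\<in>X. \<forall>y\<in>X. d (f x) (f y) = d x y} (BijGroup X)"
proof
  let ?H = "{f \<in> Bij X. \<forall>x\<in>X. \<forall>y\<in>X. d (f x) (f y) = d x y}"
  show "?H \<subseteq> carrier (BijGroup X)"
    by (auto simp: BijGroup_def)
  show "f \<otimes>\<^bsub>BijGroup X\<^esub> g \<in> ?H" if "f \<in> ?H" "g \<in> ?H" for f g
  proof -
    have "g x \<in> X" if "x \<in> X" for x
      using \<open>g \<in> ?H\<close> that Bij_imp_funcset by blast
    then show ?thesis
      using that compose_Bij[of f X g] by (simp add: BijGroup_def compose_def)
  qed
  show "\<one>\<^bsub>BijGroup X\<^esub> \<in> ?H"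
    using id_Bij[of X] by (simp add: BijGroup_def)
  show "inv\<^bsub>BijGroup X\<^esub> f \<in> ?H" if f: "f \<in> ?H" for f
  proof -
    have fB: "f \<in> Bij X"
      using f by simp
    have inv: "inv\<^bsub>BijGroup X\<^esub> f = restrict (inv_into X f) X"
      by (rule inv_BijGroup[OF fB])
    have img: "f ` X = X"
      using fB by (auto simp: Bij_def bij_betw_def)
    have "d (inv_into X f x) (inv_into X f y) = d x y" if "x \<in> X" "y \<in> X" for x y
    proof -
      have fd: "\<forall>x\<in>X. \<forall>y\<in>X. d (f x) (f y) = d x y"
        using f by simp
      have "inv_into X f x \<in> X" "inv_into X f y \<in> X"
        and eq: "f (inv_into X f x) = x" "f (inv_into X f y) = y"
        using that img by (simp_all add: inv_into_into f_inv_into_f)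
      then have "d (f (inv_into X f x)) (f (inv_into X f y)) = d (inv_into X f x) (inv_into X f y)"
        using fd by blast
      then show ?thesis
        unfolding eq by simp
    qed
    then show ?thesis
      unfolding inv using restrict_inv_into_Bij[OF fB] by simp
  qed
qed

text \<open>
  Let \<open>A\<close> be the linear map that agrees with \<open>f\<close> on a basis contained in \<open>Q\<close>. For \<open>x \<in> Q\<close> the vector
  \<open>A x - f x\<close> is orthogonal to \<open>Q\<close> with respect to the nondegenerate form \<open>J x \<bullet> y\<close>.
\<close>

lemma form_preserving_linear:
  fixes J :: "'a::euclidean_space \<Rightarrow> 'a"
  assumes J: "linear J" "inj J" and f: "f ` Q = Q" and span: "span Q = UNIV"
    and pres: "\<And>x y. \<lbrakk>x \<in> Q; y \<in> Q\<rbrakk> \<Longrightarrow> J (f x) \<bullet> f y = J x \<bullet> y"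
  obtains A where "linear A" "\<forall>x\<in>Q. A x = f x"
proof -
  obtain B where B: "B \<subseteq> Q" "independent B" "Q \<subseteq> span B"
    using maximal_independent_subset[of Q] by blast
  obtain A where A: "linear A" "\<forall>x\<in>B. A x = f x"
    using linear_independent_extend[OF B(2)] by blast
  have "span Q \<subseteq> span (span B)"
    by (rule span_mono[OF B(3)])
  then have spanB: "span B = UNIV"
    unfolding span span_span by blast
  have A': "J (A u) \<bullet> f y = J u \<bullet> y" if y: "y \<in> Q" for u y
  proof -
    have "u \<in> span B"
      using spanB by simp
    then show ?thesis
    proof (induction rule: span_induct_alt)
      case base
      then show ?case
        using A(1) J(1) by (simp add: linear_0)
    next
      case (step c x z)
      have "J (A (c *\<^sub>R x + z)) \<bullet> f y = c * (J (A x) \<bullet> f y) + J (A z) \<bullet> f y"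
        using A(1) J(1) by (simp add: linear_add linear_scale inner_add_left)
      also have "J (A x) \<bullet> f y = J x \<bullet> y"
        using A(2) step(1) pres[of x y] B(1) y by auto
      also have "J (A z) \<bullet> f y = J z \<bullet> y"
        by (rule step(2))
      finally show ?case
        using J(1) by (simp add: linear_add linear_scale inner_add_left)
    qed
  qed
  have "A x = f x" if x: "x \<in> Q" for x
  proof -
    have "J (A x - f x) \<bullet> z = 0" if z: "z \<in> Q" for z
    proof -
      have "z \<in> f ` Q"
        using z f by simp
      then obtain y where y: "y \<in> Q" "z = f y"
        by blast
      show ?thesis
        using A'[OF y(1), of x] pres[OF x y(1)] J(1) by (simp add: y(2) linear_diff inner_diff_left)
    qed
    then have "span Q \<subseteq> {z. J (A x - f x) \<bullet> z = 0}"
      by (intro span_minimal subspace_hyperplane) auto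
    then have "J (A x - f x) \<bullet> J (A x - f x) = 0"
      unfolding span by blast
    then have "J (A x - f x) = J 0"
      using J(1) by (simp add: linear_0)
    then have "A x - f x = 0"
      using J(2) by (simp only: inj_eq)
    then show ?thesis by simp
  qed
  then show ?thesis
    using that A(1) by blast
qed

lemma span_points:
  fixes K Q :: "'a::euclidean_space set"
  assumes "open K" "K \<noteq> {}" "\<And>v. v \<in> K \<Longrightarrow> \<exists>c. c *\<^sub>R v \<in> Q \<and> c \<noteq> 0"
  shows "span Q = UNIV"
proof -
  have "K \<subseteq> span Q"
  proof
    fix v assume "v \<in> K"
    then obtain c where "c *\<^sub>R v \<in> Q" "c \<noteq> 0"
      using assms(3) by blast
    then have "(1 / c) *\<^sub>R (c *\<^sub>R v) \<in> span Q"
      by (intro span_scale span_base)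
    then show "v \<in> span Q"
      using \<open>c \<noteq> 0\<close> by simp
  qed
  then have "dim K \<le> dim Q"
    by (metis dim_span dim_subset)
  moreover have "dim K = DIM('a)"
    using dim_openin[of UNIV K] assms(1,2) by simp
  ultimately show ?thesis
    using dim_subset_UNIV[of Q] dim_eq_full[of Q] by simp
qed

text \<open>
  The functional of \<open>z - x\<close> vanishes where that of \<open>a\<close> does, so the two are proportional. This applies to
  the image \<open>z\<close> of \<open>x\<close> under a reflection whose mirror has the normal \<open>a\<close>.
\<close>

lemma moves_along_normal:
  fixes J :: "'a::euclidean_space \<Rightarrow> 'a"
  assumes J: "linear J" "inj J" and K: "open K" "e \<in> K" "J a \<bullet> e = 0"
    and t: "\<And>y. \<lbrakk>y \<in> K; J a \<bullet> y = 0\<rbrakk> \<Longrightarrow> J z \<bullet> y = J x \<bullet> y"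
  shows "\<exists>l. z = x + l *\<^sub>R a"
proof -
  have "J (z - x) \<bullet> y = 0" if "y \<in> K" "J a \<bullet> y = 0" for y
    using t[OF that] J(1) by (simp add: linear_diff inner_diff_left)
  then obtain k where "J (z - x) = k *\<^sub>R J a"
    using functional_proportional[OF K, of "J (z - x)"] by blast
  then have "J (z - x) = J (k *\<^sub>R a)"
    using J(1) by (simp add: linear_scale)
  then have "z - x = k *\<^sub>R a"
    using J(2) by (simp only: inj_eq)
  then show ?thesis
    by (intro exI[of _ k]) (simp add: diff_eq_eq add.commute)
qed

subsection \<open>Projective space\<close>

lemma sgn_scale: "c > 0 \<Longrightarrow> sgn (c *\<^sub>R v) = sgn (v::'a::euclidean_space)"
  by (simp add: sgn_scaleR)

lemma sgn_multiple: "v \<noteq> 0 \<Longrightarrow> \<exists>c>0. sgn v = c *\<^sub>R (v::'a::euclidean_space)"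
  by (intro exI[of _ "inverse (norm v)"]) (simp add: sgn_div_norm)

lemma sgn_unit: "norm v = 1 \<Longrightarrow> sgn v = (v::'a::euclidean_space)"
  by (simp add: sgn_div_norm)

lemma continuous_on_sgn: "0 \<notin> K \<Longrightarrow> continuous_on K (sgn :: 'a::euclidean_space \<Rightarrow> 'a)"
  unfolding sgn_div_norm by (intro continuous_intros) auto

lemma projective_isometries_subgroup:
  fixes K :: "'a::euclidean_space set"
  assumes K: "0 \<notin> K" "\<And>v c. \<lbrakk>v \<in> K; c > 0\<rbrakk> \<Longrightarrow> c *\<^sub>R v \<in> K"
  shows "subgroup (isometries (Projective K)) (BijGroup (points (Projective K)))"
proof
  let ?Q = "K \<inter> sphere 0 1"
  let ?I = "isometries (Projective K)"
  have sgnQ: "sgn v \<in> ?Q" if "v \<in> K" for v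
  proof -
    have v: "v \<noteq> 0"
      using that K(1) by blast
    obtain c where "c > 0" "sgn v = c *\<^sub>R v"
      using sgn_multiple[OF v] by blast
    then have "sgn v \<in> K"
      using K(2)[OF that] by metis
    then show ?thesis
      using v by (simp add: norm_sgn)
  qed
  have I: "f \<in> ?I \<longleftrightarrow> f \<in> Bij ?Q \<and> (\<exists>A. linear A \<and> bij A \<and> A ` K = K \<and> (\<forall>x\<in>?Q. f x = sgn (A x)))" for f
    by simp
  have sgnA: "sgn (A (sgn v)) = sgn (A v)" if A: "linear A" and v: "v \<noteq> 0" for A :: "'a \<Rightarrow> 'a" and v
  proof -
    obtain c where "c > 0" "sgn v = c *\<^sub>R v"
      using sgn_multiple[OF v] by blast
    then show ?thesis
      using sgn_scale A by (simp add: linear_scale)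
  qed
  show "?I \<subseteq> carrier (BijGroup (points (Projective K)))"
    by (auto simp: BijGroup_def)
  show "\<one>\<^bsub>BijGroup (points (Projective K))\<^esub> \<in> ?I"
    unfolding I using id_Bij[of ?Q]
    by (auto simp: BijGroup_def sgn_unit intro!: exI[of _ "\<lambda>x. x"] bij_id[unfolded id_def] linear_ident)
  show "f \<otimes>\<^bsub>BijGroup (points (Projective K))\<^esub> g \<in> ?I" if fg: "f \<in> ?I" "g \<in> ?I" for f g
  proof -
    obtain A where A: "linear A" "bij A" "A ` K = K" "\<forall>x\<in>?Q. f x = sgn (A x)" and fB: "f \<in> Bij ?Q"
      using fg(1) unfolding I by blast
    obtain B where B: "linear B" "bij B" "B ` K = K" "\<forall>x\<in>?Q. g x = sgn (B x)" and gB: "g \<in> Bij ?Q"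
      using fg(2) unfolding I by blast
    have "compose ?Q f g x = sgn ((A \<circ> B) x)" if x: "x \<in> ?Q" for x
    proof -
      have Bx: "B x \<in> K"
        using B(3) x by blast
      have "compose ?Q f g x = f (sgn (B x))"
        using x B(4) by (simp add: compose_def)
      also have "\<dots> = sgn (A (sgn (B x)))"
        using A(4) sgnQ[OF Bx] by blast
      also have "\<dots> = sgn (A (B x))"
        by (rule sgnA[OF A(1)]) (use Bx K(1) in metis)
      finally show ?thesis by simp
    qed
    moreover have "linear (A \<circ> B)" "bij (A \<circ> B)"
      using linear_compose[OF B(1) A(1)] bij_comp[OF B(2) A(2)] .
    moreover have "(A \<circ> B) ` K = K"
      by (simp only: image_comp[symmetric] A(3) B(3))
    ultimately have "compose ?Q f g \<in> ?I"
      unfolding I using compose_Bij[OF fB gB] by blast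
    then show ?thesis
      using fB gB by (simp add: BijGroup_def)
  qed
  show "inv\<^bsub>BijGroup (points (Projective K))\<^esub> f \<in> ?I" if f: "f \<in> ?I" for f
  proof -
    obtain A where A: "linear A" "bij A" "A ` K = K" "\<forall>x\<in>?Q. f x = sgn (A x)" and fB: "f \<in> Bij ?Q"
      using f unfolding I by blast
    define B where "B = inv_into UNIV A"
    have B1: "linear B"
      unfolding B_def by (rule inj_linear_imp_inv_linear[OF A(1) bij_is_inj[OF A(2)]])
    have B2: "bij B"
      unfolding B_def by (rule bij_imp_bij_inv[OF A(2)])
    have B3: "A (B x) = x" for x
      unfolding B_def by (rule surj_f_inv_f[OF bij_is_surj[OF A(2)]])
    have B4: "B (A x) = x" for x
      unfolding B_def by (rule inv_f_f[OF bij_is_inj[OF A(2)]])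
    note B = B1 B2 B3 B4
    have BK: "B ` K = K"
    proof -
      have "B ` A ` K = K"
        using B(4) by (simp add: image_comp comp_def)
      then show ?thesis
        using A(3) by simp
    qed
    have "restrict (inv_into ?Q f) ?Q x = sgn (B x)" if x: "x \<in> ?Q" for x
    proof -
      have Bx: "B x \<in> K"
        using BK x by blast
      have "f (sgn (B x)) = sgn (A (sgn (B x)))"
        using A(4) sgnQ[OF Bx] by blast
      also have "\<dots> = sgn (A (B x))"
        by (rule sgnA[OF A(1)]) (use Bx K(1) in metis)
      also have "\<dots> = x"
        using B(3)[of x] x by (simp add: sgn_unit)
      finally have "f (sgn (B x)) = x" .
      moreover have "inj_on f ?Q"
        using fB by (auto simp: Bij_def bij_betw_def)
      ultimately have "inv_into ?Q f x = sgn (B x)"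
        using sgnQ[OF Bx] inv_into_f_f by metis
      then show ?thesis
        using x by simp
    qed
    then have "restrict (inv_into ?Q f) ?Q \<in> ?I"
      unfolding I using restrict_inv_into_Bij[OF fB] B(1,2) BK by blast
    then show ?thesis
      using inv_BijGroup[OF fB] by simp
  qed
qed

lemma projective_model:
  fixes K :: "'a::euclidean_space set"
  assumes "is_geometry (Projective K)"
  shows "space_model (Projective K) (\<lambda>x. x) sgn K"
proof -
  have K: "open K" "convex K" "K \<noteq> {}" "0 \<notin> K" "\<And>v c. \<lbrakk>v \<in> K; c > 0\<rbrakk> \<Longrightarrow> c *\<^sub>R v \<in> K"
    using assms by auto
  have nz: "v \<noteq> 0" if "v \<in> K" for v
    using K(4) that by blast
  show ?thesis
  proof (rule space_model.intro)
    show "open K" "K \<noteq> {}" "0 \<notin> K"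
      using K by auto
    show "v \<in> K \<Longrightarrow> 0 < c \<Longrightarrow> c *\<^sub>R v \<in> K" for v c
      by (rule K(5))
    show "closed_segment u v \<subseteq> K" if "u \<in> K" "v \<in> K" for u v
      using that K(2) by (rule closed_segment_subset)
    show "x \<in> K" "sgn x = x" if "x \<in> points (Projective K)" for x
      using that by (auto simp: sgn_unit)
    show sgnP: "sgn v \<in> points (Projective K)" if v: "v \<in> K" for v
    proof -
      obtain c where "c > 0" "sgn v = c *\<^sub>R v"
        using sgn_multiple[OF nz[OF v]] by blast
      then have "sgn v \<in> K"
        using K(5)[OF v] by metis
      then show ?thesis
        using nz[OF v] by (simp add: norm_sgn)
    qed
    show "\<exists>c>0. sgn v = c *\<^sub>R v" if "v \<in> K" for v
      by (rule sgn_multiple[OF nz[OF that]])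
    show "sgn (c *\<^sub>R v) = sgn v" if "0 < c" for v :: 'a and c
      by (rule sgn_scale[OF that])
    show "continuous_on (points (Projective K)) (\<lambda>x. x)"
      by (rule continuous_on_id)
    show "continuous_on K sgn"
      by (rule continuous_on_sgn[OF K(4)])
    show "\<exists>w. w \<noteq> 0 \<and> (\<forall>x\<in>points (Projective K). form (Projective K) a x - b = w \<bullet> x)"
      if "a \<noteq> 0" "Projective K = Euclidean \<or> b = 0" for a b
      using that by (intro exI[of _ a]) simp
    show "\<exists>a b. a \<noteq> 0 \<and> (Projective K = Euclidean \<or> b = 0) \<and>
        (\<forall>x\<in>points (Projective K). form (Projective K) a x - b = w \<bullet> x)" if "w \<noteq> 0" for w
      using that by (intro exI[of _ w] exI[of _ 0]) simp
    show "dimension_in (Projective K) T = int (dim ((\<lambda>x. x) ` T)) - 1" for T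
      by simp
    show "\<exists>A. linear A \<and> (\<forall>v\<in>K. A v \<in> K \<and> sgn (A v) = f (sgn v))"
      if f: "f \<in> isometries (Projective K)" for f
    proof -
      obtain A where A: "linear A" "A ` K = K" "\<forall>x\<in>points (Projective K). f x = sgn (A x)"
        using f by auto
      have "sgn (A v) = f (sgn v)" if v: "v \<in> K" for v
      proof -
        obtain c where c: "c > 0" "sgn v = c *\<^sub>R v"
          using sgn_multiple[OF nz[OF v]] by blast
        have "f (sgn v) = sgn (A (c *\<^sub>R v))"
          using A(3) c(2) sgnP[OF v] by metis
        also have "\<dots> = sgn (c *\<^sub>R A v)"
          using A(1) by (simp only: linear_scale)
        also have "\<dots> = sgn (A v)"
          by (rule sgn_scale[OF c(1)])
        finally show ?thesis by simp
      qed
      then show ?thesis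
        using A(1,2) by blast
    qed
    show "subgroup (isometries (Projective K)) (BijGroup (points (Projective K)))"
      by (rule projective_isometries_subgroup[OF K(4,5)])
  qed
qed

subsection \<open>Spheres and Lobachevsky spaces\<close>

text \<open>
  The common features of spheres and Lobachevsky spaces: the points are the vectors of \<open>K\<close> with \<open>N v = 1\<close>,
  where \<open>N\<close> normalises the vectors of \<open>K\<close>, and isometries preserve the form \<open>J x \<bullet> y\<close>, because the
  distance \<open>d\<close> determines it.
\<close>

locale quadric_model =
  fixes S :: "'a::euclidean_space geometry" and J :: "'a \<Rightarrow> 'a" and K :: "'a set"
    and N :: "'a \<Rightarrow> real" and d :: "'a \<Rightarrow> 'a \<Rightarrow> real"
  assumes J: "linear J" and JJ: "J (J x) = x"
    and K: "open K" "K \<noteq> {}" "0 \<notin> K" and K_scale: "\<lbrakk>v \<in> K; c > 0\<rbrakk> \<Longrightarrow> c *\<^sub>R v \<in> K"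
    and K_seg: "\<lbrakk>u \<in> K; v \<in> K; 0 \<notin> closed_segment u v\<rbrakk> \<Longrightarrow> closed_segment u v \<subseteq> K"
    and N: "continuous_on K N" and N_pos: "v \<in> K \<Longrightarrow> N v > 0"
    and N_scale: "\<lbrakk>v \<in> K; c > 0\<rbrakk> \<Longrightarrow> N (c *\<^sub>R v) = c * N v"
    and points_eq: "points S = {v \<in> K. N v = 1}"
    and form_eq: "form S a x = J a \<bullet> x" and not_Euclidean: "S \<noteq> Euclidean"
    and dimension_eq: "dimension_in S A = int (dim A) - 1"
    and isometries_eq: "isometries S =
      {f \<in> Bij (points S). \<forall>x\<in>points S. \<forall>y\<in>points S. d (f x) (f y) = d x y}"
    and d_form: "\<lbrakk>x \<in> points S; y \<in> points S; x' \<in> points S; y' \<in> points S; d x y = d x' y'\<rbrakk> \<Longrightarrow>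
      J x \<bullet> y = J x' \<bullet> y'"
begin

abbreviation p :: "'a \<Rightarrow> 'a"
  where "p v \<equiv> (1 / N v) *\<^sub>R v"

lemma inj_J: "inj J"
  using JJ by (metis injI)

lemma p_points: "v \<in> K \<Longrightarrow> p v \<in> points S"
  using K_scale[of v "1 / N v"] N_pos[of v] N_scale[of v "1 / N v"] by (simp add: points_eq)

lemma isometry_form:
  assumes f: "f \<in> isometries S" and xy: "x \<in> points S" "y \<in> points S"
  shows "f x \<in> points S" "J (f x) \<bullet> f y = J x \<bullet> y"
proof -
  have mem: "f z \<in> points S" if "z \<in> points S" for z
    using f that Bij_imp_funcset[of f] by (auto simp: isometries_eq)
  show "f x \<in> points S"
    using mem xy(1) .
  have "d (f x) (f y) = d x y"
    using f xy by (simp add: isometries_eq)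
  then show "J (f x) \<bullet> f y = J x \<bullet> y"
    using d_form[OF mem[OF xy(1)] mem[OF xy(2)] xy] by blast
qed

lemma space: "space_model S (\<lambda>x. x) p K"
proof (rule space_model.intro)
  show "open K" "K \<noteq> {}" "0 \<notin> K"
    by (rule K)+
  show "v \<in> K \<Longrightarrow> 0 < c \<Longrightarrow> c *\<^sub>R v \<in> K" for v c
    by (rule K_scale)
  show "u \<in> K \<Longrightarrow> v \<in> K \<Longrightarrow> 0 \<notin> closed_segment u v \<Longrightarrow> closed_segment u v \<subseteq> K" for u v
    by (rule K_seg)
  show "x \<in> K" "p x = x" if "x \<in> points S" for x
    using that by (simp_all add: points_eq)
  show "p v \<in> points S" if "v \<in> K" for v
    by (rule p_points[OF that])
  show "\<exists>c>0. p v = c *\<^sub>R v" if "v \<in> K" for v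
    using N_pos[OF that] by (intro exI[of _ "1 / N v"]) simp
  show "p (c *\<^sub>R v) = p v" if "v \<in> K" "c > 0" for v c
    using N_scale[OF that] that(2) by simp
  show "continuous_on (points S) (\<lambda>x. x)"
    by (rule continuous_on_id)
  show "continuous_on K p"
    using N N_pos by (intro continuous_intros) force+
  show "\<exists>w. w \<noteq> 0 \<and> (\<forall>x\<in>points S. form S a x - b = w \<bullet> x)" if "a \<noteq> 0" "S = Euclidean \<or> b = 0" for a b
  proof -
    have "J a \<noteq> 0"
      using JJ[of a] J that(1) by (metis linear_0)
    then show ?thesis
      using that(2) not_Euclidean by (intro exI[of _ "J a"]) (simp add: form_eq)
  qed
  show "\<exists>a b. a \<noteq> 0 \<and> (S = Euclidean \<or> b = 0) \<and> (\<forall>x\<in>points S. form S a x - b = w \<bullet> x)"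
    if "w \<noteq> 0" for w
  proof -
    have "J w \<noteq> 0"
      using JJ[of w] J that by (metis linear_0)
    then show ?thesis
      by (intro exI[of _ "J w"] exI[of _ 0]) (simp add: form_eq JJ)
  qed
  show "dimension_in S A = int (dim ((\<lambda>x. x) ` A)) - 1" for A
    by (simp add: dimension_eq)
  show "\<exists>A. linear A \<and> (\<forall>v\<in>K. A v \<in> K \<and> p (A v) = f (p v))" if f: "f \<in> isometries S" for f
  proof -
    have img: "f ` points S = points S"
      using f by (auto simp: isometries_eq Bij_def bij_betw_def)
    have "span (points S) = UNIV"
    proof (rule span_points[OF K(1,2)])
      show "\<exists>c. c *\<^sub>R v \<in> points S \<and> c \<noteq> 0" if "v \<in> K" for v
        using p_points[OF that] N_pos[OF that] by (intro exI[of _ "1 / N v"]) simp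
    qed
    then obtain A where A: "linear A" "\<forall>x\<in>points S. A x = f x"
      using form_preserving_linear[OF J inj_J img _ isometry_form(2)[OF f]] by blast
    have "A v \<in> K \<and> p (A v) = f (p v)" if v: "v \<in> K" for v
    proof -
      have fp: "f (p v) \<in> points S"
        by (rule isometry_form(1)[OF f p_points[OF v] p_points[OF v]])
      then have fK: "f (p v) \<in> K" "N (f (p v)) = 1"
        by (simp_all add: points_eq)
      have "A (p v) = f (p v)"
        using A(2) p_points[OF v] by blast
      then have "(1 / N v) *\<^sub>R A v = f (p v)"
        using A(1) by (simp add: linear_scale)
      then have "N v *\<^sub>R ((1 / N v) *\<^sub>R A v) = N v *\<^sub>R f (p v)"
        by simp
      then have Av: "A v = N v *\<^sub>R f (p v)"
        using N_pos[OF v] by simp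
      then show ?thesis
        using K_scale[OF fK(1) N_pos[OF v]] N_scale[OF fK(1) N_pos[OF v]] fK(2) N_pos[OF v]
        by simp
    qed
    then show ?thesis
      using A(1) by blast
  qed
  show "subgroup (isometries S) (BijGroup (points S))"
    unfolding isometries_eq by (rule preserving_subgroup)
qed

lemma along_normal:
  assumes r: "reflection_in S Z t" and ab: "(a, b) \<in> normals S Z" and x: "x \<in> points S"
  shows "\<exists>l. t x = x + l *\<^sub>R a"
proof -
  have t: "t \<in> isometries S" and Z: "Z = {x \<in> points S. t x = x}" "Z \<noteq> {}"
    using r by (auto simp: reflection_in_def is_hyperplane_def)
  have Z': "Z = {x \<in> points S. J a \<bullet> x = 0}"
    using ab not_Euclidean by (auto simp: normals_def hyperplane_eq_def form_eq)
  obtain e where "e \<in> Z"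
    using Z(2) by blast
  then have e: "e \<in> K" "J a \<bullet> e = 0"
    using Z' by (auto simp: points_eq)
  show ?thesis
  proof (rule moves_along_normal[OF J inj_J K(1) e])
    fix y assume y: "y \<in> K" "J a \<bullet> y = 0"
    have py: "p y \<in> points S"
      by (rule p_points[OF y(1)])
    have "p y \<in> Z"
      unfolding Z' using py y(2) by simp
    then have "t (p y) = p y"
      using Z(1) by blast
    then have "J (t x) \<bullet> p y = J x \<bullet> p y"
      using isometry_form(2)[OF t x py] by simp
    then show "J (t x) \<bullet> y = J x \<bullet> y"
      using N_pos[OF y(1)] by simp
  qed
qed

end

lemma spherical_quadric:
  "quadric_model (Spherical :: 'a::euclidean_space geometry) (\<lambda>x. x) (- {0}) norm
    (\<lambda>x y. arccos (x \<bullet> y))"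
proof
  show "- {0} \<noteq> ({} :: 'a set)"
    using nonempty_Basis nonzero_Basis by blast
  fix x y x' y' :: 'a
  assume "x \<in> points Spherical" "y \<in> points Spherical" "x' \<in> points Spherical" "y' \<in> points Spherical"
    and eq: "arccos (x \<bullet> y) = arccos (x' \<bullet> y')"
  then have "\<bar>x \<bullet> y\<bar> \<le> 1" "\<bar>x' \<bullet> y'\<bar> \<le> 1"
    using Cauchy_Schwarz_ineq2[of x y] Cauchy_Schwarz_ineq2[of x' y'] by auto
  then show "x \<bullet> y = x' \<bullet> y'"
    using eq cos_arccos_abs by metis
qed (auto intro: linear_ident continuous_on_norm_id)

text \<open>
  The reversed Cauchy-Schwarz inequality. It puts the arguments of \<^const>\<open>arcosh\<close> into the range where
  this function is injective.
\<close>

lemma lorentz_reversed: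
  fixes e :: "'a::euclidean_space"
  assumes e: "norm e = 1" and x: "lorentz e x x = -1" "x \<bullet> e > 0" and y: "lorentz e y y = -1" "y \<bullet> e > 0"
  shows "1 \<le> - lorentz e x y"
proof -
  define x' where "x' = x - (x \<bullet> e) *\<^sub>R e"
  define y' where "y' = y - (y \<bullet> e) *\<^sub>R e"
  have ee: "e \<bullet> e = 1"
    using e by (simp add: norm_eq_1)
  have l: "lorentz e u v = (u - (u \<bullet> e) *\<^sub>R e) \<bullet> (v - (v \<bullet> e) *\<^sub>R e) - (u \<bullet> e) * (v \<bullet> e)" for u v
    by (simp add: lorentz_def inner_diff_left inner_diff_right ee inner_commute[of e u] inner_commute[of e v])
  have nx: "(x \<bullet> e)\<^sup>2 = 1 + (norm x')\<^sup>2"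
    using x(1) l[of x x] unfolding x'_def power2_norm_eq_inner power2_eq_square[of "x \<bullet> e"] by simp
  have ny: "(y \<bullet> e)\<^sup>2 = 1 + (norm y')\<^sup>2"
    using y(1) l[of y y] unfolding y'_def power2_norm_eq_inner power2_eq_square[of "y \<bullet> e"] by simp
  have "(1 + norm x' * norm y')\<^sup>2 \<le> (1 + (norm x')\<^sup>2) * (1 + (norm y')\<^sup>2)"
    using zero_le_power2[of "norm x' - norm y'"] by (simp add: power2_eq_square algebra_simps)
  also have "\<dots> = ((x \<bullet> e) * (y \<bullet> e))\<^sup>2"
    by (simp add: nx ny power_mult_distrib)
  finally have "1 + norm x' * norm y' \<le> (x \<bullet> e) * (y \<bullet> e)"
    using x(2) y(2) by (rule_tac power2_le_imp_le) auto
  moreover have "x' \<bullet> y' \<le> norm x' * norm y'"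
    by (rule norm_cauchy_schwarz)
  ultimately show ?thesis
    using l[of x y] by (simp add: x'_def y'_def)
qed

lemma lobachevsky_quadric:
  fixes e :: "'a::euclidean_space"
  assumes e: "norm e = 1"
  shows "quadric_model (Lobachevsky e) (\<lambda>x. x - (2 * (x \<bullet> e)) *\<^sub>R e)
    {v. norm (v - (v \<bullet> e) *\<^sub>R e) < v \<bullet> e} (\<lambda>v. sqrt (- lorentz e v v))
    (\<lambda>x y. arcosh (- lorentz e x y))"
proof -
  let ?K = "{v. norm (v - (v \<bullet> e) *\<^sub>R e) < v \<bullet> e}"
  have ee: "e \<bullet> e = 1"
    using e by (simp add: norm_eq_1)
  have l: "lorentz e v v = (norm (v - (v \<bullet> e) *\<^sub>R e))\<^sup>2 - (v \<bullet> e)\<^sup>2" for v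
  proof -
    have "(norm (v - (v \<bullet> e) *\<^sub>R e))\<^sup>2 = v \<bullet> v - (v \<bullet> e) * (v \<bullet> e)"
      unfolding power2_norm_eq_inner
      by (simp add: inner_diff_left inner_diff_right ee inner_commute[of e v])
    then show ?thesis
      by (simp add: lorentz_def power2_eq_square)
  qed
  have neg: "lorentz e v v < 0" if "v \<in> ?K" for v
    using that power_strict_mono[of "norm (v - (v \<bullet> e) *\<^sub>R e)" "v \<bullet> e" 2] by (simp add: l)
  have pts: "points (Lobachevsky e) = {v \<in> ?K. sqrt (- lorentz e v v) = 1}"
  proof (intro equalityI subsetI)
    fix v assume "v \<in> points (Lobachevsky e)"
    then have v: "lorentz e v v = -1" "v \<bullet> e > 0"
      by auto
    then have "(norm (v - (v \<bullet> e) *\<^sub>R e))\<^sup>2 < (v \<bullet> e)\<^sup>2"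
      using l[of v] by simp
    then have "norm (v - (v \<bullet> e) *\<^sub>R e) < v \<bullet> e"
      using v(2) by (rule_tac power2_less_imp_less) auto
    then show "v \<in> {v \<in> ?K. sqrt (- lorentz e v v) = 1}"
      using v by simp
  next
    fix v assume "v \<in> {v \<in> ?K. sqrt (- lorentz e v v) = 1}"
    then have "norm (v - (v \<bullet> e) *\<^sub>R e) < v \<bullet> e" "lorentz e v v = -1"
      by auto
    moreover from this(1) have "v \<bullet> e > 0"
      by (rule le_less_trans[OF norm_ge_zero])
    ultimately show "v \<in> points (Lobachevsky e)"
      by simp
  qed
  have scale: "c *\<^sub>R v - (c *\<^sub>R v \<bullet> e) *\<^sub>R e = c *\<^sub>R (v - (v \<bullet> e) *\<^sub>R e)" for c v
    by (simp add: scaleR_right_diff_distrib)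
  show ?thesis
  proof (rule quadric_model.intro)
    show "linear (\<lambda>x. x - (2 * (x \<bullet> e)) *\<^sub>R e)"
      by (rule linearI) (simp_all add: inner_add_left algebra_simps)
    show "(x - (2 * (x \<bullet> e)) *\<^sub>R e) - (2 * ((x - (2 * (x \<bullet> e)) *\<^sub>R e) \<bullet> e)) *\<^sub>R e = x" for x
      by (simp add: inner_diff_left ee)
    show "open ?K"
      by (intro open_Collect_less continuous_intros)
    have "e \<in> ?K"
      using ee by simp
    then show "?K \<noteq> {}"
      by blast
    show "0 \<notin> ?K"
      by simp
    show "c *\<^sub>R v \<in> ?K" if "v \<in> ?K" "c > 0" for v c
      using that unfolding mem_Collect_eq scale by simp
    show "closed_segment u v \<subseteq> ?K" if u: "u \<in> ?K" and v: "v \<in> ?K" for u v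
    proof
      fix x assume "x \<in> closed_segment u v"
      then obtain t where t: "0 \<le> t" "t \<le> 1" "x = (1 - t) *\<^sub>R u + t *\<^sub>R v"
        by (auto simp: closed_segment_def)
      have "x - (x \<bullet> e) *\<^sub>R e = (1 - t) *\<^sub>R (u - (u \<bullet> e) *\<^sub>R e) + t *\<^sub>R (v - (v \<bullet> e) *\<^sub>R e)"
        unfolding t(3) by (simp add: inner_add_left algebra_simps)
      then have "norm (x - (x \<bullet> e) *\<^sub>R e) \<le>
          norm ((1 - t) *\<^sub>R (u - (u \<bullet> e) *\<^sub>R e)) + norm (t *\<^sub>R (v - (v \<bullet> e) *\<^sub>R e))"
        by (simp only: norm_triangle_ineq)
      also have "\<dots> = (1 - t) * norm (u - (u \<bullet> e) *\<^sub>R e) + t * norm (v - (v \<bullet> e) *\<^sub>R e)"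
        using t(1,2) by simp
      also have "\<dots> < (1 - t) * (u \<bullet> e) + t * (v \<bullet> e)"
      proof (cases "t = 0")
        case True
        then show ?thesis using u by simp
      next
        case False
        then show ?thesis
          using u v t(1,2) by (intro add_le_less_mono mult_left_mono mult_strict_left_mono) auto
      qed
      also have "\<dots> = x \<bullet> e"
        by (simp add: t(3) inner_add_left)
      finally show "x \<in> ?K"
        by simp
    qed
    show "continuous_on ?K (\<lambda>v. sqrt (- lorentz e v v))"
      unfolding lorentz_def by (intro continuous_intros)
    show "sqrt (- lorentz e v v) > 0" if "v \<in> ?K" for v
      using neg[OF that] by simp
    show "sqrt (- lorentz e (c *\<^sub>R v) (c *\<^sub>R v)) = c * sqrt (- lorentz e v v)" if "c > 0" for v c
    proof -
      have "- lorentz e (c *\<^sub>R v) (c *\<^sub>R v) = c\<^sup>2 * - lorentz e v v"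
        by (simp add: lorentz_def power2_eq_square algebra_simps)
      then show ?thesis
        using that by (simp only: real_sqrt_mult real_sqrt_abs abs_of_pos)
    qed
    show "points (Lobachevsky e) = {v \<in> ?K. sqrt (- lorentz e v v) = 1}"
      by (rule pts)
    show "form (Lobachevsky e) a x = (a - (2 * (a \<bullet> e)) *\<^sub>R e) \<bullet> x" for a x
      by (simp add: lorentz_def inner_diff_left inner_commute[of e])
    fix x y x' y' :: 'a
    assume x: "x \<in> points (Lobachevsky e)" "y \<in> points (Lobachevsky e)"
      "x' \<in> points (Lobachevsky e)" "y' \<in> points (Lobachevsky e)"
      and eq: "arcosh (- lorentz e x y) = arcosh (- lorentz e x' y')"
    have "1 \<le> - lorentz e x y" "1 \<le> - lorentz e x' y'"
      using x lorentz_reversed[OF e, of x y] lorentz_reversed[OF e, of x' y'] by simp_all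
    then have "- lorentz e x y = - lorentz e x' y'"
      using eq cosh_arcosh_real by metis
    then show "(x - (2 * (x \<bullet> e)) *\<^sub>R e) \<bullet> y = (x' - (2 * (x' \<bullet> e)) *\<^sub>R e) \<bullet> y'"
      by (simp add: lorentz_def inner_diff_left inner_commute[of e])
  qed auto
qed

subsection \<open>Euclidean space\<close>

text \<open>
  Subtracting \<open>(a, 1)\<close> for one point \<open>a\<close> of \<open>T\<close> reduces the span of the lifted points to \<open>(a, 1)\<close> and the
  directions of \<open>T\<close>.
\<close>

lemma aff_dim_cone:
  fixes T :: "'a::euclidean_space set"
  shows "aff_dim T = int (dim ((\<lambda>x. (x, 1::real)) ` T)) - 1"
proof (cases "T = {}")
  case False
  then obtain a where a: "a \<in> T"
    by blast
  let ?D = "(\<lambda>x. - a + x) ` T"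
  let ?D' = "(\<lambda>y. (y, 0::real)) ` ?D"
  let ?T = "(\<lambda>x. (x, 1::real)) ` T"
  have "linear (\<lambda>y::'a. (y, 0::real))"
    by (rule linearI) auto
  then have "dim ?D' = dim ?D"
    by (rule dim_image_eq) (auto simp: inj_on_def)
  moreover have "span ?T = span (insert (a, 1) ?D')"
    unfolding span_eq
  proof
    show "?T \<subseteq> span (insert (a, 1) ?D')"
    proof
      fix z assume "z \<in> ?T"
      then obtain x where x: "x \<in> T" "z = (x, 1)"
        by blast
      have "(- a + x, 0) \<in> ?D'"
        using x(1) by blast
      then have "(a, 1) + (- a + x, 0) \<in> span (insert (a, 1) ?D')"
        by (intro span_add span_base) blast+
      then show "z \<in> span (insert (a, 1) ?D')"
        using x(2) by simp
    qed
    show "insert (a, 1) ?D' \<subseteq> span ?T"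
    proof
      fix z assume "z \<in> insert (a, 1) ?D'"
      then consider "z = (a, 1)" | x where "x \<in> T" "z = (- a + x, 0)"
        by blast
      then show "z \<in> span ?T"
      proof cases
        case 1
        then show ?thesis
          using a by (auto intro: span_base)
      next
        case 2
        have "(x, 1) - (a, 1) \<in> span ?T"
          using 2(1) a by (intro span_diff span_base) blast+
        then show ?thesis
          using 2(2) by simp
      qed
    qed
  qed
  moreover have "(a, 1) \<notin> span ?D'"
  proof
    assume "(a, 1) \<in> span ?D'"
    moreover have "span ?D' \<subseteq> {z. snd z = 0}"
      by (rule span_minimal) (auto simp: subspace_def)
    ultimately show False
      by auto
  qed
  ultimately have "dim ?T = dim ?D + 1"
    by (metis dim_insert dim_span)
  moreover have "aff_dim T = int (dim ?D)"
    by (rule aff_dim_eq_dim) (simp add: a hull_inc)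
  ultimately show ?thesis
    by simp
qed simp

lemma euclidean_isometry_affine:
  fixes f :: "'a::euclidean_space \<Rightarrow> 'a"
  assumes "\<And>x y. dist (f x) (f y) = dist x y"
  obtains A where "linear A" "\<And>x. f x = A x + f 0"
proof -
  have "orthogonal_transformation (\<lambda>x. f x - f 0)"
    using assms by (intro orthogonal_transformation_isometry[THEN iffD2, simplified]) (auto simp: dist_norm)
  then have "linear (\<lambda>x. f x - f 0)"
    by (rule orthogonal_transformation_linear)
  then show ?thesis
    by (rule that) simp
qed

lemma euclidean_model:
  "space_model (Euclidean :: 'a::euclidean_space geometry) (\<lambda>x. (x, 1::real))
    (\<lambda>v. (1 / snd v) *\<^sub>R fst v) {v. snd v > 0}"
proof (rule space_model.intro)
  let ?K = "{v :: 'a \<times> real. snd v > 0}"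
  show "open ?K"
    by (intro open_Collect_less continuous_intros)
  have "(0, 1) \<in> ?K" by simp
  then show "?K \<noteq> {}" by blast
  show "closed_segment u v \<subseteq> ?K" if "u \<in> ?K" "v \<in> ?K" for u v
  proof (rule closed_segment_subset[OF that])
    have "?K = {v. (0, 1) \<bullet> v > 0}"
      by (auto simp: inner_prod_def)
    then show "convex ?K"
      by (simp only: convex_halfspace_gt)
  qed
  show "continuous_on (points Euclidean) (\<lambda>x::'a. (x, 1::real))"
    by (intro continuous_intros)
  show "continuous_on ?K (\<lambda>v. (1 / snd v) *\<^sub>R fst v)"
    by (intro continuous_intros) auto
  show "\<exists>c>0. ((1 / snd v) *\<^sub>R fst v, 1) = c *\<^sub>R v" if "v \<in> ?K" for v
    using that by (intro exI[of _ "1 / snd v"]) (auto simp: prod_eq_iff)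
  show "\<exists>w. w \<noteq> 0 \<and> (\<forall>x\<in>points Euclidean. form Euclidean a x - b = w \<bullet> (x, 1::real))"
    if "a \<noteq> 0" "(Euclidean :: 'a geometry) = Euclidean \<or> b = 0" for a :: 'a and b
    using that by (intro exI[of _ "(a, - b)"]) (simp add: inner_prod_def prod_eq_iff)
  show "\<exists>a b. a \<noteq> 0 \<and> ((Euclidean :: 'a geometry) = Euclidean \<or> b = 0) \<and>
      (\<forall>x\<in>points Euclidean. form Euclidean a x - b = w \<bullet> (x, 1::real))"
    if "w \<noteq> 0" "w \<bullet> (x\<^sub>0, 1) = 0" for w :: "'a \<times> real" and x\<^sub>0
  proof -
    have "fst w \<noteq> 0"
      using that by (auto simp: inner_prod_def prod_eq_iff)
    then show ?thesis
      by (intro exI[of _ "fst w"] exI[of _ "- snd w"]) (simp add: inner_prod_def)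
  qed
  show "dimension_in Euclidean T = int (dim ((\<lambda>x. (x, 1::real)) ` T)) - 1" for T :: "'a set"
    using aff_dim_cone[of T] by simp
  show "\<exists>A. linear A \<and> (\<forall>v\<in>?K. A v \<in> ?K \<and> (1 / snd (A v)) *\<^sub>R fst (A v) = f ((1 / snd v) *\<^sub>R fst v))"
    if f: "f \<in> isometries Euclidean" for f :: "'a \<Rightarrow> 'a"
  proof -
    obtain A where A: "linear A" "\<And>x. f x = A x + f 0"
      using euclidean_isometry_affine[of f] f by auto
    have "linear (\<lambda>v. (A (fst v) + snd v *\<^sub>R f 0, snd v))"
      using A(1) by (intro linearI) (auto simp: linear_add linear_scale algebra_simps)
    moreover have "(1 / snd v) *\<^sub>R (A (fst v) + snd v *\<^sub>R f 0) = f ((1 / snd v) *\<^sub>R fst v)"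
      if "v \<in> ?K" for v
      unfolding A(2)[of "(1 / snd v) *\<^sub>R fst v"] using that A(1)
      by (simp add: linear_scale scaleR_right_distrib)
    ultimately show ?thesis
      by (intro exI[of _ "\<lambda>v. (A (fst v) + snd v *\<^sub>R f 0, snd v)"]) simp
  qed
  have "isometries (Euclidean :: 'a geometry) =
      {f \<in> Bij UNIV. \<forall>x\<in>UNIV. \<forall>y\<in>UNIV. dist (f x) (f y) = dist x y}"
    by simp
  then show "subgroup (isometries Euclidean) (BijGroup (points (Euclidean :: 'a geometry)))"
    using preserving_subgroup[of "UNIV :: 'a set" dist] by simp
qed auto

lemma euclidean_along_normal:
  fixes t :: "'a::euclidean_space \<Rightarrow> 'a"
  assumes r: "reflection_in Euclidean Z t" and ab: "(a, b) \<in> normals Euclidean Z"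
  shows "\<exists>l. t x = x + l *\<^sub>R a"
proof -
  have t: "dist (t x) (t y) = dist x y" for x y
    using r by (auto simp: reflection_in_def)
  have Z: "Z = {x. t x = x}" "Z \<noteq> {}"
    using r by (auto simp: reflection_in_def is_hyperplane_def)
  have Z': "Z = {x. a \<bullet> x = b}"
    using ab by (auto simp: normals_def hyperplane_eq_def)
  obtain y0 where y0: "y0 \<in> Z"
    using Z(2) by blast
  have eq: "(t x - y) \<bullet> (t x - y) = (x - y) \<bullet> (x - y)" if "y \<in> Z" for y
  proof -
    have "t y = y"
      using that Z(1) by blast
    then have "norm (t x - y) = norm (x - y)"
      using t[of x y] by (simp add: dist_norm)
    then show ?thesis
      by (simp add: norm_eq)
  qed
  show ?thesis
  proof (rule moves_along_normal[of "\<lambda>x. x" UNIV 0])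
    fix v assume "a \<bullet> v = 0"
    then have "y0 + v \<in> Z"
      using y0 unfolding Z' by (simp add: inner_add_right)
    then show "t x \<bullet> v = x \<bullet> v"
      using eq[OF y0] eq[of "y0 + v"] by (simp add: inner_simps inner_commute)
  qed (auto intro: linear_ident)
qed

theorem theorem2p10:
  fixes S :: "'a::euclidean_space geometry"
    and \<Gamma> :: "('a \<Rightarrow> 'a) set"
    and D X C F :: "'a set"
  assumes "is_geometry S"
    and "coxeter_group S \<Gamma> D"
    and "X \<in> mirrors S \<Gamma>"
    and "C \<in> chambers \<Gamma> D"
    and "facet S \<Gamma> C F"
    and "F \<subseteq> X"
  shows "is_semidirect_product ((BijGroup X)\<lparr>carrier := Gamma_star \<Gamma> X\<rparr>)
           (Deck S \<Gamma> X C F) (Delta S \<Gamma> X)"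
proof (cases S)
  case Euclidean
  interpret coxeter_model S "\<lambda>x. (x, 1::real)" "\<lambda>v. (1 / snd v) *\<^sub>R fst v" "{v. snd v > 0}" \<Gamma> D
    unfolding Euclidean
    by (intro coxeter_model.intro euclidean_model coxeter_model_axioms.intro)
      (use assms(2) Euclidean in simp)
  show ?thesis
  proof (rule semidirect_product[OF assms(3-6)])
    fix s t assume st: "s \<in> Rf" "t \<in> Rf"
    have "(\<exists>(a, b)\<in>normals S (mir s). \<exists>(a', b')\<in>normals S (mir t). form S a a' = 0) \<longleftrightarrow>
        mir s \<noteq> mir t \<and> t ` mir s = mir s"
      by (rule orthogonal_iff_stable[OF _ _ st])
        (auto simp: Euclidean inner_add_right intro: euclidean_along_normal)
    then show "orthogonal_mirrors S \<Gamma> (mir s) (mir t) \<longleftrightarrow> mir s \<noteq> mir t \<and> t ` mir s = mir s"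
      by (simp add: orthogonal_mirrors_def Euclidean)
  qed
next
  case Spherical
  interpret Q: quadric_model "Spherical :: 'a geometry" "\<lambda>x. x" "- {0}" norm "\<lambda>x y. arccos (x \<bullet> y)"
    by (rule spherical_quadric)
  interpret coxeter_model S "\<lambda>x. x" "\<lambda>v. (1 / norm v) *\<^sub>R v" "- {0}" \<Gamma> D
    unfolding Spherical
    by (intro coxeter_model.intro Q.space coxeter_model_axioms.intro) (use assms(2) Spherical in simp)
  show ?thesis
  proof (rule semidirect_product[OF assms(3-6)])
    fix s t assume st: "s \<in> Rf" "t \<in> Rf"
    have "(\<exists>(a, b)\<in>normals S (mir s). \<exists>(a', b')\<in>normals S (mir t). form S a a' = 0) \<longleftrightarrow>
        mir s \<noteq> mir t \<and> t ` mir s = mir s"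
      by (rule orthogonal_iff_stable[OF _ _ st])
        (auto simp: Spherical inner_add_right intro: Q.along_normal[simplified])
    then show "orthogonal_mirrors S \<Gamma> (mir s) (mir t) \<longleftrightarrow> mir s \<noteq> mir t \<and> t ` mir s = mir s"
      by (simp add: orthogonal_mirrors_def Spherical)
  qed
next
  case (Lobachevsky e)
  have e: "norm e = 1"
    using assms(1) Lobachevsky by simp
  interpret Q: quadric_model "Lobachevsky e" "\<lambda>x. x - (2 * (x \<bullet> e)) *\<^sub>R e"
    "{v. norm (v - (v \<bullet> e) *\<^sub>R e) < v \<bullet> e}" "\<lambda>v. sqrt (- lorentz e v v)"
    "\<lambda>x y. arcosh (- lorentz e x y)"
    by (rule lobachevsky_quadric[OF e])
  interpret coxeter_model S "\<lambda>x. x" "\<lambda>v. (1 / sqrt (- lorentz e v v)) *\<^sub>R v"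
    "{v. norm (v - (v \<bullet> e) *\<^sub>R e) < v \<bullet> e}" \<Gamma> D
    unfolding Lobachevsky
    by (intro coxeter_model.intro Q.space coxeter_model_axioms.intro) (use assms(2) Lobachevsky in simp)
  show ?thesis
  proof (rule semidirect_product[OF assms(3-6)])
    fix s t assume st: "s \<in> Rf" "t \<in> Rf"
    have "(\<exists>(a, b)\<in>normals S (mir s). \<exists>(a', b')\<in>normals S (mir t). form S a a' = 0) \<longleftrightarrow>
        mir s \<noteq> mir t \<and> t ` mir s = mir s"
    proof (rule orthogonal_iff_stable[OF _ _ st])
      show "\<exists>l. t x = x + l *\<^sub>R a"
        if "reflection_in S Z t" "(a, b) \<in> normals S Z" "x \<in> points S" for Z t a b x
        using that unfolding Lobachevsky by (rule Q.along_normal)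
      show "form S a (x + l *\<^sub>R a') = form S a x + l * form S a a'" for a a' x l
        unfolding Lobachevsky by (simp add: lorentz_def inner_add_left inner_add_right algebra_simps)
    qed
    then show "orthogonal_mirrors S \<Gamma> (mir s) (mir t) \<longleftrightarrow> mir s \<noteq> mir t \<and> t ` mir s = mir s"
      by (simp add: orthogonal_mirrors_def Lobachevsky)
  qed
next
  case (Projective K)
  have g: "is_geometry (Projective K)"
    using assms(1) Projective by simp
  interpret coxeter_model S "\<lambda>x. x" sgn K \<Gamma> D
    unfolding Projective
    by (intro coxeter_model.intro projective_model[OF g] coxeter_model_axioms.intro)
      (use assms(2) Projective in simp)
  show ?thesis
  proof (rule semidirect_product[OF assms(3-6)])
    fix s t assume st: "s \<in> Rf" "t \<in> Rf"
    have unique: "s' = s" "t' = t"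
      if "s' \<in> \<Gamma>" "t' \<in> \<Gamma>" "reflection_in S (mir s) s'" "reflection_in S (mir t) t'" for s' t'
      using reflection_Rf[OF that(1,3)] reflection_Rf[OF that(2,4)] mir_subset_eq[OF st(1)]
        mir_subset_eq[OF st(2)] by blast+
    have "s \<in> \<Gamma>" "t \<in> \<Gamma>" "reflection_in S (mir s) s" "reflection_in S (mir t) t"
      using st by (auto simp: Rf_def)
    then have "(\<forall>s'\<in>\<Gamma>. \<forall>t'\<in>\<Gamma>. reflection_in S (mir s) s' \<and> reflection_in S (mir t) t' \<longrightarrow>
        (\<forall>x\<in>points S. s' (t' x) = t' (s' x))) \<longleftrightarrow> (\<forall>x\<in>points S. s (t x) = t (s x))"
      using unique by metis
    then show "orthogonal_mirrors S \<Gamma> (mir s) (mir t) \<longleftrightarrow> mir s \<noteq> mir t \<and> t ` mir s = mir s"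
      using commuting_iff[OF st] by (simp add: orthogonal_mirrors_def Projective)
  qed
qed

end
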